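(* Let $p$ be a prime number and let $\mathcal C$ be K\"ohler's full subcategory of the $C(p)$-equivariant Kasparov category $\mathsf{KK}^{C(p)}$ (where $C(p)$ is the cyclic group of order $p$), i.e. the $\mathbb Z$-linear category with objects $A_0,A_1,A_2,\Sigma A_0,\Sigma A_1,\Sigma A_2$ given by the explicit quiver with relations recalled in the context. Then $\mathcal C$ is $1$-Gorenstein.
   Context: Presentation of $\mathcal C$ as a $\mathbb Z$-linear category with an involutive automorphism $\Sigma$ ($\Sigma^2=\mathrm{id}$) exchanging $A_i$ and $\Sigma A_i$. Generating arrows: ${}_1\alpha_0\colon A_0\to A_1$, ${}_0\alpha_1\colon A_1\to A_0$, ${}_2\alpha_0\colon A_0\to A_2$, ${}_0\alpha_2\colon A_2\to A_0$, ${}_1\alpha_2\colon A_2\to\Sigma A_1$, ${}_2\alpha_1\colon\Sigma A_1\to A_2$, and loops ${}_0t_0$ on $A_0$, ${}_1s_1$ on $A_1$, ${}_2s_2$ and ${}_2t_2$ on $A_2$; together with the images of all these arrows under $\Sigma$ (e.g. $\Sigma{}_2\alpha_1\colon A_1\to\Sigma A_2$). With $N(x)=\sum_{i=0}^{p-1}x^i$ and composition written right to left, the relations (together with their images under $\Sigma$) are: (ρ1) ${}_2\alpha_1\circ\Sigma{}_1\alpha_0=0$, $\Sigma{}_0\alpha_1\circ{}_1\alpha_2=0$, ${}_0\alpha_2\circ{}_2\alpha_1=0$, ${}_1\alpha_2\circ{}_2\alpha_0=0$, ${}_1\alpha_0\circ{}_0\alpha_2=0$, ${}_2\alpha_0\circ{}_0\alpha_1=0$;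 (ρ2) ${}_0\alpha_1\circ{}_1\alpha_0=N({}_0t_0)$, ${}_1\alpha_0\circ{}_0\alpha_1=N({}_1s_1)$; (ρ3) ${}_0\alpha_2\circ{}_2\alpha_0=\mathrm{id}_{A_0}-{}_0t_0$, ${}_2\alpha_0\circ{}_0\alpha_2=\mathrm{id}_{A_2}-{}_2t_2$; (ρ4) ${}_1\alpha_2\circ{}_2\alpha_1=\mathrm{id}_{\Sigma A_1}-\Sigma{}_1s_1$, ${}_2\alpha_1\circ{}_1\alpha_2=\mathrm{id}_{A_2}-{}_2s_2$; (ρ5) $N({}_2t_2)+N({}_2s_2)=p\cdot\mathrm{id}_{A_2}$. In particular $\mathrm{End}(A_0)=\mathbb Z[t]/(1-t^p)$, $\mathrm{End}(A_1)=\mathbb Z[s]/(1-s^p)$, $\mathrm{End}(A_2)=\mathbb Z[s,t]/(N(s)+N(t)-p,(1-s)(1-t))$. $\mathrm{Mod}\,\mathcal C$ is the category of additive functors $\mathcal C^{\mathrm{op}}\to\mathrm{Mod}\,\mathbb Z$. A Gorenstein category is a Grothendieck category $\mathcal A$ such that: (i) an object has finite projective dimension iff it has finite injective dimension; (ii) the supremum of all finite projective dimensions and the supremum of all finite injective dimensions of objects are finite; (iii) $\mathcal A$ has a generator of finite projective dimension. If it has enough projectives, the two suprema coincide; if their common value is $n$, $\mathcal A$ is called $n$-Gorenstein. $\mathcal C$ is $n$-Gorenstein if $\mathrm{Mod}\,\mathcal C$ is. *)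

theory Defs
  imports
    "HOL-Algebra.Group"
    "HOL-Library.FuncSet"
    "HOL-Library.Poly_Mapping"
    "HOL-Library.Extended_Nat"
    "HOL-Computational_Algebra.Primes"
begin

section \<open>Categories\<close>

record ('o, 'm) cat =
  Obj :: "'o set"
  Arr :: "'m set"
  Dom :: "'m \<Rightarrow> 'o"
  Cod :: "'m \<Rightarrow> 'o"
  Id :: "'o \<Rightarrow> 'm"
  Comp :: "'m \<Rightarrow> 'm \<Rightarrow> 'm"  \<comment> \<open>\<open>Comp C g f\<close> is \<open>g \<circ> f\<close>\<close>

definition homs :: "('o, 'm, 'z) cat_scheme \<Rightarrow> 'o \<Rightarrow> 'o \<Rightarrow> 'm set" where
  "homs C X Y = {f \<in> Arr C. Dom C f = X \<and> Cod C f = Y}"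

definition category :: "('o, 'm, 'z) cat_scheme \<Rightarrow> bool" where
  "category C \<longleftrightarrow>
     (\<forall>f\<in>Arr C. Dom C f \<in> Obj C \<and> Cod C f \<in> Obj C) \<and>
     (\<forall>X\<in>Obj C. Id C X \<in> homs C X X) \<and>
     (\<forall>f\<in>Arr C. \<forall>g\<in>Arr C. Cod C f = Dom C g \<longrightarrow>
        Comp C g f \<in> homs C (Dom C f) (Cod C g)) \<and>
     (\<forall>f\<in>Arr C. Comp C f (Id C (Dom C f)) = f \<and> Comp C (Id C (Cod C f)) f = f) \<and>
     (\<forall>f\<in>Arr C. \<forall>g\<in>Arr C. \<forall>h\<in>Arr C. Cod C f = Dom C g \<longrightarrow> Cod C g = Dom C h \<longrightarrow>
        Comp C h (Comp C g f) = Comp C (Comp C h g) f)"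

definition opposite :: "('o, 'm) cat \<Rightarrow> ('o, 'm) cat" where
  "opposite C = \<lparr>Obj = Obj C, Arr = Arr C, Dom = Cod C, Cod = Dom C, Id = Id C,
                 Comp = (\<lambda>g f. Comp C f g)\<rparr>"

definition is_mono :: "('o, 'm) cat \<Rightarrow> 'm \<Rightarrow> bool" where
  "is_mono C f \<longleftrightarrow> f \<in> Arr C \<and>
     (\<forall>g\<in>Arr C. \<forall>h\<in>Arr C. Dom C g = Dom C h \<longrightarrow> Cod C g = Dom C f \<longrightarrow> Cod C h = Dom C f \<longrightarrow>
        Comp C f g = Comp C f h \<longrightarrow> g = h)"

definition is_epi :: "('o, 'm) cat \<Rightarrow> 'm \<Rightarrow> bool" where
  "is_epi C = is_mono (opposite C)"

definition zero_object :: "('o, 'm) cat \<Rightarrow> 'o \<Rightarrow> bool" where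
  "zero_object C Z \<longleftrightarrow> Z \<in> Obj C \<and>
     (\<forall>X\<in>Obj C. (\<exists>!f. f \<in> homs C X Z) \<and> (\<exists>!f. f \<in> homs C Z X))"

definition zero_arrow :: "('o, 'm) cat \<Rightarrow> 'm \<Rightarrow> bool" where
  "zero_arrow C f \<longleftrightarrow> f \<in> Arr C \<and>
     (\<exists>Z g h. zero_object C Z \<and> g \<in> homs C (Dom C f) Z \<and> h \<in> homs C Z (Cod C f) \<and>
        f = Comp C h g)"

definition is_kernel :: "('o, 'm) cat \<Rightarrow> 'm \<Rightarrow> 'm \<Rightarrow> bool" where
  "is_kernel C k f \<longleftrightarrow> k \<in> Arr C \<and> f \<in> Arr C \<and> Cod C k = Dom C f \<and> zero_arrow C (Comp C f k) \<and>
     (\<forall>g\<in>Arr C. Cod C g = Dom C f \<longrightarrow> zero_arrow C (Comp C f g) \<longrightarrow>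
        (\<exists>!u. u \<in> homs C (Dom C g) (Dom C k) \<and> Comp C k u = g))"

definition is_cokernel :: "('o, 'm) cat \<Rightarrow> 'm \<Rightarrow> 'm \<Rightarrow> bool" where
  "is_cokernel C = is_kernel (opposite C)"

definition is_coproduct ::
  "('o, 'm) cat \<Rightarrow> 'i set \<Rightarrow> ('i \<Rightarrow> 'o) \<Rightarrow> 'o \<Rightarrow> ('i \<Rightarrow> 'm) \<Rightarrow> bool" where
  "is_coproduct C I X S \<iota> \<longleftrightarrow> S \<in> Obj C \<and> (\<forall>i\<in>I. \<iota> i \<in> homs C (X i) S) \<and>
     (\<forall>Y\<in>Obj C. \<forall>f. (\<forall>i\<in>I. f i \<in> homs C (X i) Y) \<longrightarrow>
        (\<exists>!u. u \<in> homs C S Y \<and> (\<forall>i\<in>I. Comp C u (\<iota> i) = f i)))"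

definition is_product ::
  "('o, 'm) cat \<Rightarrow> 'i set \<Rightarrow> ('i \<Rightarrow> 'o) \<Rightarrow> 'o \<Rightarrow> ('i \<Rightarrow> 'm) \<Rightarrow> bool" where
  "is_product C = is_coproduct (opposite C)"

text \<open>Being abelian is a property of the underlying category (Freyd's axioms): the additive
  structure on the hom-sets is determined by it.\<close>

definition abelian_category :: "('o, 'm) cat \<Rightarrow> bool" where
  "abelian_category C \<longleftrightarrow> category C \<and>
     (\<exists>Z. zero_object C Z) \<and>
     (\<forall>X\<in>Obj C. \<forall>Y\<in>Obj C.
        (\<exists>S \<iota>. is_coproduct C (UNIV :: bool set) (\<lambda>b. if b then X else Y) S \<iota>) \<and>
        (\<exists>P \<pi>. is_product C (UNIV :: bool set) (\<lambda>b. if b then X else Y) P \<pi>)) \<and>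
     (\<forall>f\<in>Arr C. (\<exists>k. is_kernel C k f) \<and> (\<exists>c. is_cokernel C c f)) \<and>
     (\<forall>f. is_mono C f \<longrightarrow> (\<exists>g. is_kernel C f g)) \<and>
     (\<forall>f. is_epi C f \<longrightarrow> (\<exists>g. is_cokernel C f g))"

text \<open>Exactness of \<open>X \<rightarrow> Y \<rightarrow> Z\<close> at \<open>Y\<close>: the image of \<open>f\<close> is the kernel of \<open>g\<close>.\<close>

definition exact :: "('o, 'm) cat \<Rightarrow> 'm \<Rightarrow> 'm \<Rightarrow> bool" where
  "exact C f g \<longleftrightarrow>
     (\<exists>e m. is_epi C e \<and> is_mono C m \<and> Cod C e = Dom C m \<and> f = Comp C m e \<and> is_kernel C m g)"

definition short_exact :: "('o, 'm) cat \<Rightarrow> 'm \<Rightarrow> 'm \<Rightarrow> bool" where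
  "short_exact C f g \<longleftrightarrow> is_mono C f \<and> exact C f g \<and> is_epi C g"

definition is_functor ::
  "('i, 'j) cat \<Rightarrow> ('o, 'm) cat \<Rightarrow> ('i \<Rightarrow> 'o) \<Rightarrow> ('j \<Rightarrow> 'm) \<Rightarrow> bool" where
  "is_functor J C F\<^sub>0 F\<^sub>1 \<longleftrightarrow>
     (\<forall>i\<in>Obj J. F\<^sub>0 i \<in> Obj C \<and> F\<^sub>1 (Id J i) = Id C (F\<^sub>0 i)) \<and>
     (\<forall>u\<in>Arr J. F\<^sub>1 u \<in> homs C (F\<^sub>0 (Dom J u)) (F\<^sub>0 (Cod J u))) \<and>
     (\<forall>u\<in>Arr J. \<forall>v\<in>Arr J. Cod J u = Dom J v \<longrightarrow> F\<^sub>1 (Comp J v u) = Comp C (F\<^sub>1 v) (F\<^sub>1 u))"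

definition is_nat_trans ::
  "('i, 'j) cat \<Rightarrow> ('o, 'm) cat \<Rightarrow> ('i \<Rightarrow> 'o) \<Rightarrow> ('j \<Rightarrow> 'm) \<Rightarrow> ('i \<Rightarrow> 'o) \<Rightarrow> ('j \<Rightarrow> 'm) \<Rightarrow>
     ('i \<Rightarrow> 'm) \<Rightarrow> bool" where
  "is_nat_trans J C F\<^sub>0 F\<^sub>1 G\<^sub>0 G\<^sub>1 \<tau> \<longleftrightarrow>
     (\<forall>i\<in>Obj J. \<tau> i \<in> homs C (F\<^sub>0 i) (G\<^sub>0 i)) \<and>
     (\<forall>u\<in>Arr J. Comp C (G\<^sub>1 u) (\<tau> (Dom J u)) = Comp C (\<tau> (Cod J u)) (F\<^sub>1 u))"

definition is_cocone ::
  "('i, 'j) cat \<Rightarrow> ('o, 'm) cat \<Rightarrow> ('i \<Rightarrow> 'o) \<Rightarrow> ('j \<Rightarrow> 'm) \<Rightarrow> 'o \<Rightarrow> ('i \<Rightarrow> 'm) \<Rightarrow> bool" where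
  "is_cocone J C F\<^sub>0 F\<^sub>1 L \<kappa> \<longleftrightarrow> L \<in> Obj C \<and>
     (\<forall>i\<in>Obj J. \<kappa> i \<in> homs C (F\<^sub>0 i) L) \<and>
     (\<forall>u\<in>Arr J. Comp C (\<kappa> (Cod J u)) (F\<^sub>1 u) = \<kappa> (Dom J u))"

definition is_colimit ::
  "('i, 'j) cat \<Rightarrow> ('o, 'm) cat \<Rightarrow> ('i \<Rightarrow> 'o) \<Rightarrow> ('j \<Rightarrow> 'm) \<Rightarrow> 'o \<Rightarrow> ('i \<Rightarrow> 'm) \<Rightarrow> bool" where
  "is_colimit J C F\<^sub>0 F\<^sub>1 L \<kappa> \<longleftrightarrow> is_cocone J C F\<^sub>0 F\<^sub>1 L \<kappa> \<and>
     (\<forall>Y \<mu>. is_cocone J C F\<^sub>0 F\<^sub>1 Y \<mu> \<longrightarrow>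
        (\<exists>!u. u \<in> homs C L Y \<and> (\<forall>i\<in>Obj J. Comp C u (\<kappa> i) = \<mu> i)))"

definition filtered_category :: "('i, 'j) cat \<Rightarrow> bool" where
  "filtered_category J \<longleftrightarrow> category J \<and> Obj J \<noteq> {} \<and>
     (\<forall>i\<in>Obj J. \<forall>j\<in>Obj J. \<exists>k\<in>Obj J. homs J i k \<noteq> {} \<and> homs J j k \<noteq> {}) \<and>
     (\<forall>u\<in>Arr J. \<forall>v\<in>Arr J. Dom J u = Dom J v \<longrightarrow> Cod J u = Cod J v \<longrightarrow>
        (\<exists>w\<in>Arr J. Dom J w = Cod J u \<and> Comp J w u = Comp J w v))"

definition is_generator :: "('o, 'm) cat \<Rightarrow> 'o \<Rightarrow> bool" where
  "is_generator C G \<longleftrightarrow> G \<in> Obj C \<and>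
     (\<forall>f\<in>Arr C. \<forall>g\<in>Arr C. Dom C f = Dom C g \<longrightarrow> Cod C f = Cod C g \<longrightarrow> f \<noteq> g \<longrightarrow>
        (\<exists>h\<in>homs C G (Dom C f). Comp C f h \<noteq> Comp C g h))"

text \<open>There are no universes in HOL. The role of a universe is played by a type \<open>'u\<close>: a set or a
  category is small if its elements (objects and arrows) are taken from \<open>'u\<close>.\<close>

definition has_small_coproducts :: "'u itself \<Rightarrow> ('o, 'm) cat \<Rightarrow> bool" where
  "has_small_coproducts U C \<longleftrightarrow>
     (\<forall>(I :: 'u set) X. (\<forall>i\<in>I. X i \<in> Obj C) \<longrightarrow> (\<exists>S \<iota>. is_coproduct C I X S \<iota>))"

definition filtered_colimits_exact :: "'u itself \<Rightarrow> ('o, 'm) cat \<Rightarrow> bool" where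
  "filtered_colimits_exact U C \<longleftrightarrow>
     (\<forall>(J :: ('u, 'u) cat) F\<^sub>0 F\<^sub>1 G\<^sub>0 G\<^sub>1 H\<^sub>0 H\<^sub>1 \<sigma> \<tau> L \<kappa> M \<mu> N \<nu> f g.
        filtered_category J \<longrightarrow>
        is_functor J C F\<^sub>0 F\<^sub>1 \<longrightarrow> is_functor J C G\<^sub>0 G\<^sub>1 \<longrightarrow> is_functor J C H\<^sub>0 H\<^sub>1 \<longrightarrow>
        is_nat_trans J C F\<^sub>0 F\<^sub>1 G\<^sub>0 G\<^sub>1 \<sigma> \<longrightarrow> is_nat_trans J C G\<^sub>0 G\<^sub>1 H\<^sub>0 H\<^sub>1 \<tau> \<longrightarrow>
        (\<forall>i\<in>Obj J. short_exact C (\<sigma> i) (\<tau> i)) \<longrightarrow>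
        is_colimit J C F\<^sub>0 F\<^sub>1 L \<kappa> \<longrightarrow> is_colimit J C G\<^sub>0 G\<^sub>1 M \<mu> \<longrightarrow> is_colimit J C H\<^sub>0 H\<^sub>1 N \<nu> \<longrightarrow>
        f \<in> homs C L M \<longrightarrow> (\<forall>i\<in>Obj J. Comp C f (\<kappa> i) = Comp C (\<mu> i) (\<sigma> i)) \<longrightarrow>
        g \<in> homs C M N \<longrightarrow> (\<forall>i\<in>Obj J. Comp C g (\<mu> i) = Comp C (\<nu> i) (\<tau> i)) \<longrightarrow>
        short_exact C f g)"

definition grothendieck_category :: "'u itself \<Rightarrow> ('o, 'm) cat \<Rightarrow> bool" where
  "grothendieck_category U C \<longleftrightarrow>
     abelian_category C \<and> has_small_coproducts U C \<and> filtered_colimits_exact U C \<and>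
     (\<exists>G. is_generator C G)"


section \<open>Homological dimensions and Gorenstein categories\<close>

definition projective :: "('o, 'm) cat \<Rightarrow> 'o \<Rightarrow> bool" where
  "projective C P \<longleftrightarrow> P \<in> Obj C \<and>
     (\<forall>e. is_epi C e \<longrightarrow> (\<forall>f\<in>homs C P (Cod C e). \<exists>g\<in>homs C P (Dom C e). Comp C e g = f))"

definition injective :: "('o, 'm) cat \<Rightarrow> 'o \<Rightarrow> bool" where
  "injective C = projective (opposite C)"

definition enough_projectives :: "('o, 'm) cat \<Rightarrow> bool" where
  "enough_projectives C \<longleftrightarrow> (\<forall>X\<in>Obj C. \<exists>P. projective C P \<and> (\<exists>e\<in>homs C P X. is_epi C e))"

text \<open>An exact sequence \<open>0 \<rightarrow> P n \<rightarrow> \<dots> \<rightarrow> P 0 \<rightarrow> X \<rightarrow> 0\<close> with maps \<open>d 0 : P 0 \<rightarrow> X\<close> and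
  \<open>d (i + 1) : P (i + 1) \<rightarrow> P i\<close>.\<close>

definition projective_resolution ::
  "('o, 'm) cat \<Rightarrow> 'o \<Rightarrow> nat \<Rightarrow> (nat \<Rightarrow> 'o) \<Rightarrow> (nat \<Rightarrow> 'm) \<Rightarrow> bool" where
  "projective_resolution C X n P d \<longleftrightarrow>
     (\<forall>i\<le>n. projective C (P i)) \<and>
     d 0 \<in> homs C (P 0) X \<and> (\<forall>i<n. d (Suc i) \<in> homs C (P (Suc i)) (P i)) \<and>
     is_epi C (d 0) \<and> (\<forall>i<n. exact C (d (Suc i)) (d i)) \<and> is_mono C (d n)"

text \<open>An exact sequence \<open>0 \<rightarrow> X \<rightarrow> I 0 \<rightarrow> \<dots> \<rightarrow> I n \<rightarrow> 0\<close> with maps \<open>d 0 : X \<rightarrow> I 0\<close> and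
  \<open>d (i + 1) : I i \<rightarrow> I (i + 1)\<close>.\<close>

definition injective_resolution ::
  "('o, 'm) cat \<Rightarrow> 'o \<Rightarrow> nat \<Rightarrow> (nat \<Rightarrow> 'o) \<Rightarrow> (nat \<Rightarrow> 'm) \<Rightarrow> bool" where
  "injective_resolution C X n I d \<longleftrightarrow>
     (\<forall>i\<le>n. injective C (I i)) \<and>
     d 0 \<in> homs C X (I 0) \<and> (\<forall>i<n. d (Suc i) \<in> homs C (I i) (I (Suc i))) \<and>
     is_mono C (d 0) \<and> (\<forall>i<n. exact C (d i) (d (Suc i))) \<and> is_epi C (d n)"

text \<open>The infimum of the empty set is \<open>\<infinity>\<close>; zero objects get dimension \<open>0\<close>.\<close>

definition proj_dim :: "('o, 'm) cat \<Rightarrow> 'o \<Rightarrow> enat" where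
  "proj_dim C X = Inf {enat n | n. \<exists>P d. projective_resolution C X n P d}"

definition inj_dim :: "('o, 'm) cat \<Rightarrow> 'o \<Rightarrow> enat" where
  "inj_dim C X = Inf {enat n | n. \<exists>I d. injective_resolution C X n I d}"

definition finitary_proj_dim :: "('o, 'm) cat \<Rightarrow> enat" where
  "finitary_proj_dim C = Sup {proj_dim C X | X. X \<in> Obj C \<and> proj_dim C X < \<infinity>}"

definition finitary_inj_dim :: "('o, 'm) cat \<Rightarrow> enat" where
  "finitary_inj_dim C = Sup {inj_dim C X | X. X \<in> Obj C \<and> inj_dim C X < \<infinity>}"

definition gorenstein_category :: "'u itself \<Rightarrow> ('o, 'm) cat \<Rightarrow> bool" where
  "gorenstein_category U C \<longleftrightarrow> grothendieck_category U C \<and>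
     (\<forall>X\<in>Obj C. proj_dim C X < \<infinity> \<longleftrightarrow> inj_dim C X < \<infinity>) \<and>
     finitary_proj_dim C < \<infinity> \<and> finitary_inj_dim C < \<infinity> \<and>
     (\<exists>G. is_generator C G \<and> proj_dim C G < \<infinity>)"

definition n_gorenstein_category :: "'u itself \<Rightarrow> nat \<Rightarrow> ('o, 'm) cat \<Rightarrow> bool" where
  "n_gorenstein_category U n C \<longleftrightarrow> gorenstein_category U C \<and> enough_projectives C \<and>
     finitary_proj_dim C = enat n \<and> finitary_inj_dim C = enat n"


section \<open>Additive functors on a linear category\<close>

text \<open>\<open>Add\<close> is the addition of parallel arrows in a \<open>\<int>\<close>-linear category.\<close>

record ('o, 'm) lin_cat = "('o, 'm) cat" +
  Add :: "'m \<Rightarrow> 'm \<Rightarrow> 'm"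

text \<open>Contravariant additive functors to abelian groups with carriers in the type \<open>'u\<close>.
  The abelian groups are the commutative groups of \<open>HOL-Algebra\<close>, written multiplicatively.\<close>

record ('o, 'm, 'u) cmod =
  Grp :: "'o \<Rightarrow> 'u monoid"
  Act :: "'m \<Rightarrow> 'u \<Rightarrow> 'u"

definition is_module :: "('o, 'm) lin_cat \<Rightarrow> ('o, 'm, 'u) cmod \<Rightarrow> bool" where
  "is_module C M \<longleftrightarrow>
     (\<forall>X\<in>Obj C. comm_group (Grp M X)) \<and>
     (\<forall>f\<in>Arr C. Act M f \<in> hom (Grp M (Cod C f)) (Grp M (Dom C f))) \<and>
     (\<forall>X\<in>Obj C. \<forall>x\<in>carrier (Grp M X). Act M (Id C X) x = x) \<and>
     (\<forall>f\<in>Arr C. \<forall>g\<in>Arr C. Cod C f = Dom C g \<longrightarrow>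
        (\<forall>x\<in>carrier (Grp M (Cod C g)). Act M (Comp C g f) x = Act M f (Act M g x))) \<and>
     (\<forall>f\<in>Arr C. \<forall>g\<in>Arr C. Dom C f = Dom C g \<longrightarrow> Cod C f = Cod C g \<longrightarrow>
        (\<forall>x\<in>carrier (Grp M (Cod C f)).
           Act M (Add C f g) x = Act M f x \<otimes>\<^bsub>Grp M (Dom C f)\<^esub> Act M g x))"

definition is_module_hom ::
  "('o, 'm) lin_cat \<Rightarrow> ('o, 'm, 'u) cmod \<Rightarrow> ('o \<Rightarrow> 'u \<Rightarrow> 'u) \<Rightarrow> ('o, 'm, 'u) cmod \<Rightarrow> bool" where
  "is_module_hom C M \<eta> N \<longleftrightarrow>
     \<eta> \<in> extensional (Obj C) \<and>
     (\<forall>X\<in>Obj C. \<eta> X \<in> extensional (carrier (Grp M X)) \<inter> hom (Grp M X) (Grp N X)) \<and>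
     (\<forall>f\<in>Arr C. \<forall>x\<in>carrier (Grp M (Cod C f)).
        \<eta> (Dom C f) (Act M f x) = Act N f (\<eta> (Cod C f) x))"

definition Mod :: "'u itself \<Rightarrow> ('o, 'm) lin_cat \<Rightarrow>
    (('o, 'm, 'u) cmod, ('o, 'm, 'u) cmod \<times> ('o \<Rightarrow> 'u \<Rightarrow> 'u) \<times> ('o, 'm, 'u) cmod) cat" where
  "Mod U C =
     \<lparr>Obj = {M. is_module C M},
      Arr = {(M, \<eta>, N). is_module C M \<and> is_module C N \<and> is_module_hom C M \<eta> N},
      Dom = (\<lambda>(M, \<eta>, N). M),
      Cod = (\<lambda>(M, \<eta>, N). N),
      Id = (\<lambda>M. (M, \<lambda>X\<in>Obj C. \<lambda>x\<in>carrier (Grp M X). x, M)),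
      Comp = (\<lambda>(M', \<theta>, N') (M, \<eta>, N).
        (M, \<lambda>X\<in>Obj C. compose (carrier (Grp M X)) (\<theta> X) (\<eta> X), N'))\<rparr>"

definition n_gorenstein :: "'u itself \<Rightarrow> nat \<Rightarrow> ('o, 'm) lin_cat \<Rightarrow> bool" where
  "n_gorenstein U n C \<longleftrightarrow> n_gorenstein_category U n (Mod U C)"


section \<open>Linear categories given by quivers with relations\<close>

text \<open>The word \<open>Word [a\<^sub>n, \<dots>, a\<^sub>1]\<close> stands for the composite \<open>a\<^sub>n \<circ> \<dots> \<circ> a\<^sub>1\<close>. Integral linear
  combinations of words form the free ring on the letters, with unit the empty word.\<close>

datatype 'a word = Word "'a list"

instantiation word :: (type) monoid_add
begin

definition zero_word :: "'a word" where
  "zero_word = Word []"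

fun plus_word :: "'a word \<Rightarrow> 'a word \<Rightarrow> 'a word" where
  "plus_word (Word u) (Word v) = Word (u @ v)"

instance
proof
  fix a b c :: "'a word"
  show "a + b + c = a + (b + c)" by (cases a; cases b; cases c) simp
  show "0 + a = a" by (cases a) (simp add: zero_word_def)
  show "a + 0 = a" by (cases a) (simp add: zero_word_def)
qed

end

type_synonym 'a free_ring = "'a word \<Rightarrow>\<^sub>0 int"

definition letter :: "'a \<Rightarrow> 'a free_ring" where
  "letter a = Poly_Mapping.single (Word [a]) 1"

fun is_path :: "('a \<Rightarrow> 'v) \<Rightarrow> ('a \<Rightarrow> 'v) \<Rightarrow> 'v \<Rightarrow> 'a list \<Rightarrow> 'v \<Rightarrow> bool" where
  "is_path src tgt X [] Y \<longleftrightarrow> X = Y"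
| "is_path src tgt X (a # u) Y \<longleftrightarrow> tgt a = Y \<and> is_path src tgt X u (src a)"

text \<open>The morphisms of the free \<open>\<int>\<close>-linear category on a quiver; composition is multiplication
  in the free ring.\<close>

definition free_hom :: "('a \<Rightarrow> 'v) \<Rightarrow> ('a \<Rightarrow> 'v) \<Rightarrow> 'v \<Rightarrow> 'v \<Rightarrow> 'a free_ring set" where
  "free_hom src tgt X Y = {f. \<forall>u. Word u \<in> Poly_Mapping.keys f \<longrightarrow> is_path src tgt X u Y}"

text \<open>The two-sided ideal of the free linear category generated by relators
  \<open>R X Y r\<close> with \<open>r : X \<rightarrow> Y\<close>.\<close>

inductive rel_ideal ::
  "('a \<Rightarrow> 'v) \<Rightarrow> ('a \<Rightarrow> 'v) \<Rightarrow> ('v \<Rightarrow> 'v \<Rightarrow> 'a free_ring \<Rightarrow> bool) \<Rightarrow> 'v \<Rightarrow> 'v \<Rightarrow> 'a free_ring \<Rightarrow> bool"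
  for src tgt R where
  relator: "R X Y r \<Longrightarrow> rel_ideal src tgt R X Y r"
| zero: "rel_ideal src tgt R X Y 0"
| diff: "rel_ideal src tgt R X Y f \<Longrightarrow> rel_ideal src tgt R X Y g \<Longrightarrow> rel_ideal src tgt R X Y (f - g)"
| left: "rel_ideal src tgt R X Y f \<Longrightarrow> g \<in> free_hom src tgt Y Z \<Longrightarrow> rel_ideal src tgt R X Z (g * f)"
| right: "rel_ideal src tgt R Y Z f \<Longrightarrow> g \<in> free_hom src tgt X Y \<Longrightarrow> rel_ideal src tgt R X Z (f * g)"

definition residue_class ::
  "('a \<Rightarrow> 'v) \<Rightarrow> ('a \<Rightarrow> 'v) \<Rightarrow> ('v \<Rightarrow> 'v \<Rightarrow> 'a free_ring \<Rightarrow> bool) \<Rightarrow> 'v \<Rightarrow> 'v \<Rightarrow> 'a free_ring \<Rightarrow>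
     'a free_ring set" where
  "residue_class src tgt R X Y f = {g \<in> free_hom src tgt X Y. rel_ideal src tgt R X Y (g - f)}"

text \<open>An arrow \<open>X \<rightarrow> Y\<close> is a triple \<open>(X, c, Y)\<close> with \<open>c\<close> a residue class.\<close>

definition presented_category ::
  "('a \<Rightarrow> 'v) \<Rightarrow> ('a \<Rightarrow> 'v) \<Rightarrow> ('v \<Rightarrow> 'v \<Rightarrow> 'a free_ring \<Rightarrow> bool) \<Rightarrow>
     ('v, 'v \<times> 'a free_ring set \<times> 'v) lin_cat" where
  "presented_category src tgt R =
     \<lparr>Obj = UNIV,
      Arr = {(X, residue_class src tgt R X Y f, Y) | X Y f. f \<in> free_hom src tgt X Y},
      Dom = (\<lambda>(X, c, Y). X),
      Cod = (\<lambda>(X, c, Y). Y),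
      Id = (\<lambda>X. (X, residue_class src tgt R X X 1, X)),
      Comp = (\<lambda>(Y', d, Z) (X, c, Y). (X, \<Union>g\<in>d. \<Union>f\<in>c. residue_class src tgt R X Z (g * f), Z)),
      Add = (\<lambda>(X, c, Y) (X', d, Y'). (X, \<Union>f\<in>c. \<Union>g\<in>d. residue_class src tgt R X Y (f + g), Y))\<rparr>"


section \<open>Koehler's category\<close>

datatype vertex = V0 | V1 | V2

text \<open>\<open>(False, Vi)\<close> is \<open>A\<^sub>i\<close> and \<open>(True, Vi)\<close> is \<open>\<Sigma>A\<^sub>i\<close>.\<close>

type_synonym obj = "bool \<times> vertex"

text \<open>\<open>\<alpha>ij\<close> is the generator written \<open>\<^sub>i\<alpha>\<^sub>j\<close>, with the object of index \<open>j\<close> as its source.\<close>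

datatype generator = \<alpha>10 | \<alpha>01 | \<alpha>20 | \<alpha>02 | \<alpha>12 | \<alpha>21 | t0 | s1 | s2 | t2

text \<open>\<open>(False, g)\<close> is the generator \<open>g\<close> and \<open>(True, g)\<close> is its image under \<open>\<Sigma>\<close>.\<close>

type_synonym arrow = "bool \<times> generator"

fun arrow_src :: "arrow \<Rightarrow> obj" where
  "arrow_src (b, \<alpha>10) = (b, V0)"
| "arrow_src (b, \<alpha>01) = (b, V1)"
| "arrow_src (b, \<alpha>20) = (b, V0)"
| "arrow_src (b, \<alpha>02) = (b, V2)"
| "arrow_src (b, \<alpha>12) = (b, V2)"
| "arrow_src (b, \<alpha>21) = (\<not> b, V1)"
| "arrow_src (b, t0) = (b, V0)"
| "arrow_src (b, s1) = (b, V1)"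
| "arrow_src (b, s2) = (b, V2)"
| "arrow_src (b, t2) = (b, V2)"

fun arrow_tgt :: "arrow \<Rightarrow> obj" where
  "arrow_tgt (b, \<alpha>10) = (b, V1)"
| "arrow_tgt (b, \<alpha>01) = (b, V0)"
| "arrow_tgt (b, \<alpha>20) = (b, V2)"
| "arrow_tgt (b, \<alpha>02) = (b, V0)"
| "arrow_tgt (b, \<alpha>12) = (\<not> b, V1)"
| "arrow_tgt (b, \<alpha>21) = (b, V2)"
| "arrow_tgt (b, t0) = (b, V0)"
| "arrow_tgt (b, s1) = (b, V1)"
| "arrow_tgt (b, s2) = (b, V2)"
| "arrow_tgt (b, t2) = (b, V2)"

definition gen :: "bool \<Rightarrow> generator \<Rightarrow> arrow free_ring" where
  "gen b g = letter (b, g)"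

definition norm_sum :: "nat \<Rightarrow> arrow free_ring \<Rightarrow> arrow free_ring" where
  "norm_sum p x = (\<Sum>i<p. x ^ i)"

text \<open>For \<open>b = False\<close> these are the relations listed by Koehler, for \<open>b = True\<close> their images
  under \<open>\<Sigma>\<close>.\<close>

inductive koehler_relator :: "nat \<Rightarrow> obj \<Rightarrow> obj \<Rightarrow> arrow free_ring \<Rightarrow> bool" for p where
  "koehler_relator p (\<not> b, V0) (b, V2) (gen b \<alpha>21 * gen (\<not> b) \<alpha>10)"
| "koehler_relator p (b, V2) (\<not> b, V0) (gen (\<not> b) \<alpha>01 * gen b \<alpha>12)"
| "koehler_relator p (\<not> b, V1) (b, V0) (gen b \<alpha>02 * gen b \<alpha>21)"
| "koehler_relator p (b, V0) (\<not> b, V1) (gen b \<alpha>12 * gen b \<alpha>20)"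
| "koehler_relator p (b, V2) (b, V1) (gen b \<alpha>10 * gen b \<alpha>02)"
| "koehler_relator p (b, V1) (b, V2) (gen b \<alpha>20 * gen b \<alpha>01)"
| "koehler_relator p (b, V0) (b, V0) (gen b \<alpha>01 * gen b \<alpha>10 - norm_sum p (gen b t0))"
| "koehler_relator p (b, V1) (b, V1) (gen b \<alpha>10 * gen b \<alpha>01 - norm_sum p (gen b s1))"
| "koehler_relator p (b, V0) (b, V0) (gen b \<alpha>02 * gen b \<alpha>20 - (1 - gen b t0))"
| "koehler_relator p (b, V2) (b, V2) (gen b \<alpha>20 * gen b \<alpha>02 - (1 - gen b t2))"
| "koehler_relator p (\<not> b, V1) (\<not> b, V1) (gen b \<alpha>12 * gen b \<alpha>21 - (1 - gen (\<not> b) s1))"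
| "koehler_relator p (b, V2) (b, V2) (gen b \<alpha>21 * gen b \<alpha>12 - (1 - gen b s2))"
| "koehler_relator p (b, V2) (b, V2) (norm_sum p (gen b t2) + norm_sum p (gen b s2) - of_nat p)"

definition koehler_category :: "nat \<Rightarrow> (obj, obj \<times> arrow free_ring set \<times> obj) lin_cat" where
  "koehler_category p = presented_category arrow_src arrow_tgt (koehler_relator p)"

end

theory Submission
 imports Defs "HOL-Algebra.Free_Abelian_Groups" Complex_Main
begin

text \<open>
 The reason for the theorem is that Koehler's category is a symmetric Frobenius category over the integers
 (\<open>frobenius_koehler\<close>): there is an integral trace on endomorphisms with \<open>tr (g f) = tr (f
 g)\<close>, and every object \<open>Y\<close> has finitely many pairs of arrows \<open>e : Y \<rightarrow> X\<close>
 and \<open>f : X \<rightarrow> Y\<close> such that each arrow \<open>h : X \<rightarrow> Y\<close> is the sum of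
 \<open>tr (e h) f\<close> over the pairs that belong to \<open>X\<close>, and dually. Every such category in which
 some identity has nonzero trace is \<open>1\<close>-Gorenstein (\<open>frobenius_gorenstein\<close>), by the argument
 that shows this for the group ring of a finite group.

 For a family of abelian groups \<open>B X\<close> let \<open>coind B\<close> be the module that over \<open>Y\<close>
 consists of the additive families of maps from the arrows \<open>X \<rightarrow> Y\<close> to \<open>B X\<close>.
 Coinduction is right adjoint to the passage from a module to its groups, so \<open>coind B\<close> is injective if the
 groups are divisible (\<open>injective_coind\<close>). By the trace form it is also left adjoint, so \<open>coind
 B\<close> is projective if the groups are free (\<open>projective_coind\<close>). Every module \<open>M\<close> embeds
 into the module coinduced from its own groups and is a quotient of it. Embedding the groups of a projective module
 into divisible groups shows that it has injective dimension at most one, and resolving the groups of an injective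
 module by free groups shows that it has projective dimension at most one. If \<open>0 \<rightarrow> K \<rightarrow> P
 \<rightarrow> M \<rightarrow> 0\<close> is exact and \<open>K\<close> and \<open>P\<close> have injective dimension at
 most one, so has \<open>M\<close> (\<open>id_le_1_quotient\<close>); hence finite projective dimension implies
 injective dimension at most one, and dually. The value one is attained, because divisible groups and free groups are
 different: injective modules are divisible, but the generator coinduced from the integers is not; projective modules
 have no nonzero divisible elements, but the injective module coinduced from a divisible hull of the integers does.

 The Frobenius structure is found with complex characters of the category, each given by a \<open>p\<close>-th root of
 unity. The relations bring every arrow to a normal form with integral coefficients (\<open>normal_form\<close>), and
 by Fourier inversion the characters detect normal forms (\<open>characters_faithful\<close>). The trace is a signed
 average of characters; it is integral on normal forms, and the expansion of arrows in dual bases is an orthogonality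
 relation between characters (\<open>dual_pairs_orthogonal\<close>). That modules form a Grothendieck category is shown
 with elements: kernels, cokernels and direct sums are formed objectwise, and filtered colimits consist of germs.
\<close>

section \<open>Cardinality\<close>

text \<open>Small modules have their elements in the infinite type \<open>'u\<close>. Direct sums, divisible hulls and
 groups of functions leave this type; the bounds below are what allows copies of them inside \<open>'u\<close>.\<close>

lemma lepoll_Times_infinite:
 assumes "infinite (UNIV :: 'u set)" "S \<lesssim> (UNIV :: 'u set)" "T \<lesssim> (UNIV :: 'u set)"
 shows "S \<times> T \<lesssim> (UNIV :: 'u set)"
proof -
 have "S \<times> T \<lesssim> (UNIV :: 'u set) \<times> (UNIV :: 'u set)"
  using assms times_lepoll_mono by blast
 moreover have "(UNIV :: 'u set) \<times> (UNIV :: 'u set) \<approx> (UNIV :: 'u set)"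
  unfolding eqpoll_iff_card_of_ordIso using assms(1) card_of_Times_same_infinite by blast
 ultimately show ?thesis by (metis lepoll_trans2)
qed

lemma lepoll_Fpow_infinite:
 assumes "infinite (UNIV :: 'u set)" "S \<lesssim> (UNIV :: 'u set)"
 shows "Fpow S \<lesssim> (UNIV :: 'u set)"
proof -
 obtain f :: "_ => 'u" where f: "inj_on f S"
  using assms(2) by (auto simp: lepoll_def)
 have "inj_on ((`) f) (Fpow S)"
  using f by (auto simp: Fpow_def inj_on_def inj_on_image_eq_iff)
 moreover have "(`) f ` Fpow S \<subseteq> Fpow UNIV" by (auto simp: Fpow_def)
 ultimately have "Fpow S \<lesssim> Fpow (UNIV :: 'u set)" by (auto simp: lepoll_def)
 then show ?thesis using eqpoll_Fpow[OF assms(1)] by (metis lepoll_trans2)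
qed

lemma graph_eqD:
 assumes "(%k. (k, f k)) ` A = (%k. (k, g k)) ` B"
 shows "A = B" "k \<in> A ==> f k = g k"
proof -
 have "fst ` (%k. (k, f k)) ` A = fst ` (%k. (k, g k)) ` B" by (simp only: assms)
 then show "A = B" by (simp add: image_image)
 assume "k \<in> A"
 then have "(k, f k) \<in> (%k. (k, g k)) ` B" using assms by blast
 then show "f k = g k" by auto
qed

lemma countable_lepoll_infinite:
 assumes "infinite (UNIV :: 'u set)" "countable S"
 shows "S \<lesssim> (UNIV :: 'u set)"
proof -
 have "S \<lesssim> (UNIV :: nat set)" using assms(2) by (auto simp: countable_def lepoll_def)
 moreover have "(UNIV :: nat set) \<lesssim> (UNIV :: 'u set)"
  using assms(1) infinite_le_lepoll by blast
 ultimately show ?thesis by (rule lepoll_trans)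
qed

section \<open>Abelian groups\<close>

text \<open>Inline notation for the operations of a group, since many groups occur side by side below.\<close>

abbreviation gmult ("_ *[_] _" [70, 0, 71] 70) where "x *[G] y == x \<otimes>\<^bsub>G\<^esub> y"
abbreviation gone ("\<one>[_]") where "\<one>[G] == \<one>\<^bsub>G\<^esub>"
abbreviation ginv ("inv[_] _" [0, 81] 80) where "inv[G] x == inv\<^bsub>G\<^esub> x"
abbreviation gpow ("_ ^[_] _" [75, 0, 75] 75) where "x ^[G] n == x [^]\<^bsub>G\<^esub> n"

lemma comm_groupD:
 assumes "comm_group G"
 shows "group G" "monoid G" "comm_monoid G"
 using assms by (auto simp: comm_group_def group_def)

lemma subgroup_comm_group:
 assumes "comm_group G" "subgroup K G"
 shows "comm_group (G\<lparr>carrier := K\<rparr>)"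
proof -
 interpret G: comm_group G by fact
 interpret K: subgroup K G by fact
 show ?thesis
  by (rule group.group_comm_groupI[OF K.subgroup_is_group[OF G.is_group]]) (auto intro: G.m_comm)
qed

text \<open>The image of a group under a map \<open>r\<close>, with multiplication through chosen preimages. It serves
 for quotients, where \<open>r\<close> picks coset representatives, and for moving a group to another type, where
 \<open>r\<close> is injective.\<close>

definition img_group :: "('a, 'z) monoid_scheme => ('a => 'b) => 'b monoid" where
 "img_group G r = \<lparr>carrier = r ` carrier G,
   monoid.mult = (%a b. r (inv_into (carrier G) r a *[G] inv_into (carrier G) r b)), one = r \<one>[G]\<rparr>"

lemma carrier_img_group [simp]: "carrier (img_group G r) = r ` carrier G"
 by (simp add: img_group_def)

lemma img_group:
 assumes "comm_group G"
  and "!!x y x' y'. [|x \<in> carrier G; x' \<in> carrier G; y \<in> carrier G; y' \<in> carrier G; r x = r x'; r y = r y'|]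
   ==> r (x *[G] y) = r (x' *[G] y')"
 shows "comm_group (img_group G r)" "r \<in> hom G (img_group G r)"
proof -
 have *: "r (inv_into (carrier G) r (r x) *[G] inv_into (carrier G) r (r y)) = r (x *[G] y)"
  if "x \<in> carrier G" "y \<in> carrier G" for x y
  using that by (intro assms(2)) (auto intro!: inv_into_into f_inv_into_f)
 show h: "r \<in> hom G (img_group G r)"
  by (rule homI) (auto simp: img_group_def *)
 have "img_group G r = (img_group G r)\<lparr>carrier := r ` carrier G, one := r \<one>[G]\<rparr>"
  by (simp add: img_group_def)
 then show "comm_group (img_group G r)"
  using comm_group.hom_imp_img_comm_group[OF assms(1) h] by simp
qed

lemma hom_oneD: "[|f \<in> hom G H; comm_group G; comm_group H|] ==> f \<one>[G] = \<one>[H]"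
 by (simp add: comm_group_def hom_one)

lemma hom_invD: "[|f \<in> hom G H; comm_group G; comm_group H; x \<in> carrier G|] ==> f (inv[G] x) = inv[H] f x"
 by (simp add: comm_group_def group_hom.hom_inv group_hom.intro group_hom_axioms.intro)

lemma group_homI: "[|comm_group G; comm_group H; f \<in> hom G H|] ==> group_hom G H f"
 by (simp add: comm_group_def group_hom.intro group_hom_axioms.intro)

lemma hom_inj_onI:
 assumes "f \<in> hom G H" "comm_group G" "comm_group H"
  and "!!x. [|x \<in> carrier G; f x = \<one>[H]|] ==> x = \<one>[G]"
 shows "inj_on f (carrier G)"
proof (rule inj_onI)
 interpret G: comm_group G by fact
 interpret H: comm_group H by fact
 fix x y assume x: "x \<in> carrier G" and y: "y \<in> carrier G" and "f x = f y"
 moreover have "f x \<in> carrier H" "f y \<in> carrier H"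
  using assms(1) x y hom_in_carrier by fast+
 ultimately have "f (x *[G] inv[G] y) = \<one>[H]"
  using assms(1-3) by (simp add: hom_mult hom_invD)
 then have "x *[G] inv[G] y = \<one>[G]" using x y by (intro assms(4)) auto
 then show "x = y" using x y by (simp add: G.inv_solve_right')
qed

lemma hom_eq_iff_diff:
 assumes "f \<in> hom G H" "comm_group G" "comm_group H" "x \<in> carrier G" "y \<in> carrier G"
 shows "f x = f y \<longleftrightarrow> f (x *[G] inv[G] y) = \<one>[H]"
proof -
 interpret G: comm_group G by fact
 interpret H: comm_group H by fact
 have c: "f x \<in> carrier H" "f y \<in> carrier H" using assms hom_in_carrier by fast+
 have "f (x *[G] inv[G] y) = f x *[H] inv[H] f y"
  using assms by (simp add: hom_mult hom_invD)
 moreover have "f x *[H] inv[H] f y = \<one>[H] \<longleftrightarrow> f x = f y"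
  using c by (simp add: H.inv_solve_right')
 ultimately show ?thesis by simp
qed

text \<open>A quotient group can be kept on the type of the group itself by choosing representatives of the
 cosets.\<close>

definition coset_rep :: "('a, 'z) monoid_scheme => 'a set => 'a => 'a" where
 "coset_rep G N x = (SOME y. y \<in> carrier G \<and> x *[G] inv[G] y \<in> N)"

lemma coset_rep_eq_iff:
 assumes "comm_group G" "subgroup N G" "x \<in> carrier G" "y \<in> carrier G"
 shows "coset_rep G N x = coset_rep G N y \<longleftrightarrow> x *[G] inv[G] y \<in> N"
proof -
 interpret G: comm_group G by fact
 interpret N: subgroup N G by fact
 have r: "coset_rep G N x \<in> carrier G \<and> x *[G] inv[G] coset_rep G N x \<in> N" if "x \<in> carrier G" for x
 proof -
  have "x \<in> carrier G \<and> x *[G] inv[G] x \<in> N" using that by simp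
  then show ?thesis unfolding coset_rep_def by (rule someI)
 qed
 have trans: "a *[G] inv[G] c \<in> N" if "a *[G] inv[G] b \<in> N" "b *[G] inv[G] c \<in> N"
  "a \<in> carrier G" "b \<in> carrier G" "c \<in> carrier G" for a b c
 proof -
  have "inv[G] b *[G] (b *[G] inv[G] c) = inv[G] c"
   using that by (simp flip: G.m_assoc)
  then have "(a *[G] inv[G] b) *[G] (b *[G] inv[G] c) = a *[G] inv[G] c"
   using that by (simp add: G.m_assoc)
  then show ?thesis using that(1,2) N.m_closed by metis
 qed
 have sym: "b *[G] inv[G] a \<in> N" if "a *[G] inv[G] b \<in> N" "a \<in> carrier G" "b \<in> carrier G" for a b
 proof -
  have "inv[G] (a *[G] inv[G] b) = b *[G] inv[G] a"
   using that by (simp add: G.inv_mult_group)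
  then show ?thesis using that(1) N.m_inv_closed by metis
 qed
 show ?thesis
 proof
  assume "coset_rep G N x = coset_rep G N y"
  then show "x *[G] inv[G] y \<in> N"
   using r[OF assms(3)] r[OF assms(4)] trans sym assms by metis
 next
  assume "x *[G] inv[G] y \<in> N"
  then have "(z \<in> carrier G \<and> x *[G] inv[G] z \<in> N) = (z \<in> carrier G \<and> y *[G] inv[G] z \<in> N)" for z
   using trans sym assms(3,4) by metis
  then show "coset_rep G N x = coset_rep G N y" by (simp add: coset_rep_def)
 qed
qed

lemma coset_rep_cong:
 assumes "comm_group G" "subgroup N G" "x \<in> carrier G" "y \<in> carrier G" "x' \<in> carrier G" "y' \<in> carrier G"
  and "coset_rep G N x = coset_rep G N x'" "coset_rep G N y = coset_rep G N y'"
 shows "coset_rep G N (x *[G] y) = coset_rep G N (x' *[G] y')"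
proof -
 interpret G: comm_group G by fact
 interpret N: subgroup N G by fact
 have "(x *[G] inv[G] x') *[G] (y *[G] inv[G] y') \<in> N"
  using assms by (simp add: coset_rep_eq_iff N.m_closed)
 moreover have "(x *[G] inv[G] x') *[G] (y *[G] inv[G] y') = (x *[G] y) *[G] inv[G] (x' *[G] y')"
  using assms(3-6) by (simp add: G.inv_mult G.m_ac)
 ultimately show ?thesis using assms by (simp add: coset_rep_eq_iff)
qed

lemma quotient_group_exists:
 fixes G :: "'a monoid"
 assumes "comm_group G" "subgroup N G"
 obtains Q :: "'a monoid" and q where "comm_group Q" "q \<in> hom G Q" "q ` carrier G = carrier Q"
  "!!x. x \<in> carrier G ==> q x = \<one>[Q] \<longleftrightarrow> x \<in> N"
proof
 let ?r = "coset_rep G N"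
 interpret G: comm_group G by fact
 have c: "?r (x *[G] y) = ?r (x' *[G] y')" if "x \<in> carrier G" "x' \<in> carrier G" "y \<in> carrier G"
  "y' \<in> carrier G" "?r x = ?r x'" "?r y = ?r y'" for x y x' y'
  using coset_rep_cong[OF assms] that by blast
 show "comm_group (img_group G ?r)" "?r \<in> hom G (img_group G ?r)"
  using img_group[OF assms(1), of ?r] c by blast+
 show "?r ` carrier G = carrier (img_group G ?r)" by simp
 show "?r x = \<one>[img_group G ?r] \<longleftrightarrow> x \<in> N" if "x \<in> carrier G" for x
  using coset_rep_eq_iff[OF assms that, of "\<one>[G]"] that by (simp add: img_group_def)
qed

definition divisible :: "('a, 'z) monoid_scheme => bool" where
 "divisible D \<longleftrightarrow> (\<forall>n::nat. \<forall>x\<in>carrier D. 0 < n --> (\<exists>y\<in>carrier D. y ^[D] n = x))"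

lemma divisible_image:
 assumes "divisible D" "comm_group D" "comm_group E" "f \<in> hom D E" "f ` carrier D = carrier E"
 shows "divisible E"
 unfolding divisible_def
proof (intro allI ballI impI)
 fix n :: nat and x assume "x \<in> carrier E" "0 < n"
 then obtain y where y: "y \<in> carrier D" "x = f y" using assms(5) by auto
 then obtain z where z: "z \<in> carrier D" "z ^[D] n = y"
  using assms(1) \<open>0 < n\<close> unfolding divisible_def by blast
 have "f z ^[E] n = f (z ^[D] n)"
  using hom_nat_pow[OF assms(4) z(1), of n] assms by (simp add: comm_groupD)
 then show "\<exists>y\<in>carrier E. y ^[E] n = x"
  using z y assms(5) by (metis imageI)
qed

lemma transport_group:
 assumes "comm_group G" "inj_on r (carrier G)"
 shows "comm_group (img_group G r)" "r \<in> hom G (img_group G r)"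
 using img_group[OF assms(1), of r] assms(2) by (auto simp: inj_on_def)

text \<open>A partial extension of \<open>f\<close> along \<open>a\<close> is encoded by its graph, a subgroup of
 \<open>B \<times> D\<close> that meets \<open>0 \<times> D\<close> trivially. Zorn's lemma gives a maximal
 one.\<close>

lemma maximal_functional_subgroup:
 assumes "comm_group A" "comm_group B" "comm_group D" "a \<in> hom A B" "inj_on a (carrier A)" "f \<in> hom A D"
 obtains H where "subgroup H (B \<times>\<times> D)" "!!x. x \<in> carrier A ==> (a x, f x) \<in> H"
  "!!y. (\<one>[B], y) \<in> H ==> y = \<one>[D]"
  "!!H'. [|subgroup H' (B \<times>\<times> D); H \<subseteq> H'; !!y. (\<one>[B], y) \<in> H' ==> y = \<one>[D]|] ==> H' = H"
proof -
 interpret A: comm_group A by fact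
 interpret B: comm_group B by fact
 interpret D: comm_group D by fact
 interpret P: group "B \<times>\<times> D" by (intro DirProd_group B.is_group D.is_group)
 let ?H0 = "(%x. (a x, f x)) ` carrier A"
 define \<F> where "\<F> = {H. subgroup H (B \<times>\<times> D) \<and> ?H0 \<subseteq> H \<and> (\<forall>y. (\<one>[B], y) \<in> H --> y = \<one>[D])}"
 have "(%x. (a x, f x)) \<in> hom A (B \<times>\<times> D)"
  using assms(4,6) by (auto simp: hom_def)
 then interpret h: group_hom A "B \<times>\<times> D" "%x. (a x, f x)"
  by (simp add: group_hom.intro group_hom_axioms.intro A.is_group P.is_group)
 have "subgroup ?H0 (B \<times>\<times> D)" by (rule h.img_is_subgroup)
 moreover have "y = \<one>[D]" if "(\<one>[B], y) \<in> ?H0" for y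
 proof -
  obtain x where x: "x \<in> carrier A" "a x = \<one>[B]" "y = f x" using \<open>(\<one>[B], y) \<in> ?H0\<close> by auto
  then have "a x = a \<one>[A]" using assms by (simp add: hom_oneD)
  then have "x = \<one>[A]" using x assms(5) by (meson A.one_closed inj_onD)
  then show ?thesis using x assms by (simp add: hom_oneD)
 qed
 ultimately have ne: "\<F> \<noteq> {}" unfolding \<F>_def by blast
 have ch: "\<Union>\<C> \<in> \<F>" if "\<C> \<noteq> {}" "subset.chain \<F> \<C>" for \<C>
 proof -
  have sub: "S \<in> \<F>" if "S \<in> \<C>" for S using that \<open>subset.chain \<F> \<C>\<close> by (auto simp: subset.chain_def)
  obtain S0 where S0: "S0 \<in> \<C>" using \<open>\<C> \<noteq> {}\<close> by blast
  have "subgroup (\<Union>\<C>) (B \<times>\<times> D)"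
  proof (rule P.subgroupI)
   show "\<Union>\<C> \<subseteq> carrier (B \<times>\<times> D)" using sub by (fastforce simp: \<F>_def dest: subgroup.subset)
   show "\<Union>\<C> \<noteq> {}" using S0 sub by (fastforce simp: \<F>_def dest: subgroup.one_closed)
   fix x assume "x \<in> \<Union>\<C>"
   then show "inv[B \<times>\<times> D] x \<in> \<Union>\<C>" using sub by (fastforce simp: \<F>_def dest: subgroup.m_inv_closed)
  next
   fix x y assume "x \<in> \<Union>\<C>" "y \<in> \<Union>\<C>"
   then obtain S T where ST: "S \<in> \<C>" "T \<in> \<C>" "x \<in> S" "y \<in> T" by blast
   then have "S \<subseteq> T \<or> T \<subseteq> S" using \<open>subset.chain \<F> \<C>\<close> by (auto simp: subset.chain_def)
   then obtain R where "R \<in> \<C>" "x \<in> R" "y \<in> R" using ST by blast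
   then have "x *[B \<times>\<times> D] y \<in> R"
    using sub by (intro subgroup.m_closed) (auto simp: \<F>_def)
   then show "x *[B \<times>\<times> D] y \<in> \<Union>\<C>" using \<open>R \<in> \<C>\<close> by blast
  qed
  then show ?thesis using sub S0 by (fastforce simp: \<F>_def)
 qed
 obtain H where H: "H \<in> \<F>" "!!X. X \<in> \<F> ==> H \<subseteq> X ==> X = H"
  using subset_Zorn_nonempty[OF ne ch] by auto
 show thesis
 proof (rule that[of H])
  show "subgroup H (B \<times>\<times> D)" "!!y. (\<one>[B], y) \<in> H ==> y = \<one>[D]" using H(1) by (auto simp: \<F>_def)
  show "!!x. x \<in> carrier A ==> (a x, f x) \<in> H" using H(1) by (auto simp: \<F>_def)
  show "H' = H" if "subgroup H' (B \<times>\<times> D)" "H \<subseteq> H'" "!!y. (\<one>[B], y) \<in> H' ==> y = \<one>[D]" for H'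
  proof -
   have "?H0 \<subseteq> H'" using H(1) that(2) unfolding \<F>_def by blast
   then have "H' \<in> \<F>" using that(1,3) by (simp add: \<F>_def)
   then show ?thesis using H(2) that(2) by blast
  qed
 qed
qed

lemma functional_subgroup:
 assumes "comm_group B" "comm_group D" "subgroup H (B \<times>\<times> D)" and fn: "\<forall>y. (\<one>[B], y) \<in> H --> y = \<one>[D]"
 shows "(u, v) \<in> H ==> u \<in> carrier B \<and> v \<in> carrier D"
  "(u, v) \<in> H ==> (u', v') \<in> H ==> (u *[B] u', v *[D] v') \<in> H"
  "(u, v) \<in> H ==> (inv[B] u, inv[D] v) \<in> H"
  "(u, v) \<in> H ==> (u, v') \<in> H ==> v = v'"
proof -
 interpret B: comm_group B by fact
 interpret D: comm_group D by fact
 interpret H: subgroup H "B \<times>\<times> D" by fact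
 show car: "u \<in> carrier B \<and> v \<in> carrier D" if "(u, v) \<in> H" for u v using that H.subset by auto
 show mult: "(u *[B] u', v *[D] v') \<in> H" if "(u, v) \<in> H" "(u', v') \<in> H" for u v u' v'
  using H.m_closed[OF that] by simp
 show inv: "(inv[B] u, inv[D] v) \<in> H" if "(u, v) \<in> H" for u v
  using H.m_inv_closed[OF that] car[OF that] by (simp add: B.is_group D.is_group)
 assume that: "(u, v) \<in> H" "(u, v') \<in> H"
 have "(\<one>[B], v *[D] inv[D] v') \<in> H" using mult[OF that(1) inv[OF that(2)]] car[OF that(1)] by simp
 then have "v *[D] inv[D] v' = \<one>[D]" using fn by blast
 then show "v = v'" using car that by (metis D.inv_solve_right' D.l_one D.one_closed)
qed

text \<open>Let \<open>n\<close> be the least positive exponent with \<open>x^n\<close> in the domain of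
 \<open>H\<close>. The value there has an \<open>n\<close>-th root \<open>d\<close>, and \<open>d\<close> is a
 consistent value at \<open>x\<close>, since by division with remainder only the multiples of \<open>n\<close> occur as
 exponents. If there is no such \<open>n\<close>, every \<open>d\<close> is consistent.\<close>

lemma compatible_root:
 assumes "comm_group B" "comm_group D" "divisible D" "subgroup H (B \<times>\<times> D)"
  and fn: "!!y. (\<one>[B], y) \<in> H ==> y = \<one>[D]" and x: "x \<in> carrier B"
 obtains d where "d \<in> carrier D" "!!(k::int) y. (x ^[B] k, y) \<in> H ==> y = d ^[D] k"
proof -
 interpret B: comm_group B by fact
 interpret D: comm_group D by fact
 interpret P: group "B \<times>\<times> D" by (intro DirProd_group B.is_group D.is_group)
 interpret H: subgroup H "B \<times>\<times> D" by fact
 have "\<forall>y. (\<one>[B], y) \<in> H --> y = \<one>[D]" using fn by blast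
 note fs = functional_subgroup[OF assms(1,2,4) this]
 have car: "u \<in> carrier B" "v \<in> carrier D" if "(u, v) \<in> H" for u v using fs(1)[OF that] by auto
 note mult = fs(2) and inv = fs(3) and uniq = fs(4)
 have npow: "(u ^[B] n, v ^[D] n) \<in> H" if "(u, v) \<in> H" for u v and n :: nat
 proof (induction n)
  case 0 then show ?case using H.one_closed by simp
 next
  case (Suc n) then show ?case using mult[OF Suc that] by simp
 qed
 have ipow: "(u ^[B] k, v ^[D] k) \<in> H" if "(u, v) \<in> H" for u v and k :: int
 proof (cases "k < 0")
  case True
  then show ?thesis unfolding int_pow_def2 using inv[OF npow[OF that, of "nat (- k)"]] by simp
 next
  case False
  then show ?thesis unfolding int_pow_def2 using npow[OF that, of "nat k"] by simp
 qed
 show thesis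
 proof (cases "\<exists>n::nat. 0 < n \<and> (\<exists>y. (x ^[B] n, y) \<in> H)")
  case False
  have "k = 0" if "(x ^[B] k, y) \<in> H" for k :: int and y
  proof (rule ccontr)
   assume "k \<noteq> 0"
   have "\<exists>y. (x ^[B] nat \<bar>k\<bar>, y) \<in> H"
   proof (cases "k < 0")
    case True
    then have "nat \<bar>k\<bar> = nat (- k)" by simp
    then have "x ^[B] k = inv[B] (x ^[B] nat \<bar>k\<bar>)"
     using True by (simp only: int_pow_def2 if_True)
    then have "inv[B] (x ^[B] k) = x ^[B] nat \<bar>k\<bar>" using x by simp
    then show ?thesis using inv[OF that] by metis
   next
    case False
    then have "nat \<bar>k\<bar> = nat k" by simp
    then have "x ^[B] k = x ^[B] nat \<bar>k\<bar>"
     using False by (simp only: int_pow_def2 if_False)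
    then show ?thesis using that by metis
   qed
   then show False using False \<open>k \<noteq> 0\<close> by (meson zero_less_abs_iff zero_less_nat_eq)
  qed
  then have "y = \<one>[D] ^[D] k" if "(x ^[B] k, y) \<in> H" for k :: int and y
   using that fn by (metis int_pow_0)
  then show thesis by (rule that[OF D.one_closed])
 next
  case True
  define n where "n = (LEAST n::nat. 0 < n \<and> (\<exists>y. (x ^[B] n, y) \<in> H))"
  have n: "0 < n" "\<exists>y. (x ^[B] n, y) \<in> H" using LeastI_ex[OF True] unfolding n_def by auto
  have least: "~ (0 < m \<and> (\<exists>y. (x ^[B] m, y) \<in> H))" if "m < n" for m
   using not_less_Least that unfolding n_def by blast
  obtain y0 where y0: "(x ^[B] n, y0) \<in> H" using n by blast
  then have "y0 \<in> carrier D" by (rule car)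
  then obtain d where d: "d \<in> carrier D" "d ^[D] n = y0"
   using assms(3) n(1) unfolding divisible_def by blast
  have "y = d ^[D] k" if ky: "(x ^[B] k, y) \<in> H" for k :: int and y
  proof -
   define q r where "q = k div int n" and "r = k mod int n"
   have k: "k = int n * q + r" by (simp add: q_def r_def)
   have r: "0 \<le> r" "r < int n" using n by (auto simp: r_def)
   have nq: "(x ^[B] (int n * q), d ^[D] (int n * q)) \<in> H"
    using ipow[OF y0, of q] x d by (simp add: B.int_pow_pow[symmetric] D.int_pow_pow[symmetric] int_pow_int)
   have "x ^[B] k *[B] inv[B] (x ^[B] (int n * q)) = x ^[B] r"
    using x by (simp add: k flip: B.int_pow_diff)
   then have "\<exists>z. (x ^[B] nat r, z) \<in> H"
    using mult[OF ky inv[OF nq]] r by (metis int_nat_eq int_pow_int)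
   then have "r = 0" using least[of "nat r"] r by auto
   then show ?thesis using uniq[OF ky] nq k by simp
  qed
  then show thesis using that d by blast
 qed
qed

text \<open>Adjoining \<open>(x, d)\<close> with a consistent value \<open>d\<close> keeps the maximal graph single
 valued, so the graph was already defined at \<open>x\<close>.\<close>

theorem divisible_hom_extension:
 assumes "comm_group A" "comm_group B" "comm_group D" "divisible D"
  and a: "a \<in> hom A B" "inj_on a (carrier A)" and "f \<in> hom A D"
 obtains g where "g \<in> hom B D" "!!x. x \<in> carrier A ==> g (a x) = f x"
proof -
 interpret B: comm_group B by fact
 interpret D: comm_group D by fact
 interpret P: group "B \<times>\<times> D" by (intro DirProd_group B.is_group D.is_group)
 obtain H where H: "subgroup H (B \<times>\<times> D)" "!!x. x \<in> carrier A ==> (a x, f x) \<in> H"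
  "!!y. (\<one>[B], y) \<in> H ==> y = \<one>[D]"
  "!!H'. [|subgroup H' (B \<times>\<times> D); H \<subseteq> H'; !!y. (\<one>[B], y) \<in> H' ==> y = \<one>[D]|] ==> H' = H"
  using maximal_functional_subgroup[OF assms(1-3) a assms(7)] by blast
 interpret H: subgroup H "B \<times>\<times> D" by fact
 have "\<forall>y. (\<one>[B], y) \<in> H --> y = \<one>[D]" using H(3) by blast
 note fs = functional_subgroup[OF assms(2,3) H(1) this]
 have car: "u \<in> carrier B" "v \<in> carrier D" if "(u, v) \<in> H" for u v using fs(1)[OF that] by auto
 note mult = fs(2) and inv = fs(3) and uniq = fs(4)
 have total: "\<exists>d. (x, d) \<in> H" if x: "x \<in> carrier B" for x
 proof -
  obtain d where d: "d \<in> carrier D" "!!(k::int) y. (x ^[B] k, y) \<in> H ==> y = d ^[D] k"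
   using compatible_root[OF assms(2-4) H(1,3) x] by blast
  define H' where "H' = {(u *[B] x ^[B] k, v *[D] d ^[D] k) | u v (k::int). (u, v) \<in> H}"
  have H'I: "(u *[B] x ^[B] k, v *[D] d ^[D] k) \<in> H'" if "(u, v) \<in> H" for u v and k :: int
   using that unfolding H'_def by blast
  have one: "(\<one>[B], \<one>[D]) \<in> H" using H.one_closed by simp
  have "H \<subseteq> H'"
  proof
   fix z assume z: "z \<in> H"
   then show "z \<in> H'" using H'I[of "fst z" "snd z" 0] car[of "fst z" "snd z"] by simp
  qed
  moreover have "subgroup H' (B \<times>\<times> D)"
  proof (rule P.subgroupI)
   show "H' \<subseteq> carrier (B \<times>\<times> D)" using car x d unfolding H'_def by auto
   show "H' \<noteq> {}" using H'I[OF one] by blast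
   fix z assume "z \<in> H'"
   then obtain u v and k :: int where z: "z = (u *[B] x ^[B] k, v *[D] d ^[D] k)" "(u, v) \<in> H"
    unfolding H'_def by blast
   have "inv[B \<times>\<times> D] z = (inv[B] u *[B] x ^[B] (-k), inv[D] v *[D] d ^[D] (-k))"
    using z car[OF z(2)] x d(1)
    by (simp add: B.is_group D.is_group B.inv_mult D.inv_mult B.int_pow_neg D.int_pow_neg)
   then show "inv[B \<times>\<times> D] z \<in> H'" using H'I[OF inv[OF z(2)]] by simp
  next
   fix z w assume "z \<in> H'" "w \<in> H'"
   then obtain u v u' v' and k l :: int where z: "z = (u *[B] x ^[B] k, v *[D] d ^[D] k)" "(u, v) \<in> H"
    and w: "w = (u' *[B] x ^[B] l, v' *[D] d ^[D] l)" "(u', v') \<in> H"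
    unfolding H'_def by blast
   have "z *[B \<times>\<times> D] w = ((u *[B] u') *[B] x ^[B] (k + l), (v *[D] v') *[D] d ^[D] (k + l))"
    using z w car[OF z(2)] car[OF w(2)] x d(1)
    by (simp add: B.int_pow_mult D.int_pow_mult B.m_ac D.m_ac)
   then show "z *[B \<times>\<times> D] w \<in> H'" using H'I[OF mult[OF z(2) w(2)]] by simp
  qed
  moreover have "y = \<one>[D]" if "(\<one>[B], y) \<in> H'" for y
  proof -
   obtain u v and k :: int where z: "\<one>[B] = u *[B] x ^[B] k" "y = v *[D] d ^[D] k" "(u, v) \<in> H"
    using \<open>(\<one>[B], y) \<in> H'\<close> unfolding H'_def by blast
   have "inv[B] (x ^[B] k) = u"
    using z(1) x car(1)[OF z(3)] by (intro B.inv_equality) auto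
   then have "u = x ^[B] (-k)" using x by (simp add: B.int_pow_neg)
   then have "v = d ^[D] (-k)" using d(2) z(3) by blast
   then show ?thesis using z(2) d(1) by (simp add: D.int_pow_neg)
  qed
  ultimately have "H' = H" using H(4) by blast
  then show ?thesis using H'I[OF one, of 1] x d by auto
 qed
 define g where "g x = (THE d. (x, d) \<in> H)" for x
 have g: "g x = d" if "(x, d) \<in> H" for x d
  unfolding g_def using that uniq by blast
 have gH: "(x, g x) \<in> H" if "x \<in> carrier B" for x using total[OF that] g by auto
 have "g \<in> hom B D"
  using gH car mult by (intro homI) (blast, metis g)
 moreover have "g (a x) = f x" if "x \<in> carrier A" for x using H(2)[OF that] g by blast
 ultimately show thesis using that by blast
qed

definition projective_group :: "'u itself => 'a monoid => bool" where
 "projective_group U F \<longleftrightarrow> comm_group F \<and>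
   (\<forall>(A :: 'u monoid) (B :: 'u monoid) e f. comm_group A --> comm_group B --> e \<in> hom A B -->
    e ` carrier A = carrier B --> f \<in> hom F B --> (\<exists>h\<in>hom F A. \<forall>x\<in>carrier F. e (h x) = f x))"

lemma free_Abelian_group_hom_eq:
 assumes "f \<in> hom (free_Abelian_group S) G" "g \<in> hom (free_Abelian_group S) G" "comm_group G"
  and "!!a. a \<in> S ==> f (frag_of a) = g (frag_of a)" and "Poly_Mapping.keys x \<subseteq> S"
 shows "f x = g x"
proof (rule free_Abelian_group_induct[OF assms(5)])
 show "f 0 = g 0" using hom_oneD[OF assms(1) abelian_free_Abelian_group assms(3)]
  hom_oneD[OF assms(2) abelian_free_Abelian_group assms(3)] by simp
next
 fix x y
 assume xy: "Poly_Mapping.keys x \<subseteq> S" "Poly_Mapping.keys y \<subseteq> S" "f x = g x" "f y = g y"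
 have "h (x - y) = h x *[G] inv[G] h y" if "h \<in> hom (free_Abelian_group S) G" for h
  using hom_mult[OF that, of x "- y"] hom_invD[OF that abelian_free_Abelian_group assms(3), of y] xy(1,2) by simp
 from this[OF assms(1)] this[OF assms(2)] xy show "f (x - y) = g (x - y)" by simp
qed (use assms(4) in auto)

lemma projective_free_Abelian_group: "projective_group TYPE('u) (free_Abelian_group S)"
 unfolding projective_group_def
proof (intro conjI allI impI abelian_free_Abelian_group)
 fix A B :: "'u monoid" and e f
 assume A: "comm_group A" and B: "comm_group B" and e: "e \<in> hom A B" "e ` carrier A = carrier B"
  and f: "f \<in> hom (free_Abelian_group S) B"
 interpret A: comm_group A by fact
 define t where "t s = inv_into (carrier A) e (f (frag_of s))" for s
 have fc: "f (frag_of s) \<in> e ` carrier A" if "s \<in> S" for s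
  using that e(2) hom_in_carrier[OF f] by simp
 have "t s \<in> carrier A" if "s \<in> S" for s unfolding t_def by (rule inv_into_into[OF fc[OF that]])
 then have "t ` S \<subseteq> carrier A" by blast
 then obtain h where h: "h \<in> hom (free_Abelian_group S) A" "!!s. s \<in> S ==> h (frag_of s) = t s"
  using A.free_Abelian_group_universal by blast
 have "e \<circ> h \<in> hom (free_Abelian_group S) B" using h(1) e(1) by (rule Group.hom_compose)
 moreover have "(e \<circ> h) (frag_of s) = f (frag_of s)" if "s \<in> S" for s
  using fc[OF that] that by (simp add: h t_def f_inv_into_f)
 ultimately have "(e \<circ> h) x = f x" if "Poly_Mapping.keys x \<subseteq> S" for x
  using free_Abelian_group_hom_eq[OF _ f B] that by blast
 then show "\<exists>h\<in>hom (free_Abelian_group S) A. \<forall>x\<in>carrier (free_Abelian_group S). e (h x) = f x"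
  using h(1) by (intro bexI[of _ h]) auto
qed

lemma free_Abelian_group_cover:
 assumes "comm_group A"
 obtains h where "h \<in> hom (free_Abelian_group (carrier A)) A"
  "h ` carrier (free_Abelian_group (carrier A)) = carrier A" "!!x. x \<in> carrier A ==> h (frag_of x) = x"
proof -
 interpret A: comm_group A by fact
 obtain h where h: "h \<in> hom (free_Abelian_group (carrier A)) A" "!!x. x \<in> carrier A ==> h (frag_of x) = x"
  using A.free_Abelian_group_universal[of "%x. x" "carrier A"] by auto
 have "x \<in> h ` carrier (free_Abelian_group (carrier A))" if "x \<in> carrier A" for x
  using h(2)[OF that] that by (intro image_eqI[of _ _ "frag_of x"]) auto
 moreover have "h ` carrier (free_Abelian_group (carrier A)) \<subseteq> carrier A"
  using h(1) by (auto simp: hom_def simp del: carrier_free_Abelian_group_iff)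
 ultimately show thesis using that h by blast
qed

text \<open>A coefficient \<open>c\<close> divisible by \<open>\<bar>c\<bar> + 1\<close> vanishes.\<close>

lemma free_Abelian_group_no_divisible:
 assumes "Poly_Mapping.keys x \<subseteq> S"
  "!!n::nat. 0 < n ==> \<exists>y\<in>carrier (free_Abelian_group S). y ^[free_Abelian_group S] n = x"
 shows "x = 0"
proof (rule poly_mapping_eqI)
 fix k
 let ?n = "nat \<bar>Poly_Mapping.lookup x k\<bar> + 1"
 obtain y where "frag_cmul (int ?n) y = x" using assms(2)[of ?n] by (metis add_gr_0 pow_free_Abelian_group zero_less_one)
 then have "int ?n * Poly_Mapping.lookup y k = Poly_Mapping.lookup x k" by (metis lookup_frag_cmul)
 then have "int ?n dvd Poly_Mapping.lookup x k" by (metis dvd_triv_left)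
 then show "Poly_Mapping.lookup x k = Poly_Mapping.lookup 0 k"
  using zdvd_not_zless[of "\<bar>Poly_Mapping.lookup x k\<bar>" "int ?n"] by (cases "Poly_Mapping.lookup x k = 0") auto
qed

subsection \<open>Divisible hulls\<close>

text \<open>The rational vector space with basis \<open>S\<close>.\<close>

definition rational_group :: "'a set => ('a \<Rightarrow>\<^sub>0 rat) monoid" where
 "rational_group S = \<lparr>carrier = {c. Poly_Mapping.keys c \<subseteq> S}, monoid.mult = (+), one = 0\<rparr>"

lemma comm_group_rational_group: "comm_group (rational_group S)"
proof (rule comm_groupI)
 fix x assume "x \<in> carrier (rational_group S)"
 then show "\<exists>y\<in>carrier (rational_group S). y *[rational_group S] x = \<one>[rational_group S]"
  by (intro bexI[of _ "- x"]) (auto simp: rational_group_def)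
qed (auto simp: rational_group_def algebra_simps dest: subsetD[OF keys_add])

lemma lookup_pow_rational_group:
 "Poly_Mapping.lookup (x ^[rational_group S] (n::nat)) k = of_nat n * Poly_Mapping.lookup x k"
 by (induction n) (auto simp: rational_group_def nat_pow_def lookup_add algebra_simps)

lemma divisible_rational_group: "divisible (rational_group S)"
 unfolding divisible_def
proof (intro allI ballI impI)
 fix n :: nat and x assume x: "x \<in> carrier (rational_group S)" and n: "0 < n"
 let ?y = "Poly_Mapping.map (%q. q / of_nat n) x"
 have "Poly_Mapping.keys ?y \<subseteq> Poly_Mapping.keys x"
  by (auto simp: in_keys_iff map.rep_eq when_def)
 moreover have "?y ^[rational_group S] n = x"
  using n by (intro poly_mapping_eqI) (auto simp: lookup_pow_rational_group map.rep_eq when_def)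
 ultimately show "\<exists>y\<in>carrier (rational_group S). y ^[rational_group S] n = x"
  using x by (auto simp: rational_group_def)
qed

lemma rational_group_lepoll:
 assumes "infinite (UNIV :: 'u set)" "S \<lesssim> (UNIV :: 'u set)"
 shows "carrier (rational_group S) \<lesssim> (UNIV :: 'u set)"
proof -
 have "countable (UNIV :: rat set)" by simp
 then have "(UNIV :: rat set) \<lesssim> (UNIV :: 'u set)" using countable_lepoll_infinite assms(1) by blast
 then have "Fpow (S \<times> (UNIV :: rat set)) \<lesssim> (UNIV :: 'u set)"
  using assms by (intro lepoll_Fpow_infinite lepoll_Times_infinite)
 moreover have "carrier (rational_group S) \<lesssim> Fpow (S \<times> (UNIV :: rat set))"
  unfolding lepoll_def
 proof (intro exI conjI)
  let ?g = "%x::'a \<Rightarrow>\<^sub>0 rat. (%k. (k, Poly_Mapping.lookup x k)) ` Poly_Mapping.keys x"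
  have "Poly_Mapping.lookup x k = Poly_Mapping.lookup y k" if "?g x = ?g y" for x y k
   using graph_eqD[OF that] by (metis in_keys_iff)
  then show "inj_on ?g (carrier (rational_group S))"
   by (intro inj_onI poly_mapping_eqI) blast
  show "?g ` carrier (rational_group S) \<subseteq> Fpow (S \<times> (UNIV :: rat set))"
   by (auto simp: Fpow_def rational_group_def)
 qed
 ultimately show ?thesis using lepoll_trans by blast
qed

text \<open>Write \<open>A = F / K\<close> with \<open>F\<close> free; then \<open>A\<close> embeds into the quotient
 by \<open>K\<close> of the rational vector space on the same basis.\<close>

theorem divisible_embedding:
 fixes A :: "'a monoid"
 assumes "comm_group A" "infinite (UNIV :: 'u set)" "carrier A \<lesssim> (UNIV :: 'u set)"
 obtains D :: "'u monoid" and i where "comm_group D" "divisible D" "i \<in> hom A D" "inj_on i (carrier A)"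
proof -
 let ?F = "free_Abelian_group (carrier A)" and ?R = "rational_group (carrier A)"
 interpret A: comm_group A by fact
 interpret F: comm_group ?F by (rule abelian_free_Abelian_group)
 obtain h where h0: "h \<in> hom ?F A" "h ` carrier ?F = carrier A" "!!x. x \<in> carrier A ==> h (frag_of x) = x"
  using free_Abelian_group_cover[OF assms(1)] by blast
 note h = h0(1,3)
 let ?m = "Poly_Mapping.map (of_int :: int => rat) :: ('a \<Rightarrow>\<^sub>0 int) => _"
 have lm: "Poly_Mapping.lookup (?m x) k = of_int (Poly_Mapping.lookup x k)" for x k
  by (auto simp: map.rep_eq when_def)
 have m: "?m \<in> hom ?F ?R"
  by (intro homI) (auto simp: rational_group_def in_keys_iff lm lookup_add intro!: poly_mapping_eqI)
 interpret R: comm_group ?R by (rule comm_group_rational_group)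
 interpret m: group_hom ?F ?R ?m using abelian_free_Abelian_group comm_group_rational_group m by (rule group_homI)
 interpret h: group_hom ?F A h using abelian_free_Abelian_group assms(1) h(1) by (rule group_homI)
 have inj_m: "x = y" if "?m x = ?m y" for x y
  using that lm by (metis of_int_eq_iff poly_mapping_eqI)
 define K where "K = ?m ` kernel ?F A h"
 have "subgroup K ?R" unfolding K_def by (intro m.subgroup_img_is_subgroup h.subgroup_kernel)
 then obtain Q :: "('a \<Rightarrow>\<^sub>0 rat) monoid" and q where Q: "comm_group Q" "q \<in> hom ?R Q" "q ` carrier ?R = carrier Q"
  "!!x. x \<in> carrier ?R ==> q x = \<one>[Q] \<longleftrightarrow> x \<in> K"
  using quotient_group_exists[OF comm_group_rational_group] by blast
 interpret Q: comm_group Q by fact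
 define j where "j a = q (?m (frag_of a))" for a
 have qm: "q \<circ> ?m \<in> hom ?F Q" using m Q(2) by (rule Group.hom_compose)
 have key: "q (?m x) = \<one>[Q] \<longleftrightarrow> h x = \<one>[A]" if "x \<in> carrier ?F" for x
 proof -
  have "?m x \<in> carrier ?R" using that by (rule m.hom_closed)
  then have "q (?m x) = \<one>[Q] \<longleftrightarrow> ?m x \<in> K" by (rule Q(4))
  also have "\<dots> \<longleftrightarrow> x \<in> kernel ?F A h" unfolding K_def using inj_m by blast
  finally show ?thesis using that by (simp add: kernel_def)
 qed
 have jF: "j (h x) = q (?m x)" if x: "x \<in> carrier ?F" for x
 proof -
  have hx: "h x \<in> carrier A" using x by (rule h.hom_closed)
  have fx: "frag_of (h x) \<in> carrier ?F" using hx by simp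
  have "h (frag_of (h x) *[?F] inv[?F] x) = \<one>[A]"
   using hom_eq_iff_diff[OF h(1) abelian_free_Abelian_group assms(1) fx x] h(2)[OF hx] by simp
  then have "(q \<circ> ?m) (frag_of (h x) *[?F] inv[?F] x) = \<one>[Q]"
   using key fx x F.m_closed F.inv_closed by (metis comp_apply)
  then show ?thesis
   using hom_eq_iff_diff[OF qm abelian_free_Abelian_group Q(1) fx x] by (simp add: j_def)
 qed
 have j: "j \<in> hom A Q"
 proof (rule homI)
  fix x y assume xy: "x \<in> carrier A" "y \<in> carrier A"
  have c: "frag_of x \<in> carrier ?F" "frag_of y \<in> carrier ?F" using xy by auto
  have "h (frag_of x *[?F] frag_of y) = x *[A] y" using h.hom_mult[OF c] h(2) xy by simp
  then have "j (x *[A] y) = q (?m (frag_of x *[?F] frag_of y))"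
   using jF F.m_closed[OF c] by metis
  then show "j (x *[A] y) = j x *[Q] j y"
   using hom_mult[OF qm c] by (simp add: j_def)
 next
  fix x assume "x \<in> carrier A"
  then show "j x \<in> carrier Q" using hom_in_carrier[OF qm, of "frag_of x"] by (simp add: j_def)
 qed
 have inj: "inj_on j (carrier A)"
 proof (rule hom_inj_onI[OF j assms(1) Q(1)])
  fix x assume "x \<in> carrier A" "j x = \<one>[Q]"
  then show "x = \<one>[A]" using key[of "frag_of x"] h(2) by (simp add: j_def)
 qed
 have "divisible Q" using divisible_image[OF divisible_rational_group comm_group_rational_group Q(1-3)] .
 have "carrier Q \<lesssim> carrier ?R" using Q(3) by (metis image_lepoll)
 then have "carrier Q \<lesssim> (UNIV :: 'u set)"
  using rational_group_lepoll[OF assms(2,3)] lepoll_trans by blast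
 then obtain r :: "_ => 'u" where r: "inj_on r (carrier Q)" by (auto simp: lepoll_def)
 note t = transport_group[OF Q(1) r]
 show thesis
 proof
  show "comm_group (img_group Q r)" by (rule t)
  show "divisible (img_group Q r)"
   by (rule divisible_image[OF \<open>divisible Q\<close> Q(1) t]) simp
  show "r \<circ> j \<in> hom A (img_group Q r)" using j t(2) by (rule Group.hom_compose)
  show "inj_on (r \<circ> j) (carrier A)"
   using inj r j by (metis comp_inj_on hom_carrier inj_on_subset)
 qed
qed

text \<open>Let \<open>e : A \<rightarrow> B\<close> be surjective with kernel \<open>L\<close>, and embed
 \<open>A\<close> into a divisible group \<open>D\<close>. The map \<open>K \<rightarrow> B \<subseteq> D / L\<close>
 extends to \<open>F\<close> because \<open>D / L\<close> is divisible, the extension lifts to \<open>F \<rightarrow>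
 D\<close> because \<open>F\<close> is projective, and on \<open>K\<close> the lifting takes values in
 \<open>A\<close>.\<close>

theorem projective_subgroup:
 fixes F :: "'a monoid"
 assumes "projective_group TYPE('u) F" "subgroup K F" "infinite (UNIV :: 'u set)"
 shows "projective_group TYPE('u) (F\<lparr>carrier := K\<rparr>)"
proof -
 let ?K = "F\<lparr>carrier := K\<rparr>"
 have F: "comm_group F" using assms(1) by (simp add: projective_group_def)
 interpret F: comm_group F by fact
 have K: "comm_group ?K" using F assms(2) by (rule subgroup_comm_group)
 have KF: "(%x. x) \<in> hom ?K F" "inj_on (%x. x) (carrier ?K)"
  using subgroup.subset[OF assms(2)] by (auto simp: hom_def)
 show ?thesis
  unfolding projective_group_def
 proof (intro conjI allI impI K)
  fix A B :: "'u monoid" and e f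
  assume A: "comm_group A" and B: "comm_group B" and e: "e \<in> hom A B" "e ` carrier A = carrier B"
   and f: "f \<in> hom ?K B"
  interpret A: comm_group A by fact
  interpret B: comm_group B by fact
  have "carrier A \<lesssim> (UNIV :: 'u set)" by (simp add: subset_imp_lepoll)
  then obtain D :: "'u monoid" and i where D: "comm_group D" "divisible D" "i \<in> hom A D" "inj_on i (carrier A)"
   using divisible_embedding[OF A assms(3)] by blast
  interpret e: group_hom A B e using A B e(1) by (rule group_homI)
  interpret D: comm_group D by fact
  interpret i: group_hom A D i using A D(1,3) by (rule group_homI)
  let ?L = "i ` kernel A B e"
  have "subgroup ?L D" by (intro i.subgroup_img_is_subgroup e.subgroup_kernel)
  then obtain Q :: "'u monoid" and q where Q: "comm_group Q" "q \<in> hom D Q" "q ` carrier D = carrier Q"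
   "!!x. x \<in> carrier D ==> q x = \<one>[Q] \<longleftrightarrow> x \<in> ?L"
   using quotient_group_exists[OF D(1)] by blast
  interpret Q: comm_group Q by fact
  have divQ: "divisible Q" by (rule divisible_image[OF D(2,1) Q(1-3)])
  have qi: "q \<circ> i \<in> hom A Q" using D(3) Q(2) by (rule Group.hom_compose)
  have "e x = e y \<longleftrightarrow> q (i x) = q (i y)" if "x \<in> carrier A" "y \<in> carrier A" for x y
  proof -
   have "q (i x) = q (i y) \<longleftrightarrow> q (i (x *[A] inv[A] y)) = \<one>[Q]"
    using hom_eq_iff_diff[OF qi A Q(1) that] by simp
   also have "\<dots> \<longleftrightarrow> x *[A] inv[A] y \<in> kernel A B e"
   proof -
    let ?z = "x *[A] inv[A] y"
    have z: "?z \<in> carrier A" using that by simp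
    have "q (i ?z) = \<one>[Q] \<longleftrightarrow> i ?z \<in> ?L" using i.hom_closed[OF z] by (rule Q(4))
    also have "\<dots> \<longleftrightarrow> ?z \<in> kernel A B e"
     by (rule inj_on_image_mem_iff[OF D(4) z]) (auto simp: kernel_def)
    finally show ?thesis .
   qed
   also have "\<dots> \<longleftrightarrow> e x = e y"
    using hom_eq_iff_diff[OF e(1) A B that] that by (simp add: kernel_def)
   finally show ?thesis by simp
  qed
  note eq = this
  define \<iota> where "\<iota> b = q (i (inv_into (carrier A) e b))" for b
  have \<iota>e: "\<iota> (e x) = q (i x)" if "x \<in> carrier A" for x
   unfolding \<iota>_def using that eq by (metis f_inv_into_f image_eqI inv_into_into)
  have \<iota>: "\<iota> \<in> hom B Q"
  proof (rule homI)
   fix b b' assume "b \<in> carrier B" "b' \<in> carrier B"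
   then obtain x y where xy: "x \<in> carrier A" "y \<in> carrier A" "b = e x" "b' = e y" using e(2) by blast
   then have "\<iota> (b *[B] b') = q (i (x *[A] y))"
    using \<iota>e[OF A.m_closed[OF xy(1,2)]] by simp
   then show "\<iota> (b *[B] b') = \<iota> b *[Q] \<iota> b'"
    using xy \<iota>e hom_mult[OF qi xy(1,2)] by simp
  next
   fix b assume "b \<in> carrier B"
   then obtain x where "x \<in> carrier A" "b = e x" using e(2) by blast
   then show "\<iota> b \<in> carrier Q" using \<iota>e hom_in_carrier[OF qi] by simp
  qed
  have "\<iota> \<circ> f \<in> hom ?K Q" using f \<iota> by (rule Group.hom_compose)
  then obtain g where g0: "g \<in> hom F Q" "!!x. x \<in> carrier ?K ==> g x = (\<iota> \<circ> f) x"
   using divisible_hom_extension[OF K F Q(1) divQ KF, of "\<iota> \<circ> f"] by blast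
  then have g: "g \<in> hom F Q" "!!x. x \<in> K ==> g x = \<iota> (f x)" by auto
  obtain h where h: "h \<in> hom F D" "\<forall>x\<in>carrier F. q (h x) = g x"
   using assms(1) D(1) Q(1-3) g(1) unfolding projective_group_def by blast
  have ex: "\<exists>a\<in>carrier A. i a = h x \<and> e a = f x" if x: "x \<in> K" for x
  proof -
   have xF: "x \<in> carrier F" using x subgroup.subset[OF assms(2)] by blast
   have "f x \<in> carrier B" using f x hom_in_carrier by fastforce
   then obtain b where b: "b \<in> carrier A" "e b = f x" using e(2) by (metis imageE)
   have hx: "h x \<in> carrier D" using h(1) xF hom_in_carrier by fast
   have "q (h x) = q (i b)" using h(2) xF g(2)[OF x] b \<iota>e by metis
   then have "h x *[D] inv[D] i b \<in> ?L"
    using hom_eq_iff_diff[OF Q(2) D(1) Q(1) hx i.hom_closed[OF b(1)]] Q(4) hx b(1) by auto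
   then obtain l where l: "l \<in> carrier A" "e l = \<one>[B]" "h x *[D] inv[D] i b = i l"
    by (auto simp: kernel_def)
   have "h x = i l *[D] i b" using l hx b by (metis D.inv_solve_right' i.hom_closed)
   then have "i (l *[A] b) = h x" "e (l *[A] b) = f x" using l b \<open>f x \<in> carrier B\<close> by auto
   then show ?thesis using l(1) b(1) A.m_closed by blast
  qed
  then obtain t where t: "!!x. x \<in> K ==> t x \<in> carrier A \<and> i (t x) = h x \<and> e (t x) = f x" by metis
  have "t \<in> hom ?K A"
  proof (rule homI)
   fix x y assume "x \<in> carrier ?K" "y \<in> carrier ?K"
   then have xy: "x \<in> K" "y \<in> K" "x \<in> carrier F" "y \<in> carrier F" using subgroup.subset[OF assms(2)] by auto
   then have xyK: "x *[F] y \<in> K" using subgroup.m_closed[OF assms(2)] by blast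
   have "i (t (x *[F] y)) = i (t x *[A] t y)" using t xy xyK hom_mult[OF h(1)] by simp
   then show "t (x *[?K] y) = t x *[A] t y"
    using D(4) t xy xyK A.m_closed by (auto simp: inj_on_def)
  qed (use t in auto)
  then show "\<exists>h\<in>hom ?K A. \<forall>x\<in>carrier ?K. e (h x) = f x" using t by (intro bexI[of _ t]) auto
 qed
qed

section \<open>Modules over a linear category\<close>

abbreviation el :: "('o, 'm, 'a) cmod => 'o => 'a set" where
 "el M X \<equiv> carrier (Grp M X)"

definition mhom :: "('o, 'm) lin_cat => ('o, 'm, 'a) cmod => ('o => 'a => 'b) => ('o, 'm, 'b) cmod => bool" where
 "mhom C M \<eta> N \<longleftrightarrow> (\<forall>X\<in>Obj C. \<eta> X \<in> hom (Grp M X) (Grp N X)) \<and>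
   (\<forall>f\<in>Arr C. \<forall>x\<in>el M (Cod C f). \<eta> (Dom C f) (Act M f x) = Act N f (\<eta> (Cod C f) x))"

definition submodule :: "('o, 'm) lin_cat => ('o, 'm, 'a) cmod => ('o => 'a set) => bool" where
 "submodule C M S \<longleftrightarrow> (\<forall>X\<in>Obj C. subgroup (S X) (Grp M X)) \<and>
   (\<forall>f\<in>Arr C. \<forall>x\<in>S (Cod C f). Act M f x \<in> S (Dom C f))"

definition restrict_module :: "('o, 'm, 'a) cmod => ('o => 'a set) => ('o, 'm, 'a) cmod" where
 "restrict_module M S = \<lparr>Grp = (%X. (Grp M X)\<lparr>carrier := S X\<rparr>), Act = Act M\<rparr>"

definition img_module :: "('o, 'm) lin_cat => ('o, 'm, 'a) cmod => ('o => 'a => 'b) => ('o, 'm, 'b) cmod" where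
 "img_module C M r = \<lparr>Grp = (%X. img_group (Grp M X) (r X)),
   Act = (%f a. r (Dom C f) (Act M f (inv_into (el M (Cod C f)) (r (Cod C f)) a)))\<rparr>"

abbreviation mzero ("\<zero>[_,_]") where "\<zero>[M,X] == \<one>[Grp M X]"

abbreviation madd ("_ +[_,_] _" [65, 0, 0, 66] 65) where "x +[M,X] y == x *[Grp M X] y"

text \<open>Exactness of \<open>0 \<rightarrow> L \<rightarrow> M \<rightarrow> N \<rightarrow> 0\<close> is tested on
 elements; this agrees with exactness in the category of modules.\<close>

definition mses :: "('o, 'm) lin_cat => ('o, 'm, 'a) cmod => ('o => 'a => 'b) => ('o, 'm, 'b) cmod =>
  ('o => 'b => 'c) => ('o, 'm, 'c) cmod => bool" where
 "mses C L j M q N \<longleftrightarrow> is_module C L \<and> is_module C M \<and> is_module C N \<and> mhom C L j M \<and> mhom C M q N \<and>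
   (\<forall>X\<in>Obj C. inj_on (j X) (el L X) \<and> q X ` el M X = el N X \<and>
    (\<forall>y\<in>el M X. q X y = \<zero>[N,X] \<longleftrightarrow> y \<in> j X ` el L X))"

locale linear_category =
 fixes C :: "('o, 'm) lin_cat"
 assumes category: "category C"
  and Add_homs: "[|f \<in> homs C X Y; g \<in> homs C X Y|] ==> Add C f g \<in> homs C X Y"
begin

abbreviation Ob where "Ob == Obj C"
abbreviation Ar where "Ar == Arr C"
abbreviation dom where "dom == Dom C"
abbreviation cod where "cod == Cod C"
abbreviation is_mod where "is_mod == is_module C"

lemma Add_arr [simp]:
 assumes "f \<in> Ar" "g \<in> Ar" "dom f = dom g" "cod f = cod g"
 shows "Add C f g \<in> Ar" "dom (Add C f g) = dom g" "cod (Add C f g) = cod g"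
 using Add_homs[of f "dom g" "cod g" g] assms by (auto simp: homs_def)

lemma Dom_Obj [simp]: "f \<in> Ar ==> dom f \<in> Ob"
 and Cod_Obj [simp]: "f \<in> Ar ==> cod f \<in> Ob"
 using category by (auto simp: category_def)

lemma Id_arr [simp]: "X \<in> Ob ==> Id C X \<in> Ar" "X \<in> Ob ==> dom (Id C X) = X"
  "X \<in> Ob ==> cod (Id C X) = X"
 using category by (auto simp: category_def homs_def)

lemma Comp_arr [simp]:
 assumes "f \<in> Ar" "g \<in> Ar" "cod f = dom g"
 shows "Comp C g f \<in> Ar" "dom (Comp C g f) = dom f" "cod (Comp C g f) = cod g"
 using category assms by (auto simp: category_def homs_def)

lemma Comp_assoc:
 "[|f \<in> Ar; g \<in> Ar; h \<in> Ar; cod f = dom g; cod g = dom h|]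
  ==> Comp C h (Comp C g f) = Comp C (Comp C h g) f"
 using category by (auto simp: category_def)

lemma Comp_Id [simp]:
 "f \<in> Ar ==> Comp C f (Id C (dom f)) = f"
 "f \<in> Ar ==> Comp C (Id C (cod f)) f = f"
 using category by (auto simp: category_def)

lemma mod_group: "is_mod M ==> X \<in> Ob ==> comm_group (Grp M X)"
 by (simp add: is_module_def)

lemma mod_mult [simp]:
 assumes "is_mod M" "X \<in> Ob" "x \<in> el M X" "y \<in> el M X"
 shows "x +[M,X] y \<in> el M X"
proof -
 interpret comm_group "Grp M X" using assms by (simp add: mod_group)
 show ?thesis using assms by simp
qed

lemma mod_one [simp]:
 assumes "is_mod M" "X \<in> Ob"
 shows "\<zero>[M,X] \<in> el M X"
proof -
 interpret comm_group "Grp M X" using assms by (simp add: mod_group)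
 show ?thesis using assms by simp
qed

lemma mod_inv [simp]:
 assumes "is_mod M" "X \<in> Ob" "x \<in> el M X"
 shows "inv[Grp M X] x \<in> el M X"
proof -
 interpret comm_group "Grp M X" using assms by (simp add: mod_group)
 show ?thesis using assms by simp
qed

lemma act_hom: "[|is_mod M; f \<in> Ar|] ==> Act M f \<in> hom (Grp M (cod f)) (Grp M (dom f))"
 by (simp add: is_module_def)

lemma act_closed [simp]: "[|is_mod M; f \<in> Ar; x \<in> el M (cod f)|] ==> Act M f x \<in> el M (dom f)"
 using act_hom hom_in_carrier by fast

lemma act_mult: "[|is_mod M; f \<in> Ar; x \<in> el M (cod f); y \<in> el M (cod f)|]
  ==> Act M f (x +[M,cod f] y) = Act M f x +[M,dom f] Act M f y"
 by (rule hom_mult[OF act_hom])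

lemma act_one: "[|is_mod M; f \<in> Ar|] ==> Act M f \<zero>[M,cod f] = \<zero>[M,dom f]"
 by (rule hom_oneD[OF act_hom]) (auto simp: mod_group)

lemma act_inv: "[|is_mod M; f \<in> Ar; x \<in> el M (cod f)|]
  ==> Act M f (inv[Grp M (cod f)] x) = inv[Grp M (dom f)] Act M f x"
 by (rule hom_invD[OF act_hom]) (auto simp: mod_group)

lemma act_Id: "[|is_mod M; X \<in> Ob; x \<in> el M X|] ==> Act M (Id C X) x = x"
 by (simp add: is_module_def)

lemma act_Comp: "[|is_mod M; f \<in> Ar; g \<in> Ar; cod f = dom g; x \<in> el M (cod g)|]
  ==> Act M (Comp C g f) x = Act M f (Act M g x)"
 by (simp add: is_module_def)

lemma act_Add: "[|is_mod M; f \<in> Ar; g \<in> Ar; dom f = dom g; cod f = cod g; x \<in> el M (cod f)|]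
  ==> Act M (Add C f g) x = Act M f x +[M,dom f] Act M g x"
 by (simp add: is_module_def)

lemma mhom_hom: "[|mhom C M \<eta> N; X \<in> Ob|] ==> \<eta> X \<in> hom (Grp M X) (Grp N X)"
 by (simp add: mhom_def)

lemma mhom_nat: "[|mhom C M \<eta> N; f \<in> Ar; x \<in> el M (cod f)|]
  ==> \<eta> (dom f) (Act M f x) = Act N f (\<eta> (cod f) x)"
 by (simp add: mhom_def)

lemma mhom_closed: "[|mhom C M \<eta> N; X \<in> Ob; x \<in> el M X|] ==> \<eta> X x \<in> el N X"
 using mhom_hom hom_in_carrier by fast

lemma mhom_mult: "[|mhom C M \<eta> N; X \<in> Ob; x \<in> el M X; y \<in> el M X|]
  ==> \<eta> X (x +[M,X] y) = \<eta> X x +[N,X] \<eta> X y"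
 by (rule hom_mult[OF mhom_hom])

lemma mhom_one: "[|mhom C M \<eta> N; is_mod M; is_mod N; X \<in> Ob|] ==> \<eta> X \<zero>[M,X] = \<zero>[N,X]"
 by (rule hom_oneD[OF mhom_hom]) (auto simp: mod_group)

lemma mhom_inv: "[|mhom C M \<eta> N; is_mod M; is_mod N; X \<in> Ob; x \<in> el M X|]
  ==> \<eta> X (inv[Grp M X] x) = inv[Grp N X] \<eta> X x"
 by (rule hom_invD[OF mhom_hom]) (auto simp: mod_group)

lemma mhomI:
 assumes "!!X x. [|X \<in> Ob; x \<in> el M X|] ==> \<eta> X x \<in> el N X"
  and "!!X x y. [|X \<in> Ob; x \<in> el M X; y \<in> el M X|] ==> \<eta> X (x +[M,X] y) = \<eta> X x +[N,X] \<eta> X y"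
  and "!!f x. [|f \<in> Ar; x \<in> el M (cod f)|] ==> \<eta> (dom f) (Act M f x) = Act N f (\<eta> (cod f) x)"
 shows "mhom C M \<eta> N"
 using assms by (auto simp: mhom_def intro!: homI)

lemma mhom_id: "mhom C M (%X x. x) M"
 by (rule mhomI) auto

lemma mhom_comp:
 assumes "mhom C L a M" "mhom C M b N"
 shows "mhom C L (%X x. b X (a X x)) N"
proof (rule mhomI)
 fix X x assume *: "X \<in> Ob" "x \<in> el L X"
 then show "b X (a X x) \<in> el N X" using mhom_closed[OF assms(1)] mhom_closed[OF assms(2)] by blast
next
 fix X x y assume *: "X \<in> Ob" "x \<in> el L X" "y \<in> el L X"
 then show "b X (a X (x +[L,X] y)) = b X (a X x) +[N,X] b X (a X y)"
  using mhom_mult[OF assms(1)] mhom_mult[OF assms(2)] mhom_closed[OF assms(1)] by simp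
next
 fix f x assume "f \<in> Ar" "x \<in> el L (cod f)"
 then show "b (dom f) (a (dom f) (Act L f x)) = Act N f (b (cod f) (a (cod f) x))"
  using mhom_nat[OF assms(1)] mhom_nat[OF assms(2)] mhom_closed[OF assms(1)] by simp
qed

lemma mhom_diff:
 assumes "is_mod N" "mhom C M a N" "mhom C M b N"
 shows "mhom C M (%X x. a X x +[N,X] inv[Grp N X] b X x) N"
proof (rule mhomI)
 fix X x assume *: "X \<in> Ob" "x \<in> el M X"
 then show "a X x +[N,X] inv[Grp N X] b X x \<in> el N X"
  using mhom_closed[OF assms(2) *] mhom_closed[OF assms(3) *] assms(1) by simp
next
 fix X x y assume *: "X \<in> Ob" "x \<in> el M X" "y \<in> el M X"
 interpret comm_group "Grp N X" using assms * by (simp add: mod_group)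
 show "a X (x +[M,X] y) +[N,X] inv[Grp N X] b X (x +[M,X] y) =
  (a X x +[N,X] inv[Grp N X] b X x) +[N,X] (a X y +[N,X] inv[Grp N X] b X y)"
  using * mhom_closed[OF assms(2)] mhom_closed[OF assms(3)]
  by (simp add: mhom_mult[OF assms(2)] mhom_mult[OF assms(3)] inv_mult m_ac)
next
 fix f x assume *: "f \<in> Ar" "x \<in> el M (cod f)"
 then show "a (dom f) (Act M f x) +[N,dom f] inv[Grp N (dom f)] b (dom f) (Act M f x) =
  Act N f (a (cod f) x +[N,cod f] inv[Grp N (cod f)] b (cod f) x)"
  using assms mhom_closed[OF assms(2)] mhom_closed[OF assms(3)]
  by (simp add: act_mult act_inv mhom_nat[OF assms(2)] mhom_nat[OF assms(3)])
qed

lemma mhom_trivial: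
 assumes "is_mod N"
 shows "mhom C M (%X x. \<zero>[N,X]) N"
proof (rule mhomI)
 fix X x y assume *: "X \<in> Ob"
 interpret comm_group "Grp N X" using assms * by (simp add: mod_group)
 show "\<zero>[N,X] = \<zero>[N,X] +[N,X] \<zero>[N,X]" by simp
qed (use assms in \<open>auto simp: act_one\<close>)

lemma mhom_eq_iff:
 assumes "mhom C M \<eta> N" "is_mod M" "is_mod N" "X \<in> Ob" "x \<in> el M X" "y \<in> el M X"
 shows "\<eta> X x = \<eta> X y \<longleftrightarrow> \<eta> X (x +[M,X] inv[Grp M X] y) = \<zero>[N,X]"
 using assms by (intro hom_eq_iff_diff mhom_hom mod_group)

lemma mhom_inj_onI:
 assumes "mhom C M \<eta> N" "is_mod M" "is_mod N" "X \<in> Ob"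
  and "!!x. x \<in> el M X ==> \<eta> X x = \<zero>[N,X] ==> x = \<zero>[M,X]"
 shows "inj_on (\<eta> X) (el M X)"
 using assms by (intro hom_inj_onI[OF mhom_hom[OF assms(1)]] mod_group) auto

lemma el_restrict_module [simp]: "el (restrict_module M S) X = S X"
 and one_restrict_module [simp]: "\<zero>[restrict_module M S,X] = \<zero>[M,X]"
 and mult_restrict_module [simp]: "x +[restrict_module M S,X] y = x +[M,X] y"
 and Act_restrict_module [simp]: "Act (restrict_module M S) = Act M"
 by (auto simp: restrict_module_def)

lemma submodule_subset: "[|submodule C M S; X \<in> Ob; x \<in> S X|] ==> x \<in> el M X"
 by (meson submodule_def subgroup.mem_carrier)

lemma is_module_restrict:
 assumes "is_mod M" "submodule C M S"
 shows "is_mod (restrict_module M S)"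
proof -
 have sub: "!!X x. X \<in> Ob ==> x \<in> S X ==> x \<in> el M X" using submodule_subset[OF assms(2)] .
 show ?thesis
  unfolding is_module_def
 proof (intro conjI ballI impI)
  fix X assume "X \<in> Ob"
  then show "comm_group (Grp (restrict_module M S) X)"
   using assms by (simp add: restrict_module_def subgroup_comm_group mod_group submodule_def)
 next
  fix f assume f: "f \<in> Ar"
  show "Act (restrict_module M S) f \<in> hom (Grp (restrict_module M S) (cod f)) (Grp (restrict_module M S) (dom f))"
   using assms f sub by (intro homI) (auto simp: submodule_def act_mult)
 qed (use assms sub in \<open>auto simp: act_Id act_Comp act_Add\<close>)
qed

lemma mhom_inclusion: "submodule C M S ==> mhom C (restrict_module M S) (%X x. x) M"
 by (rule mhomI) (auto dest: submodule_subset)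

lemma submodule_kernel:
 assumes "is_mod M" "is_mod N" "mhom C M \<eta> N"
 shows "submodule C M (%X. {x \<in> el M X. \<eta> X x = \<zero>[N,X]})"
 unfolding submodule_def
proof (intro conjI ballI)
 fix X assume X: "X \<in> Ob"
 interpret group_hom "Grp M X" "Grp N X" "\<eta> X"
  using assms X by (intro group_homI mod_group mhom_hom)
 show "subgroup {x \<in> el M X. \<eta> X x = \<zero>[N,X]} (Grp M X)"
  using subgroup_kernel by (simp add: kernel_def)
next
 fix f x assume "f \<in> Ar" "x \<in> {x \<in> el M (cod f). \<eta> (cod f) x = \<zero>[N,cod f]}"
 then show "Act M f x \<in> {x \<in> el M (dom f). \<eta> (dom f) x = \<zero>[N,dom f]}"
  using assms by (auto simp: mhom_nat act_one)
qed

lemma submodule_image: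
 assumes "is_mod M" "is_mod N" "mhom C M \<eta> N"
 shows "submodule C N (%X. \<eta> X ` el M X)"
 unfolding submodule_def
proof (intro conjI ballI)
 fix X assume X: "X \<in> Ob"
 interpret group_hom "Grp M X" "Grp N X" "\<eta> X"
  using assms X by (intro group_homI mod_group mhom_hom)
 show "subgroup (\<eta> X ` el M X) (Grp N X)" by (rule img_is_subgroup)
next
 fix f x assume f: "f \<in> Ar" "x \<in> \<eta> (cod f) ` el M (cod f)"
 then obtain y where y: "y \<in> el M (cod f)" "x = \<eta> (cod f) y" by blast
 then show "Act N f x \<in> \<eta> (dom f) ` el M (dom f)"
  using f assms mhom_nat[OF assms(3) f(1) y(1)] by (intro image_eqI[of _ _ "Act M f y"]) auto
qed

lemma el_img_module [simp]: "el (img_module C M r) X = r X ` el M X"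
 by (simp add: img_module_def)

lemma img_module:
 assumes M: "is_mod M"
  and mult: "!!X x y x' y'. [|X \<in> Ob; x \<in> el M X; x' \<in> el M X; y \<in> el M X; y' \<in> el M X; r X x = r X x'; r X y = r X y'|]
   ==> r X (x +[M,X] y) = r X (x' +[M,X] y')"
  and act: "!!f x x'. [|f \<in> Ar; x \<in> el M (cod f); x' \<in> el M (cod f); r (cod f) x = r (cod f) x'|]
   ==> r (dom f) (Act M f x) = r (dom f) (Act M f x')"
 shows "is_mod (img_module C M r)" "mhom C M r (img_module C M r)"
proof -
 let ?N = "img_module C M r"
 have grpN: "Grp ?N X = img_group (Grp M X) (r X)" for X by (simp add: img_module_def)
 have grp: "comm_group (Grp ?N X)" "r X \<in> hom (Grp M X) (Grp ?N X)" if "X \<in> Ob" for X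
  unfolding grpN by (rule img_group[OF mod_group[OF M that]], erule (5) mult[OF that])+
 have act': "Act ?N f (r (cod f) x) = r (dom f) (Act M f x)" if "f \<in> Ar" "x \<in> el M (cod f)" for f x
 proof -
  have "r (cod f) x \<in> r (cod f) ` el M (cod f)" using that by simp
  note * = inv_into_into[OF this] f_inv_into_f[OF this]
  show ?thesis unfolding img_module_def using act[OF that(1) *(1) that(2) *(2)] by simp
 qed
 show h: "mhom C M r ?N"
  using grp(2) act' by (simp add: mhom_def)
 have rm: "r X (x +[M,X] y) = r X x +[?N,X] r X y" if "X \<in> Ob" "x \<in> el M X" "y \<in> el M X" for X x y
  using mhom_mult[OF h that] .
 show "is_mod ?N"
  unfolding is_module_def
 proof (intro conjI ballI impI)
  fix f assume f: "f \<in> Ar"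
  show "Act ?N f \<in> hom (Grp ?N (cod f)) (Grp ?N (dom f))"
  proof (rule homI)
   fix x assume "x \<in> el ?N (cod f)"
   then show "Act ?N f x \<in> el ?N (dom f)" using f M by (auto simp: act')
  next
   fix x y assume "x \<in> el ?N (cod f)" "y \<in> el ?N (cod f)"
   then obtain x' y' where *: "x' \<in> el M (cod f)" "y' \<in> el M (cod f)" "x = r (cod f) x'" "y = r (cod f) y'" by auto
   then show "Act ?N f (x +[?N,cod f] y) = Act ?N f x +[?N,dom f] Act ?N f y"
    using f M by (simp add: act' act_mult flip: rm)
  qed
 next
  fix X x assume "X \<in> Ob" "x \<in> el ?N X"
  then show "Act ?N (Id C X) x = x" using act'[of "Id C X"] M by (auto simp: act_Id)
 next
  fix f g x assume "f \<in> Ar" "g \<in> Ar" "cod f = dom g" "x \<in> el ?N (cod g)"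
  then obtain y where y: "y \<in> el M (cod g)" "x = r (cod g) y"
   and *: "f \<in> Ar" "g \<in> Ar" "cod f = dom g" by auto
  have "Act ?N (Comp C g f) x = r (dom f) (Act M (Comp C g f) y)" using act'[of "Comp C g f" y] y * by simp
  also have "\<dots> = Act ?N f (Act ?N g x)" using act'[of f "Act M g y"] act'[of g y] y * M by (simp add: act_Comp)
  finally show "Act ?N (Comp C g f) x = Act ?N f (Act ?N g x)" .
 next
  fix f g x assume "f \<in> Ar" "g \<in> Ar" "dom f = dom g" "cod f = cod g" "x \<in> el ?N (cod f)"
  then obtain y where y: "y \<in> el M (cod f)" "x = r (cod f) y"
   and *: "f \<in> Ar" "g \<in> Ar" "dom f = dom g" "cod f = cod g" by auto
  have "Act ?N (Add C f g) x = r (dom f) (Act M (Add C f g) y)" using act'[of "Add C f g" y] y * by simp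
  also have "\<dots> = Act ?N f x +[?N,dom f] Act ?N g x"
   using act'[of f y] act'[of g y] rm[of "dom f" "Act M f y" "Act M g y"]
    act_closed[OF M *(1), of y] act_closed[OF M *(2), of y] y * M by (simp add: act_Add)
  finally show "Act ?N (Add C f g) x = Act ?N f x +[?N,dom f] Act ?N g x" .
 qed (use grp in auto)
qed

lemma quotient_module_exists:
 fixes M :: "('o, 'm, 'a) cmod"
 assumes M: "is_mod M" and S: "submodule C M S"
 obtains Q :: "('o, 'm, 'a) cmod" and q where "is_mod Q" "mhom C M q Q"
  "!!X. X \<in> Ob ==> q X ` el M X = el Q X"
  "!!X x. X \<in> Ob ==> x \<in> el M X ==> q X x = \<zero>[Q,X] \<longleftrightarrow> x \<in> S X"
proof
 let ?r = "%X. coset_rep (Grp M X) (S X)"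
 let ?Q = "img_module C M ?r"
 have sub: "subgroup (S X) (Grp M X)" if "X \<in> Ob" for X using S that by (simp add: submodule_def)
 have iff: "?r X x = ?r X y \<longleftrightarrow> x +[M,X] inv[Grp M X] y \<in> S X" if "X \<in> Ob" "x \<in> el M X" "y \<in> el M X" for X x y
  by (rule coset_rep_eq_iff[OF mod_group[OF M that(1)] sub[OF that(1)] that(2,3)])
 have act: "?r (dom f) (Act M f x) = ?r (dom f) (Act M f x')"
  if *: "f \<in> Ar" "x \<in> el M (cod f)" "x' \<in> el M (cod f)" "?r (cod f) x = ?r (cod f) x'" for f x x'
 proof -
  have "x +[M,cod f] inv[Grp M (cod f)] x' \<in> S (cod f)" using iff * by simp
  then have "Act M f (x +[M,cod f] inv[Grp M (cod f)] x') \<in> S (dom f)"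
   using S *(1) by (simp add: submodule_def)
  then show ?thesis using iff * M by (simp add: act_mult act_inv)
 qed
 have Q: "is_mod ?Q" "mhom C M ?r ?Q"
  using img_module[OF M, of ?r] coset_rep_cong[OF mod_group[OF M] sub] act by blast+
 show "is_mod ?Q" "mhom C M ?r ?Q" by fact+
 show "?r X ` el M X = el ?Q X" for X by simp
 show "?r X x = \<zero>[?Q,X] \<longleftrightarrow> x \<in> S X" if X: "X \<in> Ob" and x: "x \<in> el M X" for X x
 proof -
  interpret comm_group "Grp M X" using M X by (rule mod_group)
  have "?r X \<zero>[M,X] = \<zero>[?Q,X]" using mhom_one[OF Q(2) M Q(1) X] .
  then show ?thesis using iff[OF X x, of "\<zero>[M,X]"] x by simp
 qed
qed

text \<open>Injections of the groups into \<open>'u\<close> carry the module structure along.\<close>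

lemma transport_module:
 fixes M :: "('o, 'm, 'a) cmod"
 assumes M: "is_mod M" and card: "!!X. X \<in> Ob ==> el M X \<lesssim> (UNIV :: 'u set)"
 obtains N :: "('o, 'm, 'u) cmod" and r s where "is_mod N" "mhom C M r N" "mhom C N s M"
  "!!X x. X \<in> Ob ==> x \<in> el M X ==> s X (r X x) = x"
  "!!X x. X \<in> Ob ==> x \<in> el N X ==> r X (s X x) = x"
proof -
 have "\<forall>X\<in>Ob. \<exists>f :: 'a => 'u. inj_on f (el M X)" using card by (auto simp: lepoll_def)
 then obtain r :: "'o => 'a => 'u" where r: "!!X. X \<in> Ob ==> inj_on (r X) (el M X)" by metis
 let ?N = "img_module C M r"
 have N: "is_mod ?N" "mhom C M r ?N"
 proof -
  have inj: "x = x'" if "X \<in> Ob" "x \<in> el M X" "x' \<in> el M X" "r X x = r X x'" for X x x'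
   using inj_onD[OF r] that by blast
  show "is_mod ?N" by (rule img_module(1)[OF M]) (metis inj, metis inj Cod_Obj)
  show "mhom C M r ?N" by (rule img_module(2)[OF M]) (metis inj, metis inj Cod_Obj)
 qed
 define s where "s X = inv_into (el M X) (r X)" for X
 have sr: "s X (r X x) = x" if "X \<in> Ob" "x \<in> el M X" for X x
  using r that by (simp add: s_def)
 have "mhom C ?N s M"
 proof (rule mhomI)
  fix X x assume "X \<in> Ob" "x \<in> el ?N X"
  then show "s X x \<in> el M X" using sr by auto
 next
  fix X x y assume X: "X \<in> Ob" and "x \<in> el ?N X" "y \<in> el ?N X"
  then obtain a b where ab: "a \<in> el M X" "b \<in> el M X" "x = r X a" "y = r X b" by auto
  then show "s X (x +[?N,X] y) = s X x +[M,X] s X y"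
   using X M mhom_mult[OF N(2) X ab(1,2)] sr by (metis mod_mult)
 next
  fix f x assume f: "f \<in> Ar" and "x \<in> el ?N (cod f)"
  then obtain a where a: "a \<in> el M (cod f)" "x = r (cod f) a" by auto
  then show "s (dom f) (Act ?N f x) = Act M f (s (cod f) x)"
   using f M mhom_nat[OF N(2) f a(1)] sr by (metis Cod_Obj Dom_Obj act_closed)
 qed
 moreover have "r X (s X x) = x" if "X \<in> Ob" "x \<in> el ?N X" for X x
  using that sr by auto
 ultimately show thesis using that N sr by blast
qed

lemma factor_surj:
 assumes Y: "is_mod Y" and E: "is_mod E" and Q: "is_mod Q"
  and q: "mhom C E q Q" "!!X. X \<in> Ob ==> q X ` el E X = el Q X"
  and g: "mhom C E g Y"
  and ker: "!!X x. X \<in> Ob ==> x \<in> el E X ==> q X x = \<zero>[Q,X] ==> g X x = \<zero>[Y,X]"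
 obtains h where "mhom C Q h Y" "!!X x. X \<in> Ob ==> x \<in> el E X ==> h X (q X x) = g X x"
proof -
 have cong: "g X x = g X y" if "X \<in> Ob" "x \<in> el E X" "y \<in> el E X" "q X x = q X y" for X x y
  using that mhom_eq_iff[OF q(1) E Q that(1-3)] mhom_eq_iff[OF g E Y that(1-3)] ker E by simp
 define h where "h X z = g X (inv_into (el E X) (q X) z)" for X z
 have hq: "h X (q X x) = g X x" if "X \<in> Ob" "x \<in> el E X" for X x
  unfolding h_def using that by (intro cong inv_into_into f_inv_into_f) auto
 have "mhom C Q h Y"
 proof (rule mhomI)
  fix X z assume "X \<in> Ob" "z \<in> el Q X"
  then obtain x where "x \<in> el E X" "z = q X x" using q(2) by blast
  then show "h X z \<in> el Y X" using \<open>X \<in> Ob\<close> hq mhom_closed[OF g] by simp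
 next
  fix X z w assume X: "X \<in> Ob" and "z \<in> el Q X" "w \<in> el Q X"
  then obtain x y where xy: "x \<in> el E X" "y \<in> el E X" "z = q X x" "w = q X y" using q(2) by blast
  then have "h X (z +[Q,X] w) = g X (x +[E,X] y)"
   using hq[OF X, of "x +[E,X] y"] E X mhom_mult[OF q(1) X xy(1,2)] by simp
  then show "h X (z +[Q,X] w) = h X z +[Y,X] h X w"
   using hq X xy mhom_mult[OF g X xy(1,2)] by simp
 next
  fix f z assume f: "f \<in> Ar" and "z \<in> el Q (cod f)"
  then obtain x where x: "x \<in> el E (cod f)" "z = q (cod f) x" using q(2)[of "cod f"] by auto
  have "h (dom f) (Act Q f z) = g (dom f) (Act E f x)"
   using x f E hq[of "dom f" "Act E f x"] mhom_nat[OF q(1) f x(1)] by simp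
  then show "h (dom f) (Act Q f z) = Act Y f (h (cod f) z)"
   using x f hq mhom_nat[OF g f x(1)] by simp
 qed
 then show thesis using that hq by blast
qed

lemma factor_inj:
 assumes L: "is_mod L"
  and j: "mhom C L j E" "!!X. X \<in> Ob ==> inj_on (j X) (el L X)"
  and g: "is_mod Y" "mhom C Y g E" "!!X x. X \<in> Ob ==> x \<in> el Y X ==> g X x \<in> j X ` el L X"
 obtains h where "mhom C Y h L" "!!X x. X \<in> Ob ==> x \<in> el Y X ==> j X (h X x) = g X x"
proof -
 define h where "h X x = inv_into (el L X) (j X) (g X x)" for X x
 have hc: "h X x \<in> el L X" "j X (h X x) = g X x" if "X \<in> Ob" "x \<in> el Y X" for X x
  using g(3)[OF that] by (auto simp: h_def inv_into_into f_inv_into_f)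
 have "mhom C Y h L"
 proof (rule mhomI)
  fix X x y assume X: "X \<in> Ob" and xy: "x \<in> el Y X" "y \<in> el Y X"
  have "j X (h X (x +[Y,X] y)) = j X (h X x +[L,X] h X y)"
   using X xy g(1) hc by (simp add: mhom_mult[OF j(1)] mhom_mult[OF g(2)])
  then show "h X (x +[Y,X] y) = h X x +[L,X] h X y"
   by (rule inj_onD[OF j(2)[OF X]]) (use hc X xy g(1) L in auto)
 next
  fix f x assume f: "f \<in> Ar" and x: "x \<in> el Y (cod f)"
  have "j (dom f) (h (dom f) (Act Y f x)) = j (dom f) (Act L f (h (cod f) x))"
   using f x g(1) hc by (simp add: mhom_nat[OF j(1)] mhom_nat[OF g(2)])
  then show "h (dom f) (Act Y f x) = Act L f (h (cod f) x)"
   by (rule inj_onD[OF j(2)[OF Dom_Obj[OF f]]]) (use hc f x g(1) L in auto)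
 qed (use hc in auto)
 then show thesis using that hc by blast
qed

subsection \<open>Projective and injective modules\<close>

text \<open>Only test modules with elements in \<open>'u\<close> occur, while the module itself may live on another
 type: coinduced modules consist of functions.\<close>

definition injective_module :: "'u itself => ('o, 'm, 'e) cmod => bool" where
 "injective_module U E \<longleftrightarrow> is_mod E \<and>
   (\<forall>(A :: ('o, 'm, 'u) cmod) (B :: ('o, 'm, 'u) cmod) a f. is_mod A --> is_mod B -->
    mhom C A a B --> (\<forall>X\<in>Ob. inj_on (a X) (el A X)) --> mhom C A f E -->
    (\<exists>g. mhom C B g E \<and> (\<forall>X\<in>Ob. \<forall>x\<in>el A X. g X (a X x) = f X x)))"

definition projective_module :: "'u itself => ('o, 'm, 'e) cmod => bool" where
 "projective_module U P \<longleftrightarrow> is_mod P \<and>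
   (\<forall>(A :: ('o, 'm, 'u) cmod) (B :: ('o, 'm, 'u) cmod) e f. is_mod A --> is_mod B -->
    mhom C A e B --> (\<forall>X\<in>Ob. e X ` el A X = el B X) --> mhom C P f B -->
    (\<exists>g. mhom C P g A \<and> (\<forall>X\<in>Ob. \<forall>x\<in>el P X. e X (g X x) = f X x)))"

abbreviation inj_mod :: "('o, 'm, 'u) cmod => bool" where "inj_mod == injective_module TYPE('u)"
abbreviation proj_mod :: "('o, 'm, 'u) cmod => bool" where "proj_mod == projective_module TYPE('u)"

lemma injective_moduleD:
 fixes A B :: "('o, 'm, 'u) cmod"
 assumes "injective_module TYPE('u) E" "is_mod A" "is_mod B" "mhom C A a B"
  "!!X. X \<in> Ob ==> inj_on (a X) (el A X)" "mhom C A f E"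
 obtains g where "mhom C B g E" "!!X x. X \<in> Ob ==> x \<in> el A X ==> g X (a X x) = f X x"
 using assms unfolding injective_module_def by metis

lemma projective_moduleD:
 fixes A B :: "('o, 'm, 'u) cmod"
 assumes "projective_module TYPE('u) P" "is_mod A" "is_mod B" "mhom C A e B"
  "!!X. X \<in> Ob ==> e X ` el A X = el B X" "mhom C P f B"
 obtains g where "mhom C P g A" "!!X x. X \<in> Ob ==> x \<in> el P X ==> e X (g X x) = f X x"
 using assms unfolding projective_module_def by metis

lemma msesD:
 assumes "mses C L j M q N"
 shows "is_mod L" "is_mod M" "is_mod N" "mhom C L j M" "mhom C M q N"
  "!!X. X \<in> Ob ==> inj_on (j X) (el L X)" "!!X. X \<in> Ob ==> q X ` el M X = el N X"
  "!!X y. X \<in> Ob ==> y \<in> el M X ==> q X y = \<zero>[N,X] \<longleftrightarrow> y \<in> j X ` el L X"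
 using assms by (simp_all add: mses_def)

lemma mses_trivial_comp:
 assumes "mses C L j M q N" "X \<in> Ob" "x \<in> el L X"
 shows "q X (j X x) = \<zero>[N,X]"
proof -
 have "j X x \<in> el M X" by (rule mhom_closed[OF msesD(4)[OF assms(1)] assms(2,3)])
 then show ?thesis using msesD(8)[OF assms(1,2)] assms(3) by blast
qed

text \<open>An injective copresentation \<open>0 \<rightarrow> F \<rightarrow> E \<rightarrow> Q \<rightarrow> 0\<close> controls the cokernel of every embedding of a
 retract \<open>P\<close> of \<open>F\<close> into an injective module \<open>E'\<close>: with extensions \<open>\<rho> : E \<rightarrow> E'\<close> and \<open>\<sigma> : E' \<rightarrow> E\<close> of the
 retraction data the map \<open>\<rho> \<circ> \<sigma> - id\<close> vanishes on \<open>P\<close>, so the identity of \<open>E' / P\<close> factors through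
 the injective module \<open>Q \<oplus> E'\<close>.\<close>

lemma cokernel_injective:
 fixes E Q E' Q' F P :: "('o, 'm, 'u) cmod"
 assumes F: "mses C F k E \<pi> Q" and E: "inj_mod E" and Q: "inj_mod Q"
  and P: "mses C P j E' \<pi>' Q'" and E': "inj_mod E'"
  and i: "mhom C P i F" and r: "mhom C F r P"
  and ri: "!!X x. X \<in> Ob ==> x \<in> el P X ==> r X (i X x) = x"
 shows "inj_mod Q'"
proof -
 note mods = msesD(1-3)[OF F] msesD(1-3)[OF P] and k = msesD(4,6)[OF F] and \<pi> = msesD(5,7,8)[OF F]
  and j = msesD(4,6)[OF P] and \<pi>' = msesD(5,7,8)[OF P]
 have \<pi>k: "!!X x. X \<in> Ob ==> x \<in> el F X ==> \<pi> X (k X x) = \<zero>[Q,X]"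
  and \<pi>'j: "!!X x. X \<in> Ob ==> x \<in> el P X ==> \<pi>' X (j X x) = \<zero>[Q',X]"
  using mses_trivial_comp[OF F] mses_trivial_comp[OF P] by blast+
 note cl = mhom_closed[OF i] mhom_closed[OF r] mhom_closed[OF k(1)] mhom_closed[OF j(1)]
 obtain \<rho> where \<rho>: "mhom C E \<rho> E'" "!!X x. X \<in> Ob ==> x \<in> el F X ==> \<rho> X (k X x) = j X (r X x)"
  using injective_moduleD[OF E' mods(1,2) k mhom_comp[OF r j(1)]] by blast
 obtain \<sigma> where \<sigma>: "mhom C E' \<sigma> E" "!!X x. X \<in> Ob ==> x \<in> el P X ==> \<sigma> X (j X x) = k X (i X x)"
  using injective_moduleD[OF E mods(4,5) j mhom_comp[OF i k(1)]] by blast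
 have "\<pi>' X (\<rho> X x) = \<zero>[Q',X]" if "X \<in> Ob" "x \<in> el E X" "\<pi> X x = \<zero>[Q,X]" for X x
  using \<pi>(3) that \<rho>(2) cl \<pi>'j by auto
 then obtain \<rho>' where \<rho>': "mhom C Q \<rho>' Q'" "!!X x. X \<in> Ob ==> x \<in> el E X ==> \<rho>' X (\<pi> X x) = \<pi>' X (\<rho> X x)"
  using factor_surj[OF mods(6,2,3) \<pi>(1,2) mhom_comp[OF \<rho>(1) \<pi>'(1)]] by blast
 have "\<pi> X (\<sigma> X x) = \<zero>[Q,X]" if "X \<in> Ob" "x \<in> el E' X" "\<pi>' X x = \<zero>[Q',X]" for X x
  using \<pi>'(3) that \<sigma>(2) cl \<pi>k by auto
 then obtain \<sigma>' where \<sigma>': "mhom C Q' \<sigma>' Q" "!!X x. X \<in> Ob ==> x \<in> el E' X ==> \<sigma>' X (\<pi>' X x) = \<pi> X (\<sigma> X x)"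
  using factor_surj[OF mods(3,5,6) \<pi>'(1,2) mhom_comp[OF \<sigma>(1) \<pi>(1)]] by blast
 let ?d = "%X x. \<rho> X (\<sigma> X x) +[E',X] inv[Grp E' X] x"
 have d: "mhom C E' ?d E'" by (rule mhom_diff[OF mods(5) mhom_comp[OF \<sigma>(1) \<rho>(1)] mhom_id])
 have "?d X x = \<zero>[E',X]" if X: "X \<in> Ob" and x: "x \<in> el E' X" "\<pi>' X x = \<zero>[Q',X]" for X x
 proof -
  interpret comm_group "Grp E' X" using mods X by (simp add: mod_group)
  obtain y where y: "y \<in> el P X" "x = j X y" using \<pi>'(3)[OF X x(1)] x(2) by auto
  then show ?thesis using X \<rho>(2) \<sigma>(2) cl ri by simp
 qed
 then obtain \<delta> where \<delta>: "mhom C Q' \<delta> E'" "!!X x. X \<in> Ob ==> x \<in> el E' X ==> \<delta> X (\<pi>' X x) = ?d X x"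
  using factor_surj[OF mods(5,5,6) \<pi>'(1,2) d] by blast
 show ?thesis
  unfolding injective_module_def
 proof (intro conjI allI impI mods)
  fix A B :: "('o, 'm, 'u) cmod" and a f
  assume AB: "is_mod A" "is_mod B" and a: "mhom C A a B" "\<forall>X\<in>Ob. inj_on (a X) (el A X)"
   and f: "mhom C A f Q'"
  obtain h where h: "mhom C B h Q" "!!X x. X \<in> Ob ==> x \<in> el A X ==> h X (a X x) = \<sigma>' X (f X x)"
   using injective_moduleD[OF Q AB a(1) _ mhom_comp[OF f \<sigma>'(1)]] a(2) by blast
  obtain h' where h': "mhom C B h' E'" "!!X x. X \<in> Ob ==> x \<in> el A X ==> h' X (a X x) = \<delta> X (f X x)"
   using injective_moduleD[OF E' AB a(1) _ mhom_comp[OF f \<delta>(1)]] a(2) by blast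
  let ?g = "%X x. \<rho>' X (h X x) +[Q',X] inv[Grp Q' X] \<pi>' X (h' X x)"
  have g: "mhom C B ?g Q'" by (rule mhom_diff[OF mods(6) mhom_comp[OF h(1) \<rho>'(1)] mhom_comp[OF h'(1) \<pi>'(1)]])
  have "?g X (a X x) = f X x" if X: "X \<in> Ob" and x: "x \<in> el A X" for X x
  proof -
   interpret Q': comm_group "Grp Q' X" using mods X by (simp add: mod_group)
   interpret E': comm_group "Grp E' X" using mods X by (simp add: mod_group)
   have "f X x \<in> el Q' X" using f X x by (rule mhom_closed)
   then obtain e where e: "e \<in> el E' X" "f X x = \<pi>' X e" using \<pi>'(2)[OF X] by blast
   note c1 = mhom_closed[OF \<sigma>(1) X e(1)]
   note c = c1 mhom_closed[OF \<rho>(1) X c1]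
   note c' = mhom_closed[OF \<pi>'(1) X c(2)] mhom_closed[OF \<pi>'(1) X e(1)]
   have "?g X (a X x) = \<pi>' X (\<rho> X (\<sigma> X e)) +[Q',X] inv[Grp Q' X] \<pi>' X (?d X e)"
    using X x e c by (simp add: h(2) h'(2) \<sigma>'(2) \<rho>'(2) \<delta>(2))
   also have "\<pi>' X (?d X e) = \<pi>' X (\<rho> X (\<sigma> X e)) +[Q',X] inv[Grp Q' X] \<pi>' X e"
    using X e c by (simp add: mhom_mult[OF \<pi>'(1)] mhom_inv[OF \<pi>'(1) mods(5,6)])
   also have "\<pi>' X (\<rho> X (\<sigma> X e)) +[Q',X] inv[Grp Q' X] (\<pi>' X (\<rho> X (\<sigma> X e)) +[Q',X] inv[Grp Q' X] \<pi>' X e) = \<pi>' X e"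
    using c' by (simp add: Q'.inv_mult_group Q'.m_lcomm)
   finally show ?thesis using e by simp
  qed
  then show "\<exists>g. mhom C B g Q' \<and> (\<forall>X\<in>Ob. \<forall>x\<in>el A X. g X (a X x) = f X x)" using g by blast
 qed
qed

text \<open>The dual argument, with liftings in place of extensions.\<close>

lemma kernel_projective:
 fixes E K E' K' F P :: "('o, 'm, 'u) cmod"
 assumes F: "mses C K k E \<pi> F" and E: "proj_mod E" and K: "proj_mod K"
  and P: "mses C K' j E' \<pi>' P" and E': "proj_mod E'"
  and i: "mhom C P i F" and r: "mhom C F r P"
  and ri: "!!X x. X \<in> Ob ==> x \<in> el P X ==> r X (i X x) = x"
 shows "proj_mod K'"
proof -
 note mods = msesD(3)[OF F] msesD(2)[OF F] msesD(1)[OF F] msesD(3)[OF P] msesD(2)[OF P] msesD(1)[OF P]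
  and k = msesD(4,6)[OF F] and \<pi> = msesD(5,7,8)[OF F]
  and j = msesD(4,6)[OF P] and \<pi>' = msesD(5,7,8)[OF P]
 have \<pi>k: "!!X x. X \<in> Ob ==> x \<in> el K X ==> \<pi> X (k X x) = \<zero>[F,X]"
  and \<pi>'j: "!!X x. X \<in> Ob ==> x \<in> el K' X ==> \<pi>' X (j X x) = \<zero>[P,X]"
  using mses_trivial_comp[OF F] mses_trivial_comp[OF P] by blast+
 obtain \<rho> where \<rho>: "mhom C E' \<rho> E" "!!X x. X \<in> Ob ==> x \<in> el E' X ==> \<pi> X (\<rho> X x) = i X (\<pi>' X x)"
  using projective_moduleD[OF E' mods(2,1) \<pi>(1,2) mhom_comp[OF \<pi>'(1) i]] by blast
 obtain \<sigma> where \<sigma>: "mhom C E \<sigma> E'" "!!X x. X \<in> Ob ==> x \<in> el E X ==> \<pi>' X (\<sigma> X x) = r X (\<pi> X x)"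
  using projective_moduleD[OF E mods(5,4) \<pi>'(1,2) mhom_comp[OF \<pi>(1) r]] by blast
 note cl = mhom_closed[OF k(1)] mhom_closed[OF j(1)] mhom_closed[OF \<rho>(1)] mhom_closed[OF \<sigma>(1)]
  mhom_closed[OF \<pi>'(1)]
 have i1: "i X \<zero>[P,X] = \<zero>[F,X]" "r X \<zero>[F,X] = \<zero>[P,X]" if "X \<in> Ob" for X
  using mhom_one[OF i mods(4,1) that] mhom_one[OF r mods(1,4) that] by auto
 have "\<rho> X (j X x) \<in> k X ` el K X" if "X \<in> Ob" "x \<in> el K' X" for X x
  using \<pi>(3)[OF that(1), of "\<rho> X (j X x)"] that \<rho>(2) cl \<pi>'j i1 by simp
 then obtain \<rho>' where \<rho>': "mhom C K' \<rho>' K" "!!X x. X \<in> Ob ==> x \<in> el K' X ==> k X (\<rho>' X x) = \<rho> X (j X x)"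
  using factor_inj[OF mods(3) k mods(6) mhom_comp[OF j(1) \<rho>(1)]] by blast
 have "\<sigma> X (k X x) \<in> j X ` el K' X" if "X \<in> Ob" "x \<in> el K X" for X x
  using \<pi>'(3)[OF that(1), of "\<sigma> X (k X x)"] that \<sigma>(2) cl \<pi>k i1 by simp
 then obtain \<sigma>' where \<sigma>': "mhom C K \<sigma>' K'" "!!X x. X \<in> Ob ==> x \<in> el K X ==> j X (\<sigma>' X x) = \<sigma> X (k X x)"
  using factor_inj[OF mods(6) j mods(3) mhom_comp[OF k(1) \<sigma>(1)]] by blast
 let ?d = "%X x. \<sigma> X (\<rho> X x) +[E',X] inv[Grp E' X] x"
 have d: "mhom C E' ?d E'" by (rule mhom_diff[OF mods(5) mhom_comp[OF \<rho>(1) \<sigma>(1)] mhom_id])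
 have "?d X x \<in> j X ` el K' X" if X: "X \<in> Ob" and x: "x \<in> el E' X" for X x
 proof -
  interpret comm_group "Grp P X" using mods X by (simp add: mod_group)
  have c: "\<rho> X x \<in> el E X" "\<sigma> X (\<rho> X x) \<in> el E' X" "inv[Grp E' X] x \<in> el E' X" using X x cl mods by auto
  have "\<pi>' X (?d X x) = \<pi>' X (\<sigma> X (\<rho> X x)) +[P,X] inv[Grp P X] \<pi>' X x"
   using X x c by (simp add: mhom_mult[OF \<pi>'(1)] mhom_inv[OF \<pi>'(1) mods(5,4)])
  also have "\<dots> = \<zero>[P,X]" using X x c \<rho>(2) \<sigma>(2) ri cl by simp
  finally show ?thesis using \<pi>'(3)[OF X, of "?d X x"] X x c mods by simp
 qed
 then obtain \<delta> where \<delta>: "mhom C E' \<delta> K'" "!!X x. X \<in> Ob ==> x \<in> el E' X ==> j X (\<delta> X x) = ?d X x"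
  using factor_inj[OF mods(6) j mods(5) d] by blast
 have \<delta>j: "\<delta> X (j X x) = \<sigma>' X (\<rho>' X x) +[K',X] inv[Grp K' X] x" if X: "X \<in> Ob" and x: "x \<in> el K' X" for X x
 proof -
  note c1 = mhom_closed[OF \<rho>'(1) X x] and c2 = mhom_closed[OF j(1) X x]
  note c = c1 mhom_closed[OF \<sigma>'(1) X c1] c2 mhom_closed[OF \<delta>(1) X c2]
  have "j X (\<delta> X (j X x)) = j X (\<sigma>' X (\<rho>' X x) +[K',X] inv[Grp K' X] x)"
   using X x c mods by (simp add: \<delta>(2) mhom_mult[OF j(1)] mhom_inv[OF j(1) mods(6,5)] \<sigma>'(2) \<rho>'(2))
  then show ?thesis using j(2)[OF X] c x X mods by (simp add: inj_on_eq_iff)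
 qed
 show ?thesis
  unfolding projective_module_def
 proof (intro conjI allI impI mods)
  fix A B :: "('o, 'm, 'u) cmod" and e f
  assume AB: "is_mod A" "is_mod B" and e: "mhom C A e B" "\<forall>X\<in>Ob. e X ` el A X = el B X"
   and f: "mhom C K' f B"
  obtain h where h: "mhom C K h A" "!!X x. X \<in> Ob ==> x \<in> el K X ==> e X (h X x) = f X (\<sigma>' X x)"
   using projective_moduleD[OF K AB e(1) _ mhom_comp[OF \<sigma>'(1) f]] e(2) by blast
  obtain h' where h': "mhom C E' h' A" "!!X x. X \<in> Ob ==> x \<in> el E' X ==> e X (h' X x) = f X (\<delta> X x)"
   using projective_moduleD[OF E' AB e(1) _ mhom_comp[OF \<delta>(1) f]] e(2) by blast
  let ?g = "%X x. h X (\<rho>' X x) +[A,X] inv[Grp A X] h' X (j X x)"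
  have g: "mhom C K' ?g A" by (rule mhom_diff[OF AB(1) mhom_comp[OF \<rho>'(1) h(1)] mhom_comp[OF j(1) h'(1)]])
  have "e X (?g X x) = f X x" if X: "X \<in> Ob" and x: "x \<in> el K' X" for X x
  proof -
   interpret B: comm_group "Grp B X" using AB X by (simp add: mod_group)
   note c1 = mhom_closed[OF \<rho>'(1) X x]
   note c = c1 mhom_closed[OF \<sigma>'(1) X c1] mhom_closed[OF j(1) X x]
   note c' = mhom_closed[OF h(1) X c(1)] mhom_closed[OF h'(1) X c(3)] mhom_closed[OF f X c(2)] mhom_closed[OF f X x]
   have "e X (?g X x) = f X (\<sigma>' X (\<rho>' X x)) +[B,X] inv[Grp B X] f X (\<delta> X (j X x))"
    using X x c c' AB by (simp add: mhom_mult[OF e(1)] mhom_inv[OF e(1) AB] h(2) h'(2))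
   also have "f X (\<delta> X (j X x)) = f X (\<sigma>' X (\<rho>' X x)) +[B,X] inv[Grp B X] f X x"
    using X x c mods by (simp add: \<delta>j mhom_mult[OF f] mhom_inv[OF f mods(6) AB(2)])
   also have "f X (\<sigma>' X (\<rho>' X x)) +[B,X] inv[Grp B X] (f X (\<sigma>' X (\<rho>' X x)) +[B,X] inv[Grp B X] f X x) = f X x"
    using c' by (simp add: B.inv_mult_group B.m_lcomm)
   finally show ?thesis .
  qed
  then show "\<exists>g. mhom C K' g A \<and> (\<forall>X\<in>Ob. \<forall>x\<in>el K' X. e X (g X x) = f X x)" using g by blast
 qed
qed

text \<open>One short exact sequence witnesses the bound. By the two preceding lemmas the bound is then visible on
 every embedding into an injective module and on every surjection from a projective one.\<close>

definition id_le_1 :: "('o, 'm, 'u) cmod => bool" where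
 "id_le_1 M \<longleftrightarrow> (\<exists>j (E :: ('o, 'm, 'u) cmod) q (Q :: ('o, 'm, 'u) cmod). mses C M j E q Q \<and>
   inj_mod E \<and> inj_mod Q)"

definition pd_le_1 :: "('o, 'm, 'u) cmod => bool" where
 "pd_le_1 M \<longleftrightarrow> (\<exists>j (K :: ('o, 'm, 'u) cmod) q (E :: ('o, 'm, 'u) cmod). mses C K j E q M \<and>
   proj_mod E \<and> proj_mod K)"

lemma id_le_1_cokernel:
 fixes P E Q :: "('o, 'm, 'u) cmod"
 assumes "id_le_1 P" "mses C P j E q Q" "inj_mod E"
 shows "inj_mod Q"
 using assms cokernel_injective[OF _ _ _ assms(2,3) mhom_id mhom_id] unfolding id_le_1_def by blast

lemma pd_le_1_kernel:
 fixes P E K :: "('o, 'm, 'u) cmod"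
 assumes "pd_le_1 P" "mses C K j E q P" "proj_mod E"
 shows "proj_mod K"
 using assms kernel_projective[OF _ _ _ assms(2,3) mhom_id mhom_id] unfolding pd_le_1_def by blast

lemma mses_quotient_exists:
 fixes L M :: "('o, 'm, 'u) cmod"
 assumes "is_mod L" "is_mod M" "mhom C L j M" "!!X. X \<in> Ob ==> inj_on (j X) (el L X)"
 obtains q and Q :: "('o, 'm, 'u) cmod" where "mses C L j M q Q"
proof -
 obtain Q :: "('o, 'm, 'u) cmod" and q where "is_mod Q" "mhom C M q Q"
  "!!X. X \<in> Ob ==> q X ` el M X = el Q X"
  "!!X x. X \<in> Ob ==> x \<in> el M X ==> q X x = \<zero>[Q,X] \<longleftrightarrow> x \<in> j X ` el L X"
  using quotient_module_exists[OF assms(2) submodule_image[OF assms(1-3)]] by blast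
 then have "mses C L j M q Q" using assms unfolding mses_def by simp
 then show thesis by (rule that)
qed

lemma mses_kernel_exists:
 fixes M N :: "('o, 'm, 'u) cmod"
 assumes "is_mod M" "is_mod N" "mhom C M q N" "!!X. X \<in> Ob ==> q X ` el M X = el N X"
 obtains j and K :: "('o, 'm, 'u) cmod" where "mses C K j M q N"
proof -
 let ?S = "%X. {x \<in> el M X. q X x = \<zero>[N,X]}"
 have S: "submodule C M ?S" by (rule submodule_kernel[OF assms(1-3)])
 have "mses C (restrict_module M ?S) (%X x. x) M q N"
  unfolding mses_def
  using assms is_module_restrict[OF assms(1) S] mhom_inclusion[OF S] by (auto simp: inj_on_def)
 then show thesis by (rule that)
qed

lemma id_le_1_retract:
 fixes F P E Q :: "('o, 'm, 'u) cmod"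
 assumes "id_le_1 F" "mhom C P i F" "mhom C F r P" "!!X x. X \<in> Ob ==> x \<in> el P X ==> r X (i X x) = x"
  and "is_mod P" "mhom C P j E" "!!X. X \<in> Ob ==> inj_on (j X) (el P X)" "inj_mod E"
 shows "id_le_1 P"
proof -
 have E: "is_mod E" using assms(8) by (simp add: injective_module_def)
 obtain q and Q :: "('o, 'm, 'u) cmod" where Q: "mses C P j E q Q"
  using mses_quotient_exists[OF assms(5) E assms(6,7)] by blast
 obtain k \<pi> and E' Q' :: "('o, 'm, 'u) cmod" where F: "mses C F k E' \<pi> Q'" "inj_mod E'" "inj_mod Q'"
  using assms(1) unfolding id_le_1_def by blast
 have "inj_mod Q"
  by (rule cokernel_injective[OF F Q assms(8,2,3,4)])
 then show ?thesis using Q assms(8) unfolding id_le_1_def by blast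
qed

lemma pd_le_1_retract:
 fixes F P E Q :: "('o, 'm, 'u) cmod"
 assumes "pd_le_1 F" "mhom C P i F" "mhom C F r P" "!!X x. X \<in> Ob ==> x \<in> el P X ==> r X (i X x) = x"
  and "is_mod P" "mhom C E q P" "!!X. X \<in> Ob ==> q X ` el E X = el P X" "proj_mod E"
 shows "pd_le_1 P"
proof -
 have E: "is_mod E" using assms(8) by (simp add: projective_module_def)
 obtain j and K :: "('o, 'm, 'u) cmod" where K: "mses C K j E q P"
  using mses_kernel_exists[OF E assms(5,6,7)] by blast
 obtain k \<pi> and K' E' :: "('o, 'm, 'u) cmod" where F: "mses C K' k E' \<pi> F" "proj_mod E'" "proj_mod K'"
  using assms(1) unfolding pd_le_1_def by blast
 have "proj_mod K"
  by (rule kernel_projective[OF F K assms(8,2,3,4)])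
 then show ?thesis using K assms(8) unfolding pd_le_1_def by blast
qed

text \<open>For \<open>K \<subseteq> P \<subseteq> E\<close> with \<open>E\<close> injective the sequence \<open>0 \<rightarrow> P / K \<rightarrow> E / K \<rightarrow> E / P \<rightarrow> 0\<close> is an injective
 copresentation.\<close>

lemma id_le_1_quotient:
 fixes K P M :: "('o, 'm, 'u) cmod"
 assumes KP: "mses C K i P e M" and K: "id_le_1 K" and P: "id_le_1 P"
 shows "id_le_1 M"
proof -
 obtain k and E :: "('o, 'm, 'u) cmod" and q and Q :: "('o, 'm, 'u) cmod"
  where E: "mses C P k E q Q" "inj_mod E" "inj_mod Q"
  using P unfolding id_le_1_def by blast
 note a = msesD[OF KP] and b = msesD[OF E(1)]
 have "inj_on (%x. k X (i X x)) (el K X)" if "X \<in> Ob" for X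
  using a(6)[OF that] b(6)[OF that] mhom_closed[OF a(4) that] by (auto simp: inj_on_def)
 then obtain q' and Q' :: "('o, 'm, 'u) cmod" where Q': "mses C K (%X x. k X (i X x)) E q' Q'"
  using mses_quotient_exists[OF a(1) b(2) mhom_comp[OF a(4) b(4)]] by blast
 note c = msesD[OF Q']
 have inj': "inj_mod Q'" using id_le_1_cokernel[OF K Q' E(2)] .
 have kk: "q' X (k X x) = \<zero>[Q',X] \<longleftrightarrow> e X x = \<zero>[M,X]" if X: "X \<in> Ob" and x: "x \<in> el P X" for X x
 proof -
  have "q' X (k X x) = \<zero>[Q',X] \<longleftrightarrow> k X x \<in> k X ` (i X ` el K X)"
   using c(8)[OF X mhom_closed[OF b(4) X x]] by (simp add: image_image)
  also have "\<dots> \<longleftrightarrow> x \<in> i X ` el K X"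
   using mhom_closed[OF a(4) X] by (intro inj_on_image_mem_iff[OF b(6)[OF X] x]) auto
  finally show ?thesis using a(8)[OF X x] by simp
 qed
 obtain u where u: "mhom C M u Q'" "!!X x. X \<in> Ob ==> x \<in> el P X ==> u X (e X x) = q' X (k X x)"
  using factor_surj[OF c(3) a(2,3) a(5,7) mhom_comp[OF b(4) c(5)]] kk by blast
 have "q X x = \<zero>[Q,X]" if X: "X \<in> Ob" and x: "x \<in> el E X" "q' X x = \<zero>[Q',X]" for X x
  using b(8)[OF X x(1)] c(8)[OF X x(1)] x(2) mhom_closed[OF a(4) X] by auto
 then obtain v where v: "mhom C Q' v Q" "!!X x. X \<in> Ob ==> x \<in> el E X ==> v X (q' X x) = q X x"
  using factor_surj[OF b(3) b(2) c(3) c(5,7) b(5)] by blast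
 have "mses C M u Q' v Q"
  unfolding mses_def
 proof (intro conjI ballI a b c u v)
  fix X assume X: "X \<in> Ob"
  show "inj_on (u X) (el M X)"
  proof (rule mhom_inj_onI[OF u(1) a(3) c(3) X])
   fix x assume "x \<in> el M X" "u X x = \<zero>[Q',X]"
   moreover obtain y where "y \<in> el P X" "x = e X y" using a(7)[OF X] \<open>x \<in> el M X\<close> by blast
   ultimately show "x = \<zero>[M,X]" using u(2) kk X by simp
  qed
  show "v X ` el Q' X = el Q X"
  proof
   show "v X ` el Q' X \<subseteq> el Q X" using mhom_closed[OF v(1) X] by blast
   show "el Q X \<subseteq> v X ` el Q' X"
   proof
    fix z assume "z \<in> el Q X"
    then obtain x where x: "x \<in> el E X" "z = q X x" using b(7)[OF X] by blast
    then show "z \<in> v X ` el Q' X"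
     using v(2)[OF X x(1)] mhom_closed[OF c(5) X x(1)] by (intro image_eqI[of _ _ "q' X x"]) auto
   qed
  qed
  fix y assume "y \<in> el Q' X"
  then obtain x where x: "x \<in> el E X" "y = q' X x" using c(7)[OF X] by blast
  have "v X y = \<zero>[Q,X] \<longleftrightarrow> x \<in> k X ` el P X" using v(2) b(8) X x by simp
  also have "\<dots> \<longleftrightarrow> y \<in> u X ` el M X"
  proof
   assume "x \<in> k X ` el P X"
   then obtain z where z: "z \<in> el P X" "x = k X z" by blast
   then show "y \<in> u X ` el M X" using u(2)[OF X z(1)] mhom_closed[OF a(5) X z(1)] x by force
  next
   assume "y \<in> u X ` el M X"
   then obtain m where m: "m \<in> el M X" "y = u X m" by blast
   then obtain z where z: "z \<in> el P X" "m = e X z" using a(7)[OF X] by blast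
   have "q' X x = q' X (k X z)" using m x z u(2)[OF X z(1)] by simp
   then have "q X x = q X (k X z)" using v(2)[OF X] x(1) mhom_closed[OF b(4) X z(1)] by metis
   also have "\<dots> = \<zero>[Q,X]" by (rule mses_trivial_comp[OF E(1) X z(1)])
   finally show "x \<in> k X ` el P X" using b(8)[OF X x(1)] by blast
  qed
  finally show "v X y = \<zero>[Q,X] \<longleftrightarrow> y \<in> u X ` el M X" .
 qed
 then show ?thesis using inj' E(3) unfolding id_le_1_def by blast
qed

text \<open>Dually, for surjections \<open>E \<rightarrow> P \<rightarrow> K\<close> with \<open>E\<close> projective
 the kernels form a short exact sequence, and the kernel of the composite is projective.\<close>

lemma pd_le_1_submodule:
 fixes K P M :: "('o, 'm, 'u) cmod"
 assumes MP: "mses C M i P e K" and P: "pd_le_1 P" and K: "pd_le_1 K"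
 shows "pd_le_1 M"
proof -
 obtain l and L :: "('o, 'm, 'u) cmod" and q and E :: "('o, 'm, 'u) cmod"
  where E: "mses C L l E q P" "proj_mod E" "proj_mod L"
  using P unfolding pd_le_1_def by blast
 note a = msesD[OF MP] and b = msesD[OF E(1)]
 have "(%x. e X (q X x)) ` el E X = el K X" if "X \<in> Ob" for X
  using a(7)[OF that] b(7)[OF that] by (simp flip: image_image)
 then obtain l' and L' :: "('o, 'm, 'u) cmod" where L': "mses C L' l' E (%X x. e X (q X x)) K"
  using mses_kernel_exists[OF b(2) a(3) mhom_comp[OF b(5) a(5)]] by blast
 note c = msesD[OF L']
 have proj': "proj_mod L'" using pd_le_1_kernel[OF K L' E(2)] .
 have "q X (l' X x) \<in> i X ` el M X" if X: "X \<in> Ob" and x: "x \<in> el L' X" for X x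
  using mses_trivial_comp[OF L' X x] a(8)[OF X] mhom_closed[OF b(5) X mhom_closed[OF c(4) X x]] by blast
 then obtain v where v: "mhom C L' v M" "!!X x. X \<in> Ob ==> x \<in> el L' X ==> i X (v X x) = q X (l' X x)"
  using factor_inj[OF a(1) a(4,6) c(1) mhom_comp[OF c(4) b(5)]] by blast
 have e1: "e X \<zero>[P,X] = \<zero>[K,X]" if "X \<in> Ob" for X
  by (rule mhom_one[OF a(5) a(2,3) that])
 have "l X x \<in> l' X ` el L' X" if X: "X \<in> Ob" and x: "x \<in> el L X" for X x
  using mses_trivial_comp[OF E(1) X x] c(8)[OF X mhom_closed[OF b(4) X x]] e1[OF X] by simp
 then obtain u where u: "mhom C L u L'" "!!X x. X \<in> Ob ==> x \<in> el L X ==> l' X (u X x) = l X x"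
  using factor_inj[OF c(1) c(4,6) b(1) b(4)] by blast
 have "mses C L u L' v M"
  unfolding mses_def
 proof (intro conjI ballI a b c u v)
  fix X assume X: "X \<in> Ob"
  show "inj_on (u X) (el L X)"
   using b(6)[OF X] u(2)[OF X] unfolding inj_on_def by metis
  show "v X ` el L' X = el M X"
  proof
   show "v X ` el L' X \<subseteq> el M X" using mhom_closed[OF v(1) X] by blast
   show "el M X \<subseteq> v X ` el L' X"
   proof
    fix m assume m: "m \<in> el M X"
    have im: "i X m \<in> el P X" by (rule mhom_closed[OF a(4) X m])
    then obtain x where x: "x \<in> el E X" "i X m = q X x" using b(7)[OF X] by blast
    have "e X (q X x) = \<zero>[K,X]" using mses_trivial_comp[OF MP X m] x(2) by simp
    then obtain y where y: "y \<in> el L' X" "x = l' X y" using c(8)[OF X x(1)] by blast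
    then have "i X (v X y) = i X m" using v(2)[OF X y(1)] x by simp
    then have "v X y = m" using inj_onD[OF a(6)[OF X]] m mhom_closed[OF v(1) X y(1)] by blast
    then show "m \<in> v X ` el L' X" using y(1) by blast
   qed
  qed
  fix y assume y: "y \<in> el L' X"
  have "v X y = \<zero>[M,X] \<longleftrightarrow> i X (v X y) = i X \<zero>[M,X]"
   using inj_on_eq_iff[OF a(6)[OF X]] mhom_closed[OF v(1) X y] mod_one[OF a(1) X] by blast
  also have "\<dots> \<longleftrightarrow> q X (l' X y) = \<zero>[P,X]" using v(2)[OF X y] mhom_one[OF a(4) a(1,2) X] by simp
  also have "\<dots> \<longleftrightarrow> l' X y \<in> l X ` el L X" by (rule b(8)[OF X mhom_closed[OF c(4) X y]])
  also have "\<dots> \<longleftrightarrow> y \<in> u X ` el L X"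
  proof
   assume "l' X y \<in> l X ` el L X"
   then obtain x where x: "x \<in> el L X" "l' X y = l' X (u X x)" using u(2)[OF X] by auto
   then have "y = u X x" using inj_onD[OF c(6)[OF X]] y mhom_closed[OF u(1) X x(1)] by blast
   then show "y \<in> u X ` el L X" using x(1) by blast
  next
   assume "y \<in> u X ` el L X"
   then show "l' X y \<in> l X ` el L X" using u(2)[OF X] by auto
  qed
  finally show "v X y = \<zero>[M,X] \<longleftrightarrow> y \<in> u X ` el L X" .
 qed
 then show ?thesis using proj' E(3) unfolding pd_le_1_def by blast
qed

lemma trivial_module:
 fixes Z :: "('o, 'm, 'u) cmod"
 assumes Z: "is_mod Z" and t: "!!X. X \<in> Ob ==> el Z X = {\<zero>[Z,X]}"
 shows "id_le_1 Z" "pd_le_1 Z"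
proof -
 have "mses C Z (%X x. x) Z (%X x. x) Z" using Z t mhom_id by (auto simp: mses_def)
 moreover have "inj_mod Z"
  unfolding injective_module_def
 proof (intro conjI allI impI Z)
  fix A B :: "('o, 'm, 'u) cmod" and a f
  assume "mhom C A f Z"
  then have "f X x = \<zero>[Z,X]" if "X \<in> Ob" "x \<in> el A X" for X x
   using mhom_closed[OF \<open>mhom C A f Z\<close> that] t[OF that(1)] by simp
  then show "\<exists>g. mhom C B g Z \<and> (\<forall>X\<in>Ob. \<forall>x\<in>el A X. g X (a X x) = f X x)"
   using mhom_trivial[OF Z] by (intro exI[of _ "%X x. \<zero>[Z,X]"]) simp
 qed
 moreover have "proj_mod Z"
  unfolding projective_module_def
 proof (intro conjI allI impI Z)
  fix A B :: "('o, 'm, 'u) cmod" and e f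
  assume A: "is_mod A" and B: "is_mod B" and e: "mhom C A e B" and f: "mhom C Z f B"
  have "e X \<zero>[A,X] = f X x" if "X \<in> Ob" "x \<in> el Z X" for X x
   using mhom_one[OF e A B that(1)] mhom_one[OF f Z B that(1)] t that by auto
  then show "\<exists>g. mhom C Z g A \<and> (\<forall>X\<in>Ob. \<forall>x\<in>el Z X. e X (g X x) = f X x)"
   using mhom_trivial[OF A] by (intro exI[of _ "%X x. \<zero>[A,X]"]) simp
 qed
 ultimately show "id_le_1 Z" "pd_le_1 Z" unfolding id_le_1_def pd_le_1_def by blast+
qed

end

section \<open>The category of modules\<close>

text \<open>A prefix name for the module category, next to the infix notation of factor groups.\<close>

abbreviation "Modcat \<equiv> Defs.Mod"

lemma opposite_simps [simp]:
 "Obj (opposite C) = Obj C" "Arr (opposite C) = Arr C" "Dom (opposite C) = Cod C" "Cod (opposite C) = Dom C"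
 "Id (opposite C) = Id C" "Comp (opposite C) g f = Comp C f g" "homs (opposite C) X Y = homs C Y X"
 by (auto simp: opposite_def homs_def)

lemma zero_object_opposite [simp]: "zero_object (opposite C) Z \<longleftrightarrow> zero_object C Z"
 by (auto simp: zero_object_def)

lemma zero_arrow_opposite [simp]: "zero_arrow (opposite C) f \<longleftrightarrow> zero_arrow C f"
 unfolding zero_arrow_def by auto

lemma Mod_simps [simp]:
 "Obj (Modcat U C) = {M. is_module C M}" "Dom (Modcat U C) (M, \<eta>, N) = M" "Cod (Modcat U C) (M, \<eta>, N) = N"
 "(M, \<eta>, N) \<in> Arr (Modcat U C) \<longleftrightarrow> is_module C M \<and> is_module C N \<and> is_module_hom C M \<eta> N"
 by (auto simp: Mod_def)

text \<open>The arrow with the given components. Values outside of the objects and carriers are normalized, as the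
 category of modules requires.\<close>

definition mk :: "('o, 'm) lin_cat => ('o, 'm, 'u) cmod => ('o => 'u => 'u) => ('o, 'm, 'u) cmod =>
  ('o, 'm, 'u) cmod \<times> ('o => 'u => 'u) \<times> ('o, 'm, 'u) cmod" where
 "mk C M \<eta> N = (M, \<lambda>X\<in>Obj C. restrict (\<eta> X) (el M X), N)"

lemma Dom_mk [simp]: "Dom (Modcat U C) (mk C M \<eta> N) = M" and Cod_mk [simp]: "Cod (Modcat U C) (mk C M \<eta> N) = N"
 by (simp_all add: mk_def)

lemma mk_eq_iff: "mk C M \<eta> N = mk C M' \<theta> N' \<longleftrightarrow> M = M' \<and> N = N' \<and> (\<forall>X\<in>Obj C. \<forall>x\<in>el M X. \<eta> X x = \<theta> X x)"
proof
 assume *: "mk C M \<eta> N = mk C M' \<theta> N'"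
 then have "M = M'" "N = N'" and **: "(\<lambda>X\<in>Obj C. restrict (\<eta> X) (el M X)) = (\<lambda>X\<in>Obj C. restrict (\<theta> X) (el M X))"
  by (auto simp: mk_def)
 moreover have "\<eta> X x = \<theta> X x" if "X \<in> Obj C" "x \<in> el M X" for X x
  using fun_cong[OF fun_cong[OF **], of X x] that by simp
 ultimately show "M = M' \<and> N = N' \<and> (\<forall>X\<in>Obj C. \<forall>x\<in>el M X. \<eta> X x = \<theta> X x)" by simp
next
 assume *: "M = M' \<and> N = N' \<and> (\<forall>X\<in>Obj C. \<forall>x\<in>el M X. \<eta> X x = \<theta> X x)"
 then show "mk C M \<eta> N = mk C M' \<theta> N'"
  by (auto simp: mk_def restrict_def fun_eq_iff)
qed

context linear_category
begin

abbreviation ModC :: "(('o, 'm, 'u) cmod, ('o, 'm, 'u) cmod \<times> ('o => 'u => 'u) \<times> ('o, 'm, 'u) cmod) cat" where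
 "ModC == Modcat TYPE('u) C"

declare mhom_id [simp] mhom_trivial [simp]

lemma mk_Arr [simp]:
 assumes "is_mod M" "is_mod N" "mhom C M \<eta> N"
 shows "mk C M \<eta> N \<in> Arr (Modcat U C)"
proof -
 have "is_module_hom C M (\<lambda>X\<in>Ob. restrict (\<eta> X) (el M X)) N"
  unfolding is_module_hom_def
 proof (intro conjI ballI)
  show "(\<lambda>X\<in>Ob. restrict (\<eta> X) (el M X)) \<in> extensional (Ob)" by simp
  fix X assume X: "X \<in> Ob"
  interpret comm_group "Grp M X" using assms(1) X by (rule mod_group)
  have "restrict (\<eta> X) (el M X) \<in> hom (Grp M X) (Grp N X)"
   using mhom_hom[OF assms(3) X] by (auto simp: hom_def)
  then show "(\<lambda>X\<in>Ob. restrict (\<eta> X) (el M X)) X \<in> extensional (el M X) \<inter> hom (Grp M X) (Grp N X)"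
   using X by simp
 next
  fix f x assume "f \<in> Ar" "x \<in> el M (cod f)"
  then show "(\<lambda>X\<in>Ob. restrict (\<eta> X) (el M X)) (dom f) (Act M f x) =
    Act N f ((\<lambda>X\<in>Ob. restrict (\<eta> X) (el M X)) (cod f) x)"
   using assms(1) mhom_nat[OF assms(3)] by simp
 qed
 then show ?thesis using assms by (simp add: mk_def)
qed

lemma mk_homs [simp]:
 "[|is_mod M; is_mod N; mhom C M \<eta> N|] ==> mk C M \<eta> N \<in> homs (Modcat U C) M N"
 by (simp add: homs_def)

lemma Arr_Mod_cases:
 assumes "F \<in> Arr (Modcat U C)"
 obtains M \<eta> N where "F = mk C M \<eta> N" "is_mod M" "is_mod N" "mhom C M \<eta> N"
proof -
 obtain M \<eta> N where F: "F = (M, \<eta>, N)" by (cases F) auto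
 then have *: "is_mod M" "is_mod N" "is_module_hom C M \<eta> N" using assms by auto
 then have "mhom C M \<eta> N" by (auto simp: is_module_hom_def mhom_def)
 moreover have "(\<lambda>X\<in>Ob. restrict (\<eta> X) (el M X)) = \<eta>"
 proof
  fix X
  have e: "\<eta> \<in> extensional (Ob)" "X \<in> Ob ==> \<eta> X \<in> extensional (el M X)"
   using *(3) by (auto simp: is_module_hom_def)
  show "(\<lambda>X\<in>Ob. restrict (\<eta> X) (el M X)) X = \<eta> X"
  proof (cases "X \<in> Ob")
   case True
   then show ?thesis using extensional_restrict[OF e(2)[OF True]] by simp
  next
   case False
   then show ?thesis using extensional_arb[OF e(1) False] by simp
  qed
 qed
 ultimately show thesis using that[of M \<eta> N] * F by (simp add: mk_def)
qed

lemma homs_Mod_cases: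
 assumes "F \<in> homs (Modcat U C) M N"
 obtains \<eta> where "F = mk C M \<eta> N" "is_mod M" "is_mod N" "mhom C M \<eta> N"
proof -
 have F: "F \<in> Arr (Modcat U C)" "Dom (Modcat U C) F = M" "Cod (Modcat U C) F = N" using assms by (auto simp: homs_def)
 obtain M' \<eta> N' where "F = mk C M' \<eta> N'" "is_mod M'" "is_mod N'" "mhom C M' \<eta> N'"
  using Arr_Mod_cases[OF F(1)] .
 then show thesis using F that by auto
qed

lemma Comp_mk [simp]:
 assumes "mhom C L a M"
 shows "Comp (Modcat U C) (mk C M b N) (mk C L a M) = mk C L (%X x. b X (a X x)) N"
proof -
 have "(\<lambda>X\<in>Ob. compose (el L X) ((\<lambda>X\<in>Ob. restrict (b X) (el M X)) X) ((\<lambda>X\<in>Ob. restrict (a X) (el L X)) X)) =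
   (\<lambda>X\<in>Ob. restrict (%x. b X (a X x)) (el L X))"
  using mhom_closed[OF assms] by (auto simp: compose_def restrict_def fun_eq_iff)
 then show ?thesis by (simp add: Mod_def mk_def)
qed

lemma Id_mk: "Id (Modcat U C) M = mk C M (%X x. x) M"
 by (simp add: Mod_def mk_def restrict_def)

lemma category_Mod: "category (Modcat U C)"
 unfolding category_def
proof (intro conjI ballI impI)
 fix f assume "f \<in> Arr (Modcat U C)"
 then obtain M \<eta> N where f: "f = mk C M \<eta> N" "is_mod M" "is_mod N" "mhom C M \<eta> N"
  by (rule Arr_Mod_cases)
 then show "Dom (Modcat U C) f \<in> Obj (Modcat U C)" "Cod (Modcat U C) f \<in> Obj (Modcat U C)"
  "Comp (Modcat U C) f (Id (Modcat U C) (Dom (Modcat U C) f)) = f" "Comp (Modcat U C) (Id (Modcat U C) (Cod (Modcat U C) f)) f = f"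
  by (auto simp: Id_mk)
next
 fix X assume "X \<in> Obj (Modcat U C)"
 then show "Id (Modcat U C) X \<in> homs (Modcat U C) X X" by (simp add: Id_mk)
next
 fix f g assume "f \<in> Arr (Modcat U C)" "g \<in> Arr (Modcat U C)" and fg: "Cod (Modcat U C) f = Dom (Modcat U C) g"
 obtain M \<eta> N where f: "f = mk C M \<eta> N" "is_mod M" "is_mod N" "mhom C M \<eta> N"
  using \<open>f \<in> _\<close> by (rule Arr_Mod_cases)
 obtain N' \<theta> P where g: "g = mk C N' \<theta> P" "is_mod N'" "is_mod P" "mhom C N' \<theta> P"
  using \<open>g \<in> _\<close> by (rule Arr_Mod_cases)
 have "N' = N" using f g fg by simp
 then show "Comp (Modcat U C) g f \<in> homs (Modcat U C) (Dom (Modcat U C) f) (Cod (Modcat U C) g)"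
  using f g by (simp add: mhom_comp[OF f(4)])
 fix h assume "h \<in> Arr (Modcat U C)" "Cod (Modcat U C) g = Dom (Modcat U C) h"
 then obtain P' \<kappa> Q where h: "h = mk C P' \<kappa> Q" "is_mod P'" "is_mod Q" "mhom C P' \<kappa> Q"
  by (metis Arr_Mod_cases)
 have "P' = P" using \<open>Cod (Modcat U C) g = Dom (Modcat U C) h\<close> g h by simp
 then show "Comp (Modcat U C) h (Comp (Modcat U C) g f) = Comp (Modcat U C) (Comp (Modcat U C) h g) f"
  using f g h \<open>N' = N\<close> by (simp add: mhom_comp[OF f(4)])
qed

text \<open>For the direct implication compare the inclusion of the kernel with the zero map.\<close>

lemma is_mono_iff:
 fixes M N :: "('o, 'm, 'u) cmod"
 assumes M: "is_mod M" and N: "is_mod N" and \<eta>: "mhom C M \<eta> N"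
 shows "is_mono ModC (mk C M \<eta> N) \<longleftrightarrow> (\<forall>X\<in>Ob. inj_on (\<eta> X) (el M X))"
proof
 assume mono: "is_mono ModC (mk C M \<eta> N)"
 let ?S = "%X. {x \<in> el M X. \<eta> X x = \<zero>[N,X]}"
 have S: "submodule C M ?S" using submodule_kernel[OF M N \<eta>] .
 let ?K = "restrict_module M ?S"
 have K: "is_mod ?K" using is_module_restrict[OF M S] .
 have i: "mhom C ?K (%X x. x) M" "mhom C ?K (%X x. \<zero>[M,X]) M"
  using mhom_inclusion[OF S] mhom_trivial[OF M] by auto
 let ?g = "mk C ?K (%X x. x) M" and ?h = "mk C ?K (%X x. \<zero>[M,X]) M"
 have "Comp ModC (mk C M \<eta> N) ?g = Comp ModC (mk C M \<eta> N) ?h"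
  using i mhom_one[OF \<eta> M N] by (simp add: mk_eq_iff)
 moreover have "?g \<in> Arr ModC" "?h \<in> Arr ModC" using K M i by auto
 ultimately have "?g = ?h" using mono by (simp add: is_mono_def)
 then show "\<forall>X\<in>Ob. inj_on (\<eta> X) (el M X)"
  by (intro ballI mhom_inj_onI[OF \<eta> M N]) (auto simp: mk_eq_iff)
next
 assume inj: "\<forall>X\<in>Ob. inj_on (\<eta> X) (el M X)"
 show "is_mono ModC (mk C M \<eta> N)"
  unfolding is_mono_def
 proof (intro conjI ballI impI)
  show "mk C M \<eta> N \<in> Arr ModC" using assms by simp
  fix g h
  assume gh: "g \<in> Arr ModC" "h \<in> Arr ModC" "Dom ModC g = Dom ModC h"
   "Cod ModC g = Dom ModC (mk C M \<eta> N)" "Cod ModC h = Dom ModC (mk C M \<eta> N)"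
   and eq: "Comp ModC (mk C M \<eta> N) g = Comp ModC (mk C M \<eta> N) h"
  obtain L a where g: "g = mk C L a M" "mhom C L a M" using Arr_Mod_cases[OF gh(1)] gh(4) by (metis Cod_mk Dom_mk)
  obtain b where h: "h = mk C L b M" "mhom C L b M" using Arr_Mod_cases[OF gh(2)] gh(3,5) g(1) by (metis Cod_mk Dom_mk)
  have "a X x = b X x" if "X \<in> Ob" "x \<in> el L X" for X x
   using eq that g h inj mhom_closed[OF g(2) that] mhom_closed[OF h(2) that]
   by (auto simp: mk_eq_iff inj_on_def)
  then show "g = h" using g h by (simp add: mk_eq_iff)
 qed
qed

text \<open>For the direct implication compare the projection to the cokernel with the zero map.\<close>

lemma is_epi_iff:
 fixes M N :: "('o, 'm, 'u) cmod"
 assumes M: "is_mod M" and N: "is_mod N" and \<eta>: "mhom C M \<eta> N"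
 shows "is_epi ModC (mk C M \<eta> N) \<longleftrightarrow> (\<forall>X\<in>Ob. \<eta> X ` el M X = el N X)"
proof
 assume epi: "is_epi ModC (mk C M \<eta> N)"
 obtain Q :: "('o, 'm, 'u) cmod" and q where Q: "is_mod Q" "mhom C N q Q"
  "!!X. X \<in> Ob ==> q X ` el N X = el Q X"
  "!!X x. X \<in> Ob ==> x \<in> el N X ==> q X x = \<zero>[Q,X] \<longleftrightarrow> x \<in> \<eta> X ` el M X"
  using quotient_module_exists[OF N submodule_image[OF M N \<eta>]] by blast
 have t: "mhom C N (%X x. \<zero>[Q,X]) Q" by (rule mhom_trivial[OF Q(1)])
 let ?g = "mk C N q Q" and ?h = "mk C N (%X x. \<zero>[Q,X]) Q"
 have "Comp ModC ?g (mk C M \<eta> N) = Comp ModC ?h (mk C M \<eta> N)"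
  using \<eta> Q(4) mhom_closed[OF \<eta>] by (auto simp: mk_eq_iff)
 moreover have "?g \<in> Arr ModC" "?h \<in> Arr ModC" using N Q t by auto
 ultimately have "?g = ?h" using epi by (simp add: is_epi_def is_mono_def)
 then have "x \<in> \<eta> X ` el M X" if "X \<in> Ob" "x \<in> el N X" for X x
  using Q(4)[OF that] that by (simp add: mk_eq_iff)
 then show "\<forall>X\<in>Ob. \<eta> X ` el M X = el N X" using mhom_closed[OF \<eta>] by blast
next
 assume surj: "\<forall>X\<in>Ob. \<eta> X ` el M X = el N X"
 show "is_epi ModC (mk C M \<eta> N)"
  unfolding is_epi_def is_mono_def opposite_simps
 proof (intro conjI ballI impI)
  show "mk C M \<eta> N \<in> Arr ModC" using assms by simp
  fix g h
  assume gh: "g \<in> Arr ModC" "h \<in> Arr ModC" "Cod ModC g = Cod ModC h"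
   "Dom ModC g = Cod ModC (mk C M \<eta> N)" "Dom ModC h = Cod ModC (mk C M \<eta> N)"
   and eq: "Comp ModC g (mk C M \<eta> N) = Comp ModC h (mk C M \<eta> N)"
  obtain L a where g: "g = mk C N a L" using Arr_Mod_cases[OF gh(1)] gh(4) by (metis Cod_mk Dom_mk)
  obtain b where h: "h = mk C N b L" using Arr_Mod_cases[OF gh(2)] gh(3,5) g(1) by (metis Cod_mk Dom_mk)
  have "a X x = b X x" if "X \<in> Ob" "x \<in> el N X" for X x
  proof -
   have "x \<in> \<eta> X ` el M X" using surj that by simp
   then obtain y where "y \<in> el M X" "x = \<eta> X y" by (rule imageE)
   then show ?thesis using eq \<open>X \<in> Ob\<close> \<eta> by (simp add: g h mk_eq_iff)
  qed
  then show "g = h" using g h by (simp add: mk_eq_iff)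
 qed
qed

definition triv :: "('o, 'm, 'u) cmod" where
 "triv = \<lparr>Grp = (%X. \<lparr>carrier = {undefined}, monoid.mult = (%x y. undefined), one = undefined\<rparr>),
   Act = (%f x. undefined)\<rparr>"

lemma triv_simps [simp]: "el triv X = {undefined}" "\<zero>[triv,X] = undefined" "Act triv f x = undefined"
  "x +[triv,X] y = undefined"
 by (auto simp: triv_def)

lemma is_module_triv [simp]: "is_mod triv"
 unfolding is_module_def by (auto intro!: comm_groupI homI)

lemma mhom_triv [simp]: "mhom C M (%X x. undefined) triv"
 by (rule mhomI) auto

lemma zero_object_triv: "zero_object ModC (triv :: ('o, 'm, 'u) cmod)"
 unfolding zero_object_def
proof (intro conjI ballI)
 show "triv \<in> Obj ModC" by simp
 fix M :: "('o, 'm, 'u) cmod" assume "M \<in> Obj ModC"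
 then have M: "is_mod M" by simp
 show "\<exists>!f. f \<in> homs ModC M triv"
 proof (rule ex1I)
  show "mk C M (%X x. undefined) triv \<in> homs ModC M triv"
   using M by simp
  fix f assume "f \<in> homs ModC M triv"
  then obtain \<eta> where f: "f = mk C M \<eta> triv" "mhom C M \<eta> triv" by (rule homs_Mod_cases)
  then show "f = mk C M (%X x. undefined) triv" using mhom_closed[OF f(2)] by (simp add: mk_eq_iff)
 qed
 show "\<exists>!f. f \<in> homs ModC triv M"
 proof (rule ex1I)
  show "mk C triv (%X x. \<zero>[M,X]) M \<in> homs ModC triv M"
   using M by simp
  fix f assume "f \<in> homs ModC triv M"
  then obtain \<eta> where f: "f = mk C triv \<eta> M" "mhom C triv \<eta> M" by (rule homs_Mod_cases)
  then show "f = mk C triv (%X x. \<zero>[M,X]) M"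
   using mhom_one[OF f(2) is_module_triv M] by (simp add: mk_eq_iff)
 qed
qed

lemma zero_arrow_iff:
 fixes M N :: "('o, 'm, 'u) cmod"
 assumes M: "is_mod M" and N: "is_mod N" and \<eta>: "mhom C M \<eta> N"
 shows "zero_arrow ModC (mk C M \<eta> N) \<longleftrightarrow> (\<forall>X\<in>Ob. \<forall>x\<in>el M X. \<eta> X x = \<zero>[N,X])"
proof
 assume "zero_arrow ModC (mk C M \<eta> N)"
 then obtain Z g h where Z: "zero_object ModC Z" and g: "g \<in> homs ModC M Z"
  and h: "h \<in> homs ModC Z N" and eq: "mk C M \<eta> N = Comp ModC h g"
  unfolding zero_arrow_def by auto
 obtain a where a: "g = mk C M a Z" "is_mod Z" "mhom C M a Z" using g by (rule homs_Mod_cases)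
 obtain b where b: "h = mk C Z b N" "mhom C Z b N" using h by (rule homs_Mod_cases)
 have "mk C M (%X x. \<zero>[Z,X]) Z \<in> homs ModC M Z" using M a(2) by simp
 then have "g = mk C M (%X x. \<zero>[Z,X]) Z"     proof -
   have "\<exists>!f. f \<in> homs ModC M Z" using Z M by (simp add: zero_object_def)
   then show ?thesis using g \<open>mk C M (%X x. \<zero>[Z,X]) Z \<in> _\<close> by blast
  qed
 then show "\<forall>X\<in>Ob. \<forall>x\<in>el M X. \<eta> X x = \<zero>[N,X]"
  using eq a b mhom_one[OF b(2) a(2) N] by (simp add: mk_eq_iff)
next
 assume *: "\<forall>X\<in>Ob. \<forall>x\<in>el M X. \<eta> X x = \<zero>[N,X]"
 have t: "mhom C M (%X x. undefined) (triv :: ('o, 'm, 'u) cmod)" "mhom C (triv :: ('o, 'm, 'u) cmod) (%X x. \<zero>[N,X]) N"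
  using N by auto
 have "mk C M \<eta> N = Comp ModC (mk C triv (%X x. \<zero>[N,X]) N) (mk C M (%X x. undefined) triv)"
  using * t by (simp add: mk_eq_iff)
 then show "zero_arrow ModC (mk C M \<eta> N)"
  unfolding zero_arrow_def
  by (intro conjI exI[of _ triv] exI[of _ "mk C M (%X x. undefined) triv"] exI[of _ "mk C triv (%X x. \<zero>[N,X]) N"])
   (use assms t in \<open>simp_all add: zero_object_triv\<close>)
qed

lemma is_kernel_iff:
 fixes K M N :: "('o, 'm, 'u) cmod"
 assumes K: "is_mod K" and M: "is_mod M" and N: "is_mod N"
  and k: "mhom C K k M" and f: "mhom C M f N"
 shows "is_kernel ModC (mk C K k M) (mk C M f N) \<longleftrightarrow>
  (\<forall>X\<in>Ob. inj_on (k X) (el K X) \<and> (\<forall>y\<in>el M X. f X y = \<zero>[N,X] \<longleftrightarrow> y \<in> k X ` el K X))"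
proof
 assume ker: "is_kernel ModC (mk C K k M) (mk C M f N)"
 have fk: "f X (k X x) = \<zero>[N,X]" if "X \<in> Ob" "x \<in> el K X" for X x
  using ker that k K M N mhom_comp[OF k f] by (auto simp: is_kernel_def zero_arrow_iff)
 have univ: "\<exists>!u. u \<in> homs ModC L K \<and> Comp ModC (mk C K k M) u = mk C L g M"
  if "is_mod L" "mhom C L g M" "!!X x. X \<in> Ob ==> x \<in> el L X ==> f X (g X x) = \<zero>[N,X]" for L g
 proof -
  have "mk C L g M \<in> Arr ModC" using that M by simp
  moreover have "zero_arrow ModC (Comp ModC (mk C M f N) (mk C L g M))"
   using that N mhom_comp[OF that(2) f] by (simp add: zero_arrow_iff)
  moreover have "\<forall>g\<in>Arr ModC. Cod ModC g = Dom ModC (mk C M f N) -->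
    zero_arrow ModC (Comp ModC (mk C M f N) g) -->
    (\<exists>!u. u \<in> homs ModC (Dom ModC g) (Dom ModC (mk C K k M)) \<and>
     Comp ModC (mk C K k M) u = g)"
   using ker unfolding is_kernel_def by (elim conjE)
  ultimately have "\<exists>!u. u \<in> homs ModC (Dom ModC (mk C L g M)) (Dom ModC (mk C K k M)) \<and>
     Comp ModC (mk C K k M) u = mk C L g M" by (metis Cod_mk Dom_mk)
  then show ?thesis by (simp only: Dom_mk)
 qed
 show "\<forall>X\<in>Ob. inj_on (k X) (el K X) \<and> (\<forall>y\<in>el M X. f X y = \<zero>[N,X] \<longleftrightarrow> y \<in> k X ` el K X)"
 proof (intro ballI conjI)
  fix X assume X: "X \<in> Ob"
  let ?S = "%X. {x \<in> el K X. k X x = \<zero>[M,X]}"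
  have S: "submodule C K ?S" using submodule_kernel[OF K M k] .
  let ?L = "restrict_module K ?S"
  have L: "is_mod ?L" using is_module_restrict[OF K S] .
  have i: "mhom C ?L (%X x. x) K" "mhom C ?L (%X x. \<zero>[K,X]) K"
   using mhom_inclusion[OF S] mhom_trivial[OF K] by auto
  have "\<exists>!u. u \<in> homs ModC ?L K \<and> Comp ModC (mk C K k M) u = mk C ?L (%X x. k X x) M"
   using fk by (intro univ L mhom_comp[OF i(1) k]) (auto simp del: el_restrict_module dest: mhom_closed[OF i(1)])
  moreover have "mk C ?L (%X x. x) K \<in> homs ModC ?L K" "mk C ?L (%X x. \<zero>[K,X]) K \<in> homs ModC ?L K"
   using L K i by auto
  moreover have "Comp ModC (mk C K k M) (mk C ?L (%X x. x) K) = mk C ?L (%X x. k X x) M"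
   "Comp ModC (mk C K k M) (mk C ?L (%X x. \<zero>[K,X]) K) = mk C ?L (%X x. k X x) M"
   using i mhom_one[OF k K M] by (auto simp: mk_eq_iff)
  ultimately have "mk C ?L (%X x. x) K = mk C ?L (%X x. \<zero>[K,X]) K" by auto
  then show "inj_on (k X) (el K X)"
   by (intro mhom_inj_onI[OF k K M X]) (auto simp: mk_eq_iff X)
 next
  fix X y assume X: "X \<in> Ob" and y: "y \<in> el M X"
  show "f X y = \<zero>[N,X] \<longleftrightarrow> y \<in> k X ` el K X"
  proof
   assume fy: "f X y = \<zero>[N,X]"
   let ?S = "%X. {x \<in> el M X. f X x = \<zero>[N,X]}"
   have S: "submodule C M ?S" using submodule_kernel[OF M N f] .
   let ?L = "restrict_module M ?S"
   have L: "is_mod ?L" using is_module_restrict[OF M S] .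
   have i: "mhom C ?L (%X x. x) M" using mhom_inclusion[OF S] .
   obtain u where u: "u \<in> homs ModC ?L K" "Comp ModC (mk C K k M) u = mk C ?L (%X x. x) M"
    using univ[OF L i] by auto
   obtain v where v: "u = mk C ?L v K" "mhom C ?L v K" using u(1) by (rule homs_Mod_cases)
   have "k X (v X y) = y" using u(2) v X y fy by (simp add: mk_eq_iff)
   moreover have "v X y \<in> el K X" using mhom_closed[OF v(2) X, of y] y fy by simp
   ultimately show "y \<in> k X ` el K X" by force
  qed (use fk X in auto)
 qed
next
 assume *: "\<forall>X\<in>Ob. inj_on (k X) (el K X) \<and> (\<forall>y\<in>el M X. f X y = \<zero>[N,X] \<longleftrightarrow> y \<in> k X ` el K X)"
 show "is_kernel ModC (mk C K k M) (mk C M f N)"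
  unfolding is_kernel_def
 proof (intro conjI ballI impI)
  show "zero_arrow ModC (Comp ModC (mk C M f N) (mk C K k M))"
   using k K N mhom_comp[OF k f] * mhom_closed[OF k] by (auto simp: zero_arrow_iff)
  fix g assume "g \<in> Arr ModC" and gM: "Cod ModC g = Dom ModC (mk C M f N)"
   and z: "zero_arrow ModC (Comp ModC (mk C M f N) g)"
  then obtain L h where g: "g = mk C L h M" "is_mod L" "mhom C L h M"
   by (metis Arr_Mod_cases Cod_mk Dom_mk)
  have "h X x \<in> k X ` el K X" if "X \<in> Ob" "x \<in> el L X" for X x
  proof -
   have "f X (h X x) = \<zero>[N,X]"
    using z that g N mhom_comp[OF g(3) f] by (simp add: zero_arrow_iff)
   then show ?thesis using * mhom_closed[OF g(3) that] that(1) by blast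
  qed
  then obtain u where u: "mhom C L u K" "!!X x. X \<in> Ob ==> x \<in> el L X ==> k X (u X x) = h X x"
   using factor_inj[OF K k _ g(2,3)] * by blast
  show "\<exists>!u. u \<in> homs ModC (Dom ModC g) (Dom ModC (mk C K k M)) \<and>
    Comp ModC (mk C K k M) u = g"
  proof (rule ex1I)
   show "mk C L u K \<in> homs ModC (Dom ModC g) (Dom ModC (mk C K k M)) \<and>
     Comp ModC (mk C K k M) (mk C L u K) = g"
    using g u K by (simp add: mk_eq_iff)
   fix w assume w: "w \<in> homs ModC (Dom ModC g) (Dom ModC (mk C K k M)) \<and>
     Comp ModC (mk C K k M) w = g"
   then obtain v where v: "w = mk C L v K" "mhom C L v K" using g by (auto elim: homs_Mod_cases)
   have "k X (v X x) = k X (u X x)" if "X \<in> Ob" "x \<in> el L X" for X x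
    using w that v g u(2) by (simp add: mk_eq_iff)
   then have "v X x = u X x" if "X \<in> Ob" "x \<in> el L X" for X x
    using * that mhom_closed[OF v(2) that] mhom_closed[OF u(1) that] unfolding inj_on_def by blast
   then show "w = mk C L u K" using v by (simp add: mk_eq_iff)
  qed
 qed (use assms in auto)
qed

lemma is_cokernelI:
 fixes L M Q :: "('o, 'm, 'u) cmod"
 assumes L: "is_mod L" and M: "is_mod M" and Q: "is_mod Q"
  and f: "mhom C L f M" and q: "mhom C M q Q"
  and surj: "!!X. X \<in> Ob ==> q X ` el M X = el Q X"
  and ker: "!!X y. X \<in> Ob ==> y \<in> el M X ==> q X y = \<zero>[Q,X] \<longleftrightarrow> y \<in> f X ` el L X"
 shows "is_cokernel ModC (mk C M q Q) (mk C L f M)"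
 unfolding is_cokernel_def is_kernel_def opposite_simps zero_arrow_opposite
proof (intro conjI ballI impI)
 show "zero_arrow ModC (Comp ModC (mk C M q Q) (mk C L f M))"
  using f L Q mhom_comp[OF f q] ker mhom_closed[OF f] by (auto simp: zero_arrow_iff)
 fix g assume "g \<in> Arr ModC" and gM: "Dom ModC g = Cod ModC (mk C L f M)"
  and z: "zero_arrow ModC (Comp ModC g (mk C L f M))"
 then obtain N h where g: "g = mk C M h N" "is_mod N" "mhom C M h N"
  by (metis Arr_Mod_cases Cod_mk Dom_mk)
 have "h X x = \<zero>[N,X]" if X: "X \<in> Ob" "x \<in> el M X" "q X x = \<zero>[Q,X]" for X x
  using z that g f L mhom_comp[OF f g(3)] ker[OF that(1,2)] by (auto simp: zero_arrow_iff)
 then obtain u where u: "mhom C Q u N" "!!X x. X \<in> Ob ==> x \<in> el M X ==> u X (q X x) = h X x"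
  using factor_surj[OF g(2) M Q q surj g(3)] by blast
 show "\<exists>!u. u \<in> homs ModC (Cod ModC (mk C M q Q)) (Cod ModC g) \<and>
   Comp ModC u (mk C M q Q) = g"
 proof (rule ex1I)
  show "mk C Q u N \<in> homs ModC (Cod ModC (mk C M q Q)) (Cod ModC g) \<and>
    Comp ModC (mk C Q u N) (mk C M q Q) = g"
   using g u q Q by (simp add: mk_eq_iff)
  fix w assume w: "w \<in> homs ModC (Cod ModC (mk C M q Q)) (Cod ModC g) \<and>
    Comp ModC w (mk C M q Q) = g"
  then obtain v where v: "w = mk C Q v N" "mhom C Q v N" using g by (auto elim: homs_Mod_cases)
  have "v X x = u X x" if X: "X \<in> Ob" "x \<in> el Q X" for X x
  proof -
   obtain y where y: "y \<in> el M X" "x = q X y" using surj[OF X(1)] X(2) by blast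
   then show ?thesis using w X v g u(2) q by (simp add: mk_eq_iff)
  qed
  then show "w = mk C Q u N" using v by (simp add: mk_eq_iff)
 qed
qed (use assms in auto)

lemma exact_iff:
 fixes L M N :: "('o, 'm, 'u) cmod"
 assumes L: "is_mod L" and M: "is_mod M" and N: "is_mod N"
  and a: "mhom C L a M" and b: "mhom C M b N"
 shows "exact ModC (mk C L a M) (mk C M b N) \<longleftrightarrow>
  (\<forall>X\<in>Ob. \<forall>y\<in>el M X. b X y = \<zero>[N,X] \<longleftrightarrow> y \<in> a X ` el L X)"
proof
 assume "exact ModC (mk C L a M) (mk C M b N)"
 then obtain e m where em: "is_epi ModC e" "is_mono ModC m"
  "Cod ModC e = Dom ModC m" "mk C L a M = Comp ModC m e"
  "is_kernel ModC m (mk C M b N)"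
  unfolding exact_def by blast
 have eA: "e \<in> Arr ModC" "m \<in> Arr ModC" "Cod ModC m = M"
  using em by (auto simp: is_epi_def is_mono_def is_kernel_def)
 obtain L' e' I where e: "e = mk C L' e' I" "is_mod L'" "is_mod I" "mhom C L' e' I"
  using Arr_Mod_cases[OF eA(1)] .
 obtain m' where m: "m = mk C I m' M" "mhom C I m' M"
  using Arr_Mod_cases[OF eA(2)] eA(3) em(3) e(1) by (metis Cod_mk Dom_mk)
 have "L' = L" and am: "!!X x. X \<in> Ob ==> x \<in> el L X ==> a X x = m' X (e' X x)"
  using em(4) e m by (auto simp: mk_eq_iff)
 have surj: "e' X ` el L X = el I X" if "X \<in> Ob" for X
  using em(1) e that \<open>L' = L\<close> by (simp add: is_epi_iff)
 show "\<forall>X\<in>Ob. \<forall>y\<in>el M X. b X y = \<zero>[N,X] \<longleftrightarrow> y \<in> a X ` el L X"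
 proof (intro ballI)
  fix X y assume X: "X \<in> Ob" and y: "y \<in> el M X"
  have "a X ` el L X = m' X ` e' X ` el L X" using am[OF X] by (auto simp: image_image)
  then show "b X y = \<zero>[N,X] \<longleftrightarrow> y \<in> a X ` el L X"
   using em(5) X y m e surj[OF X] is_kernel_iff[OF e(3) M N m(2) b] by simp
 qed
next
 assume *: "\<forall>X\<in>Ob. \<forall>y\<in>el M X. b X y = \<zero>[N,X] \<longleftrightarrow> y \<in> a X ` el L X"
 let ?S = "%X. a X ` el L X"
 have S: "submodule C M ?S" using submodule_image[OF L M a] .
 let ?I = "restrict_module M ?S"
 have I: "is_mod ?I" using is_module_restrict[OF M S] .
 have m: "mhom C ?I (%X x. x) M" using mhom_inclusion[OF S] .
 have e: "mhom C L a ?I"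
  by (rule mhomI) (auto simp: mhom_mult[OF a] mhom_nat[OF a])
 have "is_epi ModC (mk C L a ?I)" using L I e by (simp add: is_epi_iff)
 moreover have "is_mono ModC (mk C ?I (%X x. x) M)" using M I m by (simp add: is_mono_iff inj_on_def)
 moreover have "is_kernel ModC (mk C ?I (%X x. x) M) (mk C M b N)"
  using is_kernel_iff[OF I M N m b] * by (simp add: inj_on_def)
 ultimately show "exact ModC (mk C L a M) (mk C M b N)"
  unfolding exact_def using e by (intro exI[of _ "mk C L a ?I"] exI[of _ "mk C ?I (%X x. x) M"]) simp
qed

lemma projective_iff:
 fixes P :: "('o, 'm, 'u) cmod"
 shows "projective ModC P \<longleftrightarrow> proj_mod P"
proof
 assume P: "projective ModC P"
 show "proj_mod P"
  unfolding projective_module_def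
 proof (intro conjI allI impI)
  show mP: "is_mod P" using P by (simp add: projective_def)
  fix A B :: "('o, 'm, 'u) cmod" and e f
  assume AB: "is_mod A" "is_mod B" and e: "mhom C A e B" "\<forall>X\<in>Ob. e X ` el A X = el B X"
   and f: "mhom C P f B"
  have "is_epi ModC (mk C A e B)" using is_epi_iff[OF AB e(1)] e(2) by simp
  moreover have "mk C P f B \<in> homs ModC P B" using mP AB f by simp
  ultimately obtain g where g: "g \<in> homs ModC P A" "Comp ModC (mk C A e B) g = mk C P f B"
   using P unfolding projective_def by (metis Cod_mk Dom_mk)
  obtain h where h: "g = mk C P h A" "mhom C P h A" using g(1) by (rule homs_Mod_cases)
  then show "\<exists>g. mhom C P g A \<and> (\<forall>X\<in>Ob. \<forall>x\<in>el P X. e X (g X x) = f X x)"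
   using g(2) by (intro exI[of _ h]) (simp add: mk_eq_iff)
 qed
next
 assume P: "proj_mod P"
 then have mP: "is_mod P" by (simp add: projective_module_def)
 show "projective ModC P"
  unfolding projective_def
 proof (intro conjI allI impI ballI)
  show "P \<in> Obj ModC" using mP by simp
  fix e f assume e: "is_epi ModC e" and f: "f \<in> homs ModC P (Cod ModC e)"
  have "e \<in> Arr ModC" using e by (simp add: is_epi_def is_mono_def)
  then obtain A e' B where e': "e = mk C A e' B" "is_mod A" "is_mod B" "mhom C A e' B"
   by (rule Arr_Mod_cases)
  obtain f' where f': "f = mk C P f' B" "mhom C P f' B" using f e' by (auto elim: homs_Mod_cases)
  have "e' X ` el A X = el B X" if "X \<in> Ob" for X using e e' that by (simp add: is_epi_iff)
  then obtain g where g: "mhom C P g A" "!!X x. X \<in> Ob ==> x \<in> el P X ==> e' X (g X x) = f' X x"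
   using projective_moduleD[OF P e'(2-4) _ f'(2)] by blast
  then show "\<exists>g\<in>homs ModC P (Dom ModC e). Comp ModC e g = f"
   using e' f' mP by (intro bexI[of _ "mk C P g A"]) (auto simp: mk_eq_iff)
 qed
qed

lemma injective_iff:
 fixes E :: "('o, 'm, 'u) cmod"
 shows "injective ModC E \<longleftrightarrow> inj_mod E"
proof
 assume E: "injective ModC E"
 show "inj_mod E"
  unfolding injective_module_def
 proof (intro conjI allI impI)
  show mE: "is_mod E" using E by (simp add: injective_def projective_def)
  fix A B :: "('o, 'm, 'u) cmod" and a f
  assume AB: "is_mod A" "is_mod B" and a: "mhom C A a B" "\<forall>X\<in>Ob. inj_on (a X) (el A X)"
   and f: "mhom C A f E"
  have "is_epi (opposite ModC) (mk C A a B)"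
   using is_mono_iff[OF AB a(1)] a(2) by (simp add: is_epi_def is_mono_def)
  moreover have "mk C A f E \<in> homs ModC A E" using mE AB f by simp
  ultimately obtain g where g: "g \<in> homs ModC B E" "Comp ModC g (mk C A a B) = mk C A f E"
   using E unfolding injective_def projective_def opposite_simps by (metis Cod_mk Dom_mk)
  obtain h where h: "g = mk C B h E" "mhom C B h E" using g(1) by (rule homs_Mod_cases)
  then show "\<exists>g. mhom C B g E \<and> (\<forall>X\<in>Ob. \<forall>x\<in>el A X. g X (a X x) = f X x)"
   using g(2) a by (intro exI[of _ h]) (simp add: mk_eq_iff)
 qed
next
 assume E: "inj_mod E"
 then have mE: "is_mod E" by (simp add: injective_module_def)
 show "injective ModC E"
  unfolding injective_def projective_def opposite_simps
 proof (intro conjI allI impI ballI)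
  show "E \<in> Obj ModC" using mE by simp
  fix e f assume e: "is_epi (opposite ModC) e" and f: "f \<in> homs ModC (Dom ModC e) E"
  have e: "is_mono ModC e" using e by (simp add: is_epi_def is_mono_def)
  then have "e \<in> Arr ModC" by (simp add: is_mono_def)
  then obtain A e' B where e': "e = mk C A e' B" "is_mod A" "is_mod B" "mhom C A e' B"
   by (rule Arr_Mod_cases)
  obtain f' where f': "f = mk C A f' E" "mhom C A f' E" using f e' by (auto elim: homs_Mod_cases)
  have "inj_on (e' X) (el A X)" if "X \<in> Ob" for X using e e' that by (simp add: is_mono_iff)
  then obtain g where g: "mhom C B g E" "!!X x. X \<in> Ob ==> x \<in> el A X ==> g X (e' X x) = f' X x"
   using injective_moduleD[OF E e'(2-4) _ f'(2)] by blast
  then show "\<exists>g\<in>homs ModC (Cod ModC e) E. Comp ModC g e = f"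
   using e' f' mE by (intro bexI[of _ "mk C B g E"]) (auto simp: mk_eq_iff)
 qed
qed

end

section \<open>The module category is a Grothendieck category\<close>

context linear_category
begin

subsection \<open>Direct sums\<close>

definition dsum :: "'i set => ('i => ('o, 'm, 'u) cmod) => ('o, 'm, 'i => 'u) cmod" where
 "dsum I X = \<lparr>Grp = (%Y. sum_group I (%i. Grp (X i) Y)), Act = (%f c. \<lambda>i\<in>I. Act (X i) f (c i))\<rparr>"

lemma mod_is_group [simp]: "is_mod M ==> X \<in> Ob ==> group (Grp M X)"
 by (simp add: mod_group comm_groupD)

lemma el_dsum:
 assumes "\<forall>i\<in>I. is_mod (X i)" "Y \<in> Ob"
 shows "el (dsum I X) Y = {c \<in> \<Pi>\<^sub>E i\<in>I. el (X i) Y. finite {i \<in> I. c i \<noteq> \<zero>[X i,Y]}}"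
 using assms by (simp add: dsum_def carrier_sum_group)

lemma dsum_ops [simp]:
 "\<zero>[dsum I X,Y] = (\<lambda>i\<in>I. \<zero>[X i,Y])"
 "c +[dsum I X,Y] d = (\<lambda>i\<in>I. c i +[X i,Y] d i)"
 "Act (dsum I X) f c = (\<lambda>i\<in>I. Act (X i) f (c i))"
 by (simp_all add: dsum_def)

lemma dsum_act_closed:
 assumes X: "\<forall>i\<in>I. is_mod (X i)" and f: "f \<in> Ar" and c: "c \<in> el (dsum I X) (cod f)"
 shows "Act (dsum I X) f c \<in> el (dsum I X) (dom f)"
proof -
 have c': "!!i. i \<in> I ==> c i \<in> el (X i) (cod f)" "finite {i \<in> I. c i \<noteq> \<zero>[X i,cod f]}"
  using c f by (auto simp: el_dsum[OF X])
 have "{i \<in> I. Act (X i) f (c i) \<noteq> \<zero>[X i,dom f]} \<subseteq> {i \<in> I. c i \<noteq> \<zero>[X i,cod f]}"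
  using f X by (auto simp: act_one)
 then have "finite {i \<in> I. Act (X i) f (c i) \<noteq> \<zero>[X i,dom f]}"
  using c'(2) finite_subset by blast
 then show ?thesis using f c' X by (auto simp: el_dsum[OF X] cong: conj_cong)
qed

lemma is_module_dsum:
 assumes X: "\<forall>i\<in>I. is_mod (X i)"
 shows "is_mod (dsum I X)"
 unfolding is_module_def
proof (intro conjI ballI impI)
 fix Y assume Y: "Y \<in> Ob"
 have "group (Grp (dsum I X) Y)" using X Y by (simp add: dsum_def)
 then show "comm_group (Grp (dsum I X) Y)"
 proof (rule group.group_comm_groupI)
  fix c d assume "c \<in> el (dsum I X) Y" "d \<in> el (dsum I X) Y"
  then have "c i \<in> el (X i) Y" "d i \<in> el (X i) Y" if "i \<in> I" for i using that Y by (auto simp: el_dsum[OF X])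
  moreover have "comm_monoid (Grp (X i) Y)" if "i \<in> I" for i using X that Y by (simp add: mod_group comm_groupD)
  ultimately show "c +[dsum I X,Y] d = d +[dsum I X,Y] c"
   by (auto simp: restrict_def fun_eq_iff comm_monoid.m_comm)
 qed
next
 fix f assume f: "f \<in> Ar"
 show "Act (dsum I X) f \<in> hom (Grp (dsum I X) (cod f)) (Grp (dsum I X) (dom f))"
 proof (rule homI)
  fix c d assume "c \<in> el (dsum I X) (cod f)" "d \<in> el (dsum I X) (cod f)"
  then have "c i \<in> el (X i) (cod f)" "d i \<in> el (X i) (cod f)" if "i \<in> I" for i
   using that f by (auto simp: el_dsum[OF X])
  then show "Act (dsum I X) f (c +[dsum I X,cod f] d) =
    Act (dsum I X) f c +[dsum I X,dom f] Act (dsum I X) f d"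
   using f X by (auto simp: restrict_def fun_eq_iff act_mult)
 qed (use dsum_act_closed[OF X f] in auto)
next
 fix Y c assume "Y \<in> Ob" "c \<in> el (dsum I X) Y"
 then have "c \<in> extensional I" "!!i. i \<in> I ==> c i \<in> el (X i) Y" "Y \<in> Ob" by (auto simp: el_dsum[OF X] PiE_def)
 then show "Act (dsum I X) (Id C Y) c = c"
  by (intro extensionalityI[of _ I]) (use X in \<open>auto simp: act_Id\<close>)
next
 fix f g c assume *: "f \<in> Ar" "g \<in> Ar" "cod f = dom g" "c \<in> el (dsum I X) (cod g)"
 then have "c i \<in> el (X i) (cod g)" if "i \<in> I" for i using that by (auto simp: el_dsum[OF X])
 then show "Act (dsum I X) (Comp C g f) c = Act (dsum I X) f (Act (dsum I X) g c)"
  using * X by (auto simp: restrict_def fun_eq_iff act_Comp)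
next
 fix f g c assume *: "f \<in> Ar" "g \<in> Ar" "dom f = dom g" "cod f = cod g" "c \<in> el (dsum I X) (cod f)"
 then have "c i \<in> el (X i) (cod f)" if "i \<in> I" for i using that by (auto simp: el_dsum[OF X])
 then show "Act (dsum I X) (Add C f g) c = Act (dsum I X) f c +[dsum I X,dom f] Act (dsum I X) g c"
  using * X by (auto simp: restrict_def fun_eq_iff act_Add)
qed

definition dsum_in :: "'i set => ('i => ('o, 'm, 'u) cmod) => 'i => 'o => 'u => 'i => 'u" where
 "dsum_in I X i Y x = (\<lambda>k\<in>I. if k = i then x else \<zero>[X k,Y])"

lemma mhom_dsum_in:
 assumes X: "\<forall>i\<in>I. is_mod (X i)" and i: "i \<in> I"
 shows "mhom C (X i) (dsum_in I X i) (dsum I X)"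
proof (rule mhomI)
 fix Y x assume "Y \<in> Ob" "x \<in> el (X i) Y"
 moreover have "{k \<in> I. dsum_in I X i Y x k \<noteq> \<zero>[X k,Y]} \<subseteq> {i}" by (auto simp: dsum_in_def)
 then have "finite {k \<in> I. dsum_in I X i Y x k \<noteq> \<zero>[X k,Y]}" using finite_subset by blast
 ultimately show "dsum_in I X i Y x \<in> el (dsum I X) Y"
  using X by (auto simp: el_dsum[OF X] dsum_in_def)
next
 fix Y x y assume *: "Y \<in> Ob" "x \<in> el (X i) Y" "y \<in> el (X i) Y"
 then have "group (Grp (X k) Y)" if "k \<in> I" for k using X that by simp
 then have "\<zero>[X k,Y] +[X k,Y] \<zero>[X k,Y] = \<zero>[X k,Y]" if "k \<in> I" for k
  using that group.is_monoid monoid.l_one monoid.one_closed by metis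
 then show "dsum_in I X i Y (x +[X i,Y] y) = dsum_in I X i Y x +[dsum I X,Y] dsum_in I X i Y y"
  by (auto simp: dsum_in_def restrict_def fun_eq_iff)
next
 fix f x assume "f \<in> Ar" "x \<in> el (X i) (cod f)"
 then show "dsum_in I X i (dom f) (Act (X i) f x) = Act (dsum I X) f (dsum_in I X i (cod f) x)"
  using X by (auto simp: dsum_in_def restrict_def fun_eq_iff act_one)
qed

text \<open>Induction on the support: one component is split off at a time.\<close>

lemma dsum_hom_eq:
 assumes X: "\<forall>i\<in>I. is_mod (X i)" and G: "comm_group G" and Y: "Y \<in> Ob"
  and v: "v \<in> hom (Grp (dsum I X) Y) G" and w: "w \<in> hom (Grp (dsum I X) Y) G"
  and eq: "!!i x. i \<in> I ==> x \<in> el (X i) Y ==> v (dsum_in I X i Y x) = w (dsum_in I X i Y x)"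
  and c: "c \<in> el (dsum I X) Y"
 shows "v c = w c"
proof -
 have D: "comm_group (Grp (dsum I X) Y)" using is_module_dsum[OF X] Y by (rule mod_group)
 have "v c = w c" if "finite S" "c \<in> el (dsum I X) Y" "{i \<in> I. c i \<noteq> \<zero>[X i,Y]} \<subseteq> S" for S c
  using that
 proof (induction S arbitrary: c rule: finite_induct)
  case empty
  then have "c \<in> extensional I" "!!i. i \<in> I ==> c i = \<zero>[X i,Y]"
   using Y by (auto simp: el_dsum[OF X] PiE_def)
  then have "c = (\<lambda>i\<in>I. \<zero>[X i,Y])" by (intro extensionalityI[of _ I]) auto
  then have "c = \<zero>[dsum I X,Y]" by simp
  then show ?case using hom_oneD[OF v D G] hom_oneD[OF w D G] by (simp only:)
 next
  case (insert j S)
  show ?case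
  proof (cases "j \<in> I")
   case False
   then have "{i \<in> I. c i \<noteq> \<zero>[X i,Y]} \<subseteq> S" using insert.prems(2) by auto
   then show ?thesis using insert.IH insert.prems(1) by blast
  next
   case True
   have c: "c \<in> extensional I" "!!i. i \<in> I ==> c i \<in> el (X i) Y" "finite {i \<in> I. c i \<noteq> \<zero>[X i,Y]}"
    using insert.prems(1) Y by (auto simp: el_dsum[OF X] PiE_def)
   let ?d = "c(j := \<zero>[X j,Y])"
   have s: "{i \<in> I. ?d i \<noteq> \<zero>[X i,Y]} \<subseteq> {i \<in> I. c i \<noteq> \<zero>[X i,Y]} - {j}" by auto
   then have "finite {i \<in> I. ?d i \<noteq> \<zero>[X i,Y]}" using c(3) finite_subset by blast
   then have d: "?d \<in> el (dsum I X) Y"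
    using c Y True X by (auto simp: el_dsum[OF X] PiE_def extensional_def)
   have vd: "v ?d = w ?d" using insert.IH[OF d] s insert.prems(2) by blast
   have e: "dsum_in I X j Y (c j) \<in> el (dsum I X) Y" using mhom_closed[OF mhom_dsum_in[OF X True] Y c(2)[OF True]] .
   have "c i = ?d i +[X i,Y] dsum_in I X j Y (c j) i" if "i \<in> I" for i
   proof -
    interpret comm_group "Grp (X i) Y" using X that Y by (simp add: mod_group)
    have "\<zero>[X i,Y] +[X i,Y] c i = c i" "c i +[X i,Y] \<zero>[X i,Y] = c i"
     using c(2)[OF that] by simp_all
    then show ?thesis using that by (auto simp: dsum_in_def)
   qed
   then have cd: "c = ?d +[dsum I X,Y] dsum_in I X j Y (c j)"
    by (intro extensionalityI[of _ I]) (use c(1) in \<open>auto simp del: fun_upd_apply\<close>)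
   show ?thesis
    by (subst (1 2) cd) (simp only: hom_mult[OF v d e] hom_mult[OF w d e] vd eq[OF True c(2)[OF True]])
  qed
 qed
 then show ?thesis using c Y by (auto simp: el_dsum[OF X])
qed

lemma dsum_hom_exists:
 assumes X: "\<forall>i\<in>I. is_mod (X i)" and N: "is_mod N"
  and f: "!!i. i \<in> I ==> mhom C (X i) (f i) N"
 obtains u where "mhom C (dsum I X) u N"
  "!!i Y x. i \<in> I ==> Y \<in> Ob ==> x \<in> el (X i) Y ==> u Y (dsum_in I X i Y x) = f i Y x"
proof -
 define u where "u Y c = gfinprod (Grp N Y) (%i. f i Y (c i)) I" for Y c
 have D: "is_mod (dsum I X)" using X by (rule is_module_dsum)
 have uhom: "u Y \<in> hom (Grp (dsum I X) Y) (Grp N Y)" if Y: "Y \<in> Ob" for Y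
 proof -
  interpret comm_group "Grp N Y" using N Y by (rule mod_group)
  show ?thesis unfolding u_def dsum_def
   using hom_group_sum[of I "%i. f i Y" "%i. Grp (X i) Y"] f X Y by (simp add: mhom_hom)
 qed
 have uin: "u Y (dsum_in I X i Y x) = f i Y x" if "i \<in> I" "Y \<in> Ob" "x \<in> el (X i) Y" for i Y x
 proof -
  interpret comm_group "Grp N Y" using N that(2) by (rule mod_group)
  have fx: "f i Y x \<in> el N Y" using mhom_closed[OF f[OF that(1)] that(2,3)] .
  have "u Y (dsum_in I X i Y x) = gfinprod (Grp N Y) (%k. if k = i then f i Y x else \<zero>[N,Y]) I"
   unfolding u_def using f X that fx mhom_one[OF f bspec[OF X] N that(2)]
   by (intro gfinprod_cong) (auto simp: dsum_in_def simp_implies_def)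
  also have "\<dots> = gfinprod (Grp N Y) (%k. f i Y x) {i}"
   using that fx by (intro gfinprod_mono_neutral_cong_right) auto
  also have "\<dots> = f i Y x" using fx by (subst gfinprod_eq_finprod) (auto simp: finprod_singleton)
  finally show ?thesis .
 qed
 have "mhom C (dsum I X) u N"
  unfolding mhom_def
 proof (intro conjI ballI uhom)
  fix h c assume h: "h \<in> Ar" and c: "c \<in> el (dsum I X) (cod h)"
  have hh: "Act (dsum I X) h \<in> hom (Grp (dsum I X) (cod h)) (Grp (dsum I X) (dom h))"
   using D h by (rule act_hom)
  have "(u (dom h) \<circ> Act (dsum I X) h) c = (Act N h \<circ> u (cod h)) c"
  proof (rule dsum_hom_eq[OF X mod_group[OF N Dom_Obj[OF h]] Cod_Obj[OF h] _ _ _ c])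
   show "u (dom h) \<circ> Act (dsum I X) h \<in> hom (Grp (dsum I X) (cod h)) (Grp N (dom h))"
    by (rule Group.hom_compose[OF hh uhom[OF Dom_Obj[OF h]]])
   show "Act N h \<circ> u (cod h) \<in> hom (Grp (dsum I X) (cod h)) (Grp N (dom h))"
    by (rule Group.hom_compose[OF uhom[OF Cod_Obj[OF h]] act_hom[OF N h]])
   fix i x assume i: "i \<in> I" and x: "x \<in> el (X i) (cod h)"
   have "Act (dsum I X) h (dsum_in I X i (cod h) x) = dsum_in I X i (dom h) (Act (X i) h x)"
    using mhom_nat[OF mhom_dsum_in[OF X i] h x] by (simp only:)
   then show "(u (dom h) \<circ> Act (dsum I X) h) (dsum_in I X i (cod h) x) =
     (Act N h \<circ> u (cod h)) (dsum_in I X i (cod h) x)"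
    using uin[OF i] h x bspec[OF X i] mhom_nat[OF f[OF i] h x] by (simp del: dsum_ops)
  qed
  then show "u (dom h) (Act (dsum I X) h c) = Act N h (u (cod h) c)" by (simp only: comp_apply)
 qed
 then show thesis using that uin by blast
qed

lemma dsum_lepoll:
 fixes X :: "'i => ('o, 'm, 'u) cmod"
 assumes X: "\<forall>i\<in>I. is_mod (X i)" and Y: "Y \<in> Ob"
  and inf: "infinite (UNIV :: 'u set)" and I: "I \<lesssim> (UNIV :: 'u set)"
 shows "el (dsum I X) Y \<lesssim> (UNIV :: 'u set)"
proof -
 let ?s = "%c. {i \<in> I. c i \<noteq> \<zero>[X i,Y]}"
 let ?g = "%c. (%i. (i, c i)) ` ?s c"
 have "inj_on ?g (el (dsum I X) Y)"
 proof (rule inj_onI)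
  fix c d assume cd: "c \<in> el (dsum I X) Y" "d \<in> el (dsum I X) Y" and eq: "?g c = ?g d"
  have "?s c = ?s d" "!!i. i \<in> ?s c ==> c i = d i" using graph_eqD[OF eq] by blast+
  then have "c i = d i" if "i \<in> I" for i
  proof (cases "i \<in> ?s c")
   case False
   then have "i \<notin> ?s d" using \<open>?s c = ?s d\<close> by blast
   then show ?thesis using False that by simp
  qed
  then show "c = d" using cd Y by (auto simp: el_dsum[OF X] intro: PiE_ext)
 qed
 moreover have "?g ` el (dsum I X) Y \<subseteq> Fpow (I \<times> (UNIV :: 'u set))"
  using Y by (auto simp: el_dsum[OF X] Fpow_def)
 ultimately have "el (dsum I X) Y \<lesssim> Fpow (I \<times> (UNIV :: 'u set))" unfolding lepoll_def by blast
 also have "\<dots> \<lesssim> (UNIV :: 'u set)"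
  using inf I by (intro lepoll_Fpow_infinite lepoll_Times_infinite) auto
 finally show ?thesis .
qed

lemma coproduct_exists:
 fixes X :: "'i => ('o, 'm, 'u) cmod"
 assumes X: "\<forall>i\<in>I. is_mod (X i)"
  and inf: "infinite (UNIV :: 'u set)" and I: "I \<lesssim> (UNIV :: 'u set)"
 shows "\<exists>S \<iota>. is_coproduct ModC I X S \<iota>"
proof -
 have D: "is_mod (dsum I X)" using X by (rule is_module_dsum)
 obtain S :: "('o, 'm, 'u) cmod" and r s where S: "is_mod S" "mhom C (dsum I X) r S" "mhom C S s (dsum I X)"
  "!!Y x. Y \<in> Ob ==> x \<in> el (dsum I X) Y ==> s Y (r Y x) = x"
  "!!Y x. Y \<in> Ob ==> x \<in> el S Y ==> r Y (s Y x) = x"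
  using transport_module[OF D dsum_lepoll[OF X _ inf I]] by blast
 let ?\<iota> = "%i. mk C (X i) (%Y x. r Y (dsum_in I X i Y x)) S"
 have \<iota>: "mhom C (X i) (%Y x. r Y (dsum_in I X i Y x)) S" if "i \<in> I" for i
  by (rule mhom_comp[OF mhom_dsum_in[OF X that] S(2)])
 have "is_coproduct ModC I X S ?\<iota>"
  unfolding is_coproduct_def
 proof (intro conjI ballI allI impI)
  show "S \<in> Obj ModC" using S by simp
  show "?\<iota> i \<in> homs ModC (X i) S" if "i \<in> I" for i using \<iota>[OF that] bspec[OF X that] S(1) by simp
  fix N :: "('o, 'm, 'u) cmod" and f assume "N \<in> Obj ModC" and f: "\<forall>i\<in>I. f i \<in> homs ModC (X i) N"
  then have N: "is_mod N" by simp
  have "\<forall>i\<in>I. \<exists>g. f i = mk C (X i) g N \<and> mhom C (X i) g N" using f by (meson homs_Mod_cases)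
  then obtain g where g: "!!i. i \<in> I ==> f i = mk C (X i) (g i) N" "!!i. i \<in> I ==> mhom C (X i) (g i) N" by metis
  obtain u where u: "mhom C (dsum I X) u N"
   "!!i Y x. i \<in> I ==> Y \<in> Ob ==> x \<in> el (X i) Y ==> u Y (dsum_in I X i Y x) = g i Y x"
   using dsum_hom_exists[of I X N g] X N g(2) by blast
  have din: "dsum_in I X i Y x \<in> el (dsum I X) Y" if "i \<in> I" "Y \<in> Ob" "x \<in> el (X i) Y" for i Y x
   using mhom_closed[OF mhom_dsum_in[OF X that(1)] that(2,3)] .
  have us: "mhom C S (%Y x. u Y (s Y x)) N" using mhom_comp[OF S(3) u(1)] .
  show "\<exists>!v. v \<in> homs ModC S N \<and> (\<forall>i\<in>I. Comp ModC v (?\<iota> i) = f i)"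
  proof (rule ex1I)
   show "mk C S (%Y x. u Y (s Y x)) N \<in> homs ModC S N \<and>
     (\<forall>i\<in>I. Comp ModC (mk C S (%Y x. u Y (s Y x)) N) (?\<iota> i) = f i)"
    using us S(1) N \<iota> g(1) u(2) S(4) din by (simp add: mk_eq_iff)
   fix v assume v: "v \<in> homs ModC S N \<and> (\<forall>i\<in>I. Comp ModC v (?\<iota> i) = f i)"
   then obtain w where w: "v = mk C S w N" "mhom C S w N" by (auto elim: homs_Mod_cases)
   have "w Y x = u Y (s Y x)" if Y: "Y \<in> Ob" and x: "x \<in> el S Y" for Y x
   proof -
    have sx: "s Y x \<in> el (dsum I X) Y" using mhom_closed[OF S(3) Y x] .
    have "w Y (r Y (s Y x)) = u Y (s Y x)"
    proof (rule dsum_hom_eq[OF X mod_group[OF N Y] Y _ mhom_hom[OF u(1) Y] _ sx])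
     show "(%c. w Y (r Y c)) \<in> hom (Grp (dsum I X) Y) (Grp N Y)"
      using mhom_hom[OF mhom_comp[OF S(2) w(2)] Y] .
     fix i y assume i: "i \<in> I" and y: "y \<in> el (X i) Y"
     have "Comp ModC v (?\<iota> i) = f i" using v i by blast
     then show "w Y (r Y (dsum_in I X i Y y)) = u Y (dsum_in I X i Y y)"
      using w \<iota>[OF i] g(1)[OF i] u(2)[OF i Y y] Y y by (simp add: mk_eq_iff)
    qed
    then show ?thesis using S(5)[OF Y x] by simp
   qed
   then show "v = mk C S (%Y x. u Y (s Y x)) N" using w by (simp add: mk_eq_iff)
  qed
 qed
 then show ?thesis by blast
qed

lemma binary_product_exists:
 fixes X :: "bool => ('o, 'm, 'u) cmod"
 assumes X0: "!!i. is_mod (X i)" and inf: "infinite (UNIV :: 'u set)"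
 shows "\<exists>S \<pi>. is_product ModC UNIV X S \<pi>"
proof -
 let ?D = "dsum UNIV X"
 have X: "\<forall>i\<in>UNIV. is_mod (X i)" using X0 by simp
 have D: "is_mod ?D" using X by (rule is_module_dsum)
 have elD: "c \<in> el ?D Y \<longleftrightarrow> (\<forall>i. c i \<in> el (X i) Y)" if "Y \<in> Ob" for c Y
  using that by (auto simp: el_dsum[OF X])
 have "(UNIV :: bool set) \<lesssim> (UNIV :: 'u set)" using inf by (intro countable_lepoll_infinite) auto
 then obtain S :: "('o, 'm, 'u) cmod" and r s where S: "is_mod S" "mhom C ?D r S" "mhom C S s ?D"
  "!!Y x. Y \<in> Ob ==> x \<in> el ?D Y ==> s Y (r Y x) = x"
  "!!Y x. Y \<in> Ob ==> x \<in> el S Y ==> r Y (s Y x) = x"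
  using transport_module[OF D dsum_lepoll[OF X _ inf]] by blast
 let ?\<pi> = "%i. mk C S (%Y x. s Y x i) (X i)"
 have p: "mhom C ?D (%Y c. c i) (X i)" for i
  by (rule mhomI) (auto simp: elD)
 have \<pi>: "mhom C S (%Y x. s Y x i) (X i)" for i
  using mhom_comp[OF S(3) p] .
 have "is_product ModC UNIV X S ?\<pi>"
  unfolding is_product_def is_coproduct_def opposite_simps
 proof (intro conjI ballI allI impI)
  show "S \<in> Obj ModC" using S by simp
  show "?\<pi> i \<in> homs ModC S (X i)" for i using \<pi> X S(1) by simp
  fix N :: "('o, 'm, 'u) cmod" and f assume "N \<in> Obj ModC" and f: "\<forall>i\<in>UNIV. f i \<in> homs ModC N (X i)"
  then have N: "is_mod N" by simp
  have "\<forall>i. \<exists>g. f i = mk C N g (X i) \<and> mhom C N g (X i)" using f by (metis UNIV_I homs_Mod_cases)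
  then obtain g where g: "!!i. f i = mk C N (g i) (X i)" "!!i. mhom C N (g i) (X i)" by metis
  have u: "mhom C N (%Y x i. g i Y x) ?D"
   by (rule mhomI) (auto simp: elD mhom_closed[OF g(2)] mhom_mult[OF g(2)] mhom_nat[OF g(2)])
  have ru: "mhom C N (%Y x. r Y (%i. g i Y x)) S" using mhom_comp[OF u S(2)] .
  have uel: "(%i. g i Y x) \<in> el ?D Y" if "Y \<in> Ob" "x \<in> el N Y" for Y x using mhom_closed[OF u that] .
  show "\<exists>!v. v \<in> homs ModC N S \<and> (\<forall>i\<in>UNIV. Comp ModC (?\<pi> i) v = f i)"
  proof (rule ex1I)
   show "mk C N (%Y x. r Y (%i. g i Y x)) S \<in> homs ModC N S \<and>
     (\<forall>i\<in>UNIV. Comp ModC (?\<pi> i) (mk C N (%Y x. r Y (%i. g i Y x)) S) = f i)"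
    using ru S(1,4) N g(1) uel by (simp add: mk_eq_iff)
   fix v assume v: "v \<in> homs ModC N S \<and> (\<forall>i\<in>UNIV. Comp ModC (?\<pi> i) v = f i)"
   then obtain w where w: "v = mk C N w S" "mhom C N w S" by (auto elim: homs_Mod_cases)
   have "w Y x = r Y (%i. g i Y x)" if Y: "Y \<in> Ob" and x: "x \<in> el N Y" for Y x
   proof -
    have "s Y (w Y x) i = g i Y x" for i
    proof -
     have "Comp ModC (?\<pi> i) v = f i" using v by blast
     then show ?thesis using w g(1)[of i] Y x by (simp add: mk_eq_iff)
    qed
    then have "s Y (w Y x) = (%i. g i Y x)" by auto
    then show ?thesis using S(5)[OF Y mhom_closed[OF w(2) Y x]] by simp
   qed
   then show "v = mk C N (%Y x. r Y (%i. g i Y x)) S" using w by (simp add: mk_eq_iff)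
  qed
 qed
 then show ?thesis by blast
qed

theorem abelian_category_Mod:
 assumes inf: "infinite (UNIV :: 'u set)"
 shows "abelian_category (Modcat TYPE('u) C)" (is "abelian_category ?A")
 unfolding abelian_category_def
proof (intro conjI ballI allI impI category_Mod)
 show "\<exists>Z. zero_object ?A Z" using zero_object_triv by blast
next
 fix M N :: "('o, 'm, 'u) cmod" assume MN: "M \<in> Obj ?A" "N \<in> Obj ?A"
 have "(UNIV :: bool set) \<lesssim> (UNIV :: 'u set)" using inf by (intro countable_lepoll_infinite) auto
 then show "\<exists>S \<iota>. is_coproduct ?A (UNIV :: bool set) (%b. if b then M else N) S \<iota>"
  using MN inf by (intro coproduct_exists) auto
 show "\<exists>S \<pi>. is_product ?A (UNIV :: bool set) (%b. if b then M else N) S \<pi>"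
  using MN inf by (intro binary_product_exists) auto
next
 fix f assume "f \<in> Arr ?A"
 then obtain M \<eta> N where f: "f = mk C M \<eta> N" "is_mod M" "is_mod N" "mhom C M \<eta> N"
  by (rule Arr_Mod_cases)
 let ?S = "%X. {x \<in> el M X. \<eta> X x = \<zero>[N,X]}"
 have S: "submodule C M ?S" using submodule_kernel[OF f(2-4)] .
 have "is_kernel ?A (mk C (restrict_module M ?S) (%X x. x) M) (mk C M \<eta> N)"
  using is_kernel_iff[OF is_module_restrict[OF f(2) S] f(2,3) mhom_inclusion[OF S] f(4)] by (auto simp: inj_on_def)
 then show "\<exists>k. is_kernel ?A k f" using f(1) by blast
 obtain Q :: "('o, 'm, 'u) cmod" and q where Q: "is_mod Q" "mhom C N q Q"
  "!!X. X \<in> Ob ==> q X ` el N X = el Q X"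
  "!!X x. X \<in> Ob ==> x \<in> el N X ==> q X x = \<zero>[Q,X] \<longleftrightarrow> x \<in> \<eta> X ` el M X"
  using quotient_module_exists[OF f(3) submodule_image[OF f(2-4)]] by blast
 then show "\<exists>c. is_cokernel ?A c f"
  using is_cokernelI[OF f(2,3) Q(1) f(4) Q(2-4)] f(1) by blast
next
 fix f assume f0: "is_mono ?A f"
 then have "f \<in> Arr ?A" by (simp add: is_mono_def)
 then obtain M \<eta> N where f: "f = mk C M \<eta> N" "is_mod M" "is_mod N" "mhom C M \<eta> N"
  by (rule Arr_Mod_cases)
 have inj: "inj_on (\<eta> X) (el M X)" if "X \<in> Ob" for X using f0 f that by (simp add: is_mono_iff)
 obtain Q :: "('o, 'm, 'u) cmod" and q where Q: "is_mod Q" "mhom C N q Q"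
  "!!X. X \<in> Ob ==> q X ` el N X = el Q X"
  "!!X x. X \<in> Ob ==> x \<in> el N X ==> q X x = \<zero>[Q,X] \<longleftrightarrow> x \<in> \<eta> X ` el M X"
  using quotient_module_exists[OF f(3) submodule_image[OF f(2-4)]] by blast
 then have "is_kernel ?A f (mk C N q Q)"
  using is_kernel_iff[OF f(2,3) Q(1) f(4) Q(2)] f(1) inj by simp
 then show "\<exists>g. is_kernel ?A f g" by blast
next
 fix f assume f0: "is_epi ?A f"
 then have "f \<in> Arr ?A" by (simp add: is_epi_def is_mono_def)
 then obtain M \<eta> N where f: "f = mk C M \<eta> N" "is_mod M" "is_mod N" "mhom C M \<eta> N"
  by (rule Arr_Mod_cases)
 have surj: "\<eta> X ` el M X = el N X" if "X \<in> Ob" for X using f0 f that by (simp add: is_epi_iff)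
 let ?S = "%X. {x \<in> el M X. \<eta> X x = \<zero>[N,X]}"
 have S: "submodule C M ?S" using submodule_kernel[OF f(2-4)] .
 have "is_cokernel ?A f (mk C (restrict_module M ?S) (%X x. x) M)"
  unfolding f(1) by (rule is_cokernelI[OF is_module_restrict[OF f(2) S] f(2,3) mhom_inclusion[OF S] f(4) surj]) auto
 then show "\<exists>g. is_cokernel ?A f g" by blast
qed

lemma has_small_coproducts_Mod:
 assumes "infinite (UNIV :: 'u set)"
 shows "has_small_coproducts TYPE('u) (Modcat TYPE('u) C)"
 unfolding has_small_coproducts_def
proof (intro allI impI)
 fix I :: "'u set" and X :: "'u => ('o, 'm, 'u) cmod"
 assume "\<forall>i\<in>I. X i \<in> Obj (Modcat TYPE('u) C)"
 then show "\<exists>S \<iota>. is_coproduct (Modcat TYPE('u) C) I X S \<iota>"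
  using assms by (intro coproduct_exists) (auto simp: subset_imp_lepoll)
qed

end

subsection \<open>Filtered colimits\<close>

text \<open>A filtered diagram of modules, through the maps of elements that underlie its arrows.\<close>

locale filtered_system = linear_category C for C :: "('o, 'm) lin_cat" +
 fixes J :: "('i, 'k) cat" and M :: "'i => ('o, 'm, 'u) cmod" and \<phi> :: "'k => 'o => 'u => 'u"
 assumes filtered: "filtered_category J"
  and mods: "i \<in> Obj J ==> is_module C (M i)"
  and trans: "u \<in> Arr J ==> mhom C (M (Dom J u)) (\<phi> u) (M (Cod J u))"
  and trans_Id: "[|i \<in> Obj J; X \<in> Obj C; x \<in> el (M i) X|] ==> \<phi> (Id J i) X x = x"
  and trans_Comp: "[|u \<in> Arr J; v \<in> Arr J; Cod J u = Dom J v; X \<in> Obj C; x \<in> el (M (Dom J u)) X|]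
   ==> \<phi> (Comp J v u) X x = \<phi> v X (\<phi> u X x)"
begin

lemma J_simps [simp]:
 "u \<in> Arr J ==> Dom J u \<in> Obj J" "u \<in> Arr J ==> Cod J u \<in> Obj J"
 "i \<in> Obj J ==> Id J i \<in> Arr J" "i \<in> Obj J ==> Dom J (Id J i) = i" "i \<in> Obj J ==> Cod J (Id J i) = i"
 "[|u \<in> Arr J; v \<in> Arr J; Cod J u = Dom J v|] ==> Comp J v u \<in> Arr J"
 "[|u \<in> Arr J; v \<in> Arr J; Cod J u = Dom J v|] ==> Dom J (Comp J v u) = Dom J u"
 "[|u \<in> Arr J; v \<in> Arr J; Cod J u = Dom J v|] ==> Cod J (Comp J v u) = Cod J v"
 using filtered by (auto simp: filtered_category_def category_def homs_def)

lemma J_assoc: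
 "[|u \<in> Arr J; v \<in> Arr J; w \<in> Arr J; Cod J u = Dom J v; Cod J v = Dom J w|]
  ==> Comp J w (Comp J v u) = Comp J (Comp J w v) u"
 using filtered by (auto simp: filtered_category_def category_def)

lemma upper_bound:
 assumes "i \<in> Obj J" "j \<in> Obj J"
 obtains u v where "u \<in> Arr J" "v \<in> Arr J" "Dom J u = i" "Dom J v = j" "Cod J u = Cod J v"
proof -
 obtain k where "homs J i k \<noteq> {}" "homs J j k \<noteq> {}"
  using filtered assms unfolding filtered_category_def by meson
 then show thesis using that by (auto simp: homs_def)
qed

lemma equalize:
 assumes "u \<in> Arr J" "v \<in> Arr J" "Dom J u = Dom J v" "Cod J u = Cod J v"
 obtains w where "w \<in> Arr J" "Dom J w = Cod J u" "Comp J w u = Comp J w v"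
 using filtered assms unfolding filtered_category_def by meson

lemma complete_span:
 assumes "u \<in> Arr J" "v \<in> Arr J" "Dom J u = Dom J v"
 obtains s t where "s \<in> Arr J" "t \<in> Arr J" "Dom J s = Cod J u" "Dom J t = Cod J v" "Cod J s = Cod J t"
  "Comp J s u = Comp J t v"
proof -
 obtain s t where st: "s \<in> Arr J" "t \<in> Arr J" "Dom J s = Cod J u" "Dom J t = Cod J v" "Cod J s = Cod J t"
  using upper_bound[of "Cod J u" "Cod J v"] assms by auto
 obtain w where w: "w \<in> Arr J" "Dom J w = Cod J (Comp J s u)" "Comp J w (Comp J s u) = Comp J w (Comp J t v)"
  using equalize[of "Comp J s u" "Comp J t v"] assms st by auto
 show thesis
  by (rule that[of "Comp J w s" "Comp J w t"]) (use assms st w in \<open>auto simp: J_assoc\<close>)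
qed

lemma trans_closed: "[|u \<in> Arr J; X \<in> Ob; x \<in> el (M (Dom J u)) X|] ==> \<phi> u X x \<in> el (M (Cod J u)) X"
 using mhom_closed[OF trans] by blast

definition germs :: "'o => ('i \<times> 'u) set" where
 "germs X = {(i, x). i \<in> Obj J \<and> x \<in> el (M i) X}"

text \<open>The colimit at \<open>X\<close> consists of germs: pairs \<open>(i, x)\<close> with \<open>x\<close> in
 \<open>M i\<close> at \<open>X\<close>, identified if they become equal further along the diagram.\<close>

definition germ_eq :: "'o => 'i \<times> 'u => 'i \<times> 'u => bool" where
 "germ_eq X a b \<longleftrightarrow> (\<exists>u v. u \<in> Arr J \<and> v \<in> Arr J \<and> Dom J u = fst a \<and> Dom J v = fst b \<and> Cod J u = Cod J v \<and>
   \<phi> u X (snd a) = \<phi> v X (snd b))"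

definition germ :: "'o => 'i => 'u => ('i \<times> 'u) set" where
 "germ X i x = {b \<in> germs X. germ_eq X (i, x) b}"

lemma germ_eq_trans:
 assumes X: "X \<in> Ob" and abc: "a \<in> germs X" "b \<in> germs X" "c \<in> germs X"
  and ab: "germ_eq X a b" and bc: "germ_eq X b c"
 shows "germ_eq X a c"
proof -
 obtain u v where uv: "u \<in> Arr J" "v \<in> Arr J" "Dom J u = fst a" "Dom J v = fst b" "Cod J u = Cod J v"
  "\<phi> u X (snd a) = \<phi> v X (snd b)" using ab unfolding germ_eq_def by blast
 obtain v' w where vw: "v' \<in> Arr J" "w \<in> Arr J" "Dom J v' = fst b" "Dom J w = fst c" "Cod J v' = Cod J w"
  "\<phi> v' X (snd b) = \<phi> w X (snd c)" using bc unfolding germ_eq_def by blast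
 have el: "snd a \<in> el (M (fst a)) X" "snd b \<in> el (M (fst b)) X" "snd c \<in> el (M (fst c)) X"
  using abc by (auto simp: germs_def)
 obtain s t where st: "s \<in> Arr J" "t \<in> Arr J" "Dom J s = Cod J v" "Dom J t = Cod J v'" "Cod J s = Cod J t"
  "Comp J s v = Comp J t v'" using complete_span[OF uv(2) vw(1)] uv vw by auto
 have "\<phi> (Comp J s u) X (snd a) = \<phi> (Comp J s v) X (snd b)"
  using trans_Comp[OF uv(1) st(1) _ X] trans_Comp[OF uv(2) st(1) _ X] uv st el by simp
 also have "\<dots> = \<phi> (Comp J t w) X (snd c)"
  using trans_Comp[OF vw(1) st(2) _ X] trans_Comp[OF vw(2) st(2) _ X] vw st el by simp
 finally show ?thesis unfolding germ_eq_def
  using uv vw st by (intro exI[of _ "Comp J s u"] exI[of _ "Comp J t w"]) simp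
qed

lemma germ_eq_sym: "germ_eq X a b ==> germ_eq X b a"
 unfolding germ_eq_def by metis

lemma germ_eq_refl: "X \<in> Ob ==> i \<in> Obj J ==> germ_eq X (i, x) (i, x)"
 unfolding germ_eq_def by (intro exI[of _ "Id J i"]) simp

lemma germ_eq_iff:
 assumes X: "X \<in> Ob" and "i \<in> Obj J" "x \<in> el (M i) X" "j \<in> Obj J" "y \<in> el (M j) X"
 shows "germ X i x = germ X j y \<longleftrightarrow> germ_eq X (i, x) (j, y)"
proof
 have g: "(i, x) \<in> germs X" "(j, y) \<in> germs X" using assms by (auto simp: germs_def)
 show "germ X i x = germ X j y" if "germ_eq X (i, x) (j, y)"
  unfolding germ_def using that germ_eq_trans[OF X g(1,2)] germ_eq_trans[OF X g(2,1)] germ_eq_sym by blast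
 assume "germ X i x = germ X j y"
 moreover have "(j, y) \<in> germ X j y" using g germ_eq_refl[OF X assms(4)] by (simp add: germ_def)
 ultimately show "germ_eq X (i, x) (j, y)" by (auto simp: germ_def)
qed

lemma germ_push:
 assumes X: "X \<in> Ob" and u: "u \<in> Arr J" and x: "x \<in> el (M (Dom J u)) X"
 shows "germ X (Cod J u) (\<phi> u X x) = germ X (Dom J u) x"
proof -
 have "germ_eq X (Cod J u, \<phi> u X x) (Dom J u, x)"
  unfolding germ_eq_def using u trans_Id[OF _ X trans_closed[OF u X x]]
  by (intro exI[of _ "Id J (Cod J u)"] exI[of _ u]) simp
 then show ?thesis using germ_eq_iff[OF X] u x trans_closed[OF u X x] by simp
qed

lemma germ_common:
 assumes X: "X \<in> Ob" and "i \<in> Obj J" "x \<in> el (M i) X" "j \<in> Obj J" "y \<in> el (M j) X"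
 obtains k x' y' where "k \<in> Obj J" "x' \<in> el (M k) X" "y' \<in> el (M k) X" "germ X i x = germ X k x'" "germ X j y = germ X k y'"
proof -
 obtain u v where uv: "u \<in> Arr J" "v \<in> Arr J" "Dom J u = i" "Dom J v = j" "Cod J u = Cod J v"
  using upper_bound[OF assms(2,4)] by blast
 show thesis
  by (rule that[of "Cod J u" "\<phi> u X x" "\<phi> v X y"])
   (use uv assms germ_push[OF X uv(1)] germ_push[OF X uv(2)] trans_closed[OF uv(1) X] trans_closed[OF uv(2) X] in auto)
qed

lemma germ_mult_cong:
 assumes X: "X \<in> Ob" and k: "k \<in> Obj J" "x \<in> el (M k) X" "y \<in> el (M k) X"
  and l: "l \<in> Obj J" "x' \<in> el (M l) X" "y' \<in> el (M l) X"
  and eq: "germ X k x = germ X l x'" "germ X k y = germ X l y'"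
 shows "germ X k (x +[M k,X] y) = germ X l (x' +[M l,X] y')"
proof -
 obtain u1 v1 where 1: "u1 \<in> Arr J" "v1 \<in> Arr J" "Dom J u1 = k" "Dom J v1 = l" "Cod J u1 = Cod J v1" "\<phi> u1 X x = \<phi> v1 X x'"
  using eq(1) germ_eq_iff[OF X k(1,2) l(1,2)] unfolding germ_eq_def by auto
 obtain u2 v2 where 2: "u2 \<in> Arr J" "v2 \<in> Arr J" "Dom J u2 = k" "Dom J v2 = l" "Cod J u2 = Cod J v2" "\<phi> u2 X y = \<phi> v2 X y'"
  using eq(2) germ_eq_iff[OF X k(1,3) l(1,3)] unfolding germ_eq_def by auto
 obtain s t where st: "s \<in> Arr J" "t \<in> Arr J" "Dom J s = Cod J u1" "Dom J t = Cod J u2" "Cod J s = Cod J t"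
  "Comp J s u1 = Comp J t u2" using complete_span[OF 1(1) 2(1)] 1 2 by auto
 obtain w where w: "w \<in> Arr J" "Dom J w = Cod J (Comp J s v1)" "Comp J w (Comp J s v1) = Comp J w (Comp J t v2)"
  using equalize[of "Comp J s v1" "Comp J t v2"] 1 2 st by auto
 let ?u = "Comp J w (Comp J s u1)" and ?v = "Comp J w (Comp J s v1)"
 have uv: "?u \<in> Arr J" "?v \<in> Arr J" "Dom J ?u = k" "Dom J ?v = l" "Cod J ?u = Cod J ?v" using 1 2 st w by auto
 have e1: "\<phi> ?u X x = \<phi> w X (\<phi> s X (\<phi> u1 X x))" "\<phi> ?v X x' = \<phi> w X (\<phi> s X (\<phi> v1 X x'))"
  using 1(1-5) st(1-5) w(1,2) k l X by (auto simp: trans_Comp)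
 have "\<phi> ?u X y = \<phi> w X (\<phi> t X (\<phi> u2 X y))" "\<phi> ?v X y' = \<phi> w X (\<phi> t X (\<phi> v2 X y'))"
  unfolding w(3) unfolding st(6) using 1(1-5) 2(1-5) st(1-5) w(1,2) k l X by (auto simp: trans_Comp)
 then have "\<phi> ?u X (x +[M k,X] y) = \<phi> ?v X (x' +[M l,X] y')"
  using mhom_mult[OF trans[OF uv(1)] X] mhom_mult[OF trans[OF uv(2)] X] e1 uv k l 1(6) 2(6) by simp
 then have "germ_eq X (k, x +[M k,X] y) (l, x' +[M l,X] y')"
  unfolding germ_eq_def using uv by (intro exI[of _ ?u] exI[of _ ?v]) simp
 then show ?thesis using germ_eq_iff[OF X k(1) _ l(1)] k l mods X by simp
qed

lemma germ_act_cong: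
 assumes f: "f \<in> Ar" and k: "k \<in> Obj J" "x \<in> el (M k) (cod f)" and l: "l \<in> Obj J" "y \<in> el (M l) (cod f)"
  and eq: "germ (cod f) k x = germ (cod f) l y"
 shows "germ (dom f) k (Act (M k) f x) = germ (dom f) l (Act (M l) f y)"
proof -
 obtain u v where uv: "u \<in> Arr J" "v \<in> Arr J" "Dom J u = k" "Dom J v = l" "Cod J u = Cod J v" "\<phi> u (cod f) x = \<phi> v (cod f) y"
  using eq germ_eq_iff[OF Cod_Obj[OF f] k l] unfolding germ_eq_def by auto
 have "\<phi> u (dom f) (Act (M k) f x) = \<phi> v (dom f) (Act (M l) f y)"
  using mhom_nat[OF trans[OF uv(1)] f] mhom_nat[OF trans[OF uv(2)] f] uv k l by simp
 then have "germ_eq (dom f) (k, Act (M k) f x) (l, Act (M l) f y)"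
  unfolding germ_eq_def using uv by (intro exI[of _ u] exI[of _ v]) simp
 then show ?thesis using germ_eq_iff[OF Dom_Obj[OF f] k(1) _ l(1)] k l mods f by simp
qed

text \<open>Operations are carried out on representatives at a common index. \<open>SOME\<close> selects the germ of
 the result, which does not depend on the representatives.\<close>

definition germ_module :: "('o, 'm, ('i \<times> 'u) set) cmod" where
 "germ_module = \<lparr>Grp = (%X. \<lparr>carrier = (%(i, x). germ X i x) ` germs X,
    monoid.mult = (%c d. SOME e. \<exists>k x y. k \<in> Obj J \<and> x \<in> el (M k) X \<and> y \<in> el (M k) X \<and>
     c = germ X k x \<and> d = germ X k y \<and> e = germ X k (x +[M k,X] y)),
    one = germ X (SOME i. i \<in> Obj J) \<zero>[M (SOME i. i \<in> Obj J),X]\<rparr>),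
   Act = (%f c. SOME e. \<exists>k x. k \<in> Obj J \<and> x \<in> el (M k) (cod f) \<and> c = germ (cod f) k x \<and>
     e = germ (dom f) k (Act (M k) f x))\<rparr>"

lemma el_germ_module: "el germ_module X = {germ X i x | i x. i \<in> Obj J \<and> x \<in> el (M i) X}"
 by (auto simp: germ_module_def germs_def)

lemma germ_in [simp]: "i \<in> Obj J ==> x \<in> el (M i) X ==> germ X i x \<in> el germ_module X"
 by (auto simp: el_germ_module)

lemma germ_mult:
 assumes X: "X \<in> Ob" and k: "k \<in> Obj J" "x \<in> el (M k) X" "y \<in> el (M k) X"
 shows "germ X k x +[germ_module,X] germ X k y = germ X k (x +[M k,X] y)"
proof -
 have "germ X k x +[germ_module,X] germ X k y = (SOME e. \<exists>k' x' y'. k' \<in> Obj J \<and> x' \<in> el (M k') X \<and>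
   y' \<in> el (M k') X \<and> germ X k x = germ X k' x' \<and> germ X k y = germ X k' y' \<and>
   e = germ X k' (x' +[M k',X] y'))"
  by (simp add: germ_module_def)
 also have "\<dots> = germ X k (x +[M k,X] y)"
 proof (rule some_equality)
  show "\<exists>k' x' y'. k' \<in> Obj J \<and> x' \<in> el (M k') X \<and> y' \<in> el (M k') X \<and> germ X k x = germ X k' x' \<and>
    germ X k y = germ X k' y' \<and> germ X k (x +[M k,X] y) = germ X k' (x' +[M k',X] y')"
   using k by blast
  fix e assume "\<exists>k' x' y'. k' \<in> Obj J \<and> x' \<in> el (M k') X \<and> y' \<in> el (M k') X \<and> germ X k x = germ X k' x' \<and>
    germ X k y = germ X k' y' \<and> e = germ X k' (x' +[M k',X] y')"
  then show "e = germ X k (x +[M k,X] y)" using germ_mult_cong[OF X k] by metis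
 qed
 finally show ?thesis .
qed

lemma germ_act:
 assumes f: "f \<in> Ar" and k: "k \<in> Obj J" "x \<in> el (M k) (cod f)"
 shows "Act germ_module f (germ (cod f) k x) = germ (dom f) k (Act (M k) f x)"
proof -
 have "Act germ_module f (germ (cod f) k x) = (SOME e. \<exists>k' x'. k' \<in> Obj J \<and> x' \<in> el (M k') (cod f) \<and>
   germ (cod f) k x = germ (cod f) k' x' \<and> e = germ (dom f) k' (Act (M k') f x'))"
  by (simp add: germ_module_def)
 also have "\<dots> = germ (dom f) k (Act (M k) f x)"
 proof (rule some_equality)
  show "\<exists>k' x'. k' \<in> Obj J \<and> x' \<in> el (M k') (cod f) \<and> germ (cod f) k x = germ (cod f) k' x' \<and>
    germ (dom f) k (Act (M k) f x) = germ (dom f) k' (Act (M k') f x')"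
   using k by blast
  fix e assume "\<exists>k' x'. k' \<in> Obj J \<and> x' \<in> el (M k') (cod f) \<and> germ (cod f) k x = germ (cod f) k' x' \<and>
    e = germ (dom f) k' (Act (M k') f x')"
  then show "e = germ (dom f) k (Act (M k) f x)" using germ_act_cong[OF f k] by metis
 qed
 finally show ?thesis .
qed

lemma germ_one:
 assumes X: "X \<in> Ob" and i: "i \<in> Obj J"
 shows "\<zero>[germ_module,X] = germ X i \<zero>[M i,X]"
proof -
 let ?j = "SOME i. i \<in> Obj J"
 have j: "?j \<in> Obj J" using i by (rule someI)
 obtain u v where uv: "u \<in> Arr J" "v \<in> Arr J" "Dom J u = ?j" "Dom J v = i" "Cod J u = Cod J v"
  using upper_bound[OF j i] by blast
 have "\<phi> u X \<zero>[M ?j,X] = \<phi> v X \<zero>[M i,X]"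
  using mhom_one[OF trans[OF uv(1)] _ _ X] mhom_one[OF trans[OF uv(2)] _ _ X] uv mods mods[OF i] mods[OF j] by simp
 then have "germ_eq X (?j, \<zero>[M ?j,X]) (i, \<zero>[M i,X])"
  unfolding germ_eq_def using uv by (intro exI[of _ u] exI[of _ v]) simp
 then have "germ X ?j \<zero>[M ?j,X] = germ X i \<zero>[M i,X]"
  using germ_eq_iff[OF X j _ i] mods[OF j] mods[OF i] X by simp
 then show ?thesis by (simp add: germ_module_def)
qed

lemma germ_cases:
 assumes "c \<in> el germ_module X"
 obtains i x where "i \<in> Obj J" "x \<in> el (M i) X" "c = germ X i x"
 using assms by (auto simp: el_germ_module)

lemma germ_cases2:
 assumes "X \<in> Ob" "c \<in> el germ_module X" "d \<in> el germ_module X"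
 obtains i x y where "i \<in> Obj J" "x \<in> el (M i) X" "y \<in> el (M i) X" "c = germ X i x" "d = germ X i y"
proof -
 obtain i x where i: "i \<in> Obj J" "x \<in> el (M i) X" "c = germ X i x" using assms(2) by (rule germ_cases)
 obtain j y where j: "j \<in> Obj J" "y \<in> el (M j) X" "d = germ X j y" using assms(3) by (rule germ_cases)
 show thesis using germ_common[OF assms(1) i(1,2) j(1,2)] i(3) j(3) that by metis
qed

lemma comm_group_germ:
 assumes X: "X \<in> Ob"
 shows "comm_group (Grp germ_module X)"
proof (rule comm_groupI)
 obtain i0 where i0: "i0 \<in> Obj J" using filtered by (auto simp: filtered_category_def)
 then show "\<zero>[germ_module,X] \<in> el germ_module X"
  using germ_one[OF X i0] mods[OF i0] X by simp
next
 fix c d assume "c \<in> el germ_module X" "d \<in> el germ_module X"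
 then obtain i x y where i: "i \<in> Obj J" "x \<in> el (M i) X" "y \<in> el (M i) X" "c = germ X i x" "d = germ X i y"
  using germ_cases2[OF X] by blast
 interpret comm_group "Grp (M i) X" using mods[OF i(1)] X by (rule mod_group)
 show "c +[germ_module,X] d \<in> el germ_module X" using i mods X by (simp add: germ_mult)
 show "c +[germ_module,X] d = d +[germ_module,X] c" using i X by (simp add: germ_mult m_comm)
next
 fix c assume "c \<in> el germ_module X"
 then obtain i x where i: "i \<in> Obj J" "x \<in> el (M i) X" "c = germ X i x" by (rule germ_cases)
 interpret comm_group "Grp (M i) X" using mods[OF i(1)] X by (rule mod_group)
 show "\<zero>[germ_module,X] +[germ_module,X] c = c" using i X by (simp add: germ_one[OF X i(1)] germ_mult)
 show "\<exists>d\<in>el germ_module X. d +[germ_module,X] c = \<zero>[germ_module,X]"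
  using i X by (intro bexI[of _ "germ X i (inv[Grp (M i) X] x)"]) (auto simp: germ_one[OF X i(1)] germ_mult)
next
 fix c d e assume cde: "c \<in> el germ_module X" "d \<in> el germ_module X" "e \<in> el germ_module X"
 obtain i x y where i: "i \<in> Obj J" "x \<in> el (M i) X" "y \<in> el (M i) X" "c = germ X i x" "d = germ X i y"
  using germ_cases2[OF X cde(1,2)] by blast
 obtain j z where j: "j \<in> Obj J" "z \<in> el (M j) X" "e = germ X j z" using cde(3) by (rule germ_cases)
 obtain u v where uv: "u \<in> Arr J" "v \<in> Arr J" "Dom J u = i" "Dom J v = j" "Cod J u = Cod J v"
  using upper_bound[OF i(1) j(1)] by blast
 let ?k = "Cod J u"
 have k: "?k \<in> Obj J" "\<phi> u X x \<in> el (M ?k) X" "\<phi> u X y \<in> el (M ?k) X" "\<phi> v X z \<in> el (M ?k) X"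
  using uv i j X trans_closed[OF uv(1) X] trans_closed[OF uv(2) X] by auto
 have c: "c = germ X ?k (\<phi> u X x)" "d = germ X ?k (\<phi> u X y)" "e = germ X ?k (\<phi> v X z)"
  using germ_push[OF X uv(1)] germ_push[OF X uv(2)] uv i j by auto
 interpret comm_group "Grp (M ?k) X" using mods[OF k(1)] X by (rule mod_group)
 show "c +[germ_module,X] d +[germ_module,X] e = c +[germ_module,X] (d +[germ_module,X] e)"
  using k X by (simp add: c germ_mult m_assoc)
qed

lemma is_module_germ: "is_mod germ_module"
 unfolding is_module_def
proof (intro conjI ballI impI)
 fix f assume f: "f \<in> Ar"
 show "Act germ_module f \<in> hom (Grp germ_module (cod f)) (Grp germ_module (dom f))"
 proof (rule homI)
  fix c assume "c \<in> el germ_module (cod f)"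
  then obtain i x where i: "i \<in> Obj J" "x \<in> el (M i) (cod f)" "c = germ (cod f) i x" by (rule germ_cases)
  then show "Act germ_module f c \<in> el germ_module (dom f)" using f mods by (simp add: germ_act)
 next
  fix c d assume "c \<in> el germ_module (cod f)" "d \<in> el germ_module (cod f)"
  then obtain i x y where i: "i \<in> Obj J" "x \<in> el (M i) (cod f)" "y \<in> el (M i) (cod f)"
   "c = germ (cod f) i x" "d = germ (cod f) i y"
   using germ_cases2[OF Cod_Obj[OF f]] by blast
  then show "Act germ_module f (c +[germ_module,cod f] d) =
    Act germ_module f c +[germ_module,dom f] Act germ_module f d"
   using f mods by (simp add: germ_act germ_mult act_mult)
 qed
next
 fix X c assume X: "X \<in> Ob" and "c \<in> el germ_module X"
 then obtain i x where i: "i \<in> Obj J" "x \<in> el (M i) X" "c = germ X i x" by (auto elim: germ_cases)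
 then show "Act germ_module (Id C X) c = c" using germ_act[of "Id C X" i x] X mods by (simp add: act_Id)
next
 fix f g c assume *: "f \<in> Ar" "g \<in> Ar" "cod f = dom g" and "c \<in> el germ_module (cod g)"
 then obtain i x where i: "i \<in> Obj J" "x \<in> el (M i) (cod g)" "c = germ (cod g) i x" by (auto elim: germ_cases)
 have "Act germ_module (Comp C g f) c = germ (dom f) i (Act (M i) f (Act (M i) g x))"
  using germ_act[of "Comp C g f" i x] i * mods by (simp add: act_Comp)
 also have "\<dots> = Act germ_module f (Act germ_module g c)"
  using germ_act[of g i x] germ_act[of f i "Act (M i) g x"] act_closed[OF mods[OF i(1)] *(2) i(2)] i * by simp
 finally show "Act germ_module (Comp C g f) c = Act germ_module f (Act germ_module g c)" .
next
 fix f g c assume *: "f \<in> Ar" "g \<in> Ar" "dom f = dom g" "cod f = cod g" and "c \<in> el germ_module (cod f)"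
 then obtain i x where i: "i \<in> Obj J" "x \<in> el (M i) (cod f)" "c = germ (cod f) i x" by (auto elim: germ_cases)
 have "Act germ_module (Add C f g) c = germ (dom f) i (Act (M i) f x +[M i,dom f] Act (M i) g x)"
  using germ_act[of "Add C f g" i x] i * mods by (simp add: act_Add)
 also have "\<dots> = Act germ_module f c +[germ_module,dom f] Act germ_module g c"
  using germ_act[of g i x] germ_act[of f i x] germ_mult[of "dom f" i "Act (M i) f x" "Act (M i) g x"]
   act_closed[OF mods[OF i(1)] *(1), of x] act_closed[OF mods[OF i(1)] *(2), of x] i * by simp
 finally show "Act germ_module (Add C f g) c = Act germ_module f c +[germ_module,dom f] Act germ_module g c" .
qed (rule comm_group_germ)

lemma mhom_germ: "i \<in> Obj J ==> mhom C (M i) (%X. germ X i) germ_module"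
 by (rule mhomI) (auto simp: germ_mult germ_act)

text \<open>This, and the fact that every element is a germ, is what makes filtered colimits exact.\<close>

lemma germ_trivial:
 assumes X: "X \<in> Ob" and i: "i \<in> Obj J" "x \<in> el (M i) X" and "germ X i x = \<zero>[germ_module,X]"
 obtains u where "u \<in> Arr J" "Dom J u = i" "\<phi> u X x = \<zero>[M (Cod J u),X]"
proof -
 have "germ_eq X (i, x) (i, \<zero>[M i,X])"
  using assms germ_eq_iff[OF X i i(1)] germ_one[OF X i(1)] mods by simp
 then obtain u v where uv: "u \<in> Arr J" "v \<in> Arr J" "Dom J u = i" "Dom J v = i" "Cod J u = Cod J v"
  "\<phi> u X x = \<phi> v X \<zero>[M i,X]" unfolding germ_eq_def by auto
 then show thesis using that[of u] mhom_one[OF trans[OF uv(2)] _ _ X] mods mods[OF i(1)] by simp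
qed

lemma germ_module_hom:
 assumes N: "is_mod N" and g: "!!i. i \<in> Obj J ==> mhom C (M i) (g i) N"
  and gu: "!!u X x. u \<in> Arr J ==> X \<in> Ob ==> x \<in> el (M (Dom J u)) X ==> g (Cod J u) X (\<phi> u X x) = g (Dom J u) X x"
 obtains h where "mhom C germ_module h N"
  "!!i X x. i \<in> Obj J ==> X \<in> Ob ==> x \<in> el (M i) X ==> h X (germ X i x) = g i X x"
proof -
 define h where "h X c = (SOME y. \<exists>i x. i \<in> Obj J \<and> x \<in> el (M i) X \<and> c = germ X i x \<and> y = g i X x)" for X c
 have hg: "h X (germ X i x) = g i X x" if X: "X \<in> Ob" and i: "i \<in> Obj J" "x \<in> el (M i) X" for X i x
  unfolding h_def
 proof (rule some_equality)
  show "\<exists>j y. j \<in> Obj J \<and> y \<in> el (M j) X \<and> germ X i x = germ X j y \<and> g i X x = g j X y" using i by blast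
  fix z assume "\<exists>j y. j \<in> Obj J \<and> y \<in> el (M j) X \<and> germ X i x = germ X j y \<and> z = g j X y"
  then obtain j y where j: "j \<in> Obj J" "y \<in> el (M j) X" "germ X i x = germ X j y" "z = g j X y" by blast
  obtain u v where uv: "u \<in> Arr J" "v \<in> Arr J" "Dom J u = i" "Dom J v = j" "Cod J u = Cod J v" "\<phi> u X x = \<phi> v X y"
   using j(3) germ_eq_iff[OF X i j(1,2)] unfolding germ_eq_def by auto
  have "g (Cod J u) X (\<phi> u X x) = g i X x" using gu[OF uv(1) X, of x] uv(3) i by simp
  moreover have "g (Cod J u) X (\<phi> u X x) = g j X y" using gu[OF uv(2) X, of y] uv(4-6) j by simp
  ultimately show "z = g i X x" using j(4) by simp
 qed
 have "mhom C germ_module h N"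
 proof (rule mhomI)
  fix X c assume X: "X \<in> Ob" and "c \<in> el germ_module X"
  then obtain i x where i: "i \<in> Obj J" "x \<in> el (M i) X" "c = germ X i x" by (auto elim: germ_cases)
  then show "h X c \<in> el N X" using hg X mhom_closed[OF g[OF i(1)] X] by simp
 next
  fix X c d assume X: "X \<in> Ob" and cd: "c \<in> el germ_module X" "d \<in> el germ_module X"
  obtain i x y where i: "i \<in> Obj J" "x \<in> el (M i) X" "y \<in> el (M i) X" "c = germ X i x" "d = germ X i y"
   using germ_cases2[OF X cd] by blast
  then show "h X (c +[germ_module,X] d) = h X c +[N,X] h X d"
   using hg X mhom_mult[OF g[OF i(1)] X] mods by (simp add: germ_mult)
 next
  fix f c assume f: "f \<in> Ar" and "c \<in> el germ_module (cod f)"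
  then obtain i x where i: "i \<in> Obj J" "x \<in> el (M i) (cod f)" "c = germ (cod f) i x" by (auto elim: germ_cases)
  then show "h (dom f) (Act germ_module f c) = Act N f (h (cod f) c)"
   using hg f mhom_nat[OF g[OF i(1)] f] mods by (simp add: germ_act)
 qed
 then show thesis using that hg by blast
qed

end

context linear_category
begin

lemma functor_Mod_cases:
 fixes J :: "('i, 'k) cat" and F0 :: "'i => ('o, 'm, 'u) cmod"
 assumes J: "filtered_category J" and F: "is_functor J ModC F0 F1"
 obtains \<phi> where "filtered_system C J F0 \<phi>" "!!u. u \<in> Arr J ==> F1 u = mk C (F0 (Dom J u)) (\<phi> u) (F0 (Cod J u))"
proof -
 have "\<exists>\<eta>. F1 u = mk C (F0 (Dom J u)) \<eta> (F0 (Cod J u)) \<and> mhom C (F0 (Dom J u)) \<eta> (F0 (Cod J u))" if "u \<in> Arr J" for u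
 proof -
  have "F1 u \<in> homs ModC (F0 (Dom J u)) (F0 (Cod J u))" using F that by (simp add: is_functor_def)
  then show ?thesis by (rule homs_Mod_cases) blast
 qed
 then obtain \<phi> where \<phi>: "!!u. u \<in> Arr J ==> F1 u = mk C (F0 (Dom J u)) (\<phi> u) (F0 (Cod J u))"
  "!!u. u \<in> Arr J ==> mhom C (F0 (Dom J u)) (\<phi> u) (F0 (Cod J u))" by metis
 have cat: "category J" using J by (simp add: filtered_category_def)
 have "filtered_system C J F0 \<phi>"
 proof
  show "filtered_category J" by (rule J)
  show "is_mod (F0 i)" if "i \<in> Obj J" for i using F that by (simp add: is_functor_def)
  show "mhom C (F0 (Dom J u)) (\<phi> u) (F0 (Cod J u))" if "u \<in> Arr J" for u using \<phi>(2)[OF that] .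
  show "\<phi> (Id J i) X x = x" if i: "i \<in> Obj J" and X: "X \<in> Ob" "x \<in> el (F0 i) X" for i X x
  proof -
   have I: "Id J i \<in> Arr J" "Dom J (Id J i) = i" "Cod J (Id J i) = i" using cat i by (auto simp: category_def homs_def)
   have "F1 (Id J i) = Id ModC (F0 i)" using F i by (simp add: is_functor_def)
   then show ?thesis using \<phi>(1)[OF I(1)] I X by (simp add: Id_mk mk_eq_iff)
  qed
  show "\<phi> (Comp J v u) X x = \<phi> v X (\<phi> u X x)"
   if uv: "u \<in> Arr J" "v \<in> Arr J" "Cod J u = Dom J v" and X: "X \<in> Ob" "x \<in> el (F0 (Dom J u)) X" for u v X x
  proof -
   have I: "Comp J v u \<in> Arr J" "Dom J (Comp J v u) = Dom J u" "Cod J (Comp J v u) = Cod J v"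
    using cat uv by (auto simp: category_def homs_def)
   have "F1 (Comp J v u) = Comp ModC (F1 v) (F1 u)" using F uv by (simp add: is_functor_def)
   then show ?thesis using \<phi>(1)[OF I(1)] \<phi>[OF uv(1)] \<phi>(1)[OF uv(2)] uv(3) I X by (simp add: mk_eq_iff)
  qed
 qed
 then show thesis using that \<phi>(1) by blast
qed

text \<open>A colimit that is given by its universal property is isomorphic to the module of germs and inherits the
 two elementwise properties.\<close>

lemma colimit_elements:
 fixes J :: "('i, 'k) cat" and F0 :: "'i => ('o, 'm, 'u) cmod"
 assumes sys: "filtered_system C J F0 \<phi>" and F1: "!!u. u \<in> Arr J ==> F1 u = mk C (F0 (Dom J u)) (\<phi> u) (F0 (Cod J u))"
  and L: "is_colimit J ModC F0 F1 L \<kappa>"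
  and inf: "infinite (UNIV :: 'u set)" and small: "Obj J \<lesssim> (UNIV :: 'u set)"
 obtains k where "!!i. i \<in> Obj J ==> \<kappa> i = mk C (F0 i) (k i) L" "!!i. i \<in> Obj J ==> mhom C (F0 i) (k i) L"
  "is_mod L"
  "!!u X x. u \<in> Arr J ==> X \<in> Ob ==> x \<in> el (F0 (Dom J u)) X ==> k (Cod J u) X (\<phi> u X x) = k (Dom J u) X x"
  "!!X l. X \<in> Ob ==> l \<in> el L X ==> \<exists>i\<in>Obj J. \<exists>x\<in>el (F0 i) X. l = k i X x"
  "!!X i x. X \<in> Ob ==> i \<in> Obj J ==> x \<in> el (F0 i) X ==> k i X x = \<zero>[L,X] ==>
   \<exists>u\<in>Arr J. Dom J u = i \<and> \<phi> u X x = \<one>\<^bsub>Grp (F0 (Cod J u)) X\<^esub>"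
proof -
 interpret filtered_system C J F0 \<phi> by fact
 have cocone: "is_cocone J ModC F0 F1 L \<kappa>" using L by (simp add: is_colimit_def)
 then have mL: "is_mod L" by (simp add: is_cocone_def)
 have "\<exists>g. \<kappa> i = mk C (F0 i) g L \<and> mhom C (F0 i) g L" if "i \<in> Obj J" for i
 proof -
  have "\<kappa> i \<in> homs ModC (F0 i) L" using cocone that by (simp add: is_cocone_def)
  then show ?thesis by (rule homs_Mod_cases) blast
 qed
 then obtain k where k: "!!i. i \<in> Obj J ==> \<kappa> i = mk C (F0 i) (k i) L" "!!i. i \<in> Obj J ==> mhom C (F0 i) (k i) L"
  by metis
 have ku: "k (Cod J u) X (\<phi> u X x) = k (Dom J u) X x" if u: "u \<in> Arr J" and "X \<in> Ob" "x \<in> el (F0 (Dom J u)) X" for u X x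
 proof -
  have "Comp ModC (\<kappa> (Cod J u)) (F1 u) = \<kappa> (Dom J u)" using cocone u by (simp add: is_cocone_def)
  then show ?thesis using k F1[OF u] trans[OF u] that by (simp add: mk_eq_iff)
 qed
 have "el germ_module X \<lesssim> (UNIV :: 'u set)" for X
 proof -
  have "el germ_module X \<lesssim> germs X" by (simp add: germ_module_def image_lepoll)
  also have "germs X \<lesssim> Obj J \<times> (UNIV :: 'u set)" by (intro subset_imp_lepoll) (auto simp: germs_def)
  also have "\<dots> \<lesssim> (UNIV :: 'u set)" using inf small by (intro lepoll_Times_infinite) auto
  finally show ?thesis .
 qed
 then obtain Q :: "('o, 'm, 'u) cmod" and r s where Q: "is_mod Q" "mhom C germ_module r Q" "mhom C Q s germ_module"
  "!!X x. X \<in> Ob ==> x \<in> el germ_module X ==> s X (r X x) = x"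
  using transport_module[OF is_module_germ] by metis
 define q where "q i X x = r X (germ X i x)" for i X x
 have q: "mhom C (F0 i) (q i) Q" if "i \<in> Obj J" for i
  unfolding q_def using mhom_comp[OF mhom_germ[OF that] Q(2)] .
 have qu: "q (Cod J u) X (\<phi> u X x) = q (Dom J u) X x" if "u \<in> Arr J" "X \<in> Ob" "x \<in> el (F0 (Dom J u)) X" for u X x
  unfolding q_def using germ_push that by simp
 have "is_cocone J ModC F0 F1 Q (%i. mk C (F0 i) (q i) Q)"
  unfolding is_cocone_def using Q(1) mods q qu F1 trans by (auto simp: mk_eq_iff)
 then obtain a where a: "a \<in> homs ModC L Q" "\<forall>i\<in>Obj J. Comp ModC a (\<kappa> i) = mk C (F0 i) (q i) Q"
  using L unfolding is_colimit_def by blast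
 obtain a' where a': "a = mk C L a' Q" "mhom C L a' Q" using a(1) by (rule homs_Mod_cases)
 have ak: "a' X (k i X x) = q i X x" if "i \<in> Obj J" "X \<in> Ob" "x \<in> el (F0 i) X" for i X x
  using bspec[OF a(2) that(1)] a'(1) k that by (simp add: mk_eq_iff)
 obtain h where h: "mhom C germ_module h L"
  "!!i X x. i \<in> Obj J ==> X \<in> Ob ==> x \<in> el (F0 i) X ==> h X (germ X i x) = k i X x"
  using germ_module_hom[OF mL k(2) ku] by blast
 have ha: "mhom C L (%X x. h X (s X (a' X x))) L"
  using mhom_comp[OF mhom_comp[OF a'(2) Q(3)] h(1)] .
 have hak: "h X (s X (a' X (k i X x))) = k i X x" if "i \<in> Obj J" "X \<in> Ob" "x \<in> el (F0 i) X" for i X x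
  using ak[OF that] Q(4)[OF that(2)] h(2)[OF that] that by (simp add: q_def)
 have uniq: "\<exists>!u. u \<in> homs ModC L L \<and> (\<forall>i\<in>Obj J. Comp ModC u (\<kappa> i) = \<kappa> i)"
  using L cocone unfolding is_colimit_def by blast
 moreover have "mk C L (%X x. h X (s X (a' X x))) L \<in> homs ModC L L \<and>
   (\<forall>i\<in>Obj J. Comp ModC (mk C L (%X x. h X (s X (a' X x))) L) (\<kappa> i) = \<kappa> i)"
  using mL ha k hak by (simp add: mk_eq_iff)
 moreover have "mk C L (%X x. x) L \<in> homs ModC L L \<and>
   (\<forall>i\<in>Obj J. Comp ModC (mk C L (%X x. x) L) (\<kappa> i) = \<kappa> i)"
  using mL k by (simp add: mk_eq_iff)
 ultimately have "mk C L (%X x. h X (s X (a' X x))) L = mk C L (%X x. x) L" by blast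
 then have inv: "h X (s X (a' X l)) = l" if "X \<in> Ob" "l \<in> el L X" for X l
  using that by (simp add: mk_eq_iff)
 show thesis
 proof (rule that[OF k mL ku])
  fix X l assume X: "X \<in> Ob" and l: "l \<in> el L X"
  have "s X (a' X l) \<in> el germ_module X" using mhom_closed[OF Q(3) X mhom_closed[OF a'(2) X l]] .
  then obtain i x where i: "i \<in> Obj J" "x \<in> el (F0 i) X" "s X (a' X l) = germ X i x" by (rule germ_cases)
  then show "\<exists>i\<in>Obj J. \<exists>x\<in>el (F0 i) X. l = k i X x" using inv[OF X l] h(2)[OF i(1) X i(2)] by auto
 next
  fix X i x assume X: "X \<in> Ob" and i: "i \<in> Obj J" "x \<in> el (F0 i) X" and "k i X x = \<zero>[L,X]"
  then have "s X (q i X x) = s X (a' X \<zero>[L,X])" using ak[OF i(1) X i(2)] by simp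
  also have "\<dots> = \<zero>[germ_module,X]"
   using mhom_one[OF mhom_comp[OF a'(2) Q(3)] mL is_module_germ X] .
  finally have "germ X i x = \<zero>[germ_module,X]" using Q(4)[OF X] i by (simp add: q_def)
  then show "\<exists>u\<in>Arr J. Dom J u = i \<and> \<phi> u X x = \<one>\<^bsub>Grp (F0 (Cod J u)) X\<^esub>"
   using germ_trivial[OF X i] by blast
 qed
qed

lemma nat_trans_Mod_cases:
 fixes F0 G0 :: "'i => ('o, 'm, 'u) cmod"
 assumes F: "filtered_system C J F0 \<phi>" "!!u. u \<in> Arr J ==> F1 u = mk C (F0 (Dom J u)) (\<phi> u) (F0 (Cod J u))"
  and G: "!!u. u \<in> Arr J ==> G1 u = mk C (G0 (Dom J u)) (\<gamma> u) (G0 (Cod J u))"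
  and \<sigma>: "is_nat_trans J ModC F0 F1 G0 G1 \<sigma>"
 obtains s where "!!i. i \<in> Obj J ==> \<sigma> i = mk C (F0 i) (s i) (G0 i)" "!!i. i \<in> Obj J ==> mhom C (F0 i) (s i) (G0 i)"
  "!!u X x. u \<in> Arr J ==> X \<in> Ob ==> x \<in> el (F0 (Dom J u)) X ==> \<gamma> u X (s (Dom J u) X x) = s (Cod J u) X (\<phi> u X x)"
proof -
 interpret filtered_system C J F0 \<phi> by fact
 have "\<exists>g. \<sigma> i = mk C (F0 i) g (G0 i) \<and> mhom C (F0 i) g (G0 i)" if "i \<in> Obj J" for i
 proof -
  have "\<sigma> i \<in> homs ModC (F0 i) (G0 i)" using \<sigma> that by (simp add: is_nat_trans_def)
  then show ?thesis by (rule homs_Mod_cases) blast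
 qed
 then obtain s where s: "!!i. i \<in> Obj J ==> \<sigma> i = mk C (F0 i) (s i) (G0 i)" "!!i. i \<in> Obj J ==> mhom C (F0 i) (s i) (G0 i)"
  by metis
 have "\<gamma> u X (s (Dom J u) X x) = s (Cod J u) X (\<phi> u X x)" if u: "u \<in> Arr J" "X \<in> Ob" "x \<in> el (F0 (Dom J u)) X" for u X x
 proof -
  have "Comp ModC (G1 u) (\<sigma> (Dom J u)) = Comp ModC (\<sigma> (Cod J u)) (F1 u)"
   using \<sigma> u by (simp add: is_nat_trans_def)
  then show ?thesis using s F(2)[OF u(1)] G[OF u(1)] trans[OF u(1)] u by (simp add: mk_eq_iff)
 qed
 then show thesis using that s by blast
qed

lemma short_exact_iff:
 fixes L M N :: "('o, 'm, 'u) cmod"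
 assumes L: "is_mod L" and M: "is_mod M" and N: "is_mod N"
  and a: "mhom C L a M" and b: "mhom C M b N"
 shows "short_exact ModC (mk C L a M) (mk C M b N) \<longleftrightarrow> mses C L a M b N"
 unfolding short_exact_def is_mono_iff[OF L M a] is_epi_iff[OF M N b] exact_iff[OF assms] mses_def
 using assms by blast

text \<open>Exactness is a chase of elements: lift to a common index, use exactness there, and push forward.\<close>

theorem filtered_colimits_exact_Mod:
 assumes inf: "infinite (UNIV :: 'u set)"
 shows "filtered_colimits_exact TYPE('u) (Modcat TYPE('u) C)"
 unfolding filtered_colimits_exact_def
proof (intro allI impI)
 let ?A = "Modcat TYPE('u) C"
 fix J :: "('u, 'u) cat" and F0 G0 H0 :: "'u => ('o, 'm, 'u) cmod" and F1 G1 H1 \<sigma> \<tau> L \<kappa> M \<mu> N \<nu> f g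
 assume J: "filtered_category J"
  and F: "is_functor J ?A F0 F1" and G: "is_functor J ?A G0 G1"
  and H: "is_functor J ?A H0 H1"
  and \<sigma>: "is_nat_trans J ?A F0 F1 G0 G1 \<sigma>"
  and \<tau>: "is_nat_trans J ?A G0 G1 H0 H1 \<tau>"
  and ses: "\<forall>i\<in>Obj J. short_exact ?A (\<sigma> i) (\<tau> i)"
  and L: "is_colimit J ?A F0 F1 L \<kappa>" and M: "is_colimit J ?A G0 G1 M \<mu>"
  and N: "is_colimit J ?A H0 H1 N \<nu>"
  and f: "f \<in> homs ?A L M" and f\<kappa>: "\<forall>i\<in>Obj J. Comp ?A f (\<kappa> i) = Comp ?A (\<mu> i) (\<sigma> i)"
  and g: "g \<in> homs ?A M N" and g\<mu>: "\<forall>i\<in>Obj J. Comp ?A g (\<mu> i) = Comp ?A (\<nu> i) (\<tau> i)"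
 have small: "Obj J \<lesssim> (UNIV :: 'u set)" by (simp add: subset_imp_lepoll)
 obtain \<phi> where \<phi>: "filtered_system C J F0 \<phi>" "!!u. u \<in> Arr J ==> F1 u = mk C (F0 (Dom J u)) (\<phi> u) (F0 (Cod J u))"
  using functor_Mod_cases[OF J F] by blast
 obtain \<gamma> where \<gamma>: "filtered_system C J G0 \<gamma>" "!!u. u \<in> Arr J ==> G1 u = mk C (G0 (Dom J u)) (\<gamma> u) (G0 (Cod J u))"
  using functor_Mod_cases[OF J G] by blast
 obtain \<eta> where \<eta>: "filtered_system C J H0 \<eta>" "!!u. u \<in> Arr J ==> H1 u = mk C (H0 (Dom J u)) (\<eta> u) (H0 (Cod J u))"
  using functor_Mod_cases[OF J H] by blast
 interpret F: filtered_system C J F0 \<phi> by fact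
 interpret G: filtered_system C J G0 \<gamma> by fact
 interpret H: filtered_system C J H0 \<eta> by fact
 obtain s where s: "!!i. i \<in> Obj J ==> \<sigma> i = mk C (F0 i) (s i) (G0 i)" "!!i. i \<in> Obj J ==> mhom C (F0 i) (s i) (G0 i)"
  "!!u X x. u \<in> Arr J ==> X \<in> Ob ==> x \<in> el (F0 (Dom J u)) X ==> \<gamma> u X (s (Dom J u) X x) = s (Cod J u) X (\<phi> u X x)"
  using nat_trans_Mod_cases[OF \<phi> \<gamma>(2) \<sigma>] by blast
 obtain t where t: "!!i. i \<in> Obj J ==> \<tau> i = mk C (G0 i) (t i) (H0 i)" "!!i. i \<in> Obj J ==> mhom C (G0 i) (t i) (H0 i)"
  "!!u X x. u \<in> Arr J ==> X \<in> Ob ==> x \<in> el (G0 (Dom J u)) X ==> \<eta> u X (t (Dom J u) X x) = t (Cod J u) X (\<gamma> u X x)"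
  using nat_trans_Mod_cases[OF \<gamma> \<eta>(2) \<tau>] by blast
 have st: "mses C (F0 i) (s i) (G0 i) (t i) (H0 i)" if "i \<in> Obj J" for i
  using bspec[OF ses that] s(1)[OF that] t(1)[OF that]
   short_exact_iff[OF F.mods[OF that] G.mods[OF that] H.mods[OF that] s(2)[OF that] t(2)[OF that]] by simp
 obtain k where k: "!!i. i \<in> Obj J ==> \<kappa> i = mk C (F0 i) (k i) L" "!!i. i \<in> Obj J ==> mhom C (F0 i) (k i) L"
  "is_mod L"
  "!!u X x. u \<in> Arr J ==> X \<in> Ob ==> x \<in> el (F0 (Dom J u)) X ==> k (Cod J u) X (\<phi> u X x) = k (Dom J u) X x"
  "!!X l. X \<in> Ob ==> l \<in> el L X ==> \<exists>i\<in>Obj J. \<exists>x\<in>el (F0 i) X. l = k i X x"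
  "!!X i x. X \<in> Ob ==> i \<in> Obj J ==> x \<in> el (F0 i) X ==> k i X x = \<zero>[L,X] ==>
   \<exists>u\<in>Arr J. Dom J u = i \<and> \<phi> u X x = \<one>\<^bsub>Grp (F0 (Cod J u)) X\<^esub>"
  using colimit_elements[OF \<phi> L inf small] by blast
 obtain m where m: "!!i. i \<in> Obj J ==> \<mu> i = mk C (G0 i) (m i) M" "!!i. i \<in> Obj J ==> mhom C (G0 i) (m i) M"
  "is_mod M"
  "!!u X x. u \<in> Arr J ==> X \<in> Ob ==> x \<in> el (G0 (Dom J u)) X ==> m (Cod J u) X (\<gamma> u X x) = m (Dom J u) X x"
  "!!X l. X \<in> Ob ==> l \<in> el M X ==> \<exists>i\<in>Obj J. \<exists>x\<in>el (G0 i) X. l = m i X x"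
  "!!X i x. X \<in> Ob ==> i \<in> Obj J ==> x \<in> el (G0 i) X ==> m i X x = \<zero>[M,X] ==>
   \<exists>u\<in>Arr J. Dom J u = i \<and> \<gamma> u X x = \<one>\<^bsub>Grp (G0 (Cod J u)) X\<^esub>"
  using colimit_elements[OF \<gamma> M inf small] by blast
 obtain n where n0: "!!i. i \<in> Obj J ==> \<nu> i = mk C (H0 i) (n i) N" "!!i. i \<in> Obj J ==> mhom C (H0 i) (n i) N"
  "is_mod N"
  "!!u X x. u \<in> Arr J ==> X \<in> Ob ==> x \<in> el (H0 (Dom J u)) X ==> n (Cod J u) X (\<eta> u X x) = n (Dom J u) X x"
  "!!X l. X \<in> Ob ==> l \<in> el N X ==> \<exists>i\<in>Obj J. \<exists>x\<in>el (H0 i) X. l = n i X x"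
  "!!X i x. X \<in> Ob ==> i \<in> Obj J ==> x \<in> el (H0 i) X ==> n i X x = \<zero>[N,X] ==>
   \<exists>u\<in>Arr J. Dom J u = i \<and> \<eta> u X x = \<one>\<^bsub>Grp (H0 (Cod J u)) X\<^esub>"
  using colimit_elements[OF \<eta> N inf small] by blast
 note n = n0(1-3,5-6)
 obtain f' where f': "f = mk C L f' M" "mhom C L f' M" using f by (rule homs_Mod_cases)
 obtain g' where g': "g = mk C M g' N" "mhom C M g' N" using g by (rule homs_Mod_cases)
 have fk: "f' X (k i X x) = m i X (s i X x)" if "i \<in> Obj J" "X \<in> Ob" "x \<in> el (F0 i) X" for i X x
  using bspec[OF f\<kappa> that(1)] f'(1) k(1,2) m(1) s(1,2) that by (simp add: mk_eq_iff)
 have gm: "g' X (m i X x) = n i X (t i X x)" if "i \<in> Obj J" "X \<in> Ob" "x \<in> el (G0 i) X" for i X x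
  using bspec[OF g\<mu> that(1)] g'(1) m(1,2) n(1) t(1,2) that by (simp add: mk_eq_iff)
 have sc: "s i X x \<in> el (G0 i) X" if "i \<in> Obj J" "X \<in> Ob" "x \<in> el (F0 i) X" for i X x
  using mhom_closed[OF s(2)] that by blast
 have tc: "t i X x \<in> el (H0 i) X" if "i \<in> Obj J" "X \<in> Ob" "x \<in> el (G0 i) X" for i X x
  using mhom_closed[OF t(2)] that by blast
 have "mses C L f' M g' N"
  unfolding mses_def
 proof (intro conjI ballI k(3) m(3) n(3) f'(2) g'(2))
  fix X assume X: "X \<in> Ob"
  show "inj_on (f' X) (el L X)"
  proof (rule mhom_inj_onI[OF f'(2) k(3) m(3) X])
   fix l assume l: "l \<in> el L X" and fl: "f' X l = \<zero>[M,X]"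
   obtain i x where i: "i \<in> Obj J" "x \<in> el (F0 i) X" "l = k i X x" using k(5)[OF X l] by blast
   obtain u where u: "u \<in> Arr J" "Dom J u = i" "\<gamma> u X (s i X x) = \<one>\<^bsub>Grp (G0 (Cod J u)) X\<^esub>"
    using m(6)[OF X i(1) sc[OF i(1) X i(2)]] fk[OF i(1) X i(2)] fl i(3) by auto
   have j: "Cod J u \<in> Obj J" "\<phi> u X x \<in> el (F0 (Cod J u)) X" using F.trans_closed[OF u(1) X] u i by auto
   have "s (Cod J u) X (\<phi> u X x) = s (Cod J u) X \<one>\<^bsub>Grp (F0 (Cod J u)) X\<^esub>"
    using s(3)[OF u(1) X] u i mhom_one[OF s(2)[OF j(1)] F.mods[OF j(1)] G.mods[OF j(1)] X] by simp
   then have "\<phi> u X x = \<one>\<^bsub>Grp (F0 (Cod J u)) X\<^esub>"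
    using inj_onD[OF msesD(6)[OF st[OF j(1)] X]] j F.mods[OF j(1)] X by simp
   then have "k (Cod J u) X (\<phi> u X x) = \<zero>[L,X]"
    using mhom_one[OF k(2)[OF j(1)] F.mods[OF j(1)] k(3) X] by simp
   then show "l = \<zero>[L,X]" using k(4)[OF u(1) X] u i by simp
  qed
  show "g' X ` el M X = el N X"
  proof
   show "g' X ` el M X \<subseteq> el N X" using mhom_closed[OF g'(2) X] by blast
   show "el N X \<subseteq> g' X ` el M X"
   proof
    fix z assume "z \<in> el N X"
    then obtain i x where i: "i \<in> Obj J" "x \<in> el (H0 i) X" "z = n i X x" using n(4)[OF X] by blast
    then obtain y where y: "y \<in> el (G0 i) X" "x = t i X y" using msesD(7)[OF st[OF i(1)] X] by blast
    then show "z \<in> g' X ` el M X"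
     using gm[OF i(1) X y(1)] mhom_closed[OF m(2)[OF i(1)] X y(1)] i(3) by force
   qed
  qed
  fix y assume y: "y \<in> el M X"
  show "g' X y = \<zero>[N,X] \<longleftrightarrow> y \<in> f' X ` el L X"
  proof
   assume gy: "g' X y = \<zero>[N,X]"
   obtain i x where i: "i \<in> Obj J" "x \<in> el (G0 i) X" "y = m i X x" using m(5)[OF X y] by blast
   obtain u where u: "u \<in> Arr J" "Dom J u = i" "\<eta> u X (t i X x) = \<one>\<^bsub>Grp (H0 (Cod J u)) X\<^esub>"
    using n(5)[OF X i(1) tc[OF i(1) X i(2)]] gm[OF i(1) X i(2)] gy i(3) by auto
   have j: "Cod J u \<in> Obj J" "\<gamma> u X x \<in> el (G0 (Cod J u)) X" using G.trans_closed[OF u(1) X] u i by auto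
   have "t (Cod J u) X (\<gamma> u X x) = \<one>\<^bsub>Grp (H0 (Cod J u)) X\<^esub>" using t(3)[OF u(1) X] u i by simp
   then obtain w where w: "w \<in> el (F0 (Cod J u)) X" "\<gamma> u X x = s (Cod J u) X w"
    using msesD(8)[OF st[OF j(1)] X j(2)] by blast
   have "m (Cod J u) X (\<gamma> u X x) = y" using m(4)[OF u(1) X, of x] u(2) i by simp
   then have "y = f' X (k (Cod J u) X w)" using w fk[OF j(1) X w(1)] by simp
   then show "y \<in> f' X ` el L X" using mhom_closed[OF k(2)[OF j(1)] X w(1)] by blast
  next
   assume "y \<in> f' X ` el L X"
   then obtain l where l: "l \<in> el L X" "y = f' X l" by blast
   obtain i x where i: "i \<in> Obj J" "x \<in> el (F0 i) X" "l = k i X x" using k(5)[OF X l(1)] by blast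
   have "g' X y = n i X (t i X (s i X x))" using l i fk[OF i(1) X i(2)] gm[OF i(1) X sc[OF i(1) X i(2)]] by simp
   also have "\<dots> = \<zero>[N,X]"
    using mses_trivial_comp[OF st[OF i(1)] X i(2)] mhom_one[OF n(2)[OF i(1)] H.mods[OF i(1)] n(3) X] by simp
   finally show "g' X y = \<zero>[N,X]" .
  qed
 qed
 then show "short_exact ?A f g"
  using f' g' short_exact_iff[OF k(3) m(3) n(3) f'(2) g'(2)] by simp
qed

section \<open>Homological dimensions of modules\<close>

text \<open>Peel off \<open>0 \<rightarrow> K \<rightarrow> P \<rightarrow> X \<rightarrow> 0\<close>: the kernel
 \<open>K\<close> has a shorter resolution, and the bounds for \<open>K\<close> and \<open>P\<close> give the one for
 \<open>X\<close>. It is essential that the bound does not grow with the length.\<close>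

lemma projective_resolution_id_le_1:
 fixes X :: "('o, 'm, 'u) cmod"
 assumes proj: "!!P :: ('o, 'm, 'u) cmod. proj_mod P ==> id_le_1 P"
  and "projective_resolution ModC X n P d"
 shows "id_le_1 X"
 using assms(2)
proof (induction n arbitrary: X P d)
 case (0 X P d)
 note res = 0[unfolded projective_resolution_def]
 have P0: "proj_mod (P 0)" using res by (simp add: projective_iff)
 obtain e where e: "d 0 = mk C (P 0) e X" "is_mod (P 0)" "is_mod X" "mhom C (P 0) e X"
  using res by (auto elim: homs_Mod_cases)
 have surj: "e Y ` el (P 0) Y = el X Y" and inj: "inj_on (e Y) (el (P 0) Y)" if "Y \<in> Ob" for Y
  using res e that by (auto simp: is_epi_iff is_mono_iff)
 obtain j and K :: "('o, 'm, 'u) cmod" where K: "mses C K j (P 0) e X"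
  using mses_kernel_exists[OF e(2-4) surj] by blast
 have "el K Y = {\<zero>[K,Y]}" if Y: "Y \<in> Ob" for Y
 proof -
  have "x = \<zero>[K,Y]" if x: "x \<in> el K Y" for x
  proof -
   have jx: "j Y x \<in> el (P 0) Y" by (rule mhom_closed[OF msesD(4)[OF K] Y x])
   have "e Y (j Y x) = e Y \<zero>[P 0,Y]"
    using mses_trivial_comp[OF K Y x] mhom_one[OF e(4) e(2,3) Y] by simp
   then have "j Y x = \<zero>[P 0,Y]" using inj_onD[OF inj[OF Y]] jx e(2) Y by simp
   then have "j Y x = j Y \<zero>[K,Y]" using mhom_one[OF msesD(4)[OF K] msesD(1,2)[OF K] Y] by simp
   then show ?thesis using inj_onD[OF msesD(6)[OF K Y]] x msesD(1)[OF K] Y by simp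
  qed
  then show ?thesis using msesD(1)[OF K] Y by auto
 qed
 then have "id_le_1 K" using trivial_module(1)[OF msesD(1)[OF K]] by blast
 then show ?case using id_le_1_quotient[OF K _ proj[OF P0]] by blast
next
 case (Suc n X P d)
 note res = Suc.prems[unfolded projective_resolution_def]
 have P: "proj_mod (P 0)" "proj_mod (P 1)" using res by (auto simp: projective_iff)
 obtain e where e: "d 0 = mk C (P 0) e X" "is_mod (P 0)" "is_mod X" "mhom C (P 0) e X"
  using res by (auto elim: homs_Mod_cases)
 have "d 1 \<in> homs ModC (P 1) (P 0)" using res by auto
 then obtain e1 where e1: "d 1 = mk C (P 1) e1 (P 0)" "is_mod (P 1)" "mhom C (P 1) e1 (P 0)"
  by (auto elim: homs_Mod_cases)
 have surj: "e Y ` el (P 0) Y = el X Y" if "Y \<in> Ob" for Y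
  using res e that by (auto simp: is_epi_iff)
 let ?S = "%Y. {x \<in> el (P 0) Y. e Y x = \<zero>[X,Y]}"
 have S: "submodule C (P 0) ?S" using submodule_kernel[OF e(2-4)] .
 define K where "K = restrict_module (P 0) ?S"
 have K: "is_mod K" unfolding K_def using is_module_restrict[OF e(2) S] .
 have KPX: "mses C K (%Y x. x) (P 0) e X"
  unfolding mses_def using K e surj mhom_inclusion[OF S] by (auto simp: K_def inj_on_def)
 have ex: "e Y y = \<zero>[X,Y] \<longleftrightarrow> y \<in> e1 Y ` el (P 1) Y" if "Y \<in> Ob" "y \<in> el (P 0) Y" for Y y
 proof -
  have "exact ModC (d 1) (d 0)" using res by auto
  then show ?thesis using e e1 that exact_iff[OF e1(2) e(2,3) e1(3) e(4)] by simp
 qed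
 have e1K: "mhom C (P 1) e1 K"
  by (rule mhomI)
   (use e1 ex in \<open>auto simp del: One_nat_def simp: K_def mhom_closed[OF e1(3)] mhom_mult[OF e1(3)] mhom_nat[OF e1(3)]\<close>)
 let ?d = "case_nat (mk C (P 1) e1 K) (%i. d (Suc (Suc i)))"
 have "projective_resolution ModC K n (%i. P (Suc i)) ?d"
  unfolding projective_resolution_def
 proof (intro conjI allI impI)
  show "projective ModC (P (Suc i))" if "i \<le> n" for i using res that by simp
  show "?d 0 \<in> homs ModC (P (Suc 0)) K" using K e1 e1K by simp
  show "?d (Suc i) \<in> homs ModC (P (Suc (Suc i))) (P (Suc i))" if "i < n" for i using res that by simp
  show "is_epi ModC (?d 0)"
   using is_epi_iff[OF e1(2) K e1K] ex mhom_closed[OF e1(3)] by (auto simp: K_def)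
  show "exact ModC (?d (Suc i)) (?d i)" if i: "i < n" for i
  proof (cases i)
   case 0
   have "d (Suc (Suc 0)) \<in> homs ModC (P (Suc (Suc 0))) (P (Suc 0))" using res i by auto
   then obtain e2 where e2: "d (Suc (Suc 0)) = mk C (P (Suc (Suc 0))) e2 (P 1)" "is_mod (P (Suc (Suc 0)))"
    "mhom C (P (Suc (Suc 0))) e2 (P 1)" by (auto elim: homs_Mod_cases)
   have "exact ModC (d (Suc (Suc 0))) (d (Suc 0))" using res i by auto
   then have "exact ModC (mk C (P (Suc (Suc 0))) e2 (P 1)) (mk C (P 1) e1 (P 0))" using e2 e1 by simp
   then show ?thesis using 0 e2 exact_iff[OF e2(2) e1(2) K e2(3) e1K] exact_iff[OF e2(2) e1(2) e(2) e2(3) e1(3)]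
    by (simp add: K_def)
  next
   case (Suc k)
   then show ?thesis using res i by auto
  qed
  show "is_mono ModC (?d n)"
  proof (cases n)
   case 0
   have "is_mono ModC (d (Suc 0))" using res 0 by simp
   then show ?thesis using 0 e1 is_mono_iff[OF e1(2) K e1K] is_mono_iff[OF e1(2) e(2) e1(3)] by simp
  next
   case (Suc k)
   then show ?thesis using res by simp
  qed
 qed
 then have "id_le_1 K" by (rule Suc.IH)
 then show ?case using id_le_1_quotient[OF KPX _ proj[OF P(1)]] by blast
qed

text \<open>Dual to the previous lemma, with the cokernel of \<open>X \<rightarrow> I\<close> in place of the
 kernel.\<close>

lemma injective_resolution_pd_le_1:
 fixes X :: "('o, 'm, 'u) cmod"
 assumes inj: "!!I :: ('o, 'm, 'u) cmod. inj_mod I ==> pd_le_1 I"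
  and "injective_resolution ModC X n I d"
 shows "pd_le_1 X"
 using assms(2)
proof (induction n arbitrary: X I d)
 case (0 X I d)
 note res = 0[unfolded injective_resolution_def]
 have I0: "inj_mod (I 0)" using res by (simp add: injective_iff)
 obtain e where e: "d 0 = mk C X e (I 0)" "is_mod X" "is_mod (I 0)" "mhom C X e (I 0)"
  using res by (auto elim: homs_Mod_cases)
 have surj: "e Y ` el X Y = el (I 0) Y" and mono: "inj_on (e Y) (el X Y)" if "Y \<in> Ob" for Y
  using res e that by (auto simp: is_epi_iff is_mono_iff)
 obtain q and Q :: "('o, 'm, 'u) cmod" where Q: "mses C X e (I 0) q Q"
  using mses_quotient_exists[OF e(2-4) mono] by blast
 have "el Q Y = {\<zero>[Q,Y]}" if Y: "Y \<in> Ob" for Y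
 proof -
  have "q Y y = \<zero>[Q,Y]" if "y \<in> el (I 0) Y" for y
   using msesD(8)[OF Q Y that] surj[OF Y] that by simp
  then have "el Q Y \<subseteq> {\<zero>[Q,Y]}" using msesD(7)[OF Q Y] by auto
  then show ?thesis using mod_one[OF msesD(3)[OF Q] Y] by blast
 qed
 then have "pd_le_1 Q" using trivial_module(2)[OF msesD(3)[OF Q]] by blast
 then show ?case using pd_le_1_submodule[OF Q inj[OF I0]] by blast
next
 case (Suc n X I d)
 note res = Suc.prems[unfolded injective_resolution_def]
 have I: "inj_mod (I 0)" "inj_mod (I 1)" using res by (auto simp: injective_iff)
 obtain e where e: "d 0 = mk C X e (I 0)" "is_mod X" "is_mod (I 0)" "mhom C X e (I 0)"
  using res by (auto elim: homs_Mod_cases)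
 have "d 1 \<in> homs ModC (I 0) (I 1)" using res by auto
 then obtain e1 where e1: "d 1 = mk C (I 0) e1 (I 1)" "is_mod (I 1)" "mhom C (I 0) e1 (I 1)"
  by (auto elim: homs_Mod_cases)
 have mono: "inj_on (e Y) (el X Y)" if "Y \<in> Ob" for Y
  using res e that by (auto simp: is_mono_iff)
 obtain q and Q :: "('o, 'm, 'u) cmod" where Q: "mses C X e (I 0) q Q"
  using mses_quotient_exists[OF e(2-4) mono] by blast
 note mQ = msesD(3)[OF Q]
 have ex: "e1 Y y = \<zero>[I 1,Y] \<longleftrightarrow> q Y y = \<zero>[Q,Y]" if "Y \<in> Ob" "y \<in> el (I 0) Y" for Y y
 proof -
  have "exact ModC (d 0) (d 1)" using res by auto
  then show ?thesis using e e1 that exact_iff[OF e(2,3) e1(2) e(4) e1(3)] msesD(8)[OF Q that] by simp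
 qed
 obtain u where u: "mhom C Q u (I 1)" "!!Y y. Y \<in> Ob ==> y \<in> el (I 0) Y ==> u Y (q Y y) = e1 Y y"
  using factor_surj[OF e1(2) e(3) mQ msesD(5,7)[OF Q] e1(3)] ex by blast
 have uinj: "inj_on (u Y) (el Q Y)" if Y: "Y \<in> Ob" for Y
 proof (rule mhom_inj_onI[OF u(1) mQ e1(2) Y])
  fix z assume "z \<in> el Q Y" "u Y z = \<zero>[I 1,Y]"
  moreover obtain y where "y \<in> el (I 0) Y" "z = q Y y" using msesD(7)[OF Q Y] \<open>z \<in> el Q Y\<close> by blast
  ultimately show "z = \<zero>[Q,Y]" using u(2) ex Y by simp
 qed
 have uimg: "u Y ` el Q Y = e1 Y ` el (I 0) Y" if Y: "Y \<in> Ob" for Y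
  unfolding msesD(7)[OF Q Y, symmetric] image_image using u(2)[OF Y] by (intro image_cong) auto
 let ?d = "case_nat (mk C Q u (I 1)) (%i. d (Suc (Suc i)))"
 have "injective_resolution ModC Q n (%i. I (Suc i)) ?d"
  unfolding injective_resolution_def
 proof (intro conjI allI impI)
  show "injective ModC (I (Suc i))" if "i \<le> n" for i using res that by simp
  show "?d 0 \<in> homs ModC Q (I (Suc 0))" using mQ e1 u by simp
  show "?d (Suc i) \<in> homs ModC (I (Suc i)) (I (Suc (Suc i)))" if "i < n" for i using res that by simp
  show "is_mono ModC (?d 0)"
   using is_mono_iff[OF mQ e1(2) u(1)] uinj by simp
  show "exact ModC (?d i) (?d (Suc i))" if i: "i < n" for i
  proof (cases i)
   case 0
   have "d (Suc (Suc 0)) \<in> homs ModC (I (Suc 0)) (I (Suc (Suc 0)))" using res i by auto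
   then obtain e2 where e2: "d (Suc (Suc 0)) = mk C (I 1) e2 (I (Suc (Suc 0)))" "is_mod (I (Suc (Suc 0)))"
    "mhom C (I 1) e2 (I (Suc (Suc 0)))" by (auto elim: homs_Mod_cases)
   have "exact ModC (d (Suc 0)) (d (Suc (Suc 0)))" using res i by auto
   then have "exact ModC (mk C (I 0) e1 (I 1)) (mk C (I 1) e2 (I (Suc (Suc 0))))" using e2 e1 by simp
   then show ?thesis using 0 e2 exact_iff[OF mQ e1(2) e2(2) u(1) e2(3)] exact_iff[OF e(3) e1(2) e2(2) e1(3) e2(3)] uimg
    by simp
  next
   case (Suc k)
   then show ?thesis using res i by auto
  qed
  show "is_epi ModC (?d n)"
  proof (cases n)
   case 0
   have "is_epi ModC (d (Suc 0))" using res 0 by simp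
   then show ?thesis using 0 e1 is_epi_iff[OF mQ e1(2) u(1)] is_epi_iff[OF e(3) e1(2) e1(3)] uimg by simp
  next
   case (Suc k)
   then show ?thesis using res by simp
  qed
 qed
 then have "pd_le_1 Q" by (rule Suc.IH)
 then show ?case using pd_le_1_submodule[OF Q inj[OF I(1)]] by blast
qed

lemma proj_dim_le_1:
 fixes X :: "('o, 'm, 'u) cmod"
 assumes "pd_le_1 X"
 shows "proj_dim ModC X \<le> 1"
proof -
 obtain j q and K E :: "('o, 'm, 'u) cmod" where K: "mses C K j E q X" and E: "proj_mod E" "proj_mod K"
  using assms unfolding pd_le_1_def by blast
 note a = msesD[OF K]
 have se: "is_mono ModC (mk C K j E)" "exact ModC (mk C K j E) (mk C E q X)" "is_epi ModC (mk C E q X)"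
  using K short_exact_iff[OF a(1-5)] by (auto simp: short_exact_def)
 let ?P = "case_nat E (%i. K)" and ?d = "case_nat (mk C E q X) (%i. mk C K j E)"
 have "projective_resolution ModC X 1 ?P ?d"
  unfolding projective_resolution_def using se E a
  by (auto simp: projective_iff less_Suc_eq le_Suc_eq split: nat.splits)
 then have "enat 1 \<in> {enat n |n. \<exists>P d. projective_resolution ModC X n P d}" by blast
 then show ?thesis unfolding proj_dim_def one_enat_def by (rule Inf_lower)
qed

lemma inj_dim_le_1:
 fixes X :: "('o, 'm, 'u) cmod"
 assumes "id_le_1 X"
 shows "inj_dim ModC X \<le> 1"
proof -
 obtain j q and E Q :: "('o, 'm, 'u) cmod" where Q: "mses C X j E q Q" and E: "inj_mod E" "inj_mod Q"
  using assms unfolding id_le_1_def by blast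
 note a = msesD[OF Q]
 have se: "is_mono ModC (mk C X j E)" "exact ModC (mk C X j E) (mk C E q Q)" "is_epi ModC (mk C E q Q)"
  using Q short_exact_iff[OF a(1-5)] by (auto simp: short_exact_def)
 let ?I = "case_nat E (%i. Q)" and ?d = "case_nat (mk C X j E) (%i. mk C E q Q)"
 have "injective_resolution ModC X 1 ?I ?d"
  unfolding injective_resolution_def using se E a
  by (auto simp: injective_iff less_Suc_eq le_Suc_eq split: nat.splits)
 then have "enat 1 \<in> {enat n |n. \<exists>I d. injective_resolution ModC X n I d}" by blast
 then show ?thesis unfolding inj_dim_def one_enat_def by (rule Inf_lower)
qed

lemma proj_dim_finite:
 assumes "proj_dim D X < \<infinity>"
 obtains n P d where "projective_resolution D X n P d"
 using assms unfolding proj_dim_def Inf_less_iff by blast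

lemma inj_dim_finite:
 assumes "inj_dim D X < \<infinity>"
 obtains n I d where "injective_resolution D X n I d"
 using assms unfolding inj_dim_def Inf_less_iff by blast

lemma proj_dim_less_1:
 fixes X :: "('o, 'm, 'u) cmod"
 assumes "proj_dim ModC X < 1"
 shows "proj_mod X"
proof -
 obtain n P d where n: "projective_resolution ModC X n P d" "enat n < 1"
  using assms unfolding proj_dim_def Inf_less_iff by blast
 have "n = 0" using n(2) by (simp add: one_enat_def)
 note res = n(1)[unfolded projective_resolution_def \<open>n = 0\<close>]
 have P0: "proj_mod (P 0)" using res by (simp add: projective_iff)
 obtain e where e: "d 0 = mk C (P 0) e X" "is_mod (P 0)" "is_mod X" "mhom C (P 0) e X"
  using res by (auto elim: homs_Mod_cases)
 have surj: "e Y ` el (P 0) Y = el X Y" and inj: "inj_on (e Y) (el (P 0) Y)" if "Y \<in> Ob" for Y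
  using res e that by (auto simp: is_epi_iff is_mono_iff)
 obtain h where h: "mhom C X h (P 0)" "!!Y x. Y \<in> Ob ==> x \<in> el X Y ==> e Y (h Y x) = x"
  using factor_inj[OF e(2,4) inj e(3) mhom_id] surj by blast
 show ?thesis
  unfolding projective_module_def
 proof (intro conjI allI impI e(3))
  fix A B :: "('o, 'm, 'u) cmod" and a f
  assume AB: "is_mod A" "is_mod B" and a: "mhom C A a B" "\<forall>X\<in>Ob. a X ` el A X = el B X" and f: "mhom C X f B"
  obtain g where g: "mhom C (P 0) g A" "!!Y x. Y \<in> Ob ==> x \<in> el (P 0) Y ==> a Y (g Y x) = f Y (e Y x)"
   using projective_moduleD[OF P0 AB a(1) _ mhom_comp[OF e(4) f]] a(2) by blast
  show "\<exists>g. mhom C X g A \<and> (\<forall>Y\<in>Ob. \<forall>x\<in>el X Y. a Y (g Y x) = f Y x)"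
   using mhom_comp[OF h(1) g(1)] g(2) h(2) mhom_closed[OF h(1)] by (intro exI[of _ "%Y x. g Y (h Y x)"]) simp
 qed
qed

lemma inj_dim_less_1:
 fixes X :: "('o, 'm, 'u) cmod"
 assumes "inj_dim ModC X < 1"
 shows "inj_mod X"
proof -
 obtain n I d where n: "injective_resolution ModC X n I d" "enat n < 1"
  using assms unfolding inj_dim_def Inf_less_iff by blast
 have "n = 0" using n(2) by (simp add: one_enat_def)
 note res = n(1)[unfolded injective_resolution_def \<open>n = 0\<close>]
 have I0: "inj_mod (I 0)" using res by (simp add: injective_iff)
 obtain e where e: "d 0 = mk C X e (I 0)" "is_mod X" "is_mod (I 0)" "mhom C X e (I 0)"
  using res by (auto elim: homs_Mod_cases)
 have surj: "e Y ` el X Y = el (I 0) Y" and inj: "inj_on (e Y) (el X Y)" if "Y \<in> Ob" for Y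
  using res e that by (auto simp: is_epi_iff is_mono_iff)
 obtain h where h: "mhom C (I 0) h X" "!!Y x. Y \<in> Ob ==> x \<in> el (I 0) Y ==> e Y (h Y x) = x"
  using factor_inj[OF e(2,4) inj e(3) mhom_id] surj by blast
 have he: "h Y (e Y x) = x" if "Y \<in> Ob" "x \<in> el X Y" for Y x
  using inj_onD[OF inj[OF that(1)]] h(2)[OF that(1)] mhom_closed[OF e(4) that] mhom_closed[OF h(1) that(1)] that by simp
 show ?thesis
  unfolding injective_module_def
 proof (intro conjI allI impI e(2))
  fix A B :: "('o, 'm, 'u) cmod" and a f
  assume AB: "is_mod A" "is_mod B" and a: "mhom C A a B" "\<forall>X\<in>Ob. inj_on (a X) (el A X)" and f: "mhom C A f X"
  obtain g where g: "mhom C B g (I 0)" "!!Y x. Y \<in> Ob ==> x \<in> el A Y ==> g Y (a Y x) = e Y (f Y x)"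
   using injective_moduleD[OF I0 AB a(1) _ mhom_comp[OF f e(4)]] a(2) by blast
  show "\<exists>g. mhom C B g X \<and> (\<forall>Y\<in>Ob. \<forall>x\<in>el A Y. g Y (a Y x) = f Y x)"
   using mhom_comp[OF g(1) h(1)] g(2) he mhom_closed[OF f] by (intro exI[of _ "%Y x. h Y (g Y x)"]) simp
 qed
qed

end

section \<open>Symmetric Frobenius categories\<close>

subsection \<open>Sums over lists in abelian groups\<close>

definition gsum :: "('a, 'z) monoid_scheme => ('i => 'a) => 'i list => 'a" where
 "gsum G f xs = foldr (%i a. f i *[G] a) xs \<one>[G]"

lemma gsum_simps [simp]: "gsum G f [] = \<one>[G]" "gsum G f (i # is) = f i *[G] gsum G f is"
 by (simp_all add: gsum_def)

lemma gsum_closed: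
 assumes "comm_group G" "!!i. i \<in> set is ==> f i \<in> carrier G"
 shows "gsum G f is \<in> carrier G"
proof -
 interpret comm_group G by fact
 show ?thesis using assms(2) by (induction "is") auto
qed

lemma gsum_cong: "(!!i. i \<in> set is ==> f i = g i) ==> gsum G f is = gsum G g is"
 by (induction "is") auto

lemma gsum_hom:
 assumes "comm_group G" "comm_group H" "h \<in> hom G H" "!!i. i \<in> set is ==> f i \<in> carrier G"
 shows "h (gsum G f is) = gsum H (%i. h (f i)) is"
 using assms(4)
proof (induction "is")
 case Nil
 then show ?case using assms by (simp add: hom_oneD)
next
 case (Cons i "is")
 then show ?case using hom_mult[OF assms(3)] gsum_closed[OF assms(1), of "is" f] by simp
qed

lemma gsum_mult:
 assumes "comm_group G" "!!i. i \<in> set is ==> f i \<in> carrier G" "!!i. i \<in> set is ==> g i \<in> carrier G"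
 shows "gsum G (%i. f i *[G] g i) is = gsum G f is *[G] gsum G g is"
 using assms(2,3)
proof (induction "is")
 case Nil
 interpret comm_group G by fact
 show ?case by simp
next
 case (Cons i "is")
 interpret comm_group G by fact
 show ?case using Cons gsum_closed[OF assms(1), of "is" f] gsum_closed[OF assms(1), of "is" g] by (simp add: m_ac)
qed

lemma gsum_one:
 assumes "comm_group G" "!!i. i \<in> set is ==> f i = \<one>[G]"
 shows "gsum G f is = \<one>[G]"
proof -
 interpret comm_group G by fact
 show ?thesis using assms(2) by (induction "is") auto
qed

lemma gsum_swap:
 assumes "comm_group G" "!!i j. i \<in> set is ==> j \<in> set js ==> f i j \<in> carrier G"
 shows "gsum G (%i. gsum G (f i) js) is = gsum G (%j. gsum G (%i. f i j) is) js"
 using assms(2)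
proof (induction "is")
 case Nil
 then show ?case using gsum_one[OF assms(1), of js "%j. \<one>[G]"] by simp
next
 case (Cons i "is")
 have "gsum G (%j. f i j *[G] gsum G (%i. f i j) is) js = gsum G (f i) js *[G] gsum G (%j. gsum G (%i. f i j) is) js"
  using Cons.prems by (intro gsum_mult[OF assms(1)] gsum_closed[OF assms(1)]) auto
 then show ?case using Cons by simp
qed

lemma gsum_filter:
 assumes "comm_group G" "!!i. i \<in> set is ==> P i ==> f i \<in> carrier G"
 shows "gsum G f (filter P is) = gsum G (%i. if P i then f i else \<one>[G]) is"
proof -
 interpret comm_group G by fact
 show ?thesis using assms(2)
 proof (induction "is")
  case (Cons i "is")
  then show ?case using gsum_closed[OF assms(1), of "is" "%i. if P i then f i else \<one>[G]"] by auto
 qed simp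
qed

subsection \<open>Coinduced modules\<close>

text \<open>The pairs \<open>(e, f)\<close> in \<open>cas Y\<close> are dual bases for the trace form:
 \<open>e\<close> runs through arrows \<open>Y \<rightarrow> X\<close> and \<open>f\<close> through arrows \<open>X
 \<rightarrow> Y\<close>, for all \<open>X\<close> together. By the last two assumptions every arrow is a combination
 of one basis, and its coefficients are traces against the other one. The groups \<open>hg X Y\<close> give the arrows
 the operations of \<open>HOL-Algebra\<close>.\<close>

locale frobenius_category = linear_category C for C :: "('o, 'm) lin_cat" +
 fixes hg :: "'o => 'o => 'm monoid" and tr :: "'m => int" and cas :: "'o => ('m \<times> 'm) list"
 assumes hg: "[|X \<in> Obj C; Y \<in> Obj C|] ==> comm_group (hg X Y)"
  and hg_carrier: "[|X \<in> Obj C; Y \<in> Obj C|] ==> carrier (hg X Y) = homs C X Y"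
  and hg_mult: "[|X \<in> Obj C; Y \<in> Obj C; f \<in> homs C X Y; g \<in> homs C X Y|] ==> f *[hg X Y] g = Add C f g"
  and Comp_Add_left: "[|f \<in> homs C X Y; g \<in> homs C Y Z; h \<in> homs C Y Z|]
   ==> Comp C (Add C g h) f = Add C (Comp C g f) (Comp C h f)"
  and Comp_Add_right: "[|f \<in> homs C X Y; g \<in> homs C X Y; h \<in> homs C Y Z|]
   ==> Comp C h (Add C f g) = Add C (Comp C h f) (Comp C h g)"
  and tr_Add: "[|f \<in> homs C X X; g \<in> homs C X X|] ==> tr (Add C f g) = tr f + tr g"
  and tr_comm: "[|f \<in> homs C X Y; g \<in> homs C Y X|] ==> tr (Comp C g f) = tr (Comp C f g)"
  and cas_arr: "[|Y \<in> Obj C; (e, f) \<in> set (cas Y)|]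
   ==> e \<in> Arr C \<and> f \<in> Arr C \<and> Dom C e = Y \<and> Cod C f = Y \<and> Cod C e = Dom C f"
  and cas_left: "f \<in> homs C X Y
   ==> gsum (hg X Y) (%(e, f'). f' ^[hg X Y] tr (Comp C e f)) (filter (%(e, f'). Dom C f' = X) (cas Y)) = f"
  and cas_right: "g \<in> homs C Y X
   ==> gsum (hg Y X) (%(e, f'). e ^[hg Y X] tr (Comp C f' g)) (filter (%(e, f'). Dom C f' = X) (cas Y)) = g"
begin

definition into :: "'o => 'm set" where
 "into Y = {f \<in> Ar. cod f = Y}"

text \<open>Coinduction is right adjoint to the passage from a module to the family of its groups: an element over
 \<open>Y\<close> assigns to each arrow \<open>X \<rightarrow> Y\<close> an element of \<open>B X\<close>,
 additively.\<close>

definition coind_car :: "('o => ('b, 'z) monoid_scheme) => 'o => ('m => 'b) set" where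
 "coind_car B Y = {\<phi> \<in> extensional (into Y). (\<forall>f\<in>into Y. \<phi> f \<in> carrier (B (dom f))) \<and>
   (\<forall>f\<in>into Y. \<forall>g\<in>into Y. dom f = dom g --> \<phi> (Add C f g) = \<phi> f *[B (dom f)] \<phi> g)}"

definition coind :: "('o => ('b, 'z) monoid_scheme) => ('o, 'm, 'm => 'b) cmod" where
 "coind B = \<lparr>Grp = (%Y. \<lparr>carrier = coind_car B Y,
    monoid.mult = (%\<phi> \<psi>. \<lambda>f\<in>into Y. \<phi> f *[B (dom f)] \<psi> f), one = (\<lambda>f\<in>into Y. \<one>[B (dom f)])\<rparr>),
   Act = (%h \<phi>. \<lambda>f\<in>into (dom h). \<phi> (Comp C h f))\<rparr>"

lemma coind_simps [simp]:
 "el (coind B) Y = coind_car B Y"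
 "\<phi> +[coind B,Y] \<psi> = (\<lambda>f\<in>into Y. \<phi> f *[B (dom f)] \<psi> f)"
 "\<zero>[coind B,Y] = (\<lambda>f\<in>into Y. \<one>[B (dom f)])"
 "Act (coind B) h \<phi> = (\<lambda>f\<in>into (dom h). \<phi> (Comp C h f))"
 by (simp_all add: coind_def)

lemma intoD: "f \<in> into Y ==> f \<in> Ar" "f \<in> into Y ==> cod f = Y" "f \<in> into Y ==> dom f \<in> Ob"
 by (auto simp: into_def)

lemma into_homs: "f \<in> into Y ==> f \<in> homs C (dom f) Y"
 by (simp add: into_def homs_def)

lemma homsD: "f \<in> homs C X Y ==> f \<in> Ar" "f \<in> homs C X Y ==> dom f = X" "f \<in> homs C X Y ==> cod f = Y"
  "f \<in> homs C X Y ==> X \<in> Ob" "f \<in> homs C X Y ==> Y \<in> Ob"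
 by (auto simp: homs_def)

lemma homs_into: "f \<in> homs C X Y ==> f \<in> into Y"
 by (auto simp: into_def homs_def)

lemma into_Comp: "f \<in> into (dom h) ==> h \<in> Ar ==> Comp C h f \<in> into (cod h)"
 by (simp add: into_def)

lemma into_Add: "f \<in> into Y ==> g \<in> into Y ==> dom f = dom g ==> Add C f g \<in> into Y"
 by (simp add: into_def)

lemma coind_carD:
 assumes "\<phi> \<in> coind_car B Y"
 shows "f \<in> into Y ==> \<phi> f \<in> carrier (B (dom f))"
  "[|f \<in> into Y; g \<in> into Y; dom f = dom g|] ==> \<phi> (Add C f g) = \<phi> f *[B (dom f)] \<phi> g"
  "\<phi> \<in> extensional (into Y)"
 using assms by (auto simp: coind_car_def)

lemma coind_carI:
 assumes "\<phi> \<in> extensional (into Y)" "!!f. f \<in> into Y ==> \<phi> f \<in> carrier (B (dom f))"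
  "!!f g. f \<in> into Y ==> g \<in> into Y ==> dom f = dom g ==> \<phi> (Add C f g) = \<phi> f *[B (dom g)] \<phi> g"
 shows "\<phi> \<in> coind_car B Y"
 using assms by (simp add: coind_car_def)

lemma coind_eqI:
 "[|\<phi> \<in> extensional (into Y); \<psi> \<in> extensional (into Y); !!f. f \<in> into Y ==> \<phi> f = \<psi> f|] ==> \<phi> = \<psi>"
 by (rule extensionalityI)

lemma coind_act_closed:
 assumes h: "h \<in> Ar" and \<phi>: "\<phi> \<in> coind_car B (cod h)"
 shows "(\<lambda>f\<in>into (dom h). \<phi> (Comp C h f)) \<in> coind_car B (dom h)"
proof (rule coind_carI)
 fix f assume f: "f \<in> into (dom h)"
 then show "(\<lambda>f\<in>into (dom h). \<phi> (Comp C h f)) f \<in> carrier (B (dom f))"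
  using coind_carD(1)[OF \<phi> into_Comp[OF f h]] h by (simp add: intoD)
next
 fix f g assume fg: "f \<in> into (dom h)" "g \<in> into (dom h)" "dom f = dom g"
 have hh: "h \<in> homs C (dom h) (cod h)" using h by (simp add: homs_def)
 have "Comp C h (Add C f g) = Add C (Comp C h f) (Comp C h g)"
  using Comp_Add_right[OF _ into_homs[OF fg(2)] hh] into_homs[OF fg(1)] fg(3) by simp
 then show "(\<lambda>f\<in>into (dom h). \<phi> (Comp C h f)) (Add C f g) =
   (\<lambda>f\<in>into (dom h). \<phi> (Comp C h f)) f *[B (dom g)] (\<lambda>f\<in>into (dom h). \<phi> (Comp C h f)) g"
  using coind_carD(2)[OF \<phi> into_Comp[OF fg(1) h] into_Comp[OF fg(2) h]] fg h into_Add[OF fg] by (simp add: intoD)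
qed simp

lemma subgroup_coind_car:
 assumes B: "!!X. X \<in> Ob ==> comm_group (B X)"
 shows "subgroup (coind_car B Y) (product_group (into Y) (%f. B (dom f)))"
proof -
 have Bf: "comm_group (B (dom f))" if "f \<in> into Y" for f using B that by (simp add: intoD)
 have "group (product_group (into Y) (%f. B (dom f)))" using Bf by (simp add: comm_groupD)
 then show ?thesis
 proof (rule group.subgroupI)
  show "coind_car B Y \<subseteq> carrier (product_group (into Y) (%f. B (dom f)))"
   by (auto simp: coind_car_def PiE_def)
  have "(\<lambda>f\<in>into Y. \<one>[B (dom f)]) \<in> coind_car B Y"
   using Bf into_Add by (intro coind_carI) (simp_all add: comm_groupD monoid.one_closed monoid.l_one intoD)
  then show "coind_car B Y \<noteq> {}" by blast
  fix \<phi> assume \<phi>: "\<phi> \<in> coind_car B Y"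
  have "(\<lambda>f\<in>into Y. inv[B (dom f)] \<phi> f) \<in> coind_car B Y"
  proof (rule coind_carI)
   fix f g assume fg: "f \<in> into Y" "g \<in> into Y" "dom f = dom g"
   interpret comm_group "B (dom g)" using Bf[OF fg(2)] .
   show "(\<lambda>f\<in>into Y. inv[B (dom f)] \<phi> f) (Add C f g) =
     (\<lambda>f\<in>into Y. inv[B (dom f)] \<phi> f) f *[B (dom g)] (\<lambda>f\<in>into Y. inv[B (dom f)] \<phi> f) g"
    using fg into_Add[OF fg] coind_carD(1)[OF \<phi> fg(1)] coind_carD(1)[OF \<phi> fg(2)] coind_carD(2)[OF \<phi> fg]
    by (simp add: intoD inv_mult)
  qed (use Bf coind_carD(1)[OF \<phi>] in \<open>simp_all add: comm_groupD group.inv_closed\<close>)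
  moreover have "\<phi> \<in> (\<Pi>\<^sub>E f\<in>into Y. carrier (B (dom f)))" using \<phi> by (auto simp: coind_car_def PiE_def)
  ultimately show "inv[product_group (into Y) (%f. B (dom f))] \<phi> \<in> coind_car B Y"
   using Bf by (simp add: comm_groupD)
  fix \<psi> assume \<psi>: "\<psi> \<in> coind_car B Y"
  have "(\<lambda>f\<in>into Y. \<phi> f *[B (dom f)] \<psi> f) \<in> coind_car B Y"
  proof (rule coind_carI)
   fix f g assume fg: "f \<in> into Y" "g \<in> into Y" "dom f = dom g"
   interpret comm_group "B (dom g)" using Bf[OF fg(2)] .
   show "(\<lambda>f\<in>into Y. \<phi> f *[B (dom f)] \<psi> f) (Add C f g) =
     (\<lambda>f\<in>into Y. \<phi> f *[B (dom f)] \<psi> f) f *[B (dom g)] (\<lambda>f\<in>into Y. \<phi> f *[B (dom f)] \<psi> f) g"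
    using fg into_Add[OF fg] coind_carD(1)[OF \<phi> fg(1)] coind_carD(1)[OF \<psi> fg(1)] coind_carD(1)[OF \<phi> fg(2)]
     coind_carD(1)[OF \<psi> fg(2)] coind_carD(2)[OF \<phi> fg] coind_carD(2)[OF \<psi> fg]
    by (simp add: intoD m_ac)
  qed (use Bf coind_carD(1)[OF \<phi>] coind_carD(1)[OF \<psi>] in \<open>simp_all add: comm_groupD monoid.m_closed\<close>)
  then show "\<phi> *[product_group (into Y) (%f. B (dom f))] \<psi> \<in> coind_car B Y" by simp
 qed
qed

lemma comm_group_coind:
 assumes B: "!!X. X \<in> Ob ==> comm_group (B X)"
 shows "comm_group (Grp (coind B) Y)"
proof -
 let ?P = "product_group (into Y) (%f. B (dom f))"
 have Bf: "comm_group (B (dom f))" if "f \<in> into Y" for f using B that by (simp add: intoD)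
 have "comm_group ?P"
 proof (rule group.group_comm_groupI)
  show "group ?P" using Bf by (simp add: comm_groupD)
  show "x *[?P] y = y *[?P] x" if "x \<in> carrier ?P" "y \<in> carrier ?P" for x y
   using that unfolding carrier_product_group mult_product_group
   by (intro restrict_ext comm_monoid.m_comm[OF comm_groupD(3)[OF Bf]]) (auto simp: PiE_mem)
 qed
 moreover have "Grp (coind B) Y = ?P\<lparr>carrier := coind_car B Y\<rparr>"
  by (simp add: coind_def product_group_def)
 ultimately show ?thesis using subgroup_comm_group[OF _ subgroup_coind_car[of B Y, OF B]] by simp
qed

lemma is_module_coind:
 assumes B: "!!X. X \<in> Ob ==> comm_group (B X)"
 shows "is_mod (coind B)"
 unfolding is_module_def
proof (intro conjI ballI impI)
 show "comm_group (Grp (coind B) Y)" for Y using B by (rule comm_group_coind)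
next
 fix h assume h: "h \<in> Ar"
 show "Act (coind B) h \<in> hom (Grp (coind B) (cod h)) (Grp (coind B) (dom h))"
 proof (rule homI)
  show "Act (coind B) h \<phi> \<in> el (coind B) (dom h)" if "\<phi> \<in> el (coind B) (cod h)" for \<phi>
   using coind_act_closed[OF h] that by simp
  show "Act (coind B) h (\<phi> +[coind B,cod h] \<psi>) = Act (coind B) h \<phi> +[coind B,dom h] Act (coind B) h \<psi>" for \<phi> \<psi>
   using h by (auto intro!: restrict_ext simp: into_Comp intoD)
 qed
next
 fix Y \<phi> assume Y: "Y \<in> Ob" and "\<phi> \<in> el (coind B) Y"
 then have \<phi>: "\<phi> \<in> coind_car B Y" by simp
 show "Act (coind B) (Id C Y) \<phi> = \<phi>"
  unfolding coind_simps using Y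
 proof (intro coind_eqI[OF _ coind_carD(3)[OF \<phi>]])
  fix f assume f: "f \<in> into Y"
  have "Comp C (Id C Y) f = f" using Comp_Id(2)[of f] f by (simp add: intoD)
  then show "(\<lambda>f\<in>into (dom (Id C Y)). \<phi> (Comp C (Id C Y) f)) f = \<phi> f" using f Y by simp
 qed simp
next
 fix f g \<phi> assume *: "f \<in> Ar" "g \<in> Ar" "cod f = dom g" "\<phi> \<in> el (coind B) (cod g)"
 show "Act (coind B) (Comp C g f) \<phi> = Act (coind B) f (Act (coind B) g \<phi>)"
  unfolding coind_simps using *
  by (auto intro!: restrict_ext simp: Comp_assoc into_def)
next
 fix f g \<phi> assume *: "f \<in> Ar" "g \<in> Ar" "dom f = dom g" "cod f = cod g" "\<phi> \<in> el (coind B) (cod f)"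
 then have \<phi>: "\<phi> \<in> coind_car B (cod g)" by simp
 have fg: "f \<in> homs C (dom g) (cod g)" "g \<in> homs C (dom g) (cod g)" using * by (auto simp: homs_def)
 have "\<phi> (Comp C (Add C f g) k) = \<phi> (Comp C f k) *[B (dom k)] \<phi> (Comp C g k)" if k: "k \<in> into (dom g)" for k
 proof -
  have c: "Comp C f k \<in> into (cod g)" "Comp C g k \<in> into (cod g)" using k * by (auto simp: into_def)
  have "Comp C (Add C f g) k = Add C (Comp C f k) (Comp C g k)" using Comp_Add_left[OF into_homs[OF k] fg] .
  then show ?thesis using coind_carD(2)[OF \<phi> c] k * by (simp add: intoD)
 qed
 then show "Act (coind B) (Add C f g) \<phi> = Act (coind B) f \<phi> +[coind B,dom f] Act (coind B) g \<phi>"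
  unfolding coind_simps using * by (auto intro!: restrict_ext)
qed

lemma coind_hom:
 assumes \<phi>: "\<phi> \<in> coind_car B Y" and X: "X \<in> Ob" and Y: "Y \<in> Ob"
 shows "\<phi> \<in> hom (hg X Y) (B X)"
proof (rule homI)
 fix f assume "f \<in> carrier (hg X Y)"
 then have f: "f \<in> homs C X Y" by (simp add: hg_carrier[OF X Y])
 show "\<phi> f \<in> carrier (B X)" using coind_carD(1)[OF \<phi> homs_into[OF f]] homsD[OF f] by simp
next
 fix f g assume "f \<in> carrier (hg X Y)" "g \<in> carrier (hg X Y)"
 then have f: "f \<in> homs C X Y" and g: "g \<in> homs C X Y" by (auto simp: hg_carrier[OF X Y])
 show "\<phi> (f *[hg X Y] g) = \<phi> f *[B X] \<phi> g"
  using coind_carD(2)[OF \<phi> homs_into[OF f] homs_into[OF g]] homsD(2)[OF f] homsD(2)[OF g]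
  by (simp add: hg_mult[OF X Y f g])
qed

lemma cas_homs:
 assumes "Y \<in> Ob" "(e, f) \<in> set (cas Y)"
 shows "e \<in> homs C Y (dom f)" "f \<in> homs C (dom f) Y" "dom f \<in> Ob"
 using cas_arr[OF assms] by (auto simp: homs_def)

text \<open>An additive function on arrows is determined by its values on a dual basis.\<close>

lemma additive_expand:
 assumes H: "comm_group H" and G: "comm_group G" and \<phi>: "\<phi> \<in> hom H G"
  and c: "!!i. i \<in> set is ==> P i ==> c i \<in> carrier H"
 shows "gsum G (%i. if P i then \<phi> (c i) ^[G] (k i :: int) else \<one>[G]) is = \<phi> (gsum H (%i. c i ^[H] k i) (filter P is))"
proof -
 interpret H: comm_group H by fact
 interpret G: comm_group G by fact
 have "\<phi> (gsum H (%i. c i ^[H] k i) (filter P is)) = gsum G (%i. \<phi> (c i ^[H] k i)) (filter P is)"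
  using c by (intro gsum_hom[OF H G \<phi>]) auto
 also have "\<dots> = gsum G (%i. \<phi> (c i) ^[G] k i) (filter P is)"
  using c hom_int_pow[OF \<phi> _ H.is_group G.is_group] by (intro gsum_cong) auto
 also have "\<dots> = gsum G (%i. if P i then \<phi> (c i) ^[G] k i else \<one>[G]) is"
  using c hom_in_carrier[OF \<phi>] by (intro gsum_filter[OF G]) auto
 finally show ?thesis ..
qed

lemma additive_expand_left:
 assumes G: "comm_group G" and f: "f \<in> homs C X Y" and \<phi>: "\<phi> \<in> hom (hg X Y) G"
 shows "gsum G (%(e, f'). if dom f' = X then \<phi> f' ^[G] tr (Comp C e f) else \<one>[G]) (cas Y) = \<phi> f"
proof -
 have X: "X \<in> Ob" "Y \<in> Ob" using f by (auto simp: homsD)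
 have "snd i \<in> carrier (hg X Y)" if "i \<in> set (cas Y)" "dom (snd i) = X" for i
  using cas_homs(2)[OF X(2), of "fst i" "snd i"] that by (simp add: hg_carrier[OF X])
 then show ?thesis
  using additive_expand[OF hg[OF X] G \<phi>, of "cas Y" "%i. dom (snd i) = X" snd "%i. tr (Comp C (fst i) f)"] cas_left[OF f]
  unfolding split_def by simp
qed

lemma additive_expand_right:
 assumes G: "comm_group G" and g: "g \<in> homs C Y X" and \<phi>: "\<phi> \<in> hom (hg Y X) G"
 shows "gsum G (%(e, f'). if dom f' = X then \<phi> e ^[G] tr (Comp C f' g) else \<one>[G]) (cas Y) = \<phi> g"
proof -
 have X: "Y \<in> Ob" "X \<in> Ob" using g by (auto simp: homsD)
 have "fst i \<in> carrier (hg Y X)" if "i \<in> set (cas Y)" "dom (snd i) = X" for i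
  using cas_homs(1)[OF X(1), of "fst i" "snd i"] that by (simp add: hg_carrier[OF X])
 then show ?thesis
  using additive_expand[OF hg[OF X] G \<phi>, of "cas Y" "%i. dom (snd i) = X" fst "%i. tr (Comp C (snd i) g)"] cas_right[OF g]
  unfolding split_def by simp
qed

text \<open>An element is determined by its values on the finitely many arrows in \<open>cas Y\<close>.\<close>

lemma coind_lepoll:
 fixes B :: "'o => ('b, 'z) monoid_scheme"
 assumes B: "!!X. X \<in> Ob ==> comm_group (B X)" and Y: "Y \<in> Ob"
  and inf: "infinite (UNIV :: 'u set)" and card: "!!X. X \<in> Ob ==> carrier (B X) \<lesssim> (UNIV :: 'u set)"
 shows "coind_car B Y \<lesssim> (UNIV :: 'u set)"
proof -
 let ?S = "snd ` set (cas Y)"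
 let ?T = "\<Union>f\<in>?S. {f} \<times> carrier (B (dom f))"
 let ?g = "%\<phi>. (%f. (f, \<phi> f)) ` ?S"
 have S: "f \<in> into Y" "dom f \<in> Ob" if "f \<in> ?S" for f using that cas_homs[OF Y] homs_into by fastforce+
 have "inj_on ?g (coind_car B Y)"
 proof (rule inj_onI)
  fix \<phi> \<psi> assume \<phi>: "\<phi> \<in> coind_car B Y" and \<psi>: "\<psi> \<in> coind_car B Y" and eq: "?g \<phi> = ?g \<psi>"
  have eq': "\<phi> f = \<psi> f" if "f \<in> ?S" for f
  proof -
   have "(f, \<phi> f) \<in> ?g \<psi>" using that eq by blast
   then show ?thesis by auto
  qed
  show "\<phi> = \<psi>"
  proof (rule coind_eqI[OF coind_carD(3)[OF \<phi>] coind_carD(3)[OF \<psi>]])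
   fix f assume f: "f \<in> into Y"
   note X = intoD(3)[OF f]
   have "\<phi> f = gsum (B (dom f)) (%(e, f'). if dom f' = dom f then \<phi> f' ^[B (dom f)] tr (Comp C e f) else \<one>[B (dom f)]) (cas Y)"
    using additive_expand_left[OF B[OF X] into_homs[OF f] coind_hom[OF \<phi> X Y]] by simp
   also have "\<dots> = gsum (B (dom f)) (%(e, f'). if dom f' = dom f then \<psi> f' ^[B (dom f)] tr (Comp C e f) else \<one>[B (dom f)]) (cas Y)"
    using eq' by (intro gsum_cong) force
   also have "\<dots> = \<psi> f"
    using additive_expand_left[OF B[OF X] into_homs[OF f] coind_hom[OF \<psi> X Y]] by simp
   finally show "\<phi> f = \<psi> f" .
  qed
 qed
 moreover have "?g ` coind_car B Y \<subseteq> Fpow ?T"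
   proof (rule image_subsetI)
  fix \<phi> assume \<phi>: "\<phi> \<in> coind_car B Y"
  have "?g \<phi> \<subseteq> ?T" using coind_carD(1)[OF \<phi> S(1)] by blast
  then show "?g \<phi> \<in> Fpow ?T" by (simp add: Fpow_def)
 qed
 ultimately have "coind_car B Y \<lesssim> Fpow ?T" unfolding lepoll_def by blast
 also have "\<dots> \<lesssim> (UNIV :: 'u set)"
 proof (rule lepoll_Fpow_infinite[OF inf])
  have "\<forall>f\<in>?S. \<exists>r :: 'b => 'u. inj_on r (carrier (B (dom f)))" using card S by (auto simp: lepoll_def)
  then obtain r :: "'m => 'b => 'u" where r: "!!f. f \<in> ?S ==> inj_on (r f) (carrier (B (dom f)))" by metis
  have "inj_on (%(f, b). (f, r f b)) ?T"
  proof (rule inj_onI)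
   fix p q assume p: "p \<in> ?T" and q: "q \<in> ?T" and "(%(f, b). (f, r f b)) p = (%(f, b). (f, r f b)) q"
   then have "fst p = fst q" "r (fst p) (snd p) = r (fst p) (snd q)" by (auto simp: case_prod_unfold)
   moreover have "fst p \<in> ?S" using p by force
   moreover have "snd p \<in> carrier (B (dom (fst p)))" using p by auto
   moreover have "snd q \<in> carrier (B (dom (fst p)))" using q \<open>fst p = fst q\<close> by auto
   ultimately show "p = q" using inj_onD[OF r[of "fst p"]] by (simp add: prod_eq_iff)
  qed
  then have "?T \<lesssim> ?S \<times> (UNIV :: 'u set)" unfolding lepoll_def by (intro exI[of _ "%(f, b). (f, r f b)"]) auto
  moreover have "?S \<lesssim> (UNIV :: 'u set)" using inf by (intro countable_lepoll_infinite) (auto simp: countable_finite)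
  ultimately show "?T \<lesssim> (UNIV :: 'u set)"
   using lepoll_trans[OF _ lepoll_Times_infinite[OF inf _ lepoll_refl]] by blast
 qed
 finally show ?thesis .
qed

definition coind_map :: "('o => 'a => 'b) => 'o => ('m => 'a) => 'm => 'b" where
 "coind_map \<beta> Y \<phi> = (\<lambda>f\<in>into Y. \<beta> (dom f) (\<phi> f))"

lemma mhom_coind_map:
 assumes \<beta>: "!!X. X \<in> Ob ==> \<beta> X \<in> hom (A X) (B X)"
 shows "mhom C (coind A) (coind_map \<beta>) (coind B)"
proof (rule mhomI)
 fix Y \<phi> assume Y: "Y \<in> Ob" and "\<phi> \<in> el (coind A) Y"
 then have \<phi>: "\<phi> \<in> coind_car A Y" by simp
 have "coind_map \<beta> Y \<phi> \<in> coind_car B Y"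
 proof (rule coind_carI)
  fix f assume f: "f \<in> into Y"
  show "coind_map \<beta> Y \<phi> f \<in> carrier (B (dom f))"
   using f hom_in_carrier[OF \<beta>[OF intoD(3)[OF f]] coind_carD(1)[OF \<phi> f]] by (simp add: coind_map_def)
 next
  fix f g assume fg: "f \<in> into Y" "g \<in> into Y" "dom f = dom g"
  show "coind_map \<beta> Y \<phi> (Add C f g) = coind_map \<beta> Y \<phi> f *[B (dom g)] coind_map \<beta> Y \<phi> g"
   using fg into_Add[OF fg] coind_carD(1)[OF \<phi> fg(1)] coind_carD(1)[OF \<phi> fg(2)] coind_carD(2)[OF \<phi> fg]
    hom_mult[OF \<beta>[OF intoD(3)[OF fg(2)]]] by (simp add: coind_map_def intoD)
 qed (simp add: coind_map_def)
 then show "coind_map \<beta> Y \<phi> \<in> el (coind B) Y" by simp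
next
 fix Y \<phi> \<psi> assume Y: "Y \<in> Ob" and "\<phi> \<in> el (coind A) Y" "\<psi> \<in> el (coind A) Y"
 then have \<phi>: "\<phi> \<in> coind_car A Y" and \<psi>: "\<psi> \<in> coind_car A Y" by auto
 show "coind_map \<beta> Y (\<phi> +[coind A,Y] \<psi>) = coind_map \<beta> Y \<phi> +[coind B,Y] coind_map \<beta> Y \<psi>"
  unfolding coind_simps coind_map_def
 proof (rule restrict_ext)
  fix f assume f: "f \<in> into Y"
  show "\<beta> (dom f) ((\<lambda>f\<in>into Y. \<phi> f *[A (dom f)] \<psi> f) f) =
    (\<lambda>f\<in>into Y. \<beta> (dom f) (\<phi> f)) f *[B (dom f)] (\<lambda>f\<in>into Y. \<beta> (dom f) (\<psi> f)) f"
   using f hom_mult[OF \<beta>[OF intoD(3)[OF f]] coind_carD(1)[OF \<phi> f] coind_carD(1)[OF \<psi> f]] by simp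
 qed
next
 fix h \<phi> assume h: "h \<in> Ar" and "\<phi> \<in> el (coind A) (cod h)"
 show "coind_map \<beta> (dom h) (Act (coind A) h \<phi>) = Act (coind B) h (coind_map \<beta> (cod h) \<phi>)"
  unfolding coind_simps coind_map_def using h
  by (auto intro!: restrict_ext simp: into_Comp intoD)
qed

text \<open>Preimages are chosen on the dual basis only and are extended additively through the trace.\<close>

lemma coind_map_surj:
 assumes A: "!!X. X \<in> Ob ==> comm_group (A X)" and B: "!!X. X \<in> Ob ==> comm_group (B X)"
  and \<beta>: "!!X. X \<in> Ob ==> \<beta> X \<in> hom (A X) (B X)" "!!X. X \<in> Ob ==> \<beta> X ` carrier (A X) = carrier (B X)"
  and Y: "Y \<in> Ob" and \<psi>: "\<psi> \<in> coind_car B Y"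
 shows "\<exists>\<phi>\<in>coind_car A Y. coind_map \<beta> Y \<phi> = \<psi>"
proof -
 define b where "b f = inv_into (carrier (A (dom f))) (\<beta> (dom f)) (\<psi> f)" for f
 have b: "b f \<in> carrier (A (dom f))" "\<beta> (dom f) (b f) = \<psi> f" if "f \<in> into Y" for f
  using coind_carD(1)[OF \<psi> that] \<beta>(2)[OF intoD(3)[OF that]] by (auto simp: b_def inv_into_into f_inv_into_f)
 define \<phi>' where "\<phi>' f = gsum (A (dom f)) (%(e, f'). if dom f' = dom f then b f' ^[A (dom f)] tr (Comp C e f) else \<one>[A (dom f)]) (cas Y)" for f
 have casb: "b f' \<in> carrier (A X)" "f' \<in> into Y" if "(e, f') \<in> set (cas Y)" "dom f' = X" for e f' X
  using b(1) homs_into[OF cas_homs(2)[OF Y that(1)]] that(2) by auto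
 have c: "\<phi>' f \<in> carrier (A (dom f))" if f: "f \<in> into Y" for f
 proof -
  interpret comm_group "A (dom f)" using A[OF intoD(3)[OF f]] .
  show ?thesis unfolding \<phi>'_def using casb by (intro gsum_closed[OF comm_group_axioms]) auto
 qed
 have add: "\<phi>' (Add C f g) = \<phi>' f *[A (dom g)] \<phi>' g" if fg: "f \<in> into Y" "g \<in> into Y" "dom f = dom g" for f g
 proof -
  note X = intoD(3)[OF fg(2)]
  interpret comm_group "A (dom g)" using A[OF X] .
  have "\<phi>' (Add C f g) = gsum (A (dom g)) (%i. (case i of (e, f') => if dom f' = dom g then b f' ^[A (dom g)] tr (Comp C e f) else \<one>[A (dom g)]) *[A (dom g)]
    (case i of (e, f') => if dom f' = dom g then b f' ^[A (dom g)] tr (Comp C e g) else \<one>[A (dom g)])) (cas Y)"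
   unfolding \<phi>'_def
  proof (simp only: Add_arr[OF intoD(1)[OF fg(1)] intoD(1)[OF fg(2)] fg(3)] intoD(2)[OF fg(1)] intoD(2)[OF fg(2)], intro gsum_cong)
   fix i assume i: "i \<in> set (cas Y)"
   obtain e f' where ef: "i = (e, f')" by force
   have e: "e \<in> homs C Y (dom f')" using cas_homs(1)[OF Y] i ef by simp
   show "(case i of (e, f') => if dom f' = dom g then b f' ^[A (dom g)] tr (Comp C e (Add C f g)) else \<one>[A (dom g)]) =
    (case i of (e, f') => if dom f' = dom g then b f' ^[A (dom g)] tr (Comp C e f) else \<one>[A (dom g)]) *[A (dom g)]
    (case i of (e, f') => if dom f' = dom g then b f' ^[A (dom g)] tr (Comp C e g) else \<one>[A (dom g)])"
   proof (cases "dom f' = dom g")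
    case True
    have h: "f \<in> homs C (dom g) Y" "g \<in> homs C (dom g) Y" "e \<in> homs C Y (dom g)"
     using into_homs[OF fg(1)] into_homs[OF fg(2)] fg(3) e True by auto
    have "tr (Comp C e (Add C f g)) = tr (Comp C e f) + tr (Comp C e g)"
     using Comp_Add_right[OF h] tr_Add[of "Comp C e f" "dom g" "Comp C e g"] h by (simp add: homs_def)
    then show ?thesis using True ef casb[of e f'] i by (simp add: int_pow_mult)
   qed (simp add: ef)
  qed
  also have "\<dots> = \<phi>' f *[A (dom g)] \<phi>' g"
   unfolding \<phi>'_def fg(3) using casb by (intro gsum_mult[OF comm_group_axioms]) auto
  finally show ?thesis .
 qed
 let ?\<phi> = "restrict \<phi>' (into Y)"
 have "?\<phi> \<in> coind_car A Y"
  using c add into_Add by (intro coind_carI) auto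
 moreover have "coind_map \<beta> Y ?\<phi> = \<psi>"
  unfolding coind_map_def
 proof (rule coind_eqI[OF _ coind_carD(3)[OF \<psi>]])
  fix f assume f: "f \<in> into Y"
  note X = intoD(3)[OF f]
  interpret A: comm_group "A (dom f)" using A[OF X] .
  interpret B: comm_group "B (dom f)" using B[OF X] .
  have "\<beta> (dom f) (\<phi>' f) = gsum (B (dom f)) (%i. \<beta> (dom f) (case i of (e, f') => if dom f' = dom f then b f' ^[A (dom f)] tr (Comp C e f) else \<one>[A (dom f)])) (cas Y)"
   unfolding \<phi>'_def by (rule gsum_hom[OF A.comm_group_axioms B.comm_group_axioms \<beta>(1)[OF X]]) (use casb in auto)
  also have "\<dots> = gsum (B (dom f)) (%(e, f'). if dom f' = dom f then \<psi> f' ^[B (dom f)] tr (Comp C e f) else \<one>[B (dom f)]) (cas Y)"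
  proof (rule gsum_cong)
   fix i assume i: "i \<in> set (cas Y)"
   obtain e f' where ef: "i = (e, f')" by force
   show "\<beta> (dom f) (case i of (e, f') => if dom f' = dom f then b f' ^[A (dom f)] tr (Comp C e f) else \<one>[A (dom f)]) =
    (case i of (e, f') => if dom f' = dom f then \<psi> f' ^[B (dom f)] tr (Comp C e f) else \<one>[B (dom f)])"
   proof (cases "dom f' = dom f")
    case True
    have f': "b f' \<in> carrier (A (dom f))" "f' \<in> into Y" using casb[of e f' "dom f"] i ef True by auto
    then show ?thesis using b(2)[OF f'(2)] True ef
     hom_int_pow[OF \<beta>(1)[OF X] f'(1) A.is_group B.is_group] by simp
   next
    case False
    then show ?thesis using ef hom_oneD[OF \<beta>(1)[OF X] A.comm_group_axioms B.comm_group_axioms] by simp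
   qed
  qed
  also have "\<dots> = \<psi> f"
   by (rule additive_expand_left[OF B[OF X] into_homs[OF f] coind_hom[OF \<psi> X Y]])
  finally show "(\<lambda>f\<in>into Y. \<beta> (dom f) (?\<phi> f)) f = \<psi> f" using f by simp
 qed simp
 ultimately show ?thesis by blast
qed

lemma coind_mses:
 assumes A: "!!X. X \<in> Ob ==> comm_group (A X)" and B: "!!X. X \<in> Ob ==> comm_group (B X)"
  and Q: "!!X. X \<in> Ob ==> comm_group (Q X)"
  and \<alpha>: "!!X. X \<in> Ob ==> \<alpha> X \<in> hom (A X) (B X)" "!!X. X \<in> Ob ==> inj_on (\<alpha> X) (carrier (A X))"
  and \<beta>: "!!X. X \<in> Ob ==> \<beta> X \<in> hom (B X) (Q X)" "!!X. X \<in> Ob ==> \<beta> X ` carrier (B X) = carrier (Q X)"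
  and ex: "!!X y. X \<in> Ob ==> y \<in> carrier (B X) ==> \<beta> X y = \<one>[Q X] \<longleftrightarrow> y \<in> \<alpha> X ` carrier (A X)"
 shows "mses C (coind A) (coind_map \<alpha>) (coind B) (coind_map \<beta>) (coind Q)"
 unfolding mses_def
proof (intro conjI ballI is_module_coind mhom_coind_map A B Q \<alpha> \<beta>)
 fix Y assume Y: "Y \<in> Ob"
 show "inj_on (coind_map \<alpha> Y) (el (coind A) Y)"
  unfolding coind_simps
 proof (rule inj_onI)
  fix \<phi> \<psi> assume \<phi>: "\<phi> \<in> coind_car A Y" and \<psi>: "\<psi> \<in> coind_car A Y" and eq: "coind_map \<alpha> Y \<phi> = coind_map \<alpha> Y \<psi>"
  show "\<phi> = \<psi>"
  proof (rule coind_eqI[OF coind_carD(3)[OF \<phi>] coind_carD(3)[OF \<psi>]])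
   fix f assume f: "f \<in> into Y"
   have "\<alpha> (dom f) (\<phi> f) = \<alpha> (dom f) (\<psi> f)" using fun_cong[OF eq, of f] f by (simp add: coind_map_def)
   then show "\<phi> f = \<psi> f"
    using inj_onD[OF \<alpha>(2)[OF intoD(3)[OF f]]] coind_carD(1)[OF \<phi> f] coind_carD(1)[OF \<psi> f] by blast
  qed
 qed
 show "coind_map \<beta> Y ` el (coind B) Y = el (coind Q) Y"
  using coind_map_surj[OF B Q \<beta> Y] mhom_closed[OF mhom_coind_map[of \<beta> B Q, OF \<beta>(1)] Y] by fastforce
 fix \<phi> assume "\<phi> \<in> el (coind B) Y"
 then have \<phi>: "\<phi> \<in> coind_car B Y" by simp
 show "coind_map \<beta> Y \<phi> = \<zero>[coind Q,Y] \<longleftrightarrow> \<phi> \<in> coind_map \<alpha> Y ` el (coind A) Y"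
 proof
  assume eq: "coind_map \<beta> Y \<phi> = \<zero>[coind Q,Y]"
  have "\<phi> f \<in> \<alpha> (dom f) ` carrier (A (dom f))" if f: "f \<in> into Y" for f
   using fun_cong[OF eq, of f] f ex[OF intoD(3)[OF f] coind_carD(1)[OF \<phi> f]] by (simp add: coind_map_def)
  then have "\<forall>f\<in>into Y. \<exists>a. a \<in> carrier (A (dom f)) \<and> \<phi> f = \<alpha> (dom f) a" by blast
  then obtain \<psi> where \<psi>: "!!f. f \<in> into Y ==> \<psi> f \<in> carrier (A (dom f)) \<and> \<phi> f = \<alpha> (dom f) (\<psi> f)" by metis
  have "restrict \<psi> (into Y) \<in> coind_car A Y"
  proof (rule coind_carI)
   fix f g assume fg: "f \<in> into Y" "g \<in> into Y" "dom f = dom g"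
   note X = intoD(3)[OF fg(2)]
   interpret A: comm_group "A (dom g)" using A[OF X] .
   have m: "Add C f g \<in> into Y" "dom (Add C f g) = dom g" using into_Add[OF fg] fg by (auto simp: intoD)
   have "\<alpha> (dom g) (\<psi> (Add C f g)) = \<alpha> (dom g) (\<psi> f *[A (dom g)] \<psi> g)"
    using \<psi>[OF fg(1)] \<psi>[OF fg(2)] \<psi>[OF m(1)] m(2) fg(3) coind_carD(2)[OF \<phi> fg] hom_mult[OF \<alpha>(1)[OF X]] by simp
   then have "\<psi> (Add C f g) = \<psi> f *[A (dom g)] \<psi> g"
    using inj_onD[OF \<alpha>(2)[OF X]] \<psi>[OF fg(1)] \<psi>[OF fg(2)] \<psi>[OF m(1)] m(2) fg(3) by simp
   then show "restrict \<psi> (into Y) (Add C f g) = restrict \<psi> (into Y) f *[A (dom g)] restrict \<psi> (into Y) g"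
    using fg m by simp
  qed (use \<psi> in auto)
  moreover have "coind_map \<alpha> Y (restrict \<psi> (into Y)) = \<phi>"
   unfolding coind_map_def by (rule coind_eqI[OF _ coind_carD(3)[OF \<phi>]]) (use \<psi> in auto)
  ultimately show "\<phi> \<in> coind_map \<alpha> Y ` el (coind A) Y" by force
 next
  assume "\<phi> \<in> coind_map \<alpha> Y ` el (coind A) Y"
  then obtain \<psi> where \<psi>: "\<psi> \<in> coind_car A Y" "\<phi> = coind_map \<alpha> Y \<psi>" by auto
  have "\<beta> (dom f) (\<phi> f) = \<one>[Q (dom f)]" if f: "f \<in> into Y" for f
   using ex[OF intoD(3)[OF f] coind_carD(1)[OF \<phi> f]] coind_carD(1)[OF \<psi>(1) f] \<psi>(2) f by (simp add: coind_map_def)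
  then show "coind_map \<beta> Y \<phi> = \<zero>[coind Q,Y]" unfolding coind_map_def coind_simps by (intro restrict_ext)
 qed
qed

text \<open>A homomorphism into \<open>coind D\<close> is the same as a family of group homomorphisms, namely its
 values at identity arrows. These extend along monomorphisms because the groups are divisible.\<close>

lemma injective_coind:
 fixes D :: "'o => ('b, 'z) monoid_scheme"
 assumes D: "!!X. X \<in> Ob ==> comm_group (D X)" "!!X. X \<in> Ob ==> divisible (D X)"
 shows "injective_module TYPE('u) (coind D)"
 unfolding injective_module_def
proof (intro conjI allI impI is_module_coind D)
 fix A B :: "('o, 'm, 'u) cmod" and a f
 assume A: "is_mod A" and B: "is_mod B" and a: "mhom C A a B" "\<forall>X\<in>Ob. inj_on (a X) (el A X)"
  and f: "mhom C A f (coind D)"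
 have fc: "f X x \<in> coind_car D X" if "X \<in> Ob" "x \<in> el A X" for X x
  using mhom_closed[OF f that] by simp
 have Id: "Id C X \<in> into X" if "X \<in> Ob" for X using that by (simp add: into_def)
 have "\<exists>g. g \<in> hom (Grp B X) (D X) \<and> (\<forall>x\<in>el A X. g (a X x) = f X x (Id C X))" if X: "X \<in> Ob" for X
 proof -
  have "(%x. f X x (Id C X)) \<in> hom (Grp A X) (D X)"
  proof (rule homI)
   fix x assume x: "x \<in> el A X"
   show "f X x (Id C X) \<in> carrier (D X)" using coind_carD(1)[OF fc[OF X x] Id[OF X]] X by simp
  next
   fix x y assume xy: "x \<in> el A X" "y \<in> el A X"
   show "f X (x +[A,X] y) (Id C X) = f X x (Id C X) *[D X] f X y (Id C X)"
    using mhom_mult[OF f X xy] Id[OF X] X by simp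
  qed
  then obtain g where "g \<in> hom (Grp B X) (D X)" "!!x. x \<in> el A X ==> g (a X x) = f X x (Id C X)"
   using divisible_hom_extension[OF mod_group[OF A X] mod_group[OF B X] D(1)[OF X] D(2)[OF X] mhom_hom[OF a(1) X]] a(2) X
   by blast
  then show ?thesis by blast
 qed
 then obtain g where g: "!!X. X \<in> Ob ==> g X \<in> hom (Grp B X) (D X)"
  "!!X x. X \<in> Ob ==> x \<in> el A X ==> g X (a X x) = f X x (Id C X)" by metis
 let ?G = "%Y y. \<lambda>h\<in>into Y. g (dom h) (Act B h y)"
 have "mhom C B ?G (coind D)"
 proof (rule mhomI)
  fix Y y assume Y: "Y \<in> Ob" and y: "y \<in> el B Y"
  have c: "Act B h y \<in> el B (dom h)" if "h \<in> into Y" for h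
   using act_closed[OF B intoD(1)[OF that]] intoD(2)[OF that] y by simp
  have "?G Y y \<in> coind_car D Y"
  proof (rule coind_carI)
   fix h assume h: "h \<in> into Y"
   then show "?G Y y h \<in> carrier (D (dom h))" using hom_in_carrier[OF g(1)[OF intoD(3)[OF h]] c[OF h]] by simp
  next
   fix h k assume hk: "h \<in> into Y" "k \<in> into Y" "dom h = dom k"
   then show "?G Y y (Add C h k) = ?G Y y h *[D (dom k)] ?G Y y k"
    using into_Add[OF hk] y act_Add[OF B intoD(1)[OF hk(1)] intoD(1)[OF hk(2)] hk(3)]
     hom_mult[OF g(1)[OF intoD(3)[OF hk(2)]], of "Act B h y" "Act B k y"] c[OF hk(1)] c[OF hk(2)]
    by (simp add: intoD)
  qed simp
  then show "?G Y y \<in> el (coind D) Y" by simp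
 next
  fix Y y z assume Y: "Y \<in> Ob" and yz: "y \<in> el B Y" "z \<in> el B Y"
  show "?G Y (y +[B,Y] z) = ?G Y y +[coind D,Y] ?G Y z"
   unfolding coind_simps
  proof (rule restrict_ext)
   fix h assume h: "h \<in> into Y"
   have yz': "y \<in> el B (cod h)" "z \<in> el B (cod h)" using yz intoD(2)[OF h] by auto
   show "g (dom h) (Act B h (y +[B,Y] z)) = ?G Y y h *[D (dom h)] ?G Y z h"
    using h hom_mult[OF g(1)[OF intoD(3)[OF h]]] act_mult[OF B intoD(1)[OF h] yz'] act_closed[OF B intoD(1)[OF h]] yz'
    by (simp add: intoD(2)[OF h])
  qed
 next
  fix h y assume h: "h \<in> Ar" and y: "y \<in> el B (cod h)"
  show "?G (dom h) (Act B h y) = Act (coind D) h (?G (cod h) y)"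
   unfolding coind_simps
  proof (rule restrict_ext)
   fix k assume k: "k \<in> into (dom h)"
   show "g (dom k) (Act B k (Act B h y)) = ?G (cod h) y (Comp C h k)"
    using k h y act_Comp[OF B intoD(1)[OF k] h] into_Comp[OF k h] by (simp add: intoD)
  qed
 qed
 moreover have "?G Y (a Y x) = f Y x" if Y: "Y \<in> Ob" and x: "x \<in> el A Y" for Y x
 proof (rule coind_eqI[OF _ coind_carD(3)[OF fc[OF Y x]]])
  fix h assume h: "h \<in> into Y"
  have x': "x \<in> el A (cod h)" using x intoD(2)[OF h] by simp
  have "g (dom h) (Act B h (a Y x)) = g (dom h) (a (dom h) (Act A h x))"
   using mhom_nat[OF a(1) intoD(1)[OF h] x'] intoD(2)[OF h] by simp
  also have "\<dots> = f (dom h) (Act A h x) (Id C (dom h))"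
   using g(2)[OF intoD(3)[OF h] act_closed[OF A intoD(1)[OF h] x']] .
  also have "\<dots> = f Y x (Comp C h (Id C (dom h)))"
   using mhom_nat[OF f intoD(1)[OF h] x'] intoD(2)[OF h] Id[OF intoD(3)[OF h]] by simp
  also have "\<dots> = f Y x h" using intoD(1)[OF h] by simp
  finally show "?G Y (a Y x) h = f Y x h" using h by simp
 qed simp
 ultimately show "\<exists>g. mhom C B g (coind D) \<and> (\<forall>X\<in>Ob. \<forall>x\<in>el A X. g X (a X x) = f X x)"
  by (intro exI[of _ ?G] conjI ballI) auto
qed

definition coind_unit :: "('o, 'm, 'a) cmod => 'o => 'a => 'm => 'a" where
 "coind_unit M Y m = (\<lambda>f\<in>into Y. Act M f m)"

lemma coind_unit:
 assumes M: "is_mod M"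
 shows "mhom C M (coind_unit M) (coind (Grp M))" "!!Y. Y \<in> Ob ==> inj_on (coind_unit M Y) (el M Y)"
proof -
 have c: "m \<in> el M (cod f)" if "f \<in> into Y" "m \<in> el M Y" for f Y m using that by (simp add: intoD)
 show "mhom C M (coind_unit M) (coind (Grp M))"
 proof (rule mhomI)
  fix Y m assume Y: "Y \<in> Ob" and m: "m \<in> el M Y"
  have "coind_unit M Y m \<in> coind_car (Grp M) Y"
  proof (rule coind_carI)
   fix f assume f: "f \<in> into Y"
   show "coind_unit M Y m f \<in> el M (dom f)" using f act_closed[OF M intoD(1)[OF f] c[OF f m]] by (simp add: coind_unit_def)
  next
   fix f g assume fg: "f \<in> into Y" "g \<in> into Y" "dom f = dom g"
   show "coind_unit M Y m (Add C f g) = coind_unit M Y m f +[M,dom g] coind_unit M Y m g"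
    using fg into_Add[OF fg] act_Add[OF M intoD(1)[OF fg(1)] intoD(1)[OF fg(2)] fg(3) _ c[OF fg(1) m]]
    by (simp add: coind_unit_def intoD)
  qed (simp add: coind_unit_def)
  then show "coind_unit M Y m \<in> el (coind (Grp M)) Y" by simp
 next
  fix Y m n assume Y: "Y \<in> Ob" and mn: "m \<in> el M Y" "n \<in> el M Y"
  show "coind_unit M Y (m +[M,Y] n) = coind_unit M Y m +[coind (Grp M),Y] coind_unit M Y n"
   unfolding coind_unit_def coind_simps
  proof (rule restrict_ext)
   fix f assume f: "f \<in> into Y"
   show "Act M f (m +[M,Y] n) = (\<lambda>f\<in>into Y. Act M f m) f +[M,dom f] (\<lambda>f\<in>into Y. Act M f n) f"
    using f act_mult[OF M intoD(1)[OF f] c[OF f mn(1)] c[OF f mn(2)]] by (simp add: intoD)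
  qed
 next
  fix h m assume h: "h \<in> Ar" and m: "m \<in> el M (cod h)"
  show "coind_unit M (dom h) (Act M h m) = Act (coind (Grp M)) h (coind_unit M (cod h) m)"
   unfolding coind_unit_def coind_simps
  proof (rule restrict_ext)
   fix f assume f: "f \<in> into (dom h)"
   show "Act M f (Act M h m) = (\<lambda>f\<in>into (cod h). Act M f m) (Comp C h f)"
    using act_Comp[OF M intoD(1)[OF f] h intoD(2)[OF f] m] into_Comp[OF f h] by simp
  qed
 qed
 show "inj_on (coind_unit M Y) (el M Y)" if Y: "Y \<in> Ob" for Y
 proof (rule inj_onI)
  fix m n assume mn: "m \<in> el M Y" "n \<in> el M Y" and eq: "coind_unit M Y m = coind_unit M Y n"
  have "Id C Y \<in> into Y" using Y by (simp add: into_def)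
  then have "Act M (Id C Y) m = Act M (Id C Y) n" using fun_cong[OF eq, of "Id C Y"] by (simp add: coind_unit_def)
  then show "m = n" using act_Id[OF M Y] mn by simp
 qed
qed

text \<open>By the trace form the coinduced module is also induced: a homomorphism out of \<open>coind B\<close> is the same as a
 family of group homomorphisms out of the groups \<open>B X\<close>.\<close>

definition coind_out :: "('o, 'm, 'a) cmod => ('o => 'b => 'a) => 'o => ('m => 'b) => 'a" where
 "coind_out M g Y \<phi> = gsum (Grp M Y) (%(e, f). Act M e (g (dom f) (\<phi> f))) (cas Y)"

text \<open>The unit of this second adjunction.\<close>

definition delta :: "('o => ('b, 'z) monoid_scheme) => 'o => 'b => 'm => 'b" where
 "delta B X b = (\<lambda>f\<in>into X. if dom f = X then b ^[B X] tr f else \<one>[B (dom f)])"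

lemma delta_car:
 assumes B: "!!X. X \<in> Ob ==> comm_group (B X)" and X: "X \<in> Ob" and b: "b \<in> carrier (B X)"
 shows "delta B X b \<in> coind_car B X"
proof (rule coind_carI)
 fix f assume f: "f \<in> into X"
 interpret comm_group "B (dom f)" using B[OF intoD(3)[OF f]] .
 show "delta B X b f \<in> carrier (B (dom f))"
  using f b by (auto simp: delta_def)
next
 fix f g assume fg: "f \<in> into X" "g \<in> into X" "dom f = dom g"
 interpret comm_group "B (dom g)" using B[OF intoD(3)[OF fg(2)]] .
 show "delta B X b (Add C f g) =
  delta B X b f *[B (dom g)]
  delta B X b g"
 proof (cases "dom g = X")
  case True
  have "tr (Add C f g) = tr f + tr g"
   using tr_Add[of f X g] into_homs[OF fg(1)] into_homs[OF fg(2)] fg(3) True by simp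
  then show ?thesis using True fg into_Add[OF fg] b int_pow_mult[of b "tr f" "tr g"] by (simp add: delta_def intoD)
 next
  case False
  then show ?thesis using fg into_Add[OF fg] by (simp add: delta_def intoD)
 qed
qed (simp add: delta_def)

lemma delta_hom:
 assumes B: "!!X. X \<in> Ob ==> comm_group (B X)" and X: "X \<in> Ob"
 shows "delta B X \<in> hom (B X) (Grp (coind B) X)"
proof (rule homI)
 show "delta B X b \<in> el (coind B) X" if "b \<in> carrier (B X)" for b using delta_car[of B, OF B X that] by simp
 fix b c assume bc: "b \<in> carrier (B X)" "c \<in> carrier (B X)"
 show "delta B X (b *[B X] c) = delta B X b +[coind B,X] delta B X c"
  unfolding coind_simps
 proof (rule coind_eqI)
  fix f assume f: "f \<in> into X"
  interpret comm_group "B (dom f)" using B[OF intoD(3)[OF f]] .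
  interpret BX: comm_group "B X" using B[OF X] .
  show "delta B X (b *[B X] c) f = (\<lambda>f\<in>into X. delta B X b f *[B (dom f)] delta B X c f) f"
   using f bc by (simp add: delta_def BX.int_pow_distrib)
 qed (auto simp: delta_def)
qed

text \<open>For naturality along \<open>h\<close> expand one side over the dual basis at the source of
 \<open>h\<close> and the other side over the dual basis at its target. The coefficients agree because the trace is
 symmetric.\<close>

lemma mhom_coind_out:
 assumes B: "!!X. X \<in> Ob ==> comm_group (B X)" and M: "is_mod M"
  and g: "!!X. X \<in> Ob ==> g X \<in> hom (B X) (Grp M X)"
 shows "mhom C (coind B) (coind_out M g) M"
proof -
 have val: "Act M e (g (dom f) (\<phi> f)) \<in> el M Y" "g (dom f) (\<phi> f) \<in> el M (dom f)" "\<phi> f \<in> carrier (B (dom f))"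
  if "Y \<in> Ob" "\<phi> \<in> coind_car B Y" "(e, f) \<in> set (cas Y)" for Y \<phi> e f
 proof -
  note c = cas_homs[OF that(1,3)]
  show "\<phi> f \<in> carrier (B (dom f))" using coind_carD(1)[OF that(2) homs_into[OF c(2)]] .
  then show *: "g (dom f) (\<phi> f) \<in> el M (dom f)" by (rule hom_in_carrier[OF g[OF c(3)]])
  show "Act M e (g (dom f) (\<phi> f)) \<in> el M Y" using act_closed[OF M homsD(1)[OF c(1)]] * homsD[OF c(1)] by simp
 qed
 show ?thesis
 proof (rule mhomI)
  fix Y \<phi> assume Y: "Y \<in> Ob" and "\<phi> \<in> el (coind B) Y"
  then show "coind_out M g Y \<phi> \<in> el M Y"
   unfolding coind_out_def using val(1)[OF Y] by (intro gsum_closed[OF mod_group[OF M Y]]) auto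
 next
  fix Y \<phi> \<psi> assume Y: "Y \<in> Ob" and "\<phi> \<in> el (coind B) Y" "\<psi> \<in> el (coind B) Y"
  then have \<phi>: "\<phi> \<in> coind_car B Y" and \<psi>: "\<psi> \<in> coind_car B Y" by auto
  have "coind_out M g Y (\<phi> +[coind B,Y] \<psi>) =
    gsum (Grp M Y) (%i. (case i of (e, f) => Act M e (g (dom f) (\<phi> f))) +[M,Y] (case i of (e, f) => Act M e (g (dom f) (\<psi> f)))) (cas Y)"
   unfolding coind_out_def
  proof (rule gsum_cong)
   fix i assume i: "i \<in> set (cas Y)"
   obtain e f where ef: "i = (e, f)" by force
   note i' = i[unfolded ef]
   note c = cas_homs[OF Y i']
   have "Act M e (g (dom f) (\<phi> f) +[M,dom f] g (dom f) (\<psi> f)) =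
     Act M e (g (dom f) (\<phi> f)) +[M,Y] Act M e (g (dom f) (\<psi> f))"
    using act_mult[OF M homsD(1)[OF c(1)], of "g (dom f) (\<phi> f)" "g (dom f) (\<psi> f)"] homsD[OF c(1)]
     val(2)[OF Y \<phi> i'] val(2)[OF Y \<psi> i'] by simp
   then show "(case i of (e, f) => Act M e (g (dom f) ((\<phi> +[coind B,Y] \<psi>) f))) =
     (case i of (e, f) => Act M e (g (dom f) (\<phi> f))) +[M,Y] (case i of (e, f) => Act M e (g (dom f) (\<psi> f)))"
    using ef hom_mult[OF g[OF c(3)] val(3)[OF Y \<phi> i'] val(3)[OF Y \<psi> i']] homs_into[OF c(2)] by simp
  qed
  also have "\<dots> = coind_out M g Y \<phi> +[M,Y] coind_out M g Y \<psi>"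
   unfolding coind_out_def using val(1)[OF Y] \<phi> \<psi> by (intro gsum_mult[OF mod_group[OF M Y]]) auto
  finally show "coind_out M g Y (\<phi> +[coind B,Y] \<psi>) = coind_out M g Y \<phi> +[M,Y] coind_out M g Y \<psi>" .
 next
  fix h \<phi> assume h: "h \<in> Ar" and "\<phi> \<in> el (coind B) (cod h)"
  then have \<phi>: "\<phi> \<in> coind_car B (cod h)" by simp
  let ?Y = "cod h" and ?Y' = "dom h"
  have Y: "?Y \<in> Ob" "?Y' \<in> Ob" using h by auto
  have hh: "h \<in> homs C ?Y' ?Y" using h by (simp add: homs_def)
  interpret MY: comm_group "Grp M ?Y'" using mod_group[OF M Y(2)] .
  \<comment> \<open>The matrix of mixed terms; expanding along either index gives one side of naturality.\<close>
  define t where "t e' f' e f = (if dom f = dom f' then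
   (Act M e' (g (dom f) (\<phi> f))) ^[Grp M ?Y'] tr (Comp C e (Comp C h f')) else \<zero>[M,?Y'])" for e' f' e f
  have tc: "t e' f' e f \<in> el M ?Y'" if "(e', f') \<in> set (cas ?Y')" "(e, f) \<in> set (cas ?Y)" for e' f' e f
  proof (cases "dom f = dom f'")
   case True
   note c' = cas_homs[OF Y(2) that(1)]
   have "Act M e' (g (dom f) (\<phi> f)) \<in> el M ?Y'"
    using act_closed[OF M homsD(1)[OF c'(1)]] val(2)[OF Y(1) \<phi> that(2)] homsD[OF c'(1)] True by simp
   then show ?thesis using True by (simp add: t_def)
  qed (simp add: t_def)
  have 1: "Act M e' (g (dom f') (\<phi> (Comp C h f'))) = gsum (Grp M ?Y') (%(e, f). t e' f' e f) (cas ?Y)"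
   if i: "(e', f') \<in> set (cas ?Y')" for e' f'
  proof -
   note c' = cas_homs[OF Y(2) i]
   let ?X = "dom f'"
   have k: "Comp C h f' \<in> homs C ?X ?Y" using c'(2) hh by (simp add: homs_def)
   have comp: "(%x. Act M e' (g ?X x)) \<in> hom (B ?X) (Grp M ?Y')"
    using Group.hom_compose[OF g[OF c'(3)], of "Act M e'" "Grp M ?Y'"] act_hom[OF M homsD(1)[OF c'(1)]] homsD[OF c'(1)]
    by (simp add: comp_def)
   have "(%k. Act M e' (g ?X (\<phi> k))) \<in> hom (hg ?X ?Y) (Grp M ?Y')"
    using Group.hom_compose[OF coind_hom[OF \<phi> c'(3) Y(1)] comp] by (simp add: comp_def)
   then have "gsum (Grp M ?Y') (%(e, f). if dom f = ?X then (Act M e' (g ?X (\<phi> f))) ^[Grp M ?Y'] tr (Comp C e (Comp C h f')) else \<zero>[M,?Y']) (cas ?Y) =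
     Act M e' (g ?X (\<phi> (Comp C h f')))"
    using additive_expand_left[OF MY.comm_group_axioms k] by blast
   moreover have "gsum (Grp M ?Y') (%(e, f). t e' f' e f) (cas ?Y) = gsum (Grp M ?Y') (%(e, f). if dom f = ?X then (Act M e' (g ?X (\<phi> f))) ^[Grp M ?Y'] tr (Comp C e (Comp C h f')) else \<zero>[M,?Y']) (cas ?Y)"
    by (intro gsum_cong) (auto simp: t_def)
   ultimately show ?thesis by simp
  qed
  have 2: "gsum (Grp M ?Y') (%(e', f'). t e' f' e f) (cas ?Y') = Act M h (Act M e (g (dom f) (\<phi> f)))"
   if i: "(e, f) \<in> set (cas ?Y)" for e f
  proof -
   note c = cas_homs[OF Y(1) i]
   let ?X = "dom f" and ?x = "g (dom f) (\<phi> f)"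
   have x: "?x \<in> el M ?X" using val(2)[OF Y(1) \<phi> i] .
   have k: "Comp C e h \<in> homs C ?Y' ?X" using c(1) hh by (simp add: homs_def)
   have ah: "(%k. Act M k ?x) \<in> hom (hg ?Y' ?X) (Grp M ?Y')"
   proof (rule homI)
    fix k assume "k \<in> carrier (hg ?Y' ?X)"
    then show "Act M k ?x \<in> el M ?Y'" using act_closed[OF M, of k ?x] x c(3) Y by (simp add: hg_carrier homsD)
   next
    fix k l assume "k \<in> carrier (hg ?Y' ?X)" "l \<in> carrier (hg ?Y' ?X)"
    then have kl: "k \<in> homs C ?Y' ?X" "l \<in> homs C ?Y' ?X" using c(3) Y by (auto simp: hg_carrier)
    show "Act M (k *[hg ?Y' ?X] l) ?x = Act M k ?x +[M,?Y'] Act M l ?x"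
     using act_Add[OF M, of k l ?x] kl x c(3) Y by (simp add: hg_mult homsD)
   qed
   have "gsum (Grp M ?Y') (%(e', f'). if dom f' = ?X then (Act M e' ?x) ^[Grp M ?Y'] tr (Comp C f' (Comp C e h)) else \<zero>[M,?Y']) (cas ?Y') =
     Act M (Comp C e h) ?x"
    using additive_expand_right[OF MY.comm_group_axioms k ah] .
   moreover have "gsum (Grp M ?Y') (%(e', f'). t e' f' e f) (cas ?Y') = gsum (Grp M ?Y') (%(e', f'). if dom f' = ?X then (Act M e' ?x) ^[Grp M ?Y'] tr (Comp C f' (Comp C e h)) else \<zero>[M,?Y']) (cas ?Y')"
   proof (rule gsum_cong)
    fix i assume i': "i \<in> set (cas ?Y')"
    obtain e' f' where ef: "i = (e', f')" by force
    note c' = cas_homs[OF Y(2) i'[unfolded ef]]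
    have "tr (Comp C e (Comp C h f')) = tr (Comp C f' (Comp C e h))" if d: "dom f = dom f'"
    proof -
     have "Comp C e (Comp C h f') = Comp C (Comp C e h) f'"
      by (intro Comp_assoc) (use homsD[OF c'(2)] homsD[OF hh] homsD[OF c(1)] in simp_all)
     then show ?thesis using tr_comm[OF c'(2), of "Comp C e h"] k d by simp
    qed
    then show "(case i of (e', f') => t e' f' e f) = (case i of (e', f') => if dom f' = ?X then (Act M e' ?x) ^[Grp M ?Y'] tr (Comp C f' (Comp C e h)) else \<zero>[M,?Y'])"
     using ef by (auto simp: t_def)
   qed
   moreover have "Act M (Comp C e h) ?x = Act M h (Act M e ?x)"
    using act_Comp[OF M h homsD(1)[OF c(1)]] homsD[OF c(1)] x by simp
   ultimately show ?thesis by simp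
  qed
  have "coind_out M g ?Y' (Act (coind B) h \<phi>) = gsum (Grp M ?Y') (%(e', f'). gsum (Grp M ?Y') (%(e, f). t e' f' e f) (cas ?Y)) (cas ?Y')"
   unfolding coind_out_def
  proof (rule gsum_cong)
   fix i assume i: "i \<in> set (cas ?Y')"
   obtain e' f' where ef: "i = (e', f')" by force
   then show "(case i of (e, f) => Act M e (g (dom f) (Act (coind B) h \<phi> f))) = (case i of (e', f') => gsum (Grp M ?Y') (%(e, f). t e' f' e f) (cas ?Y))"
    using 1 i homs_into[OF cas_homs(2)[OF Y(2)]] by simp
  qed
  also have "\<dots> = gsum (Grp M ?Y') (%i. gsum (Grp M ?Y') (%j. t (fst i) (snd i) (fst j) (snd j)) (cas ?Y)) (cas ?Y')"
   unfolding case_prod_unfold ..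
  also have "\<dots> = gsum (Grp M ?Y') (%j. gsum (Grp M ?Y') (%i. t (fst i) (snd i) (fst j) (snd j)) (cas ?Y')) (cas ?Y)"
   using tc by (intro gsum_swap[OF MY.comm_group_axioms]) auto
  also have "\<dots> = gsum (Grp M ?Y') (%(e, f). Act M h (Act M e (g (dom f) (\<phi> f)))) (cas ?Y)"
   using 2 by (intro gsum_cong) (auto simp: case_prod_unfold)
  also have "\<dots> = Act M h (coind_out M g ?Y \<phi>)"
   unfolding coind_out_def
   using gsum_hom[OF mod_group[OF M Y(1)] MY.comm_group_axioms act_hom[OF M h], of "cas ?Y" "%(e, f). Act M e (g (dom f) (\<phi> f))"]
    val(1)[OF Y(1) \<phi>] by (simp add: case_prod_unfold)
  finally show "coind_out M g ?Y' (Act (coind B) h \<phi>) = Act M h (coind_out M g ?Y \<phi>)" .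
 qed
qed

lemma coind_out_delta:
 assumes B: "!!X. X \<in> Ob ==> comm_group (B X)" and M: "is_mod M"
  and g: "!!X. X \<in> Ob ==> g X \<in> hom (B X) (Grp M X)" and X: "X \<in> Ob" and b: "b \<in> carrier (B X)"
 shows "coind_out M g X (delta B X b) = g X b"
proof -
 interpret MX: comm_group "Grp M X" using mod_group[OF M X] .
 interpret BX: comm_group "B X" using B[OF X] .
 have gb: "g X b \<in> el M X" using hom_in_carrier[OF g[OF X] b] .
 have I: "Id C X \<in> homs C X X" using X by (simp add: homs_def)
 have ah: "(%k. Act M k (g X b)) \<in> hom (hg X X) (Grp M X)"
 proof (rule homI)
  fix k assume "k \<in> carrier (hg X X)"
  then show "Act M k (g X b) \<in> el M X" using act_closed[OF M, of k "g X b"] gb X by (simp add: hg_carrier homsD)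
 next
  fix k l assume "k \<in> carrier (hg X X)" "l \<in> carrier (hg X X)"
  then have kl: "k \<in> homs C X X" "l \<in> homs C X X" using X by (auto simp: hg_carrier)
  show "Act M (k *[hg X X] l) (g X b) = Act M k (g X b) +[M,X] Act M l (g X b)"
   using act_Add[OF M, of k l "g X b"] kl gb X by (simp add: hg_mult homsD)
 qed
 have "coind_out M g X (delta B X b) =
   gsum (Grp M X) (%(e, f'). if dom f' = X then (Act M e (g X b)) ^[Grp M X] tr (Comp C f' (Id C X)) else \<zero>[M,X]) (cas X)"
  unfolding coind_out_def
 proof (rule gsum_cong)
  fix i assume i: "i \<in> set (cas X)"
  obtain e f where ef: "i = (e, f)" by force
  note c = cas_homs[OF X i[unfolded ef]]
  show "(case i of (e, f) => Act M e (g (dom f) (delta B X b f))) =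
    (case i of (e, f') => if dom f' = X then (Act M e (g X b)) ^[Grp M X] tr (Comp C f' (Id C X)) else \<zero>[M,X])"
  proof (cases "dom f = X")
   case True
   have e: "e \<in> Ar" "dom e = X" "cod e = X" using c(1) True by (auto simp: homsD)
   have "Comp C f (Id C X) = f" using Comp_Id(1)[of f] c(2) True by (simp add: homsD)
   moreover have "Act M e (g X (b ^[B X] tr f)) = (Act M e (g X b)) ^[Grp M X] tr f"
    using hom_int_pow[OF g[OF X] b BX.is_group MX.is_group] hom_int_pow[OF act_hom[OF M e(1)], of "g X b" "tr f"] gb e MX.is_group by simp
   ultimately show ?thesis using ef True homs_into[OF c(2)] by (simp add: delta_def)
  next
   case False
   have "Act M e (g (dom f) \<one>[B (dom f)]) = \<zero>[M,X]"
    using hom_oneD[OF g[OF c(3)] B[OF c(3)] mod_group[OF M c(3)]] act_one[OF M homsD(1)[OF c(1)]] homsD[OF c(1)] by simp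
   then show ?thesis using ef False homs_into[OF c(2)] by (simp add: delta_def)
  qed
 qed
 also have "\<dots> = Act M (Id C X) (g X b)" by (rule additive_expand_right[OF MX.comm_group_axioms I ah])
 finally show ?thesis using act_Id[OF M X gb] by simp
qed

text \<open>Each element of \<open>coind B\<close> is a sum of translates of elements \<open>delta B X b\<close>, so
 these determine a homomorphism.\<close>

lemma coind_out_unique:
 assumes B: "!!X. X \<in> Ob ==> comm_group (B X)" and N: "is_mod N" and G: "mhom C (coind B) G N"
  and Y: "Y \<in> Ob" and \<phi>: "\<phi> \<in> coind_car B Y"
 shows "coind_out N (%X b. G X (delta B X b)) Y \<phi> = G Y \<phi>"
proof -
 have MB: "is_mod (coind B)" using B by (rule is_module_coind)
 have c\<phi>: "\<phi> f \<in> carrier (B (dom f))" "delta B (dom f) (\<phi> f) \<in> coind_car B (dom f)" if "(e, f) \<in> set (cas Y)" for e f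
 proof -
  note c = cas_homs[OF Y that]
  show 1: "\<phi> f \<in> carrier (B (dom f))" using coind_carD(1)[OF \<phi> homs_into[OF c(2)]] .
  show "delta B (dom f) (\<phi> f) \<in> coind_car B (dom f)" using delta_car[of B "dom f" "\<phi> f"] B c(3) 1 by blast
 qed
 let ?s = "gsum (Grp (coind B) Y) (%(e, f). Act (coind B) e (delta B (dom f) (\<phi> f))) (cas Y)"
 have ac: "Act (coind B) e (delta B (dom f) (\<phi> f)) \<in> el (coind B) Y" if "(e, f) \<in> set (cas Y)" for e f
 proof -
  note c = cas_homs[OF Y that]
  have "delta B (dom f) (\<phi> f) \<in> el (coind B) (cod e)" using c\<phi>(2)[OF that] homsD(3)[OF c(1)] by simp
  then show ?thesis using act_closed[OF MB homsD(1)[OF c(1)]] homsD(2)[OF c(1)] by metis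
 qed
 have "coind_out N (%X b. G X (delta B X b)) Y \<phi> = gsum (Grp N Y) (%i. G Y (case i of (e, f) => Act (coind B) e (delta B (dom f) (\<phi> f)))) (cas Y)"
  unfolding coind_out_def
 proof (rule gsum_cong)
  fix i assume i: "i \<in> set (cas Y)"
  obtain e f where ef: "i = (e, f)" by force
  note c = cas_homs[OF Y i[unfolded ef]]
  have "delta B (dom f) (\<phi> f) \<in> el (coind B) (cod e)" using c\<phi>(2)[OF i[unfolded ef]] homsD[OF c(1)] by simp
  then have "G Y (Act (coind B) e (delta B (dom f) (\<phi> f))) = Act N e (G (dom f) (delta B (dom f) (\<phi> f)))"
   using mhom_nat[OF G homsD(1)[OF c(1)]] homsD[OF c(1)] by metis
  then show "(case i of (e, f) => Act N e (G (dom f) (delta B (dom f) (\<phi> f)))) =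
    G Y (case i of (e, f) => Act (coind B) e (delta B (dom f) (\<phi> f)))"
   using ef by (simp del: coind_simps)
 qed
 also have "\<dots> = G Y ?s"
  using gsum_hom[OF mod_group[OF MB Y] mod_group[OF N Y] mhom_hom[OF G Y], of "cas Y" "%(e, f). Act (coind B) e (delta B (dom f) (\<phi> f))"] ac
  by (simp add: case_prod_unfold del: coind_simps)
 also have "?s = \<phi>"
 proof (rule coind_eqI[OF _ coind_carD(3)[OF \<phi>]])
  have sc: "?s \<in> el (coind B) Y" using ac by (intro gsum_closed[OF mod_group[OF MB Y]]) auto
  then show "?s \<in> extensional (into Y)" unfolding coind_simps(1) by (rule coind_carD(3))
  fix f assume f: "f \<in> into Y"
  note X = intoD(3)[OF f]
  interpret BX: comm_group "B (dom f)" using B[OF X] .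
  have ev: "(%\<psi>. \<psi> f) \<in> hom (Grp (coind B) Y) (B (dom f))"
   using f coind_carD(1)[OF _ f] by (intro homI) auto
  have "?s f = gsum (B (dom f)) (%i. (case i of (e, f) => Act (coind B) e (delta B (dom f) (\<phi> f))) f) (cas Y)"
   using gsum_hom[OF mod_group[OF MB Y] BX.comm_group_axioms ev, of "cas Y" "%(e, f). Act (coind B) e (delta B (dom f) (\<phi> f))"] ac
   by (simp add: case_prod_unfold del: coind_simps)
  also have "\<dots> = gsum (B (dom f)) (%(e, f'). if dom f' = dom f then \<phi> f' ^[B (dom f)] tr (Comp C e f) else \<one>[B (dom f)]) (cas Y)"
  proof (rule gsum_cong)
   fix i assume i: "i \<in> set (cas Y)"
   obtain e f' where ef: "i = (e, f')" by force
   note c = cas_homs[OF Y i[unfolded ef]]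
   have "f \<in> into (dom e)" using f homsD[OF c(1)] by simp
   moreover have "Comp C e f \<in> into (dom f')" "dom (Comp C e f) = dom f"
    using homsD[OF c(1)] f by (auto simp: into_def)
   ultimately show "(case i of (e, f) => Act (coind B) e (delta B (dom f) (\<phi> f))) f =
    (case i of (e, f') => if dom f' = dom f then \<phi> f' ^[B (dom f)] tr (Comp C e f) else \<one>[B (dom f)])"
    using ef by (auto simp: delta_def)
  qed
  also have "\<dots> = \<phi> f" by (rule additive_expand_left[OF B[OF X] into_homs[OF f] coind_hom[OF \<phi> X Y]])
  finally show "?s f = \<phi> f" .
 qed
 finally show ?thesis .
qed

text \<open>By the second adjunction a lifting problem for \<open>coind B\<close> becomes a family of lifting problems
 for the groups.\<close>

lemma projective_coind:
 fixes B :: "'o => 'b monoid"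
 assumes B: "!!X. X \<in> Ob ==> projective_group TYPE('u) (B X)"
 shows "projective_module TYPE('u) (coind B)"
proof -
 have cB: "!!X. X \<in> Ob ==> comm_group (B X)" using B by (simp add: projective_group_def)
 show ?thesis
  unfolding projective_module_def
 proof (intro conjI allI impI is_module_coind cB)
  fix M N :: "('o, 'm, 'u) cmod" and e G
  assume M: "is_mod M" and N: "is_mod N" and e: "mhom C M e N" "\<forall>X\<in>Ob. e X ` el M X = el N X"
   and G: "mhom C (coind B) G N"
  have Gd: "(%b. G X (delta B X b)) \<in> hom (B X) (Grp N X)" if X: "X \<in> Ob" for X
   using Group.hom_compose[OF delta_hom[of B, OF cB X] mhom_hom[OF G X]] by (simp add: comp_def)
  have "\<exists>g\<in>hom (B X) (Grp M X). \<forall>b\<in>carrier (B X). e X (g b) = G X (delta B X b)" if X: "X \<in> Ob" for X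
   using B[OF X] mod_group[OF M X] mod_group[OF N X] mhom_hom[OF e(1) X] bspec[OF e(2) X] Gd[OF X]
   unfolding projective_group_def by blast
  then obtain g where g: "!!X. X \<in> Ob ==> g X \<in> hom (B X) (Grp M X)"
   "!!X b. X \<in> Ob ==> b \<in> carrier (B X) ==> e X (g X b) = G X (delta B X b)" by metis
  have "e Y (coind_out M g Y \<phi>) = G Y \<phi>" if Y: "Y \<in> Ob" and \<phi>: "\<phi> \<in> coind_car B Y" for Y \<phi>
  proof -
   have v: "\<phi> f \<in> carrier (B (dom f))" "g (dom f) (\<phi> f) \<in> el M (dom f)" "Act M k (g (dom f) (\<phi> f)) \<in> el M Y"
    "e Y (Act M k (g (dom f) (\<phi> f))) = Act N k (G (dom f) (delta B (dom f) (\<phi> f)))"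
    if "(k, f) \<in> set (cas Y)" for k f
   proof -
    note c = cas_homs[OF Y that]
    show 1: "\<phi> f \<in> carrier (B (dom f))" using coind_carD(1)[OF \<phi> homs_into[OF c(2)]] .
    then show 2: "g (dom f) (\<phi> f) \<in> el M (dom f)" by (rule hom_in_carrier[OF g(1)[OF c(3)]])
    show "Act M k (g (dom f) (\<phi> f)) \<in> el M Y" using act_closed[OF M homsD(1)[OF c(1)]] 2 homsD[OF c(1)] by simp
    show "e Y (Act M k (g (dom f) (\<phi> f))) = Act N k (G (dom f) (delta B (dom f) (\<phi> f)))"
     using mhom_nat[OF e(1) homsD(1)[OF c(1)], of "g (dom f) (\<phi> f)"] g(2)[OF c(3) 1] 2 homsD[OF c(1)] by simp
   qed
   have "e Y (coind_out M g Y \<phi>) = gsum (Grp N Y) (%i. e Y (case i of (k, f) => Act M k (g (dom f) (\<phi> f)))) (cas Y)"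
    unfolding coind_out_def using v(3)
    by (intro gsum_hom[OF mod_group[OF M Y] mod_group[OF N Y] mhom_hom[OF e(1) Y]]) auto
   also have "\<dots> = coind_out N (%X b. G X (delta B X b)) Y \<phi>"
    unfolding coind_out_def using v(4) by (intro gsum_cong) auto
   also have "\<dots> = G Y \<phi>" by (rule coind_out_unique[OF cB N G Y \<phi>])
   finally show ?thesis .
  qed
  then show "\<exists>g. mhom C (coind B) g M \<and> (\<forall>X\<in>Ob. \<forall>x\<in>el (coind B) X. e X (g X x) = G X x)"
   using mhom_coind_out[OF cB M g(1)] by (intro exI[of _ "coind_out M g"]) auto
 qed
qed

lemma projective_retract:
 fixes F :: "('o, 'm, 'e) cmod" and P :: "('o, 'm, 'v) cmod"
 assumes F: "projective_module TYPE('u) F" and P: "is_mod P" and i: "mhom C P i F" and r: "mhom C F r P"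
  and ri: "!!X x. X \<in> Ob ==> x \<in> el P X ==> r X (i X x) = x"
 shows "projective_module TYPE('u) P"
 unfolding projective_module_def
proof (intro conjI allI impI P)
 fix A B :: "('o, 'm, 'u) cmod" and e f
 assume AB: "is_mod A" "is_mod B" and e: "mhom C A e B" "\<forall>X\<in>Ob. e X ` el A X = el B X" and f: "mhom C P f B"
 obtain g where g: "mhom C F g A" "!!X x. X \<in> Ob ==> x \<in> el F X ==> e X (g X x) = f X (r X x)"
  using projective_moduleD[OF F AB e(1) _ mhom_comp[OF r f]] e(2) by blast
 show "\<exists>g. mhom C P g A \<and> (\<forall>X\<in>Ob. \<forall>x\<in>el P X. e X (g X x) = f X x)"
  using mhom_comp[OF i g(1)] g(2) ri mhom_closed[OF i] by (intro exI[of _ "%X x. g X (i X x)"]) simp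
qed

lemma injective_retract:
 fixes F :: "('o, 'm, 'e) cmod" and P :: "('o, 'm, 'v) cmod"
 assumes F: "injective_module TYPE('u) F" and P: "is_mod P" and i: "mhom C P i F" and r: "mhom C F r P"
  and ri: "!!X x. X \<in> Ob ==> x \<in> el P X ==> r X (i X x) = x"
 shows "injective_module TYPE('u) P"
 unfolding injective_module_def
proof (intro conjI allI impI P)
 fix A B :: "('o, 'm, 'u) cmod" and a f
 assume AB: "is_mod A" "is_mod B" and a: "mhom C A a B" "\<forall>X\<in>Ob. inj_on (a X) (el A X)" and f: "mhom C A f P"
 obtain g where g: "mhom C B g F" "!!X x. X \<in> Ob ==> x \<in> el A X ==> g X (a X x) = i X (f X x)"
  using injective_moduleD[OF F AB a(1) _ mhom_comp[OF f i]] a(2) by blast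
 show "\<exists>g. mhom C B g P \<and> (\<forall>X\<in>Ob. \<forall>x\<in>el A X. g X (a X x) = f X x)"
  using mhom_comp[OF g(1) r] g(2) ri mhom_closed[OF f] by (intro exI[of _ "%X x. r X (g X x)"]) simp
qed

text \<open>An isomorphic copy of a coinduced module whose elements lie in the universe.\<close>

definition coind_copy :: "('o => ('b, 'z) monoid_scheme) => ('o, 'm, 'u) cmod => ('o => ('m => 'b) => 'u) => ('o => 'u => 'm => 'b) => bool" where
 "coind_copy B K r s \<longleftrightarrow> is_mod K \<and> mhom C (coind B) r K \<and> mhom C K s (coind B) \<and>
   (\<forall>X\<in>Ob. (\<forall>x\<in>coind_car B X. s X (r X x) = x) \<and> (\<forall>x\<in>el K X. r X (s X x) = x))"

lemma coind_copyD:
 assumes "coind_copy B K r s"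
 shows "is_mod K" "mhom C (coind B) r K" "mhom C K s (coind B)"
  "!!X x. X \<in> Ob ==> x \<in> el (coind B) X ==> s X (r X x) = x" "!!X x. X \<in> Ob ==> x \<in> el K X ==> r X (s X x) = x"
 using assms by (simp_all add: coind_copy_def)

lemma coind_copy_exists:
 fixes B :: "'o => ('b, 'z) monoid_scheme"
 assumes B: "!!X. X \<in> Ob ==> comm_group (B X)"
  and inf: "infinite (UNIV :: 'u set)" and card: "!!X. X \<in> Ob ==> carrier (B X) \<lesssim> (UNIV :: 'u set)"
 obtains K :: "('o, 'm, 'u) cmod" and r s where "coind_copy B K r s"
proof -
 have "el (coind B) Y \<lesssim> (UNIV :: 'u set)" if "Y \<in> Ob" for Y
  using coind_lepoll[of B Y, OF B that inf card] by simp
 then obtain K :: "('o, 'm, 'u) cmod" and r s where "is_mod K" "mhom C (coind B) r K" "mhom C K s (coind B)"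
  "!!X x. X \<in> Ob ==> x \<in> el (coind B) X ==> s X (r X x) = x" "!!X x. X \<in> Ob ==> x \<in> el K X ==> r X (s X x) = x"
  using transport_module[OF is_module_coind[of B, OF B]] by blast
 then have "coind_copy B K r s" by (simp add: coind_copy_def)
 then show thesis by (rule that)
qed

lemma injective_coind_copy:
 fixes K :: "('o, 'm, 'u) cmod"
 assumes "!!X. X \<in> Ob ==> comm_group (D X)" "!!X. X \<in> Ob ==> divisible (D X)" and K: "coind_copy D K r s"
 shows "inj_mod K"
proof -
 have "injective_module TYPE('u) (coind D)" using assms(1,2) by (rule injective_coind)
 then show ?thesis
  by (rule injective_retract[OF _ coind_copyD(1)[OF K] coind_copyD(3)[OF K] coind_copyD(2)[OF K]]) (rule coind_copyD(5)[OF K])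
qed

lemma projective_coind_copy:
 fixes K :: "('o, 'm, 'u) cmod"
 assumes "!!X. X \<in> Ob ==> projective_group TYPE('u) (B X)" and K: "coind_copy B K r s"
 shows "proj_mod K"
proof -
 have "projective_module TYPE('u) (coind B)" using assms(1) by (rule projective_coind)
 then show ?thesis
  by (rule projective_retract[OF _ coind_copyD(1)[OF K] coind_copyD(3)[OF K] coind_copyD(2)[OF K]]) (rule coind_copyD(5)[OF K])
qed

lemma coind_copy_mses:
 fixes K1 K2 K3 :: "('o, 'm, 'u) cmod"
 assumes ses: "mses C (coind A) a (coind B) b (coind Q)"
  and 1: "coind_copy A K1 r1 s\<^sub>1" and 2: "coind_copy B K2 r2 s\<^sub>2" and 3: "coind_copy Q K3 r3 s\<^sub>3"
 shows "mses C K1 (%X x. r2 X (a X (s\<^sub>1 X x))) K2 (%X x. r3 X (b X (s\<^sub>2 X x))) K3"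
proof -
 note S = msesD[OF ses] and c1 = coind_copyD[OF 1] and c2 = coind_copyD[OF 2] and c3 = coind_copyD[OF 3]
 have h1: "mhom C K1 (%X x. r2 X (a X (s\<^sub>1 X x))) K2" using mhom_comp[OF mhom_comp[OF c1(3) S(4)] c2(2)] .
 have h2: "mhom C K2 (%X x. r3 X (b X (s\<^sub>2 X x))) K3" using mhom_comp[OF mhom_comp[OF c2(3) S(5)] c3(2)] .
 show ?thesis
  unfolding mses_def
 proof (intro conjI ballI c1(1) c2(1) c3(1) h1 h2)
  fix X assume X: "X \<in> Ob"
  note cl = mhom_closed[OF c1(3) X] mhom_closed[OF c2(3) X] mhom_closed[OF c3(3) X] mhom_closed[OF S(4) X] mhom_closed[OF S(5) X]
   mhom_closed[OF c1(2) X] mhom_closed[OF c2(2) X] mhom_closed[OF c3(2) X]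
  show "inj_on (%x. r2 X (a X (s\<^sub>1 X x))) (el K1 X)"
  proof (rule inj_onI)
   fix x y assume xy: "x \<in> el K1 X" "y \<in> el K1 X" and "r2 X (a X (s\<^sub>1 X x)) = r2 X (a X (s\<^sub>1 X y))"
   then have "a X (s\<^sub>1 X x) = a X (s\<^sub>1 X y)"
    using c2(4)[OF X cl(4)[OF cl(1)[OF xy(1)]]] c2(4)[OF X cl(4)[OF cl(1)[OF xy(2)]]] by metis
   then have "s\<^sub>1 X x = s\<^sub>1 X y" using inj_onD[OF S(6)[OF X]] cl(1) xy by metis
   then show "x = y" using c1(5)[OF X] xy by metis
  qed
  show "(%x. r3 X (b X (s\<^sub>2 X x))) ` el K2 X = el K3 X"
  proof
   show "(%x. r3 X (b X (s\<^sub>2 X x))) ` el K2 X \<subseteq> el K3 X" using mhom_closed[OF h2 X] by blast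
   show "el K3 X \<subseteq> (%x. r3 X (b X (s\<^sub>2 X x))) ` el K2 X"
   proof
    fix z assume z: "z \<in> el K3 X"
    obtain y where y: "y \<in> el (coind B) X" "s\<^sub>3 X z = b X y" using S(7)[OF X] cl(3)[OF z] by blast
    then have "z = r3 X (b X (s\<^sub>2 X (r2 X y)))" using c2(4)[OF X y(1)] c3(5)[OF X z] by simp
    then show "z \<in> (%x. r3 X (b X (s\<^sub>2 X x))) ` el K2 X" using cl(7)[OF y(1)] by blast
   qed
  qed
  fix y assume y: "y \<in> el K2 X"
  have "r3 X (b X (s\<^sub>2 X y)) = \<zero>[K3,X] \<longleftrightarrow> b X (s\<^sub>2 X y) = \<zero>[coind Q,X]"
   using c3(4)[OF X cl(5)[OF cl(2)[OF y]]] mhom_one[OF c3(2) S(3) c3(1) X] mhom_one[OF c3(3) c3(1) S(3) X] by metis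
  also have "\<dots> \<longleftrightarrow> s\<^sub>2 X y \<in> a X ` el (coind A) X" by (rule S(8)[OF X cl(2)[OF y]])
  also have "\<dots> \<longleftrightarrow> y \<in> (%x. r2 X (a X (s\<^sub>1 X x))) ` el K1 X"
  proof
   assume "s\<^sub>2 X y \<in> a X ` el (coind A) X"
   then obtain x where x: "x \<in> el (coind A) X" "s\<^sub>2 X y = a X x" by blast
   then have "y = r2 X (a X (s\<^sub>1 X (r1 X x)))" using c1(4)[OF X x(1)] c2(5)[OF X y] by simp
   then show "y \<in> (%x. r2 X (a X (s\<^sub>1 X x))) ` el K1 X" using cl(6)[OF x(1)] by blast
  next
   assume "y \<in> (%x. r2 X (a X (s\<^sub>1 X x))) ` el K1 X"
   then obtain x where x: "x \<in> el K1 X" "y = r2 X (a X (s\<^sub>1 X x))" by blast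
   then have "s\<^sub>2 X y = a X (s\<^sub>1 X x)" using c2(4)[OF X cl(4)[OF cl(1)[OF x(1)]]] by simp
   then show "s\<^sub>2 X y \<in> a X ` el (coind A) X" using cl(1)[OF x(1)] by blast
  qed
  finally show "r3 X (b X (s\<^sub>2 X y)) = \<zero>[K3,X] \<longleftrightarrow> y \<in> (%x. r2 X (a X (s\<^sub>1 X x))) ` el K1 X" .
 qed
qed

text \<open>Coinduce \<open>0 \<rightarrow> P \<rightarrow> D \<rightarrow> D / P \<rightarrow> 0\<close> with
 \<open>D\<close> divisible: quotients of divisible groups are divisible, so the last two terms become
 injective.\<close>

lemma injective_copresentation:
 fixes P :: "('o, 'm, 'u) cmod"
 assumes P: "is_mod P" and inf: "infinite (UNIV :: 'u set)"
 obtains K1 :: "('o, 'm, 'u) cmod" and r s j and K2 :: "('o, 'm, 'u) cmod" and q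
  and K3 :: "('o, 'm, 'u) cmod" and D :: "'o => 'u monoid" and r' s'
 where "coind_copy (Grp P) K1 r s" "mses C K1 j K2 q K3" "inj_mod K2" "inj_mod K3"
  "\<forall>X\<in>Ob. comm_group (D X) \<and> divisible (D X)" "coind_copy D K2 r' s'"
proof -
 have U: "S \<lesssim> (UNIV :: 'u set)" for S :: "'u set" by (simp add: subset_imp_lepoll)
 have "\<exists>(D :: 'u monoid) i. comm_group D \<and> divisible D \<and> i \<in> hom (Grp P X) D \<and> inj_on i (el P X)"
  if X: "X \<in> Ob" for X
  using divisible_embedding[OF mod_group[OF P X] inf U] by metis
 then obtain D :: "'o => 'u monoid" and i
  where D: "!!X. X \<in> Ob ==> comm_group (D X)" "!!X. X \<in> Ob ==> divisible (D X)"
   "!!X. X \<in> Ob ==> i X \<in> hom (Grp P X) (D X)" "!!X. X \<in> Ob ==> inj_on (i X) (el P X)"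
  by metis
 have "\<exists>(Q :: 'u monoid) q. comm_group Q \<and> q \<in> hom (D X) Q \<and> q ` carrier (D X) = carrier Q \<and>
   (\<forall>x\<in>carrier (D X). q x = \<one>[Q] \<longleftrightarrow> x \<in> i X ` el P X)"
  if X: "X \<in> Ob" for X
 proof -
  have "group_hom (Grp P X) (D X) (i X)"
   using mod_group[OF P X] D(1,3)[OF X] by (rule group_homI)
  then have "subgroup (i X ` el P X) (D X)" by (rule group_hom.img_is_subgroup)
  then show ?thesis using quotient_group_exists[OF D(1)[OF X]] by metis
 qed
 then obtain Q :: "'o => 'u monoid" and q
  where Q: "!!X. X \<in> Ob ==> comm_group (Q X)" "!!X. X \<in> Ob ==> q X \<in> hom (D X) (Q X)"
   "!!X. X \<in> Ob ==> q X ` carrier (D X) = carrier (Q X)"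
   "!!X x. X \<in> Ob ==> x \<in> carrier (D X) ==> q X x = \<one>[Q X] \<longleftrightarrow> x \<in> i X ` el P X"
  by metis
 have ses: "mses C (coind (Grp P)) (coind_map i) (coind D) (coind_map q) (coind Q)"
  by (rule coind_mses[OF mod_group[OF P] D(1) Q(1) D(3,4) Q(2,3,4)])
 obtain K1 :: "('o, 'm, 'u) cmod" and r1 s\<^sub>1 where K1: "coind_copy (Grp P) K1 r1 s\<^sub>1"
  using coind_copy_exists[of "Grp P", OF mod_group[OF P] inf U] by blast
 obtain K2 :: "('o, 'm, 'u) cmod" and r2 s\<^sub>2 where K2: "coind_copy D K2 r2 s\<^sub>2"
  using coind_copy_exists[of D, OF D(1) inf U] by blast
 obtain K3 :: "('o, 'm, 'u) cmod" and r3 s\<^sub>3 where K3: "coind_copy Q K3 r3 s\<^sub>3"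
  using coind_copy_exists[of Q, OF Q(1) inf U] by blast
 have cD: "\<forall>X\<in>Ob. comm_group (D X) \<and> divisible (D X)"
  by (intro ballI conjI) (erule D(1), erule D(2))
 have dQ: "divisible (Q X)" if "X \<in> Ob" for X
  by (rule divisible_image[OF D(2)[OF that] D(1)[OF that] Q(1-3)[OF that]])
 show thesis
  by (rule that[OF K1 coind_copy_mses[OF ses K1 K2 K3] injective_coind_copy[of D, OF D(1,2) K2]
    injective_coind_copy[of Q, OF Q(1) dQ K3] cD K2])
qed

text \<open>Coinduce a free resolution \<open>0 \<rightarrow> K \<rightarrow> F \<rightarrow> J \<rightarrow>
 0\<close> of the groups: subgroups of free groups are projective, so the first two terms become projective.\<close>

lemma projective_presentation:
 fixes J :: "('o, 'm, 'u) cmod"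
 assumes J: "is_mod J" and inf: "infinite (UNIV :: 'u set)"
 obtains K1 K2 K3 :: "('o, 'm, 'u) cmod" and r s j q r' s'
 where "coind_copy (Grp J) K3 r s" "mses C K1 j K2 q K3" "proj_mod K2" "proj_mod K1"
  "coind_copy (%X. free_Abelian_group (el J X)) K2 r' s'"
proof -
 have U: "S \<lesssim> (UNIV :: 'u set)" for S :: "'u set" by (simp add: subset_imp_lepoll)
 let ?F = "%X. free_Abelian_group (el J X)"
 have F: "comm_group (?F X)" for X by (rule abelian_free_Abelian_group)
 have "\<exists>h. h \<in> hom (?F X) (Grp J X) \<and> h ` carrier (?F X) = el J X" if X: "X \<in> Ob" for X
  using free_Abelian_group_cover[OF mod_group[OF J X]] by metis
 then obtain h where h: "!!X. X \<in> Ob ==> h X \<in> hom (?F X) (Grp J X)" "!!X. X \<in> Ob ==> h X ` carrier (?F X) = el J X"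
  by metis
 let ?K = "%X. (?F X)\<lparr>carrier := kernel (?F X) (Grp J X) (h X)\<rparr>"
 have sub: "subgroup (kernel (?F X) (Grp J X) (h X)) (?F X)" if X: "X \<in> Ob" for X
 proof -
  have "group_hom (?F X) (Grp J X) (h X)"
   using F mod_group[OF J X] h(1)[OF X] by (rule group_homI)
  then show ?thesis by (rule group_hom.subgroup_kernel)
 qed
 have pK: "projective_group TYPE('u) (?K X)" if "X \<in> Ob" for X
  by (rule projective_subgroup[OF projective_free_Abelian_group sub[OF that] inf])
 have K: "comm_group (?K X)" if "X \<in> Ob" for X using pK[OF that] by (simp add: projective_group_def)
 have cF: "carrier (?F X) \<lesssim> (UNIV :: 'u set)" for X
 proof -
  have "carrier (?F X) \<lesssim> carrier (free_Abelian_group (UNIV :: 'u set))" by (intro subset_imp_lepoll) auto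
  then show ?thesis using eqpoll_free_Abelian_group_infinite[OF inf] by (rule lepoll_trans2)
 qed
 have cK: "carrier (?K X) \<lesssim> (UNIV :: 'u set)" for X
 proof -
  have "carrier (?K X) \<subseteq> carrier (?F X)" by (auto simp: kernel_def)
  then show ?thesis by (rule lepoll_trans[OF subset_imp_lepoll cF])
 qed
 have ses: "mses C (coind ?K) (coind_map (%X x. x)) (coind ?F) (coind_map h) (coind (Grp J))"
 proof (rule coind_mses[OF K F mod_group[OF J] _ _ h])
  show "(%x. x) \<in> hom (?K X) (?F X)" if "X \<in> Ob" for X by (auto simp: hom_def kernel_def)
  show "h X y = \<zero>[J,X] \<longleftrightarrow> y \<in> (%x. x) ` carrier (?K X)" if "X \<in> Ob" "y \<in> carrier (?F X)" for X y
   using that by (auto simp: kernel_def)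
 qed auto
 obtain K1 :: "('o, 'm, 'u) cmod" and r1 s\<^sub>1 where K1: "coind_copy ?K K1 r1 s\<^sub>1"
  using coind_copy_exists[of ?K, OF K inf cK] by blast
 obtain K2 :: "('o, 'm, 'u) cmod" and r2 s\<^sub>2 where K2: "coind_copy ?F K2 r2 s\<^sub>2"
  using coind_copy_exists[of ?F, OF F inf cF] by blast
 obtain K3 :: "('o, 'm, 'u) cmod" and r3 s\<^sub>3 where K3: "coind_copy (Grp J) K3 r3 s\<^sub>3"
  using coind_copy_exists[of "Grp J", OF mod_group[OF J] inf U] by blast
 show thesis
  by (rule that[OF K3 coind_copy_mses[OF ses K1 K2 K3] projective_coind_copy[of ?F, OF projective_free_Abelian_group K2]
    projective_coind_copy[of ?K, OF pK K1] K2])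
qed

lemma copy_unit:
 fixes M K :: "('o, 'm, 'u) cmod"
 assumes M: "is_mod M" and K: "coind_copy (Grp M) K r s"
 shows "mhom C M (%X x. r X (coind_unit M X x)) K" "!!X. X \<in> Ob ==> inj_on (%x. r X (coind_unit M X x)) (el M X)"
proof -
 show "mhom C M (%X x. r X (coind_unit M X x)) K" using mhom_comp[OF coind_unit(1)[OF M] coind_copyD(2)[OF K]] .
 fix X assume X: "X \<in> Ob"
 have "inj_on (r X) (el (coind (Grp M)) X)" using coind_copyD(4)[OF K X] by (metis inj_on_inverseI)
 then show "inj_on (%x. r X (coind_unit M X x)) (el M X)"
  using coind_unit(2)[OF M X] mhom_closed[OF coind_unit(1)[OF M] X] by (auto simp: inj_on_def simp del: coind_simps)
qed

text \<open>The identities of the groups correspond to a homomorphism \<open>coind M \<rightarrow> M\<close>, which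
 sends \<open>delta m\<close> to \<open>m\<close>.\<close>

lemma copy_counit:
 fixes M K :: "('o, 'm, 'u) cmod"
 assumes M: "is_mod M" and K: "coind_copy (Grp M) K r s"
 obtains e where "mhom C K e M" "!!X. X \<in> Ob ==> e X ` el K X = el M X"
proof
 let ?e = "coind_out M (%X x. x)"
 have g: "(%x. x) \<in> hom (Grp M X) (Grp M X)" for X by (auto simp: hom_def)
 have e: "mhom C (coind (Grp M)) ?e M" using mhom_coind_out[of "Grp M" M "%X x. x"] mod_group[OF M] M g by blast
 show "mhom C K (%X x. ?e X (s X x)) M" using mhom_comp[OF coind_copyD(3)[OF K] e] .
 then have "(%x. ?e X (s X x)) ` el K X \<subseteq> el M X" if "X \<in> Ob" for X
  using mhom_closed[OF \<open>mhom C K (%X x. ?e X (s X x)) M\<close> that] by blast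
 moreover have "el M X \<subseteq> (%x. ?e X (s X x)) ` el K X" if X: "X \<in> Ob" for X
 proof
  fix m assume m: "m \<in> el M X"
  have d: "delta (Grp M) X m \<in> el (coind (Grp M)) X" using delta_car[of "Grp M" X m] mod_group[OF M] X m by simp
  have "?e X (delta (Grp M) X m) = m" using coind_out_delta[of "Grp M" M "%X x. x" X m] mod_group[OF M] M g X m by blast
  then have "m = ?e X (s X (r X (delta (Grp M) X m)))" using coind_copyD(4)[OF K X d] by simp
  then show "m \<in> (%x. ?e X (s X x)) ` el K X" using mhom_closed[OF coind_copyD(2)[OF K] X d] by blast
 qed
 ultimately show "(%x. ?e X (s X x)) ` el K X = el M X" if "X \<in> Ob" for X using that by blast
qed

subsection \<open>The Gorenstein property\<close>

text \<open>The surjection from \<open>coind P\<close> splits, so \<open>P\<close> is a retract of a module with an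
 injective copresentation.\<close>

theorem projective_id_le_1:
 fixes P :: "('o, 'm, 'u) cmod"
 assumes P: "proj_mod P" and inf: "infinite (UNIV :: 'u set)"
 shows "id_le_1 P"
proof -
 have mP: "is_mod P" using P by (simp add: projective_module_def)
 obtain K1 K2 K3 :: "('o, 'm, 'u) cmod" and r s j q and D :: "'o => 'u monoid" and r' s'
  where K: "coind_copy (Grp P) K1 r s" "mses C K1 j K2 q K3" "inj_mod K2" "inj_mod K3"
   "\<forall>X\<in>Ob. comm_group (D X) \<and> divisible (D X)" "coind_copy D K2 r' s'"
  by (rule injective_copresentation[OF mP inf])
 note J = msesD[OF K(2)]
 obtain e where e: "mhom C K1 e P" "!!X. X \<in> Ob ==> e X ` el K1 X = el P X"
  using copy_counit[OF mP K(1)] by blast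
 obtain i where i: "mhom C P i K1" "!!X x. X \<in> Ob ==> x \<in> el P X ==> e X (i X x) = x"
  using projective_moduleD[OF P J(1) mP e mhom_id] by blast
 have inj: "inj_on (%x. j X (i X x)) (el P X)" if X: "X \<in> Ob" for X
 proof (rule inj_onI)
  fix x y assume xy: "x \<in> el P X" "y \<in> el P X" "j X (i X x) = j X (i X y)"
  then have "i X x = i X y" using inj_onD[OF J(6)[OF X]] mhom_closed[OF i(1) X] by blast
  then show "x = y" using i(2)[OF X] xy by metis
 qed
 have "id_le_1 K1" using K(2-4) unfolding id_le_1_def by blast
 then show ?thesis
  by (rule id_le_1_retract[OF _ i(1) e(1) i(2) mP mhom_comp[OF i(1) J(4)] inj K(3)])
qed

text \<open>The embedding into \<open>coind J\<close> splits, so \<open>J\<close> is a retract of a module with a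
 projective presentation.\<close>

theorem injective_pd_le_1:
 fixes J :: "('o, 'm, 'u) cmod"
 assumes J: "inj_mod J" and inf: "infinite (UNIV :: 'u set)"
 shows "pd_le_1 J"
proof -
 have mJ: "is_mod J" using J by (simp add: injective_module_def)
 obtain K1 K2 K3 :: "('o, 'm, 'u) cmod" and r s j q r' s'
  where K: "coind_copy (Grp J) K3 r s" "mses C K1 j K2 q K3" "proj_mod K2" "proj_mod K1"
   "coind_copy (%X. free_Abelian_group (el J X)) K2 r' s'"
  by (rule projective_presentation[OF mJ inf])
 note S = msesD[OF K(2)] and u = copy_unit[OF mJ K(1)]
 obtain e where e: "mhom C K3 e J" "!!X x. X \<in> Ob ==> x \<in> el J X ==> e X (r X (coind_unit J X x)) = x"
  using injective_moduleD[OF J mJ S(3) u mhom_id] by blast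
 have surj: "(%x. e X (q X x)) ` el K2 X = el J X" if X: "X \<in> Ob" for X
 proof -
  have "e X ` el K3 X = el J X"
  proof
   show "e X ` el K3 X \<subseteq> el J X" using mhom_closed[OF e(1) X] by blast
   show "el J X \<subseteq> e X ` el K3 X" using e(2)[OF X] mhom_closed[OF u(1) X] by force
  qed
  then show ?thesis using S(7)[OF X] by (simp flip: image_image)
 qed
 have "pd_le_1 K3" using K(2-4) unfolding pd_le_1_def by blast
 then show ?thesis
  by (rule pd_le_1_retract[OF _ u(1) e(1) e(2) mJ mhom_comp[OF S(5) e(1)] surj K(3)])
qed

lemma proj_dim_finite_iff_inj_dim_finite:
 fixes X :: "('o, 'm, 'u) cmod"
 assumes inf: "infinite (UNIV :: 'u set)"
 shows "proj_dim ModC X < \<infinity> ==> inj_dim ModC X \<le> 1"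
  and "inj_dim ModC X < \<infinity> ==> proj_dim ModC X \<le> 1"
proof -
 assume "proj_dim ModC X < \<infinity>"
 then obtain n P d where "projective_resolution ModC X n P d" by (rule proj_dim_finite)
 then have "id_le_1 X" using projective_resolution_id_le_1 projective_id_le_1[OF _ inf] by blast
 then show "inj_dim ModC X \<le> 1" by (rule inj_dim_le_1)
next
 assume "inj_dim ModC X < \<infinity>"
 then obtain n I d where "injective_resolution ModC X n I d" by (rule inj_dim_finite)
 then have "pd_le_1 X" using injective_resolution_pd_le_1 injective_pd_le_1[OF _ inf] by blast
 then show "proj_dim ModC X \<le> 1" by (rule proj_dim_le_1)
qed

lemma enough_projectives_Mod:
 assumes inf: "infinite (UNIV :: 'u set)"
 shows "enough_projectives (Modcat TYPE('u) C)"
 unfolding enough_projectives_def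
proof
 let ?A = "Modcat TYPE('u) C"
 fix M :: "('o, 'm, 'u) cmod" assume "M \<in> Obj ?A"
 then have M: "is_mod M" by simp
 obtain K1 K2 K3 :: "('o, 'm, 'u) cmod" and r s j q r' s'
  where K: "coind_copy (Grp M) K3 r s" "mses C K1 j K2 q K3" "proj_mod K2" "proj_mod K1"
   "coind_copy (%X. free_Abelian_group (el M X)) K2 r' s'"
  by (rule projective_presentation[OF M inf])
 note S = msesD[OF K(2)]
 obtain e where e: "mhom C K3 e M" "!!X. X \<in> Ob ==> e X ` el K3 X = el M X"
  using copy_counit[OF M K(1)] by blast
 have h: "mhom C K2 (%X x. e X (q X x)) M" using mhom_comp[OF S(5) e(1)] .
 have "(%x. e X (q X x)) ` el K2 X = el M X" if "X \<in> Ob" for X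
  using S(7)[OF that] e(2)[OF that] by (simp flip: image_image)
 then have "is_epi ?A (mk C K2 (%X x. e X (q X x)) M)"
  using is_epi_iff[OF S(2) M h] by simp
 then show "\<exists>P. projective ?A P \<and> (\<exists>e\<in>homs ?A P M. is_epi ?A e)"
  using K(3) S(2) M h by (intro exI[of _ "K2"] conjI bexI[of _ "mk C K2 (%X x. e X (q X x)) M"])
   (simp_all add: projective_iff)
qed

text \<open>Coinduced from the integers at every object, a module maps onto any chosen element of any module; this
 makes it a generator.\<close>

definition regular_groups :: "'o => (unit \<Rightarrow>\<^sub>0 int) monoid" where
 "regular_groups X = free_Abelian_group UNIV"

lemma regular_copy_exists:
 assumes inf: "infinite (UNIV :: 'u set)"
 obtains G :: "('o, 'm, 'u) cmod" and r s where "coind_copy regular_groups G r s"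
proof -
 have "carrier (free_Abelian_group (UNIV :: unit set)) \<lesssim> (UNIV :: 'u set)"
 proof -
  have "inj (%c :: unit \<Rightarrow>\<^sub>0 int. Poly_Mapping.lookup c ())"
   by (intro injI poly_mapping_eqI) simp
  then have "countable (UNIV :: (unit \<Rightarrow>\<^sub>0 int) set)" by (metis countable_image_inj_on countableI_type)
  then have "(UNIV :: (unit \<Rightarrow>\<^sub>0 int) set) \<lesssim> (UNIV :: 'u set)" by (rule countable_lepoll_infinite[OF inf])
  then show ?thesis by (rule lepoll_trans[OF subset_imp_lepoll[OF subset_UNIV]])
 qed
 then show thesis
  using coind_copy_exists[of regular_groups] inf abelian_free_Abelian_group that
  unfolding regular_groups_def by metis
qed

lemma is_generator_regular:
 fixes G :: "('o, 'm, 'u) cmod"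
 assumes G: "coind_copy regular_groups G r s"
 shows "is_generator (Modcat TYPE('u) C) G"
 unfolding is_generator_def
proof (intro conjI ballI impI)
 let ?A = "Modcat TYPE('u) C"
 note c = coind_copyD[OF G]
 show "G \<in> Obj ?A" using c(1) by simp
 fix f g assume "f \<in> Arr ?A" "g \<in> Arr ?A" and d: "Dom ?A f = Dom ?A g"
  "Cod ?A f = Cod ?A g" and ne: "f \<noteq> g"
 obtain M a N where f: "f = mk C M a N" "is_mod M" "is_mod N" "mhom C M a N" using \<open>f \<in> _\<close> by (rule Arr_Mod_cases)
 obtain b where g: "g = mk C M b N" "mhom C M b N" using Arr_Mod_cases[OF \<open>g \<in> _\<close>] d f(1) by (metis Cod_mk Dom_mk)
 obtain X x where X: "X \<in> Ob" "x \<in> el M X" "a X x \<noteq> b X x" using ne f(1) g(1) by (auto simp: mk_eq_iff)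
 have reg: "comm_group (regular_groups Y)" for Y by (simp add: regular_groups_def abelian_free_Abelian_group)
 have "\<exists>h. h \<in> hom (regular_groups Y) (Grp M Y) \<and> (Y = X --> h (frag_of ()) = x)" if Y: "Y \<in> Ob" for Y
 proof -
  interpret comm_group "Grp M Y" using f(2) Y by (rule mod_group)
  let ?y = "if Y = X then x else \<zero>[M,Y]"
  have "(%_. ?y) ` (UNIV :: unit set) \<subseteq> el M Y" using X by auto
  then obtain h where "h \<in> hom (free_Abelian_group (UNIV :: unit set)) (Grp M Y)" "!!u. u \<in> UNIV ==> h (frag_of u) = ?y"
   using free_Abelian_group_universal by blast
  then show ?thesis by (auto simp: regular_groups_def)
 qed
 then obtain h where h: "!!Y. Y \<in> Ob ==> h Y \<in> hom (regular_groups Y) (Grp M Y)" "h X (frag_of ()) = x"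
  using X(1) by metis
 let ?H = "coind_out M h"
 have H: "mhom C (coind regular_groups) ?H M" using mhom_coind_out[of regular_groups M h] reg f(2) h(1) by blast
 have u: "frag_of () \<in> carrier (regular_groups X)" by (simp add: regular_groups_def)
 let ?\<delta> = "delta regular_groups X (frag_of ())"
 have \<delta>: "?\<delta> \<in> el (coind regular_groups) X" using delta_car[of regular_groups X "frag_of ()"] reg X(1) u by simp
 have Hx: "?H X ?\<delta> = x" using coind_out_delta[of regular_groups M h X "frag_of ()"] reg f(2) h X(1) u by simp
 have k: "mhom C G (%Y y. ?H Y (s Y y)) M" using mhom_comp[OF c(3) H] .
 have e: "r X ?\<delta> \<in> el G X" "s X (r X ?\<delta>) = ?\<delta>" using mhom_closed[OF c(2) X(1) \<delta>] c(4)[OF X(1) \<delta>] by auto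
 have "Comp ?A f (mk C G (%Y y. ?H Y (s Y y)) M) \<noteq> Comp ?A g (mk C G (%Y y. ?H Y (s Y y)) M)"
 proof
  assume "Comp ?A f (mk C G (%Y y. ?H Y (s Y y)) M) = Comp ?A g (mk C G (%Y y. ?H Y (s Y y)) M)"
  then have "a X (?H X (s X (r X ?\<delta>))) = b X (?H X (s X (r X ?\<delta>)))"
   using k e(1) X(1) by (simp add: f(1) g(1) mk_eq_iff)
  then show False using X(3) e(2) Hx by simp
 qed
 then show "\<exists>h\<in>homs ?A G (Dom ?A f). Comp ?A f h \<noteq> Comp ?A g h"
  using k c(1) f by (intro bexI[of _ "mk C G (%Y y. ?H Y (s Y y)) M"]) auto
qed

lemma divisible_coind:
 fixes D :: "'o => ('b, 'z) monoid_scheme"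
 assumes D: "!!X. X \<in> Ob ==> comm_group (D X)" "!!X. X \<in> Ob ==> divisible (D X)" and Y: "Y \<in> Ob"
 shows "divisible (Grp (coind D) Y)"
 unfolding divisible_def
proof (intro allI ballI impI)
 fix n :: nat and \<phi> assume "\<phi> \<in> el (coind D) Y" and n: "0 < n"
 then have \<phi>: "\<phi> \<in> coind_car D Y" by simp
 let ?p = "%X x. x ^[D X] n"
 have p: "?p X \<in> hom (D X) (D X)" "?p X ` carrier (D X) = carrier (D X)" if X: "X \<in> Ob" for X
 proof -
  interpret comm_group "D X" using D(1)[OF X] .
  show "?p X \<in> hom (D X) (D X)" by (intro homI) (auto simp: nat_pow_distrib)
  show "?p X ` carrier (D X) = carrier (D X)"
  proof
   show "?p X ` carrier (D X) \<subseteq> carrier (D X)" by auto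
   show "carrier (D X) \<subseteq> ?p X ` carrier (D X)"
   proof
    fix x assume "x \<in> carrier (D X)"
    then obtain y where "y \<in> carrier (D X)" "y ^[D X] n = x" using D(2)[OF X] n unfolding divisible_def by blast
    then show "x \<in> ?p X ` carrier (D X)" by blast
   qed
  qed
 qed
 obtain \<psi> where \<psi>: "\<psi> \<in> coind_car D Y" "coind_map ?p Y \<psi> = \<phi>"
  using coind_map_surj[of D D ?p Y \<phi>] D(1) p Y \<phi> by blast
 have pw: "\<psi> ^[Grp (coind D) Y] (m::nat) = (\<lambda>f\<in>into Y. \<psi> f ^[D (dom f)] m)" for m
 proof (induction m)
  case (Suc m)
  then show ?case by (auto intro!: restrict_ext)
 qed (simp)
 then have "\<psi> ^[Grp (coind D) Y] n = \<phi>" using \<psi>(2) by (simp add: coind_map_def)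
 then show "\<exists>\<psi>\<in>el (coind D) Y. \<psi> ^[Grp (coind D) Y] n = \<phi>" using \<psi>(1) by auto
qed

text \<open>Evaluation at \<open>f\<close> is a homomorphism to a free group, whose only divisible element is
 zero.\<close>

lemma coind_free_no_divisible:
 fixes S :: "'o => 'a set"
 assumes Y: "Y \<in> Ob" and \<phi>: "\<phi> \<in> coind_car (%X. free_Abelian_group (S X)) Y"
  and dv: "!!n::nat. 0 < n ==> \<exists>\<psi>\<in>coind_car (%X. free_Abelian_group (S X)) Y. \<psi> ^[Grp (coind (%X. free_Abelian_group (S X))) Y] n = \<phi>"
  and f: "f \<in> into Y"
 shows "\<phi> f = 0"
proof (rule free_Abelian_group_no_divisible[of _ "S (dom f)"])
 let ?B = "%X. free_Abelian_group (S X)"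
 show "Poly_Mapping.keys (\<phi> f) \<subseteq> S (dom f)" using coind_carD(1)[OF \<phi> f] by simp
 have ev: "(%\<psi>. \<psi> f) \<in> hom (Grp (coind ?B) Y) (?B (dom f))"
  using f coind_carD(1)[OF _ f] by (intro homI) fastforce+
 have B: "comm_group (?B X)" for X by (rule abelian_free_Abelian_group)
 have grp: "group (Grp (coind ?B) Y)" using is_module_coind[of ?B] B Y by simp
 fix n :: nat assume "0 < n"
 then obtain \<psi> where \<psi>: "\<psi> \<in> coind_car ?B Y" "\<psi> ^[Grp (coind ?B) Y] n = \<phi>" using dv by blast
 have "\<psi> f ^[?B (dom f)] n = \<phi> f"
  using hom_nat_pow[OF ev _ grp comm_groupD(1)[OF B], of \<psi> n] \<psi> by simp
 then show "\<exists>y\<in>carrier (?B (dom f)). y ^[?B (dom f)] n = \<phi> f"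
  using coind_carD(1)[OF \<psi>(1) f] by blast
qed

text \<open>An injective module is a retract of one that is coinduced from divisible groups, so it is divisible. But
 \<open>delta\<close> of a generator is not divisible: its value at the identity of \<open>X\<close> is \<open>tr (Id C
 X)\<close> times that generator.\<close>

lemma regular_not_injective:
 fixes G :: "('o, 'm, 'u) cmod"
 assumes G: "coind_copy regular_groups G r s" and inf: "infinite (UNIV :: 'u set)"
  and X: "X \<in> Ob" and tr: "tr (Id C X) \<noteq> 0"
 shows "~ inj_mod G"
proof
 assume inj: "inj_mod G"
 note c = coind_copyD[OF G]
 obtain K1 K2 K3 :: "('o, 'm, 'u) cmod" and r1 s\<^sub>1 j q and D :: "'o => 'u monoid" and r' s'
  where K: "coind_copy (Grp G) K1 r1 s\<^sub>1" "mses C K1 j K2 q K3" "inj_mod K2" "inj_mod K3"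
   "\<forall>X\<in>Ob. comm_group (D X) \<and> divisible (D X)" "coind_copy D K2 r' s'"
  by (rule injective_copresentation[OF c(1) inf])
 note S = msesD[OF K(2)] and u = copy_unit[OF c(1) K(1)] and c' = coind_copyD[OF K(6)]
 have ji: "inj_on (%x. j X (r1 X (coind_unit G X x))) (el G X)" if X: "X \<in> Ob" for X
  using u(2)[OF X] S(6)[OF X] mhom_closed[OF u(1) X] unfolding inj_on_def by blast
 obtain e where e: "mhom C K2 e G" "!!X x. X \<in> Ob ==> x \<in> el G X ==> e X (j X (r1 X (coind_unit G X x))) = x"
  using injective_moduleD[OF inj c(1) S(2) mhom_comp[OF u(1) S(4)] ji mhom_id] by blast
 let ?w = "%Y x. s Y (e Y (r' Y x))"
 have w: "mhom C (coind D) ?w (coind regular_groups)" using mhom_comp[OF mhom_comp[OF c'(2) e(1)] c(3)] .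
 have mD: "is_mod (coind D)" using is_module_coind[of D] K(5) by blast
 have reg: "comm_group (regular_groups Y)" for Y by (simp add: regular_groups_def abelian_free_Abelian_group)
 have mR: "is_mod (coind regular_groups)" using reg by (rule is_module_coind)
 have "?w X ` el (coind D) X = el (coind regular_groups) X"
 proof
  show "?w X ` el (coind D) X \<subseteq> el (coind regular_groups) X" using mhom_closed[OF w X] by blast
  show "el (coind regular_groups) X \<subseteq> ?w X ` el (coind D) X"
  proof
   fix \<phi> assume \<phi>: "\<phi> \<in> el (coind regular_groups) X"
   have g: "r X \<phi> \<in> el G X" using mhom_closed[OF c(2) X \<phi>] .
   let ?k = "j X (r1 X (coind_unit G X (r X \<phi>)))"
   have k: "?k \<in> el K2 X" using mhom_closed[OF mhom_comp[OF u(1) S(4)] X g] .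
   have "?w X (s' X ?k) = \<phi>" using c'(5)[OF X k] e(2)[OF X g] c(4)[OF X \<phi>] by simp
   then show "\<phi> \<in> ?w X ` el (coind D) X" using mhom_closed[OF c'(3) X k] by force
  qed
 qed
 moreover have "divisible (Grp (coind D) X)" using divisible_coind[of D X] K(5) X by blast
 ultimately have dR: "divisible (Grp (coind regular_groups) X)"
  using divisible_image[OF _ mod_group[OF mD X] mod_group[OF mR X] mhom_hom[OF w X]] by blast
 let ?\<delta> = "delta regular_groups X (frag_of ())"
 have u1: "frag_of () \<in> carrier (regular_groups X)" by (simp add: regular_groups_def)
 have \<delta>: "?\<delta> \<in> coind_car regular_groups X" using delta_car[of regular_groups X "frag_of ()"] reg X u1 by simp
 have IdX: "Id C X \<in> into X" using X by (simp add: into_def)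
 have R: "regular_groups = (%X. free_Abelian_group UNIV)" by (simp add: regular_groups_def fun_eq_iff)
 have "\<exists>\<psi>\<in>coind_car regular_groups X. \<psi> ^[Grp (coind regular_groups) X] n = ?\<delta>" if "0 < n" for n :: nat
  using dR \<delta> that unfolding divisible_def by simp
 then have "?\<delta> (Id C X) = 0"
  using coind_free_no_divisible[OF X \<delta>[unfolded R] _ IdX] unfolding R by blast
 moreover have "?\<delta> (Id C X) = frag_cmul (tr (Id C X)) (frag_of ())"
  using IdX X by (simp add: delta_def regular_groups_def)
 ultimately show False using tr by simp
qed

text \<open>A projective module embeds into one that is coinduced from free groups, so it has no nonzero divisible
 element. Coinducing the divisible hull of the integers gives an injective module in which \<open>delta\<close> of an
 integral element is divisible, and nonzero because \<open>tr (Id C X)\<close> is.\<close>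

lemma divisible_not_projective:
 assumes inf: "infinite (UNIV :: 'u set)" and X: "X \<in> Ob" and tr: "tr (Id C X) \<noteq> 0"
 obtains I :: "('o, 'm, 'u) cmod" where "inj_mod I" "~ proj_mod I"
proof -
 let ?Z = "free_Abelian_group (UNIV :: unit set)"
 have Z: "comm_group ?Z" by (rule abelian_free_Abelian_group)
 have "carrier ?Z \<lesssim> (UNIV :: 'u set)"
 proof -
  have "inj (%c :: unit \<Rightarrow>\<^sub>0 int. Poly_Mapping.lookup c ())"
   by (intro injI poly_mapping_eqI) simp
  then have "countable (UNIV :: (unit \<Rightarrow>\<^sub>0 int) set)" by (metis countable_image_inj_on countableI_type)
  then have "(UNIV :: (unit \<Rightarrow>\<^sub>0 int) set) \<lesssim> (UNIV :: 'u set)" by (rule countable_lepoll_infinite[OF inf])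
  then show ?thesis by (rule lepoll_trans[OF subset_imp_lepoll[OF subset_UNIV]])
 qed
 then obtain D :: "'u monoid" and i where D: "comm_group D" "divisible D" "i \<in> hom ?Z D" "inj_on i (carrier ?Z)"
  using divisible_embedding[OF Z inf] by blast
 let ?D = "%Y::'o. D"
 obtain I :: "('o, 'm, 'u) cmod" and r s where I: "coind_copy ?D I r s"
  using coind_copy_exists[of ?D] D(1) inf by (metis subset_UNIV subset_imp_lepoll)
 note c = coind_copyD[OF I]
 have inj: "inj_mod I" using injective_coind_copy[of ?D I r s] D(1,2) I by blast
 have "~ proj_mod I"
 proof
  assume proj: "proj_mod I"
  obtain K1 K2 K3 :: "('o, 'm, 'u) cmod" and r1 s\<^sub>1 j q r' s'
   where K: "coind_copy (Grp I) K3 r1 s\<^sub>1" "mses C K1 j K2 q K3" "proj_mod K2" "proj_mod K1"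
    "coind_copy (%X. free_Abelian_group (el I X)) K2 r' s'"
   by (rule projective_presentation[OF c(1) inf])
  let ?F = "%X. free_Abelian_group (el I X)"
  note S = msesD[OF K(2)] and c' = coind_copyD[OF K(5)]
  obtain e where e: "mhom C K3 e I" "!!X. X \<in> Ob ==> e X ` el K3 X = el I X"
   using copy_counit[OF c(1) K(1)] by blast
  have surj: "(%x. e X (q X x)) ` el K2 X = el I X" if "X \<in> Ob" for X
   using S(7)[OF that] e(2)[OF that] by (simp flip: image_image)
  obtain t where t: "mhom C I t K2" "!!X x. X \<in> Ob ==> x \<in> el I X ==> e X (q X (t X x)) = x"
   using projective_moduleD[OF proj S(2) c(1) mhom_comp[OF S(5) e(1)] surj mhom_id] by blast
  let ?w = "%Y x. s' Y (t Y (r Y x))"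
  have w: "mhom C (coind ?D) ?w (coind ?F)" using mhom_comp[OF mhom_comp[OF c(2) t(1)] c'(3)] .
  have mD: "is_mod (coind ?D)" using is_module_coind[of ?D] D(1) by blast
  have mF: "is_mod (coind ?F)" using is_module_coind[of ?F] abelian_free_Abelian_group by blast
  have winj: "x = y" if xy: "x \<in> el (coind ?D) X" "y \<in> el (coind ?D) X" "?w X x = ?w X y" for x y
  proof -
   have rx: "r X x \<in> el I X" "r X y \<in> el I X" using mhom_closed[OF c(2) X] xy by auto
   have tx: "t X (r X x) \<in> el K2 X" "t X (r X y) \<in> el K2 X" using mhom_closed[OF t(1) X] rx by auto
   have "t X (r X x) = t X (r X y)" using c'(5)[OF X tx(1)] c'(5)[OF X tx(2)] xy(3) by metis
   then have "r X x = r X y" using t(2)[OF X rx(1)] t(2)[OF X rx(2)] by metis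
   then show "x = y" using c(4)[OF X xy(1)] c(4)[OF X xy(2)] by metis
  qed
  let ?d = "i (frag_of ())"
  have d: "?d \<in> carrier D" using hom_in_carrier[OF D(3), of "frag_of ()"] by simp
  let ?\<delta> = "delta ?D X ?d"
  have \<delta>: "?\<delta> \<in> el (coind ?D) X" using delta_car[of ?D X ?d] D(1) X d by simp
  have IdX: "Id C X \<in> into X" using X by (simp add: into_def)
  have dD: "divisible (Grp (coind ?D) X)" using divisible_coind[of ?D X] D(1,2) X by blast
  have "?w X ?\<delta> = \<zero>[coind ?F,X]"
  proof -
   have w\<delta>: "?w X ?\<delta> \<in> coind_car ?F X" using mhom_closed[OF w X \<delta>] by simp
   have "\<exists>\<psi>\<in>coind_car ?F X. \<psi> ^[Grp (coind ?F) X] n = ?w X ?\<delta>" if n: "0 < n" for n :: nat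
   proof -
    obtain \<chi> where \<chi>: "\<chi> \<in> el (coind ?D) X" "\<chi> ^[Grp (coind ?D) X] n = ?\<delta>"
     using dD \<delta> n unfolding divisible_def by blast
    have "?w X \<chi> ^[Grp (coind ?F) X] n = ?w X ?\<delta>"
     using hom_nat_pow[OF mhom_hom[OF w X] \<chi>(1) mod_is_group[OF mD X] mod_is_group[OF mF X], of n] \<chi>(2) by simp
    then show ?thesis using mhom_closed[OF w X \<chi>(1)] by auto
   qed
   then have z: "?w X ?\<delta> f = 0" if "f \<in> into X" for f
    using coind_free_no_divisible[OF X w\<delta> _ that] by blast
   show ?thesis
    unfolding coind_simps
    by (rule coind_eqI[OF coind_carD(3)[OF w\<delta>]]) (use z in auto)
  qed
  also have "\<dots> = ?w X \<zero>[coind ?D,X]" using mhom_one[OF w mD mF X] by simp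
  finally have "?\<delta> = \<zero>[coind ?D,X]" using winj[OF \<delta>] mod_one[OF mD X] by blast
  then have "?\<delta> (Id C X) = \<zero>[coind ?D,X] (Id C X)" by (simp only:)
  then have "?d ^[D] tr (Id C X) = \<one>[D]" using IdX X by (simp add: delta_def)
  then have "i (frag_cmul (tr (Id C X)) (frag_of ())) = i 0"
   using hom_int_pow[OF D(3) _ comm_groupD(1)[OF Z] comm_groupD(1)[OF D(1)], of "frag_of ()" "tr (Id C X)"]
    hom_oneD[OF D(3) Z D(1)] by simp
  then have "frag_cmul (tr (Id C X)) (frag_of ()) = 0"
   using inj_onD[OF D(4), of "frag_cmul (tr (Id C X)) (frag_of ())" 0] by simp
  then show False using tr by simp
 qed
 then show thesis using that inj by blast
qed

text \<open>Resolutions reduce every finite dimension to the bounds for projective and injective modules, and the two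
 preceding lemmas show that the value one is attained.\<close>

theorem frobenius_gorenstein:
 assumes inf: "infinite (UNIV :: 'u set)" and X: "X \<in> Ob" and tr: "tr (Id C X) \<noteq> 0"
 shows "n_gorenstein TYPE('u) 1 C"
proof -
 let ?D = "Modcat TYPE('u) C"
 obtain G :: "('o, 'm, 'u) cmod" and r s where G: "coind_copy regular_groups G r s"
  using regular_copy_exists[OF inf] by blast
 have mG: "is_mod G" using coind_copyD(1)[OF G] .
 have gen: "is_generator ?D G" using is_generator_regular[OF G] .
 have pG: "proj_mod G"
  by (rule projective_coind_copy[OF _ G]) (simp add: regular_groups_def projective_free_Abelian_group)
 obtain I :: "('o, 'm, 'u) cmod" where I: "inj_mod I" "~ proj_mod I"
  using divisible_not_projective[OF inf X tr] by blast
 have mI: "is_mod I" using I(1) by (simp add: injective_module_def)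
 have groth: "grothendieck_category TYPE('u) ?D"
  unfolding grothendieck_category_def
  using abelian_category_Mod[OF inf] has_small_coproducts_Mod[OF inf] filtered_colimits_exact_Mod[OF inf] gen by blast
 have iG: "inj_dim ?D G = 1"
 proof (rule antisym)
  show "inj_dim ?D G \<le> 1" using inj_dim_le_1[OF projective_id_le_1[OF pG inf]] .
  show "1 \<le> inj_dim ?D G" using inj_dim_less_1[of G] regular_not_injective[OF G inf X tr] by (meson not_le)
 qed
 have pI: "proj_dim ?D I = 1"
 proof (rule antisym)
  show "proj_dim ?D I \<le> 1" using proj_dim_le_1[OF injective_pd_le_1[OF I(1) inf]] .
  show "1 \<le> proj_dim ?D I" using proj_dim_less_1[of I] I(2) by (meson not_le)
 qed
 have fin1: "(1 :: enat) < \<infinity>" by (simp add: one_enat_def)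
 have iff: "proj_dim ?D M < \<infinity> \<longleftrightarrow> inj_dim ?D M < \<infinity>" for M
  using proj_dim_finite_iff_inj_dim_finite[OF inf, of M] fin1 by (meson le_less_trans)
 have fpd: "finitary_proj_dim ?D = 1"
  unfolding finitary_proj_dim_def
 proof (rule antisym)
  show "Sup {proj_dim ?D M |M. M \<in> Obj ?D \<and> proj_dim ?D M < \<infinity>} \<le> 1"
   using proj_dim_finite_iff_inj_dim_finite(2)[OF inf] iff by (intro Sup_least) blast
  show "1 \<le> Sup {proj_dim ?D M |M. M \<in> Obj ?D \<and> proj_dim ?D M < \<infinity>}"
   using pI mI fin1 by (intro Sup_upper CollectI exI[of _ I]) simp
 qed
 have fid: "finitary_inj_dim ?D = 1"
  unfolding finitary_inj_dim_def
 proof (rule antisym)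
  show "Sup {inj_dim ?D M |M. M \<in> Obj ?D \<and> inj_dim ?D M < \<infinity>} \<le> 1"
   using proj_dim_finite_iff_inj_dim_finite(1)[OF inf] iff by (intro Sup_least) blast
  show "1 \<le> Sup {inj_dim ?D M |M. M \<in> Obj ?D \<and> inj_dim ?D M < \<infinity>}"
   using iG mG fin1 by (intro Sup_upper CollectI exI[of _ G]) simp
 qed
 have "proj_dim ?D G < \<infinity>" using iff[of G] fin1 by (simp only: iG)
 then show ?thesis
  unfolding n_gorenstein_def n_gorenstein_category_def gorenstein_category_def
  using groth iff fpd fid gen enough_projectives_Mod[OF inf] fin1 by (auto simp: one_enat_def)
qed

end

section \<open>Categories presented by quivers with relations\<close>

lemma is_path_append:
 "is_path src tgt X (u @ v) Y \<longleftrightarrow> (\<exists>Z. is_path src tgt X v Z \<and> is_path src tgt Z u Y)"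
 by (induction u arbitrary: Y) auto

lemma free_hom_zero: "0 \<in> free_hom src tgt X Y"
 by (simp add: free_hom_def)

lemma free_hom_one: "1 \<in> free_hom src tgt X X"
 by (simp add: free_hom_def in_keys_iff lookup_one zero_word_def)

lemma free_hom_add: "f \<in> free_hom src tgt X Y ==> g \<in> free_hom src tgt X Y ==> f + g \<in> free_hom src tgt X Y"
 using keys_add[of f g] by (auto simp: free_hom_def)

lemma free_hom_diff: "f \<in> free_hom src tgt X Y ==> g \<in> free_hom src tgt X Y ==> f - g \<in> free_hom src tgt X Y"
 using keys_diff[of f g] by (auto simp: free_hom_def)

lemma free_hom_uminus: "f \<in> free_hom src tgt X Y ==> - f \<in> free_hom src tgt X Y"
 by (simp add: free_hom_def)

lemma free_hom_mult:
 assumes "g \<in> free_hom src tgt Y Z" "f \<in> free_hom src tgt X Y"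
 shows "g * f \<in> free_hom src tgt X Z"
 unfolding free_hom_def
proof (intro CollectI allI impI)
 fix u assume "Word u \<in> Poly_Mapping.keys (g * f)"
 then obtain v w where "Word u = v + w" "v \<in> Poly_Mapping.keys g" "w \<in> Poly_Mapping.keys f"
  using keys_mult[of g f] by blast
 then show "is_path src tgt X u Z"
  using assms by (cases v; cases w) (auto simp: free_hom_def is_path_append)
qed

lemma free_hom_of_int: "of_int k \<in> free_hom src tgt X X"
 by (auto simp: free_hom_def in_keys_iff lookup_of_int zero_word_def when_def split: if_splits)

lemma free_hom_power: "f \<in> free_hom src tgt X X ==> f ^ n \<in> free_hom src tgt X X"
 by (induction n) (auto intro: free_hom_one free_hom_mult)

lemma free_hom_scale: "f \<in> free_hom src tgt X Y ==> of_int k * f \<in> free_hom src tgt X Y"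
 by (rule free_hom_mult[OF free_hom_of_int])

lemma free_hom_sum: "(!!i. i \<in> I ==> f i \<in> free_hom src tgt X Y) ==> sum f I \<in> free_hom src tgt X Y"
 by (induction I rule: infinite_finite_induct) (auto intro: free_hom_zero free_hom_add)

lemma free_hom_sum_list: "(!!i. i \<in> set is ==> f i \<in> free_hom src tgt X Y) ==> sum_list (map f is) \<in> free_hom src tgt X Y"
 by (induction "is") (auto intro: free_hom_zero free_hom_add)

lemmas free_hom_intros = free_hom_zero free_hom_one free_hom_add free_hom_diff free_hom_uminus free_hom_of_int
 free_hom_scale free_hom_power free_hom_sum

locale presentation =
 fixes src tgt :: "'a => 'v" and R :: "'v => 'v => 'a free_ring => bool"
begin

abbreviation Hom :: "'v => 'v => 'a free_ring set" where
 "Hom \<equiv> free_hom src tgt"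

abbreviation PC :: "('v, 'v \<times> 'a free_ring set \<times> 'v) lin_cat" where
 "PC \<equiv> presented_category src tgt R"

text \<open>Congruence modulo the relators; with it, computations take place between representatives.\<close>

definition eqm :: "'v => 'v => 'a free_ring => 'a free_ring => bool" where
 "eqm X Y f g \<longleftrightarrow> rel_ideal src tgt R X Y (f - g)"

definition arr :: "'v => 'v => 'a free_ring => 'v \<times> 'a free_ring set \<times> 'v" where
 "arr X Y f = (X, residue_class src tgt R X Y f, Y)"

lemma rel_ideal_uminus: "rel_ideal src tgt R X Y f ==> rel_ideal src tgt R X Y (- f)"
 using rel_ideal.diff[OF rel_ideal.zero, of src tgt R X Y f] by simp

lemma rel_ideal_add: "rel_ideal src tgt R X Y f ==> rel_ideal src tgt R X Y g ==> rel_ideal src tgt R X Y (f + g)"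
 using rel_ideal.diff[of src tgt R X Y f "- g"] rel_ideal_uminus by simp

lemma eqm_refl [intro, simp]: "eqm X Y f f"
 by (simp add: eqm_def rel_ideal.zero)

lemma eqm_sym: "eqm X Y f g ==> eqm X Y g f"
 using rel_ideal_uminus[of X Y "f - g"] by (simp add: eqm_def)

lemma eqm_trans [trans]: "eqm X Y f g ==> eqm X Y g h ==> eqm X Y f h"
 using rel_ideal_add[of X Y "f - g" "g - h"] by (simp add: eqm_def)

lemma eqm_add: "eqm X Y f f' ==> eqm X Y g g' ==> eqm X Y (f + g) (f' + g')"
 using rel_ideal_add[of X Y "f - f'" "g - g'"] by (simp add: eqm_def algebra_simps)

lemma eqm_diff: "eqm X Y f f' ==> eqm X Y g g' ==> eqm X Y (f - g) (f' - g')"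
 using rel_ideal.diff[of src tgt R X Y "f - f'" "g - g'"] by (simp add: eqm_def algebra_simps)

lemma eqm_sum: "(!!i. i \<in> I ==> eqm X Y (f i) (g i)) ==> eqm X Y (sum f I) (sum g I)"
 by (induction I rule: infinite_finite_induct) (auto intro: eqm_add)

lemma eqm_left: "eqm X Y f g ==> h \<in> Hom Y Z ==> eqm X Z (h * f) (h * g)"
 using rel_ideal.left[of src tgt R X Y "f - g" h Z] by (simp add: eqm_def algebra_simps)

lemma eqm_right: "eqm Y Z f g ==> h \<in> Hom X Y ==> eqm X Z (f * h) (g * h)"
 using rel_ideal.right[of src tgt R Y Z "f - g" h X] by (simp add: eqm_def algebra_simps)

lemma eqm_mult:
 assumes "eqm X Y f f'" "eqm Y Z g g'" "f \<in> Hom X Y" "g' \<in> Hom Y Z"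
 shows "eqm X Z (g * f) (g' * f')"
 using eqm_trans[OF eqm_right[OF assms(2,3)] eqm_left[OF assms(1,4)]] .

lemma residue_classI:
 assumes "eqm X Y f g"
 shows "residue_class src tgt R X Y f = residue_class src tgt R X Y g"
proof -
 have "eqm X Y h f \<longleftrightarrow> eqm X Y h g" for h using assms eqm_trans eqm_sym by blast
 then show ?thesis by (auto simp: residue_class_def eqm_def)
qed

lemma arr_eq_iff:
 assumes f: "f \<in> Hom X Y" and g: "g \<in> Hom X Y"
 shows "arr X Y f = arr X Y g \<longleftrightarrow> eqm X Y f g"
proof
 assume "arr X Y f = arr X Y g"
 moreover have "f \<in> residue_class src tgt R X Y f" using f by (simp add: residue_class_def rel_ideal.zero)
 ultimately show "eqm X Y f g" by (simp add: arr_def residue_class_def eqm_def)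
next
 assume "eqm X Y f g"
 then show "arr X Y f = arr X Y g" by (simp add: arr_def residue_classI)
qed

lemma residue_class_iff: "g \<in> residue_class src tgt R X Y f \<longleftrightarrow> g \<in> Hom X Y \<and> eqm X Y g f"
 by (simp add: residue_class_def eqm_def)

lemma Obj_PC [simp]: "Obj PC = UNIV"
 and Arr_PC: "Arr PC = {arr X Y f | X Y f. f \<in> Hom X Y}"
 and Dom_arr [simp]: "Dom PC (arr X Y f) = X"
 and Cod_arr [simp]: "Cod PC (arr X Y f) = Y"
 and Id_PC: "Id PC X = arr X X 1"
 by (simp_all add: presented_category_def arr_def)

lemma arr_Arr [simp]: "f \<in> Hom X Y ==> arr X Y f \<in> Arr PC"
 by (auto simp: Arr_PC)

lemma homs_PC: "homs PC X Y = arr X Y ` Hom X Y"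
 by (auto simp: homs_def Arr_PC)

lemma Arr_PCE:
 assumes "a \<in> Arr PC"
 obtains f where "f \<in> Hom (Dom PC a) (Cod PC a)" "a = arr (Dom PC a) (Cod PC a) f"
proof -
 from assms obtain X Y f where "a = arr X Y f" "f \<in> Hom X Y" by (auto simp: Arr_PC)
 then show thesis using that[of f] by simp
qed

lemma homs_PCE:
 assumes "a \<in> homs PC X Y"
 obtains f where "f \<in> Hom X Y" "a = arr X Y f"
 using assms by (auto simp: homs_PC)

lemma Comp_arr [simp]:
 assumes f: "f \<in> Hom X Y" and g: "g \<in> Hom Y Z"
 shows "Comp PC (arr Y Z g) (arr X Y f) = arr X Z (g * f)"
proof -
 have "residue_class src tgt R X Z (g' * f') = residue_class src tgt R X Z (g * f)"
  if "g' \<in> residue_class src tgt R Y Z g" "f' \<in> residue_class src tgt R X Y f" for g' f'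
  using that g by (intro residue_classI eqm_mult[of X Y f' f Z g' g]) (auto simp: residue_class_iff)
 moreover have "g \<in> residue_class src tgt R Y Z g" "f \<in> residue_class src tgt R X Y f"
  using f g by (auto simp: residue_class_iff)
 ultimately have "(\<Union>g'\<in>residue_class src tgt R Y Z g. \<Union>f'\<in>residue_class src tgt R X Y f.
   residue_class src tgt R X Z (g' * f')) = residue_class src tgt R X Z (g * f)"
  by blast
 then show ?thesis by (simp add: presented_category_def arr_def)
qed

lemma Add_arr [simp]:
 assumes f: "f \<in> Hom X Y" and g: "g \<in> Hom X Y"
 shows "Add PC (arr X Y f) (arr X Y g) = arr X Y (f + g)"
proof -
 have "residue_class src tgt R X Y (f' + g') = residue_class src tgt R X Y (f + g)"
  if "g' \<in> residue_class src tgt R X Y g" "f' \<in> residue_class src tgt R X Y f" for g' f'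
  using that by (intro residue_classI eqm_add) (auto simp: residue_class_iff)
 moreover have "g \<in> residue_class src tgt R X Y g" "f \<in> residue_class src tgt R X Y f"
  using f g by (auto simp: residue_class_iff)
 ultimately have "(\<Union>f'\<in>residue_class src tgt R X Y f. \<Union>g'\<in>residue_class src tgt R X Y g.
   residue_class src tgt R X Y (f' + g')) = residue_class src tgt R X Y (f + g)"
  by blast
 then show ?thesis by (simp add: presented_category_def arr_def)
qed

lemma category_PC: "category PC"
 unfolding category_def
proof (intro conjI ballI impI)
 fix a b assume a: "a \<in> Arr PC" and b: "b \<in> Arr PC" and ab: "Cod PC a = Dom PC b"
 define X Y Z where XYZ: "X = Dom PC a" "Y = Dom PC b" "Z = Cod PC b"
 obtain f where f: "f \<in> Hom X Y" "a = arr X Y f" using a ab XYZ by (metis Arr_PCE)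
 obtain g where g: "g \<in> Hom Y Z" "b = arr Y Z g" using b XYZ by (metis Arr_PCE)
 show "Comp PC b a \<in> homs PC (Dom PC a) (Cod PC b)" using f g by (auto simp: homs_PC free_hom_mult)
 fix c assume c: "c \<in> Arr PC" and bc: "Cod PC b = Dom PC c"
 obtain h where h: "h \<in> Hom Z (Cod PC c)" "c = arr Z (Cod PC c) h" using c bc XYZ by (metis Arr_PCE)
 have "g * f \<in> Hom X Z" "h * g \<in> Hom Y (Cod PC c)" using f g h by (auto intro: free_hom_mult)
 then show "Comp PC c (Comp PC b a) = Comp PC (Comp PC c b) a"
  unfolding f(2) g(2) by (subst (1 2) h(2)) (simp add: f(1) g(1) h(1) mult.assoc)
next
 fix X show "Id PC X \<in> homs PC X X" by (auto simp: homs_PC Id_PC free_hom_one)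
next
 fix a assume "a \<in> Arr PC"
 then obtain X Y f where a: "f \<in> Hom X Y" "a = arr X Y f" by (auto simp: Arr_PC)
 then show "Comp PC a (Id PC (Dom PC a)) = a" "Comp PC (Id PC (Cod PC a)) a = a" by (simp_all add: Id_PC free_hom_one)
qed simp_all

definition hgrp :: "'v => 'v => ('v \<times> 'a free_ring set \<times> 'v) monoid" where
 "hgrp X Y = \<lparr>carrier = homs PC X Y, monoid.mult = Add PC, one = arr X Y 0\<rparr>"

lemma hgrp_simps [simp]:
 "carrier (hgrp X Y) = homs PC X Y" "a *[hgrp X Y] b = Add PC a b" "\<one>[hgrp X Y] = arr X Y 0"
 by (simp_all add: hgrp_def)

lemma comm_group_hgrp: "comm_group (hgrp X Y)"
proof (rule comm_groupI)
 fix a assume "a \<in> carrier (hgrp X Y)"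
 then obtain f where a: "f \<in> Hom X Y" "a = arr X Y f" by (auto elim: homs_PCE)
 then show "\<exists>b\<in>carrier (hgrp X Y). b *[hgrp X Y] a = \<one>[hgrp X Y]"
  by (intro bexI[of _ "arr X Y (- f)"]) (auto simp: homs_PC free_hom_uminus)
qed (auto simp: homs_PC free_hom_intros algebra_simps)

lemma hgrp_int_pow:
 assumes f: "f \<in> Hom X Y"
 shows "arr X Y f ^[hgrp X Y] (k::int) = arr X Y (of_int k * f)"
proof -
 interpret comm_group "hgrp X Y" by (rule comm_group_hgrp)
 have nat: "arr X Y f ^[hgrp X Y] (n::nat) = arr X Y (of_nat n * f)" for n
 proof (induction n)
  case (Suc n)
  have "of_nat n * f \<in> Hom X Y" using free_hom_scale[OF f, of "int n"] by simp
  then show ?case using Suc f by (simp add: algebra_simps)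
 qed simp
 have inv: "inv[hgrp X Y] (arr X Y g) = arr X Y (- g)" if "g \<in> Hom X Y" for g
  using that by (intro inv_equality) (auto simp: homs_PC free_hom_uminus)
 show ?thesis
 proof (cases k rule: int_cases2)
  case (nonneg n)
  then show ?thesis using nat[of n] by (simp add: int_pow_int)
 next
  case (nonpos n)
  have "of_nat n * f \<in> Hom X Y" using free_hom_scale[OF f, of "int n"] by simp
  then have "inv[hgrp X Y] (arr X Y f ^[hgrp X Y] n) = arr X Y (- (of_nat n * f))" using nat inv by simp
  then show ?thesis using nonpos f by (simp add: int_pow_neg_int homs_PC)
 qed
qed

lemma gsum_hgrp:
 "(!!i. i \<in> set is ==> f i \<in> Hom X Y) ==> gsum (hgrp X Y) (%i. arr X Y (f i)) is = arr X Y (sum_list (map f is))"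
 by (induction "is") (auto simp: free_hom_sum_list)

end

section \<open>Normal forms in Koehler's category\<close>

abbreviation Khom :: "obj => obj => arrow free_ring set" where
 "Khom \<equiv> free_hom arrow_src arrow_tgt"

lemma gen_hom:
 "gen b \<alpha>10 \<in> Khom (b, V0) (b, V1)" "gen b \<alpha>01 \<in> Khom (b, V1) (b, V0)"
 "gen b \<alpha>20 \<in> Khom (b, V0) (b, V2)" "gen b \<alpha>02 \<in> Khom (b, V2) (b, V0)"
 "gen b \<alpha>12 \<in> Khom (b, V2) (~ b, V1)" "gen b \<alpha>21 \<in> Khom (~ b, V1) (b, V2)"
 "gen b t0 \<in> Khom (b, V0) (b, V0)" "gen b s1 \<in> Khom (b, V1) (b, V1)"
 "gen b s2 \<in> Khom (b, V2) (b, V2)" "gen b t2 \<in> Khom (b, V2) (b, V2)"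
 by (simp_all add: gen_def letter_def free_hom_def)

lemma one_minus_norm_sum: "(1 - x) * norm_sum n x = 1 - x ^ n"
 by (induction n) (simp_all add: norm_sum_def distrib_left left_diff_distrib)

lemma mult_of_int_left: "g * (of_int k * f) = of_int k * (g * f)" for f g :: "'a :: ring_1"
 by (metis mult.assoc mult_of_int_commute)

locale koehler =
 fixes p :: nat
 assumes p: "0 < p"
begin

sublocale presentation arrow_src arrow_tgt "koehler_relator p"
 .

definition psum :: "arrow free_ring => (nat => int) => arrow free_ring" where
 "psum x c = (\<Sum>i<p. of_int (c i) * x ^ i)"

lemma psum_hom: "x \<in> Khom X X ==> psum x c \<in> Khom X X"
 unfolding psum_def by (intro free_hom_intros)

lemma psum_diff: "psum x c - psum x d = psum x (%i. c i - d i)"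
 by (simp add: psum_def sum_subtractf algebra_simps)

lemma psum_const: "psum x (%_. m) = of_int m * norm_sum p x"
 by (simp add: psum_def norm_sum_def sum_distrib_left)

lemma psum_delta: "psum x (%i. if i = 0 then k else 0) = of_int k"
proof -
 have "psum x (%i. if i = 0 then k else 0) = (\<Sum>i<p. if i = 0 then of_int k else 0)"
  unfolding psum_def by (intro sum.cong) auto
 then show ?thesis using p by simp
qed

lemma psum_zero [simp]: "psum x (%_. 0) = 0"
 by (simp add: psum_def)

lemma psum_cong: "(!!i. i < p ==> c i = d i) ==> psum x c = psum x d"
 by (simp add: psum_def)

subsection \<open>Consequences of a pair of factorizations\<close>

text \<open>The relations have the form \<open>u v = 1 - x\<close> and \<open>v u = 1 - y\<close>. An arrow that
 annihilates \<open>u\<close>, or is annihilated by \<open>v\<close>, does not see \<open>x\<close>; moreover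
 \<open>u\<close> and \<open>v\<close> intertwine \<open>x\<close> with \<open>y\<close>.\<close>

lemma absorb_right:
 assumes uv: "eqm X X (u * v) (1 - x)" and gu: "eqm Y Z (g * u) 0"
  and "v \<in> Khom X Y" "g \<in> Khom X Z"
 shows "eqm X Z (g * x) g"
proof -
 have "eqm X Z (g * (1 - x)) (g * (u * v))" using eqm_left[OF eqm_sym[OF uv]] assms by blast
 also have "eqm X Z (g * (u * v)) (0 * v)" using eqm_right[OF gu] assms by (simp add: mult.assoc)
 finally have "eqm X Z (g - (g - g * x)) (g - 0)" by (intro eqm_diff) (simp_all add: algebra_simps)
 then show ?thesis by simp
qed

lemma absorb_left:
 assumes uv: "eqm X X (u * v) (1 - x)" and vh: "eqm W Y (v * h) 0"
  and "u \<in> Khom Y X" "h \<in> Khom W X"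
 shows "eqm W X (x * h) h"
proof -
 have "eqm W X ((1 - x) * h) ((u * v) * h)" using eqm_right[OF eqm_sym[OF uv]] assms by blast
 also have "eqm W X ((u * v) * h) (u * 0)" using eqm_left[OF vh] assms by (simp add: mult.assoc)
 finally have "eqm W X (h - (h - x * h)) (h - 0)" by (intro eqm_diff) (simp_all add: algebra_simps)
 then show ?thesis by simp
qed

lemma intertwine:
 assumes uv: "eqm X X (u * v) (1 - x)" and vu: "eqm Y Y (v * u) (1 - y)" and u: "u \<in> Khom Y X"
 shows "eqm Y X (x * u) (u * y)"
proof -
 have "eqm Y X ((1 - x) * u) ((u * v) * u)" using eqm_right[OF eqm_sym[OF uv] u] .
 also have "eqm Y X ((u * v) * u) (u * (1 - y))" using eqm_left[OF vu u] by (simp add: mult.assoc)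
 finally have "eqm Y X (u - (1 - x) * u) (u - u * (1 - y))" by (rule eqm_diff[OF eqm_refl])
 then show ?thesis by (simp add: algebra_simps)
qed

lemma intertwine_power:
 assumes "eqm Y X (x * u) (u * y)" and x: "x \<in> Khom X X" and y: "y \<in> Khom Y Y"
 shows "eqm Y X (x ^ n * u) (u * y ^ n)"
proof (induction n)
 case (Suc n)
 have "eqm Y X (x * (x ^ n * u)) (x * (u * y ^ n))" using eqm_left[OF Suc x] .
 also have "eqm Y X \<dots> (u * y * y ^ n)" using eqm_right[OF assms(1) free_hom_power[OF y, of n]] by (simp add: mult.assoc)
 finally show ?case by (simp add: mult.assoc)
qed simp

lemma intertwine_norm_sum:
 assumes "eqm Y X (x * u) (u * y)" "x \<in> Khom X X" "y \<in> Khom Y Y"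
 shows "eqm Y X (norm_sum n x * u) (u * norm_sum n y)"
 unfolding norm_sum_def sum_distrib_left sum_distrib_right by (intro eqm_sum intertwine_power assms)

text \<open>\<open>1 - x^p = (1 - x) N(x) = u v N(x)\<close>.\<close>

lemma power_p_eq_one:
 assumes uv: "eqm X X (u * v) (1 - x)" and vN: "eqm X Y (v * norm_sum p x) 0"
  and u: "u \<in> Khom Y X" and x: "x \<in> Khom X X"
 shows "eqm X X (x ^ p) 1"
proof -
 have N: "norm_sum p x \<in> Khom X X" unfolding norm_sum_def using x by (intro free_hom_intros)
 have "eqm X X ((1 - x) * norm_sum p x) (u * v * norm_sum p x)" using eqm_right[OF eqm_sym[OF uv] N] .
 also have "eqm X X \<dots> (u * 0)" using eqm_left[OF vN u] by (simp add: mult.assoc)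
 finally have "eqm X X (1 - (1 - x ^ p)) (1 - 0)" unfolding one_minus_norm_sum by (intro eqm_diff) simp_all
 then show ?thesis by simp
qed

lemma absorb_psum:
 assumes gx: "eqm X Z (g * x) g" and x: "x \<in> Khom X X" and g: "g \<in> Khom X Z"
 shows "eqm X Z (g * psum x c) (of_int (\<Sum>i<p. c i) * g)"
proof -
 have pow: "eqm X Z (g * x ^ n) g" for n
 proof (induction n)
  case (Suc n)
  have "eqm X Z (g * x * x ^ n) (g * x ^ n)" using eqm_right[OF gx free_hom_power[OF x]] .
  then show ?case using eqm_trans[OF _ Suc] by (simp add: mult.assoc)
 qed simp
 have "eqm X Z (\<Sum>i<p. of_int (c i) * (g * x ^ i)) (\<Sum>i<p. of_int (c i) * g)"
  by (intro eqm_sum eqm_left[OF pow free_hom_of_int])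
 moreover have "g * psum x c = (\<Sum>i<p. of_int (c i) * (g * x ^ i))"
  by (simp add: psum_def sum_distrib_left mult_of_int_left)
 ultimately show ?thesis by (simp add: sum_distrib_right)
qed

text \<open>Multiplication by a loop \<open>x\<close> with \<open>x^p = 1\<close> rotates the coefficients.\<close>

definition cyc :: "(nat => int) => nat => int" where
 "cyc c i = c (if i = 0 then p - 1 else i - 1)"

lemma mult_psum:
 assumes xp: "eqm X X (x ^ p) 1"
 shows "eqm X X (x * psum x c) (psum x (cyc c))"
proof -
 obtain q where q: "p = Suc q" using p by (cases p) auto
 have "x * psum x c = (\<Sum>i<p. of_int (c i) * x ^ Suc i)"
  by (simp add: psum_def sum_distrib_left mult_of_int_left)
 also have "\<dots> = (\<Sum>i<q. of_int (c i) * x ^ Suc i) + of_int (c q) * x ^ p" by (simp add: q)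
 finally have 1: "x * psum x c = (\<Sum>i<q. of_int (c i) * x ^ Suc i) + of_int (c q) * x ^ p" .
 have cyc: "cyc c 0 = c q" "cyc c (Suc i) = c i" for i unfolding cyc_def by (simp_all add: q)
 have "psum x (cyc c) = (\<Sum>i<Suc q. of_int (cyc c i) * x ^ i)" by (simp add: psum_def flip: q)
 then have 2: "psum x (cyc c) = (\<Sum>i<q. of_int (c i) * x ^ Suc i) + of_int (c q) * 1"
  unfolding sum.lessThan_Suc_shift cyc by simp
 show ?thesis unfolding 1 2 by (intro eqm_add eqm_refl eqm_left[OF xp free_hom_of_int])
qed

subsection \<open>Relations\<close>

lemma relations:
 "eqm (~ b, V0) (b, V2) (gen b \<alpha>21 * gen (~ b) \<alpha>10) 0"
 "eqm (b, V2) (~ b, V0) (gen (~ b) \<alpha>01 * gen b \<alpha>12) 0"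
 "eqm (~ b, V1) (b, V0) (gen b \<alpha>02 * gen b \<alpha>21) 0"
 "eqm (b, V0) (~ b, V1) (gen b \<alpha>12 * gen b \<alpha>20) 0"
 "eqm (b, V2) (b, V1) (gen b \<alpha>10 * gen b \<alpha>02) 0"
 "eqm (b, V1) (b, V2) (gen b \<alpha>20 * gen b \<alpha>01) 0"
 "eqm (b, V0) (b, V0) (gen b \<alpha>01 * gen b \<alpha>10) (norm_sum p (gen b t0))"
 "eqm (b, V1) (b, V1) (gen b \<alpha>10 * gen b \<alpha>01) (norm_sum p (gen b s1))"
 "eqm (b, V0) (b, V0) (gen b \<alpha>02 * gen b \<alpha>20) (1 - gen b t0)"
 "eqm (b, V2) (b, V2) (gen b \<alpha>20 * gen b \<alpha>02) (1 - gen b t2)"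
 "eqm (~ b, V1) (~ b, V1) (gen b \<alpha>12 * gen b \<alpha>21) (1 - gen (~ b) s1)"
 "eqm (b, V2) (b, V2) (gen b \<alpha>21 * gen b \<alpha>12) (1 - gen b s2)"
 "eqm (b, V2) (b, V2) (norm_sum p (gen b t2) + norm_sum p (gen b s2)) (of_nat p)"
 unfolding eqm_def diff_zero by (rule rel_ideal.relator, rule koehler_relator.intros)+

lemmas zero_rels = relations(1-6)
lemmas norm_rels = relations(7,8)
lemmas unit_rels_t = relations(9,10)
lemmas unit_rels_s = relations(11,12)

lemma absorptions:
 "eqm (b, V0) (b, V1) (gen b \<alpha>10 * gen b t0) (gen b \<alpha>10)"
 "eqm (b, V1) (b, V0) (gen b t0 * gen b \<alpha>01) (gen b \<alpha>01)"
 "eqm (~ b, V0) (~ b, V1) (gen (~ b) s1 * gen (~ b) \<alpha>10) (gen (~ b) \<alpha>10)"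
 "eqm (~ b, V1) (~ b, V0) (gen (~ b) \<alpha>01 * gen (~ b) s1) (gen (~ b) \<alpha>01)"
 "eqm (b, V0) (b, V2) (gen b s2 * gen b \<alpha>20) (gen b \<alpha>20)"
 "eqm (b, V2) (b, V0) (gen b \<alpha>02 * gen b s2) (gen b \<alpha>02)"
 "eqm (~ b, V1) (b, V2) (gen b t2 * gen b \<alpha>21) (gen b \<alpha>21)"
 "eqm (b, V2) (~ b, V1) (gen b \<alpha>12 * gen b t2) (gen b \<alpha>12)"
 by (rule absorb_right[OF unit_rels_t(1) zero_rels(5)] absorb_left[OF unit_rels_t(1) zero_rels(6)] absorb_left[OF unit_rels_s(1) zero_rels(1)] absorb_right[OF unit_rels_s(1) zero_rels(2)]
   absorb_left[OF unit_rels_s(2) zero_rels(4)] absorb_right[OF unit_rels_s(2) zero_rels(3)] absorb_left[OF unit_rels_t(2) zero_rels(3)] absorb_right[OF unit_rels_t(2) zero_rels(4)]; rule gen_hom)+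

lemma absorptions_V2:
 "eqm (b, V2) (b, V2) ((gen b t2 - 1) * gen b s2) (gen b t2 - 1)"
 "eqm (b, V2) (b, V2) ((gen b s2 - 1) * gen b t2) (gen b s2 - 1)"
proof -
 have "eqm (~ b, V1) (b, V2) ((gen b t2 - 1) * gen b \<alpha>21) 0" "eqm (b, V0) (b, V2) ((gen b s2 - 1) * gen b \<alpha>20) 0"
  using eqm_diff[OF absorptions(7)[of b] eqm_refl[of _ _ "gen b \<alpha>21"]] eqm_diff[OF absorptions(5)[of b] eqm_refl[of _ _ "gen b \<alpha>20"]]
  by (simp_all add: algebra_simps)
 then show "eqm (b, V2) (b, V2) ((gen b t2 - 1) * gen b s2) (gen b t2 - 1)"
  "eqm (b, V2) (b, V2) ((gen b s2 - 1) * gen b t2) (gen b s2 - 1)"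
  by (auto intro!: absorb_right[OF unit_rels_s(2)] absorb_right[OF unit_rels_t(2)] free_hom_intros gen_hom)
qed

lemma intertwinings:
 "eqm (b, V2) (b, V0) (gen b t0 * gen b \<alpha>02) (gen b \<alpha>02 * gen b t2)"
 "eqm (b, V0) (b, V2) (gen b t2 * gen b \<alpha>20) (gen b \<alpha>20 * gen b t0)"
 "eqm (b, V2) (~ b, V1) (gen (~ b) s1 * gen b \<alpha>12) (gen b \<alpha>12 * gen b s2)"
 "eqm (~ b, V1) (b, V2) (gen b s2 * gen b \<alpha>21) (gen b \<alpha>21 * gen (~ b) s1)"
 by (rule intertwine[OF unit_rels_t(1) unit_rels_t(2)] intertwine[OF unit_rels_t(2) unit_rels_t(1)] intertwine[OF unit_rels_s(1) unit_rels_s(2)] intertwine[OF unit_rels_s(2) unit_rels_s(1)]; rule gen_hom)+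

text \<open>The norms at \<open>V0\<close> and \<open>V1\<close> factor into two arrows, one of which composes to zero
 with the given one. The norms at \<open>V2\<close> are moved there by the intertwining relations.\<close>

lemma vanishing_norms:
 "eqm (b, V0) (b, V2) (gen b \<alpha>20 * norm_sum p (gen b t0)) 0"
 "eqm (~ b, V1) (b, V2) (gen b \<alpha>21 * norm_sum p (gen (~ b) s1)) 0"
 "eqm (b, V2) (b, V0) (gen b \<alpha>02 * norm_sum p (gen b t2)) 0"
 "eqm (b, V2) (~ b, V1) (gen b \<alpha>12 * norm_sum p (gen b s2)) 0"
proof -
 have *: "eqm X Z (g * N) 0" if "eqm X X (u * v) N" "eqm Y Z (g * u) 0" "g \<in> Khom X Z" "v \<in> Khom X Y" for X Y Z g u v N
  using eqm_trans[OF eqm_left[OF eqm_sym[OF that(1)] that(3)]] eqm_right[OF that(2,4)] by (simp add: mult.assoc)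
 have **: "eqm W X (N * h) 0" if "eqm X X (u * v) N" "eqm W Y (v * h) 0" "u \<in> Khom Y X" "h \<in> Khom W X" for W X Y h u v N
  using eqm_trans[OF eqm_right[OF eqm_sym[OF that(1)] that(4)]] eqm_left[OF that(2,3)] by (simp add: mult.assoc)
 show "eqm (b, V0) (b, V2) (gen b \<alpha>20 * norm_sum p (gen b t0)) 0" by (rule *[OF norm_rels(1) zero_rels(6)]; rule gen_hom)
 show "eqm (~ b, V1) (b, V2) (gen b \<alpha>21 * norm_sum p (gen (~ b) s1)) 0" by (rule *[OF norm_rels(2) zero_rels(1)]; rule gen_hom)
 show "eqm (b, V2) (b, V0) (gen b \<alpha>02 * norm_sum p (gen b t2)) 0"
  by (rule eqm_trans[OF eqm_sym[OF intertwine_norm_sum[OF intertwinings(1)]] **[OF norm_rels(1) zero_rels(5)]]; rule gen_hom)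
 show "eqm (b, V2) (~ b, V1) (gen b \<alpha>12 * norm_sum p (gen b s2)) 0"
  by (rule eqm_trans[OF eqm_sym[OF intertwine_norm_sum[OF intertwinings(3)]] **[OF norm_rels(2) zero_rels(2)]]; rule gen_hom)
qed

lemma unipotent:
 "eqm (b, V0) (b, V0) (gen b t0 ^ p) 1" "eqm (~ b, V1) (~ b, V1) (gen (~ b) s1 ^ p) 1"
 "eqm (b, V2) (b, V2) (gen b t2 ^ p) 1" "eqm (b, V2) (b, V2) (gen b s2 ^ p) 1"
 by (rule power_p_eq_one[OF unit_rels_t(1) vanishing_norms(1)] power_p_eq_one[OF unit_rels_s(1) vanishing_norms(2)]
   power_p_eq_one[OF unit_rels_t(2) vanishing_norms(3)] power_p_eq_one[OF unit_rels_s(2) vanishing_norms(4)]; rule gen_hom)+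

subsection \<open>Normal forms\<close>

text \<open>Arrows are represented by a polynomial of degree less than \<open>p\<close> in the loop at the source,
 followed by a generator towards the target. Between \<open>V0\<close> and \<open>V1\<close> the loop acts trivially
 and one coefficient remains; at \<open>V2\<close> both loops are needed.\<close>

fun nf :: "obj => obj => (nat => int) => (nat => int) => arrow free_ring" where
 "nf (b, V0) (b', V0) c d = (if b' = b then psum (gen b t0) c else 0)"
| "nf (b, V0) (b', V1) c d = (if b' = b then of_int (c 0) * gen b \<alpha>10 else 0)"
| "nf (b, V0) (b', V2) c d = (if b' = b then gen b \<alpha>20 * psum (gen b t0) c else 0)"
| "nf (b, V1) (b', V0) c d = (if b' = b then of_int (c 0) * gen b \<alpha>01 else 0)"
| "nf (b, V1) (b', V1) c d = (if b' = b then psum (gen b s1) c else 0)"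
| "nf (b, V1) (b', V2) c d = (if b' \<noteq> b then gen b' \<alpha>21 * psum (gen b s1) c else 0)"
| "nf (b, V2) (b', V0) c d = (if b' = b then gen b \<alpha>02 * psum (gen b t2) c else 0)"
| "nf (b, V2) (b', V1) c d = (if b' \<noteq> b then gen b \<alpha>12 * psum (gen b s2) c else 0)"
| "nf (b, V2) (b', V2) c d = (if b' = b then psum (gen b t2) c + psum (gen b s2) d else 0)"

definition normal :: "obj => obj => arrow free_ring => bool" where
 "normal X Y f \<longleftrightarrow> (\<exists>c d. eqm X Y f (nf X Y c d))"

lemma normal_eqm: "eqm X Y f g ==> normal X Y g ==> normal X Y f"
 unfolding normal_def using eqm_trans by blast

lemma nf_diff: "nf X Y c d - nf X Y c' d' = nf X Y (%i. c i - c' i) (%i. d i - d' i)"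
 by (induction X Y c d rule: nf.induct)
  (simp_all add: psum_diff[symmetric] left_diff_distrib right_diff_distrib)

lemma nf_zero: "nf X Y (%_. 0) (%_. 0) = 0"
 using nf_diff[of X Y "%_. 0" "%_. 0" "%_. 0" "%_. 0"] by simp

lemma normal_zero: "normal X Y 0"
 unfolding normal_def using nf_zero eqm_refl by metis

lemma normal_diff:
 assumes "normal X Y f" "normal X Y g"
 shows "normal X Y (f - g)"
proof -
 obtain c d c' d' where "eqm X Y f (nf X Y c d)" "eqm X Y g (nf X Y c' d')"
  using assms unfolding normal_def by blast
 then have "eqm X Y (f - g) (nf X Y c d - nf X Y c' d')" by (rule eqm_diff)
 then show ?thesis unfolding normal_def nf_diff by blast
qed

lemma normal_add: "normal X Y f ==> normal X Y g ==> normal X Y (f + g)"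
 using normal_diff[OF _ normal_diff[OF normal_zero]] by fastforce

lemma normal_psum:
 "normal (b, V0) (b, V0) (psum (gen b t0) c)" "normal (b, V0) (b, V2) (gen b \<alpha>20 * psum (gen b t0) c)"
 "normal (b, V1) (b, V1) (psum (gen b s1) c)" "normal (~ b, V1) (b, V2) (gen b \<alpha>21 * psum (gen (~ b) s1) c)"
 "normal (b, V2) (b, V0) (gen b \<alpha>02 * psum (gen b t2) c)" "normal (b, V2) (~ b, V1) (gen b \<alpha>12 * psum (gen b s2) c)"
 "normal (b, V2) (b, V2) (psum (gen b t2) c + psum (gen b s2) d)"
 unfolding normal_def by (rule exI[of _ c], rule exI[of _ d], simp)+

lemma normal_scale: "normal (b, V0) (b, V1) (of_int k * gen b \<alpha>10)" "normal (b, V1) (b, V0) (of_int k * gen b \<alpha>01)"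
 unfolding normal_def by (rule exI[of _ "%_. k"], simp)+

lemma normal_V2: "normal (b, V2) (b, V2) (psum (gen b t2) c)" "normal (b, V2) (b, V2) (psum (gen b s2) c)"
 using normal_psum(7)[of b c "%_. 0"] normal_psum(7)[of b "%_. 0" c] by simp_all

lemma psum_int: "of_int k = psum x (%i. if i = 0 then k else 0)"
 by (simp add: psum_delta)

lemma normal_loop:
 assumes "eqm X X (x ^ p) 1" "!!c. normal X Y (u * psum x c)" "u \<in> Khom X Y"
 shows "normal X Y (u * (x * psum x c))"
 using normal_eqm[OF eqm_left[OF mult_psum[OF assms(1)] assms(3)] assms(2)] .

lemma normal_unit_minus:
 assumes "eqm X X (x ^ p) 1" "!!c. normal X X (psum x c)"
 shows "normal X X ((1 - x) * psum x c)"
 using normal_diff[OF assms(2)[of c] normal_eqm[OF mult_psum[OF assms(1)] assms(2)], of c] by (simp add: algebra_simps)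

lemma normal_assoc:
 "eqm Y Z (x * u) w ==> h \<in> Khom X Y ==> normal X Z (w * h) ==> normal X Z (x * (u * h))"
 using normal_eqm[OF eqm_right] by (simp add: mult.assoc[symmetric])

lemma normal_scale_mult:
 "eqm X Z (x * u) w ==> normal X Z (of_int k * w) ==> normal X Z (x * (of_int k * u))"
 using normal_eqm[OF eqm_left[OF _ free_hom_of_int]] by (simp add: mult_of_int_left)

lemma normal_letters_V0:
 "normal (b, V0) (b, V0) (gen b t0 * psum (gen b t0) c)"
 "normal (b, V0) (b, V1) (gen b \<alpha>10 * psum (gen b t0) c)"
 "normal (b, V0) (b, V1) (gen b s1 * (of_int k * gen b \<alpha>10))"
 "normal (b, V0) (b, V0) (gen b \<alpha>01 * (of_int k * gen b \<alpha>10))"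
 "normal (~ b, V0) (b, V2) (gen b \<alpha>21 * (of_int k * gen (~ b) \<alpha>10))"
 "normal (b, V0) (b, V2) (gen b t2 * (gen b \<alpha>20 * psum (gen b t0) c))"
 "normal (b, V0) (b, V2) (gen b s2 * (gen b \<alpha>20 * psum (gen b t0) c))"
 "normal (b, V0) (b, V0) (gen b \<alpha>02 * (gen b \<alpha>20 * psum (gen b t0) c))"
 "normal (b, V0) (~ b, V1) (gen b \<alpha>12 * (gen b \<alpha>20 * psum (gen b t0) c))"
proof -
 note P = psum_hom[OF gen_hom(7)[of b]]
 show "normal (b, V0) (b, V0) (gen b t0 * psum (gen b t0) c)"
  by (rule normal_eqm[OF mult_psum[OF unipotent(1)] normal_psum(1)])
 show "normal (b, V0) (b, V1) (gen b \<alpha>10 * psum (gen b t0) c)"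
  by (rule normal_eqm[OF absorb_psum[OF absorptions(1)] normal_scale(1)]) (rule gen_hom)+
 show "normal (b, V0) (b, V1) (gen b s1 * (of_int k * gen b \<alpha>10))"
  using normal_scale_mult[OF absorptions(3)[of "~ b"]] normal_scale by simp
 show "normal (b, V0) (b, V0) (gen b \<alpha>01 * (of_int k * gen b \<alpha>10))"
  using normal_scale_mult[OF norm_rels(1)] normal_psum(1)[of b "%_. k"] by (simp add: psum_const)
 show "normal (~ b, V0) (b, V2) (gen b \<alpha>21 * (of_int k * gen (~ b) \<alpha>10))"
  using normal_scale_mult[OF zero_rels(1)] normal_zero by simp
 show "normal (b, V0) (b, V2) (gen b t2 * (gen b \<alpha>20 * psum (gen b t0) c))"
  using normal_assoc[OF intertwinings(2) P] normal_loop[OF unipotent(1) normal_psum(2) gen_hom(3)] by (simp add: mult.assoc)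
 show "normal (b, V0) (b, V2) (gen b s2 * (gen b \<alpha>20 * psum (gen b t0) c))"
  by (rule normal_assoc[OF absorptions(5) P normal_psum(2)])
 show "normal (b, V0) (b, V0) (gen b \<alpha>02 * (gen b \<alpha>20 * psum (gen b t0) c))"
  by (rule normal_assoc[OF unit_rels_t(1) P normal_unit_minus[OF unipotent(1) normal_psum(1)]])
 show "normal (b, V0) (~ b, V1) (gen b \<alpha>12 * (gen b \<alpha>20 * psum (gen b t0) c))"
  using normal_assoc[OF zero_rels(4) P] normal_zero by simp
qed

lemma normal_letters_V1:
 "normal (~ b, V1) (~ b, V1) (gen (~ b) s1 * psum (gen (~ b) s1) c)"
 "normal (~ b, V1) (~ b, V0) (gen (~ b) \<alpha>01 * psum (gen (~ b) s1) c)"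
 "normal (b, V1) (b, V0) (gen b t0 * (of_int k * gen b \<alpha>01))"
 "normal (b, V1) (b, V1) (gen b \<alpha>10 * (of_int k * gen b \<alpha>01))"
 "normal (b, V1) (b, V2) (gen b \<alpha>20 * (of_int k * gen b \<alpha>01))"
 "normal (~ b, V1) (b, V2) (gen b s2 * (gen b \<alpha>21 * psum (gen (~ b) s1) c))"
 "normal (~ b, V1) (b, V2) (gen b t2 * (gen b \<alpha>21 * psum (gen (~ b) s1) c))"
 "normal (~ b, V1) (~ b, V1) (gen b \<alpha>12 * (gen b \<alpha>21 * psum (gen (~ b) s1) c))"
 "normal (~ b, V1) (b, V0) (gen b \<alpha>02 * (gen b \<alpha>21 * psum (gen (~ b) s1) c))"
proof -
 note P = psum_hom[OF gen_hom(8)[of "~ b"]]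
 show "normal (~ b, V1) (~ b, V1) (gen (~ b) s1 * psum (gen (~ b) s1) c)"
  by (rule normal_eqm[OF mult_psum[OF unipotent(2)] normal_psum(3)])
 show "normal (~ b, V1) (~ b, V0) (gen (~ b) \<alpha>01 * psum (gen (~ b) s1) c)"
  by (rule normal_eqm[OF absorb_psum[OF absorptions(4)] normal_scale(2)]) (rule gen_hom)+
 show "normal (b, V1) (b, V0) (gen b t0 * (of_int k * gen b \<alpha>01))"
  by (rule normal_scale_mult[OF absorptions(2) normal_scale(2)])
 show "normal (b, V1) (b, V1) (gen b \<alpha>10 * (of_int k * gen b \<alpha>01))"
  using normal_scale_mult[OF norm_rels(2)] normal_psum(3)[of b "%_. k"] by (simp add: psum_const)
 show "normal (b, V1) (b, V2) (gen b \<alpha>20 * (of_int k * gen b \<alpha>01))"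
  using normal_scale_mult[OF zero_rels(6)] normal_zero by simp
 show "normal (~ b, V1) (b, V2) (gen b s2 * (gen b \<alpha>21 * psum (gen (~ b) s1) c))"
  using normal_assoc[OF intertwinings(4) P] normal_loop[OF unipotent(2) normal_psum(4) gen_hom(6)] by (simp add: mult.assoc)
 show "normal (~ b, V1) (b, V2) (gen b t2 * (gen b \<alpha>21 * psum (gen (~ b) s1) c))"
  by (rule normal_assoc[OF absorptions(7) P normal_psum(4)])
 show "normal (~ b, V1) (~ b, V1) (gen b \<alpha>12 * (gen b \<alpha>21 * psum (gen (~ b) s1) c))"
  by (rule normal_assoc[OF unit_rels_s(1) P normal_unit_minus[OF unipotent(2) normal_psum(3)]])
 show "normal (~ b, V1) (b, V0) (gen b \<alpha>02 * (gen b \<alpha>21 * psum (gen (~ b) s1) c))"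
  using normal_assoc[OF zero_rels(3) P] normal_zero by simp
qed

lemma normal_V2_mixed:
 assumes xy: "eqm (b, V2) (b, V2) ((x - 1) * y) (x - 1)" and x: "x \<in> Khom (b, V2) (b, V2)" "y \<in> Khom (b, V2) (b, V2)"
  and nx: "!!c. normal (b, V2) (b, V2) (psum x c)" "!!c. normal (b, V2) (b, V2) (psum y c)" and xp: "eqm (b, V2) (b, V2) (x ^ p) 1"
 shows "normal (b, V2) (b, V2) (x * psum y d)"
proof -
 define k where "k = (\<Sum>i<p. d i)"
 have "eqm (b, V2) (b, V2) ((x - 1) * psum y d) (of_int k * (x - 1))"
  unfolding k_def using xy x(2) by (rule absorb_psum) (intro free_hom_intros x)
 moreover have "of_int k * (x - 1) = x * of_int k - of_int k" by (simp add: right_diff_distrib mult_of_int_commute)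
 moreover have "normal (b, V2) (b, V2) (x * of_int k)"
  unfolding psum_int[of k x] by (rule normal_eqm[OF mult_psum[OF xp] nx(1)])
 moreover have "normal (b, V2) (b, V2) (of_int k)"
  unfolding psum_int[of k x] by (rule nx(1))
 ultimately have "normal (b, V2) (b, V2) ((x - 1) * psum y d)" by (metis normal_eqm normal_diff)
 then have "normal (b, V2) (b, V2) ((x - 1) * psum y d + psum y d)" using nx(2) by (rule normal_add)
 then show ?thesis by (simp add: left_diff_distrib)
qed

lemma normal_letters_V2:
 "normal (b, V2) (b, V2) (gen b t2 * (psum (gen b t2) c + psum (gen b s2) d))"
 "normal (b, V2) (b, V2) (gen b s2 * (psum (gen b t2) c + psum (gen b s2) d))"
 "normal (b, V2) (b, V0) (gen b \<alpha>02 * (psum (gen b t2) c + psum (gen b s2) d))"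
 "normal (b, V2) (~ b, V1) (gen b \<alpha>12 * (psum (gen b t2) c + psum (gen b s2) d))"
 "normal (b, V2) (b, V0) (gen b t0 * (gen b \<alpha>02 * psum (gen b t2) c))"
 "normal (b, V2) (b, V1) (gen b \<alpha>10 * (gen b \<alpha>02 * psum (gen b t2) c))"
 "normal (b, V2) (b, V2) (gen b \<alpha>20 * (gen b \<alpha>02 * psum (gen b t2) c))"
 "normal (b, V2) (~ b, V1) (gen (~ b) s1 * (gen b \<alpha>12 * psum (gen b s2) c))"
 "normal (b, V2) (~ b, V0) (gen (~ b) \<alpha>01 * (gen b \<alpha>12 * psum (gen b s2) c))"
 "normal (b, V2) (b, V2) (gen b \<alpha>21 * (gen b \<alpha>12 * psum (gen b s2) c))"
proof -
 note P = psum_hom[OF gen_hom(10)[of b]] and Q = psum_hom[OF gen_hom(9)[of b]]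
 show "normal (b, V2) (b, V2) (gen b t2 * (psum (gen b t2) c + psum (gen b s2) d))"
  unfolding distrib_left
  by (rule normal_add[OF normal_eqm[OF mult_psum[OF unipotent(3)] normal_V2(1)]
    normal_V2_mixed[OF absorptions_V2(1) gen_hom(10) gen_hom(9) normal_V2 unipotent(3)]])
 show "normal (b, V2) (b, V2) (gen b s2 * (psum (gen b t2) c + psum (gen b s2) d))"
  unfolding distrib_left
  by (rule normal_add[OF normal_V2_mixed[OF absorptions_V2(2) gen_hom(9) gen_hom(10) normal_V2(2,1) unipotent(4)]
    normal_eqm[OF mult_psum[OF unipotent(4)] normal_V2(2)]])
 have "normal (b, V2) (b, V0) (gen b \<alpha>02 * psum (gen b s2) d)"
 proof (rule normal_eqm[OF absorb_psum[OF absorptions(6)]])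
  show "normal (b, V2) (b, V0) (of_int (\<Sum>i<p. d i) * gen b \<alpha>02)"
   using normal_psum(5)[of b "%i. if i = 0 then (\<Sum>i<p. d i) else 0"] unfolding psum_delta mult_of_int_commute .
 qed (rule gen_hom)+
 then show "normal (b, V2) (b, V0) (gen b \<alpha>02 * (psum (gen b t2) c + psum (gen b s2) d))"
  unfolding distrib_left by (rule normal_add[OF normal_psum(5)])
 have "normal (b, V2) (~ b, V1) (gen b \<alpha>12 * psum (gen b t2) c)"
 proof (rule normal_eqm[OF absorb_psum[OF absorptions(8)]])
  show "normal (b, V2) (~ b, V1) (of_int (\<Sum>i<p. c i) * gen b \<alpha>12)"
   using normal_psum(6)[of b "%i. if i = 0 then (\<Sum>i<p. c i) else 0"] unfolding psum_delta mult_of_int_commute .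
 qed (rule gen_hom)+
 then show "normal (b, V2) (~ b, V1) (gen b \<alpha>12 * (psum (gen b t2) c + psum (gen b s2) d))"
  unfolding distrib_left using normal_psum(6) by (rule normal_add)
 show "normal (b, V2) (b, V0) (gen b t0 * (gen b \<alpha>02 * psum (gen b t2) c))"
  using normal_assoc[OF intertwinings(1) P] normal_loop[OF unipotent(3) normal_psum(5) gen_hom(4)] by (simp add: mult.assoc)
 show "normal (b, V2) (b, V1) (gen b \<alpha>10 * (gen b \<alpha>02 * psum (gen b t2) c))"
  using normal_assoc[OF zero_rels(5) P] normal_zero by simp
 show "normal (b, V2) (b, V2) (gen b \<alpha>20 * (gen b \<alpha>02 * psum (gen b t2) c))"
  by (rule normal_assoc[OF unit_rels_t(2) P normal_unit_minus[OF unipotent(3) normal_V2(1)]])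
 show "normal (b, V2) (~ b, V1) (gen (~ b) s1 * (gen b \<alpha>12 * psum (gen b s2) c))"
  using normal_assoc[OF intertwinings(3) Q] normal_loop[OF unipotent(4) normal_psum(6) gen_hom(5)] by (simp add: mult.assoc)
 show "normal (b, V2) (~ b, V0) (gen (~ b) \<alpha>01 * (gen b \<alpha>12 * psum (gen b s2) c))"
  using normal_assoc[OF zero_rels(2) Q] normal_zero by simp
 show "normal (b, V2) (b, V2) (gen b \<alpha>21 * (gen b \<alpha>12 * psum (gen b s2) c))"
  by (rule normal_assoc[OF unit_rels_s(2) Q normal_unit_minus[OF unipotent(4) normal_V2(2)]])
qed

lemmas normal_letters = normal_psum(2,4) normal_letters_V0 normal_letters_V1 normal_letters_V2

lemma normal_letter: "normal X (arrow_tgt a) (letter a * nf X (arrow_src a) c d)"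
proof -
 obtain b v b' g where "X = (b, v)" "a = (b', g)" by (cases X; cases a)
 then show ?thesis
  by (cases b; cases b'; cases v; cases g)
   (simp_all add: normal_zero normal_letters[of True, simplified] normal_letters[of False, simplified] flip: gen_def)
qed

lemma normal_word: "is_path arrow_src arrow_tgt X u Y ==> normal X Y (Poly_Mapping.single (Word u) 1)"
proof (induction u arbitrary: Y)
 case Nil
 have 1: "Poly_Mapping.single (Word []) 1 = (of_int 1 :: arrow free_ring)" by (simp flip: zero_word_def)
 have "nf X X (%i. if i = 0 then 1 else 0) (%_. 0) = 1"
  by (cases X; cases "snd X") (auto simp: psum_delta)
 then show ?case using Nil 1 unfolding normal_def by (metis eqm_refl is_path.simps(1) of_int_1)
next
 case (Cons a u)
 have eq: "Poly_Mapping.single (Word (a # u)) 1 = letter a * Poly_Mapping.single (Word u) 1"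
  by (simp add: letter_def mult_single)
 have a: "letter a \<in> Khom (arrow_src a) (arrow_tgt a)" by (simp add: letter_def free_hom_def)
 have Y: "Y = arrow_tgt a" using Cons.prems by simp
 obtain c d where nf: "eqm X (arrow_src a) (Poly_Mapping.single (Word u) 1) (nf X (arrow_src a) c d)"
  using Cons.IH[of "arrow_src a"] Cons.prems unfolding normal_def by (simp only: is_path.simps) blast
 show ?case unfolding eq Y by (rule normal_eqm[OF eqm_left[OF nf a] normal_letter])
qed

text \<open>A letter in front of a normal form can again be brought to normal form, so induction on words
 applies.\<close>

proposition normal_form: "f \<in> Khom X Y ==> normal X Y f"
proof -
 assume "f \<in> Khom X Y"
 then have "Poly_Mapping.keys f \<subseteq> {Word u | u. is_path arrow_src arrow_tgt X u Y}"
  unfolding free_hom_def by (smt (verit) mem_Collect_eq subsetI word.exhaust)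
 then show ?thesis
  by (induction f rule: frag_induction) (auto intro: normal_zero normal_word normal_diff)
qed

end

section \<open>Complex characters\<close>

subsection \<open>Sums over roots of unity\<close>

lemma sum_powers_roots_of_unity:
 assumes p: "0 < p"
 shows "(\<Sum>z | z ^ p = 1. z ^ n) = (if p dvd n then of_nat p else (0 :: complex))"
proof (cases "p dvd n")
 case True
 then obtain k where k: "n = p * k" by blast
 have "(\<Sum>z\<in>{z :: complex. z ^ p = 1}. z ^ n) = (\<Sum>z\<in>{z :: complex. z ^ p = 1}. 1)"
  by (intro sum.cong) (auto simp: k power_mult)
 then show ?thesis using True card_roots_unity_eq[OF p] by simp
next
 case False
 let ?U = "{z :: complex. z ^ p = 1}" and ?\<zeta> = "cis (2 * pi / p)"
 have \<zeta>: "?\<zeta> ^ p = 1" using p by (simp add: DeMoivre)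
 have "?\<zeta> ^ n \<noteq> 1"
 proof
  assume "?\<zeta> ^ n = 1"
  then have "cos (2 * pi * (real n / real p)) = 1" by (simp add: DeMoivre complex_eq_iff algebra_simps)
  then obtain k :: int where "2 * pi * (real n / real p) = real_of_int k * 2 * pi" by (auto simp: cos_one_2pi_int)
  then have "real n = real_of_int k * real p" using p by (simp add: field_simps)
  then have "real_of_int (int n) = real_of_int (k * int p)" by simp
  then have "int n = k * int p" by (simp only: of_int_eq_iff)
  then show False using False by (metis dvd_triv_right int_dvd_int_iff)
 qed
 moreover have "bij_betw (%z. ?\<zeta> * z) ?U ?U"
  by (rule bij_betw_byWitness[where f' = "%z. z / ?\<zeta>"]) (use \<zeta> in \<open>auto simp: power_mult_distrib power_divide\<close>)
 then have "(\<Sum>z\<in>?U. (?\<zeta> * z) ^ n) = (\<Sum>z\<in>?U. z ^ n)" by (rule sum.reindex_bij_betw)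
 then have "?\<zeta> ^ n * (\<Sum>z\<in>?U. z ^ n) = (\<Sum>z\<in>?U. z ^ n)" by (simp add: power_mult_distrib sum_distrib_left)
 ultimately show ?thesis using False by (metis mult_cancel_right1)
qed

lemma sum_quotient_powers:
 assumes u: "u ^ p = (1 :: complex)" and v: "v ^ p = 1" and p: "0 < p"
 shows "(\<Sum>i<p. u ^ (p - i) * v ^ i) = (if u = v then of_nat p else 0)"
proof -
 have u0: "u \<noteq> 0" using u p by (metis power_0_left zero_neq_one less_numeral_extra(3))
 have "(\<Sum>i<p. u ^ (p - i) * v ^ i) = (\<Sum>i<p. (v / u) ^ i)"
  using u0 by (intro sum.cong) (auto simp: power_diff u power_divide)
 moreover have "(v / u) ^ p = 1" by (simp add: power_divide u v)
 ultimately show ?thesis using u0 by (auto simp: geometric_sum)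
qed

context koehler
begin

definition roots :: "complex set" where
 "roots = {z. z ^ p = 1} - {1}"

lemma finite_roots [simp]: "finite roots"
 using finite_roots_unity[of p] p by (simp add: roots_def)

lemma rootsD: "z \<in> roots ==> z ^ p = 1" "z \<in> roots ==> z \<noteq> 1"
 by (auto simp: roots_def)

lemma sum_roots:
 fixes c :: "nat => int"
 shows "(\<Sum>z\<in>roots. \<Sum>i<p. of_int (c i) * z ^ i) = of_int (int p * c 0 - (\<Sum>i<p. c i))"
proof -
 let ?U = "{z :: complex. z ^ p = 1}"
 have U: "finite ?U" using finite_roots_unity[of p] p by simp
 have "(\<Sum>z\<in>?U. \<Sum>i<p. of_int (c i) * z ^ i) = (\<Sum>i<p. of_int (c i) * (\<Sum>z\<in>?U. z ^ i))"
  by (subst sum.swap) (simp add: sum_distrib_left)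
 also have "\<dots> = (\<Sum>i<p. if i = 0 then of_int (int p * c 0) else 0)"
  by (intro sum.cong) (auto simp: sum_powers_roots_of_unity[OF p] dest: dvd_imp_le)
 also have "\<dots> = of_int (int p * c 0)" using p by simp
 finally show ?thesis using U by (simp add: roots_def sum_diff1)
qed

text \<open>Fourier inversion: \<open>p c_k\<close> is the sum of \<open>z^(-k) q(z)\<close> over the
 \<open>p\<close>-th roots of unity, where \<open>q\<close> is the polynomial with coefficients \<open>c\<close>, and
 only \<open>z = 1\<close> contributes.\<close>

lemma coefficients_constant:
 fixes c :: "nat => int"
 assumes "!!z. z \<in> roots ==> (\<Sum>i<p. of_int (c i) * z ^ i) = (0 :: complex)" and k: "k < p"
 shows "int p * c k = (\<Sum>i<p. c i)"
proof -
 let ?U = "{z :: complex. z ^ p = 1}"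
 have U: "finite ?U" using finite_roots_unity[of p] p by simp
 have dv: "p dvd p - k + i \<longleftrightarrow> i = k" if "i < p" for i
 proof
  assume "p dvd p - k + i"
  then obtain m where "p - k + i = p * m" by blast
  moreover have "0 < p - k + i" "p - k + i < p * 2" using that k by auto
  ultimately have "m = 1" using p by (cases m; cases "m - 1") auto
  then show "i = k" using \<open>p - k + i = p * m\<close> k by simp
 qed (use k in simp)
 have "(\<Sum>z\<in>?U. z ^ (p - k) * (\<Sum>i<p. of_int (c i) * z ^ i)) = (\<Sum>i<p. of_int (c i) * (\<Sum>z\<in>?U. z ^ (p - k + i)))"
  unfolding sum_distrib_left by (subst sum.swap) (simp add: power_add mult_ac)
 also have "\<dots> = (\<Sum>i<p. if i = k then of_int (int p * c k) else 0)"
  by (intro sum.cong) (auto simp: sum_powers_roots_of_unity[OF p] dv)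
 also have "\<dots> = of_int (int p * c k)" using k by simp
 finally have "of_int (int p * c k) = (\<Sum>z\<in>?U. z ^ (p - k) * (\<Sum>i<p. of_int (c i) * z ^ i))" by simp
 also have "\<dots> = (\<Sum>z\<in>{1}. z ^ (p - k) * (\<Sum>i<p. of_int (c i) * z ^ i))"
  using U assms(1) by (intro sum.mono_neutral_right) (auto simp: roots_def)
 also have "\<dots> = of_int (\<Sum>i<p. c i)" by simp
 finally show ?thesis by (simp only: of_int_eq_iff)
qed

lemma coefficients_constant':
 fixes c :: "nat => int"
 assumes "!!z. z \<in> roots ==> (\<Sum>i<p. of_int (c i) * z ^ i) = (0 :: complex)"
 shows "psum x c = of_int (c 0) * norm_sum p x"
proof -
 have "c i = c 0" if "i < p" for i
 proof -
  have "int p * c i = int p * c 0"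
   using coefficients_constant[of c, OF assms that] coefficients_constant[of c 0, OF assms p] by simp
  then show ?thesis using p by simp
 qed
 then have "psum x c = psum x (%_. c 0)" by (rule psum_cong)
 then show ?thesis by (simp add: psum_const)
qed

lemma sum_powers_root: "z \<in> roots ==> (\<Sum>i<p. z ^ i) = 0"
 using geometric_sum[of z p] rootsD[of z] by simp

end

subsection \<open>The characters\<close>

text \<open>The arrows are detected by complex characters. Each of them is supported on two objects and assigns a
 scalar to every generator, compatibly with the relators: \<open>WA b\<close> sends the loops to \<open>1\<close>, and
 \<open>WT b z\<close> and \<open>WS b z\<close> belong to a nontrivial \<open>p\<close>-th root of unity
 \<open>z\<close>.\<close>

datatype character = WA bool | WT bool complex | WS bool complex

fun char_letter :: "nat => character => arrow => complex" where
 "char_letter p (WA b) (b', g) = (if b' = b then case g of \<alpha>10 => 1 | \<alpha>01 => of_nat p | t0 => 1 | s1 => 1 | _ => 0 else 0)"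
| "char_letter p (WT b z) (b', g) =
   (if b' = b then case g of \<alpha>20 => 1 | \<alpha>02 => 1 - z | t0 => z | t2 => z | s2 => 1 | _ => 0 else 0)"
| "char_letter p (WS b z) (b', g) =
   (if b' = b then case g of \<alpha>12 => 1 - z | \<alpha>21 => 1 | s2 => z | t2 => 1 | _ => 0 else if g = s1 then z else 0)"

fun supp :: "character => obj set" where
 "supp (WA b) = {(b, V0), (b, V1)}"
| "supp (WT b z) = {(b, V0), (b, V2)}"
| "supp (WS b z) = {(b, V2), (~ b, V1)}"

fun char_word :: "nat => character => arrow word => complex" where
 "char_word p w (Word u) = prod_list (map (char_letter p w) u)"

definition ev :: "nat => character => arrow free_ring => complex" where
 "ev p w f = (\<Sum>u\<in>Poly_Mapping.keys f. of_int (Poly_Mapping.lookup f u) * char_word p w u)"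

lemma ev_superset:
 "finite S ==> Poly_Mapping.keys f \<subseteq> S ==> ev p w f = (\<Sum>u\<in>S. of_int (Poly_Mapping.lookup f u) * char_word p w u)"
 unfolding ev_def by (rule sum.mono_neutral_left) (auto simp: in_keys_iff)

lemma ev_diff [simp]: "ev p w (f - g) = ev p w f - ev p w g"
proof -
 let ?S = "Poly_Mapping.keys f \<union> Poly_Mapping.keys g"
 have "Poly_Mapping.keys (f - g) \<subseteq> ?S" by (rule keys_diff)
 then show ?thesis
  by (simp add: ev_superset[of ?S] lookup_minus left_diff_distrib sum_subtractf)
qed

lemma ev_zero [simp]: "ev p w 0 = 0"
 by (simp add: ev_def)

lemma ev_uminus [simp]: "ev p w (- f) = - ev p w f"
 using ev_diff[of p w 0 f] by simp

lemma ev_add [simp]: "ev p w (f + g) = ev p w f + ev p w g"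
 using ev_diff[of p w f "- g"] by simp

lemma ev_sum [simp]: "ev p w (sum f I) = (\<Sum>i\<in>I. ev p w (f i))"
 by (induction I rule: infinite_finite_induct) auto

lemma ev_sum_list [simp]: "ev p w (sum_list (map f is)) = (\<Sum>i\<leftarrow>is. ev p w (f i))"
 by (induction "is") auto

lemma ev_single: "ev p w (Poly_Mapping.single u k) = of_int k * char_word p w u"
 by (simp add: ev_def)

lemma char_word_plus: "char_word p w (u + v) = char_word p w u * char_word p w v"
 by (cases u; cases v) simp

lemma ev_mult [simp]: "ev p w (f * g) = ev p w f * ev p w g"
proof -
 have f: "Poly_Mapping.keys f \<subseteq> UNIV" and g: "Poly_Mapping.keys g \<subseteq> UNIV" by auto
 have 1: "ev p w (frag_of u * g) = ev p w (frag_of u) * ev p w g" for u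
  using g by (induction g rule: frag_induction) (auto simp: mult_single ev_single char_word_plus right_diff_distrib)
 show ?thesis
  using f by (induction f rule: frag_induction) (auto simp: 1 left_diff_distrib)
qed

lemma ev_of_int [simp]: "ev p w (of_int k) = of_int k"
proof -
 have "of_int k = (Poly_Mapping.single 0 k :: arrow free_ring)"
  by (rule poly_mapping_eqI) (simp add: lookup_of_int lookup_single when_def)
 then show ?thesis by (simp add: ev_single zero_word_def)
qed

lemma ev_one [simp]: "ev p w 1 = 1"
 using ev_of_int[of p w 1] by simp

lemma ev_of_nat [simp]: "ev p w (of_nat n) = of_nat n"
 using ev_of_int[of p w "int n"] by simp

lemma ev_power [simp]: "ev p w (f ^ n) = ev p w f ^ n"
 by (induction n) auto

lemma ev_gen [simp]: "ev p w (gen b g) = char_letter p w (b, g)"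
 by (simp add: gen_def letter_def ev_single)

lemma ev_norm_sum [simp]: "ev p w (norm_sum n x) = (\<Sum>i<n. ev p w x ^ i)"
 by (simp add: norm_sum_def)

lemma char_letter_supp:
 "char_letter p w a \<noteq> 0 ==> arrow_src a \<in> supp w \<and> arrow_tgt a \<in> supp w"
 by (cases a; cases w; cases "snd a") (auto split: if_splits)

lemma char_word_supp:
 assumes "is_path arrow_src arrow_tgt X u Y" "char_word p w (Word u) \<noteq> 0" "u \<noteq> []"
 shows "X \<in> supp w \<and> Y \<in> supp w"
 using assms
proof (induction u arbitrary: Y)
 case (Cons a u)
 then show ?case using char_letter_supp[of p w a] Cons.IH[of "arrow_src a"] by (cases "u = []") auto
qed simp

lemma ev_outside:
 assumes f: "f \<in> Khom X Y" and XY: "(X \<in> supp w) \<noteq> (Y \<in> supp w)"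
 shows "ev p w f = 0"
 unfolding ev_def
proof (intro sum.neutral ballI)
 fix u assume u: "u \<in> Poly_Mapping.keys f"
 obtain l where l: "u = Word l" by (cases u)
 have path: "is_path arrow_src arrow_tgt X l Y" using f u l by (auto simp: free_hom_def)
 have "l \<noteq> []" using path XY by auto
 then show "of_int (Poly_Mapping.lookup f u) * char_word p w u = 0"
  using char_word_supp[OF path, of p w] XY l by auto
qed

context koehler
begin

fun chars :: "obj => character set" where
 "chars (b, V0) = insert (WA b) (WT b ` roots)"
| "chars (b, V1) = insert (WA b) (WS (~ b) ` roots)"
| "chars (b, V2) = WT b ` roots \<union> WS b ` roots"

fun valid :: "character => bool" where
 "valid (WA b) \<longleftrightarrow> True"
| "valid (WT b z) \<longleftrightarrow> z \<in> roots"
| "valid (WS b z) \<longleftrightarrow> z \<in> roots"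

lemma chars_iff: "w \<in> chars X \<longleftrightarrow> valid w \<and> X \<in> supp w"
 by (cases X; cases "snd X"; cases w) auto

lemma finite_chars [simp]: "finite (chars X)"
 by (cases X; cases "snd X") auto

abbreviation chi :: "character => arrow free_ring => complex" where
 "chi \<equiv> ev p"

lemma chi_psum [simp]: "chi w (psum x c) = (\<Sum>i<p. of_int (c i) * chi w x ^ i)"
 by (simp add: psum_def)

lemma chi_relator:
 assumes "koehler_relator p X Y r" "valid w" "X \<in> supp w" "Y \<in> supp w"
 shows "chi w r = 0"
 using assms by (induction rule: koehler_relator.induct; cases w) (auto simp: sum_powers_root)

text \<open>Composites through an object outside of the support vanish, because an arrow that enters or leaves the
 support has the value zero.\<close>

lemma chi_rel_ideal:
 assumes "rel_ideal arrow_src arrow_tgt (koehler_relator p) X Y f" and w: "valid w" and "X \<in> supp w" "Y \<in> supp w"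
 shows "chi w f = 0"
 using assms(1,3,4)
proof (induction rule: rel_ideal.induct)
 case (left X Y f g Z)
 then show ?case using ev_outside[of g Y Z w p] by (cases "Y \<in> supp w") auto
next
 case (right Y Z f g X)
 then show ?case using ev_outside[of g X Y w p] by (cases "Y \<in> supp w") auto
qed (auto simp: chi_relator[OF _ w])

lemma chi_eqm: "eqm X Y f g ==> w \<in> chars X ==> w \<in> chars Y ==> chi w f = chi w g"
 using chi_rel_ideal[of X Y "f - g" w] by (simp add: eqm_def chars_iff)

lemma eqm_norm_zero: "eqm X Y (g * norm_sum p x) 0 ==> eqm X Y (g * (of_int k * norm_sum p x)) 0"
 using eqm_left[OF _ free_hom_of_int[of k]] by (fastforce simp: mult_of_int_left)

text \<open>A polynomial that vanishes at the nontrivial roots of unity is a multiple of the norm, by Fourier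
 inversion. The generator that follows annihilates the norm, or else the character \<open>WA\<close> shows that the
 multiple is zero. At \<open>V2\<close> both polynomials are multiples of norms up to constants, and the relator
 \<open>N(t) + N(s) - p\<close> remains.\<close>

lemma nf_faithful:
 assumes "!!w. w \<in> chars X ==> w \<in> chars Y ==> chi w (nf X Y c d) = 0"
 shows "eqm X Y (nf X Y c d) 0"
proof -
 have zero: "psum x c = 0" if "!!z. z \<in> roots ==> (\<Sum>i<p. of_int (c i) * z ^ i) = (0 :: complex)"
  "(\<Sum>i<p. of_int (c i)) = (0 :: complex)" for x c
 proof -
  have "(\<Sum>i<p. c i) = 0" using that(2) by (simp flip: of_int_sum)
  then have "c 0 = 0" using coefficients_constant[of c 0, OF that(1) p] p by simp
  then show ?thesis using coefficients_constant'[of c x, OF that(1)] by simp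
 qed
 obtain b v b' v' where XY: "X = (b, v)" "Y = (b', v')" by (cases X; cases Y)
 have neg: "b' = (~ b)" if "b' \<noteq> b" using that by auto
 show ?thesis
 proof (cases v; cases v')
  assume v: "v = V0" "v' = V0"
  show ?thesis
  proof (cases "b' = b")
   case True
   have "psum (gen b t0) c = 0"
    using assms[of "WA b"] assms[of "WT b _"] by (intro zero) (auto simp: XY v True)
   then show ?thesis by (simp add: XY v)
  qed (simp add: XY v)
 next
  assume v: "v = V0" "v' = V1"
  show ?thesis using assms[of "WA b"] by (cases "b' = b") (auto simp: XY v)
 next
  assume v: "v = V0" "v' = V2"
  show ?thesis
  proof (cases "b' = b")
   case True
   have "psum (gen b t0) c = of_int (c 0) * norm_sum p (gen b t0)"
    using assms[of "WT b _"] by (intro coefficients_constant') (auto simp: XY v True)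
   then show ?thesis using eqm_norm_zero[OF vanishing_norms(1)] by (simp add: XY v True)
  qed (simp add: XY v)
 next
  assume v: "v = V1" "v' = V0"
  show ?thesis using assms[of "WA b"] p by (cases "b' = b") (auto simp: XY v)
 next
  assume v: "v = V1" "v' = V1"
  show ?thesis
  proof (cases "b' = b")
   case True
   have "psum (gen b s1) c = 0"
    using assms[of "WA b"] assms[of "WS (~ b) _"] by (intro zero) (auto simp: XY v True)
   then show ?thesis by (simp add: XY v)
  qed (simp add: XY v)
 next
  assume v: "v = V1" "v' = V2"
  show ?thesis
  proof (cases "b' = b")
   case False
   have "psum (gen b s1) c = of_int (c 0) * norm_sum p (gen b s1)"
    using assms[of "WS (~ b) _"] by (intro coefficients_constant') (auto simp: XY v neg[OF False])
   then show ?thesis using eqm_norm_zero[OF vanishing_norms(2)[of b']] by (simp add: XY v neg[OF False])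
  qed (simp add: XY v)
 next
  assume v: "v = V2" "v' = V0"
  show ?thesis
  proof (cases "b' = b")
   case True
   have "psum (gen b t2) c = of_int (c 0) * norm_sum p (gen b t2)"
    using assms[of "WT b _"] rootsD(2) by (intro coefficients_constant') (auto simp: XY v True)
   then show ?thesis using eqm_norm_zero[OF vanishing_norms(3)] by (simp add: XY v True)
  qed (simp add: XY v)
 next
  assume v: "v = V2" "v' = V1"
  show ?thesis
  proof (cases "b' = b")
   case False
   have "psum (gen b s2) c = of_int (c 0) * norm_sum p (gen b s2)"
    using assms[of "WS b _"] rootsD(2) by (intro coefficients_constant') (auto simp: XY v neg[OF False])
   then show ?thesis using eqm_norm_zero[OF vanishing_norms(4)] by (simp add: XY v neg[OF False])
  qed (simp add: XY v)
 next
  assume v: "v = V2" "v' = V2"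
  show ?thesis
  proof (cases "b' = b")
   case True
   define C D where CD: "C = (\<Sum>i<p. c i)" "D = (\<Sum>i<p. d i)"
   define c' d' where c': "c' = (%i. c i + (if i = 0 then D else 0))" and d': "d' = (%i. d i + (if i = 0 then C else 0))"
   have sums: "(\<Sum>i<p. of_int (c' i) * x ^ i) = (\<Sum>i<p. of_int (c i) * x ^ i) + of_int D"
    "(\<Sum>i<p. of_int (d' i) * x ^ i) = (\<Sum>i<p. of_int (d i) * x ^ i) + of_int C" for x :: "'z :: ring_1"
   proof -
    have "(\<Sum>i<p. of_int (if i = 0 then k else 0) * x ^ i) = of_int k" for k
    proof -
     have "(\<Sum>i<p. of_int (if i = 0 then k else 0) * x ^ i) = (\<Sum>i<p. if i = 0 then of_int k else 0)" by (intro sum.cong) auto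
     then show ?thesis using p by simp
    qed
    then show "(\<Sum>i<p. of_int (c' i) * x ^ i) = (\<Sum>i<p. of_int (c i) * x ^ i) + of_int D"
     "(\<Sum>i<p. of_int (d' i) * x ^ i) = (\<Sum>i<p. of_int (d i) * x ^ i) + of_int C"
     by (simp_all add: c' d' distrib_right sum.distrib)
   qed
   have rc: "(\<Sum>i<p. of_int (c' i) * z ^ i) = (0 :: complex)" and rd: "(\<Sum>i<p. of_int (d' i) * z ^ i) = (0 :: complex)" if "z \<in> roots" for z
    using assms[of "WT b z"] assms[of "WS b z"] that unfolding sums by (auto simp: XY v True CD add.commute)
   have "int p * c' 0 = C + D" "int p * d' 0 = C + D"
    using coefficients_constant[of c' 0, OF rc p] coefficients_constant[of d' 0, OF rd p] sums[of "1 :: int"] by (simp_all add: CD)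
   then have "int p * c' 0 = int p * d' 0" "C + D = int p * c' 0" by (simp_all only:)
   then have cd: "c' 0 = d' 0" "C + D = int p * c' 0" using p by simp_all
   have "psum (gen b t2) c + of_int D = of_int (c' 0) * norm_sum p (gen b t2)" "psum (gen b s2) d + of_int C = of_int (c' 0) * norm_sum p (gen b s2)"
    using coefficients_constant'[of c' "gen b t2", OF rc] coefficients_constant'[of d' "gen b s2", OF rd] cd(1)
    unfolding psum_def sums by simp_all
   then have "psum (gen b t2) c = of_int (c' 0) * norm_sum p (gen b t2) - of_int D"
    "psum (gen b s2) d = of_int (c' 0) * norm_sum p (gen b s2) - of_int C"
    by (simp_all only: eq_diff_eq)
   note eqs = this
   have "psum (gen b t2) c + psum (gen b s2) d =
     of_int (c' 0) * (norm_sum p (gen b t2) + norm_sum p (gen b s2)) - of_int (C + D)"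
    unfolding eqs by (simp add: algebra_simps)
   also have "\<dots> = of_int (c' 0) * (norm_sum p (gen b t2) + norm_sum p (gen b s2) - of_nat p)"
    unfolding cd(2) by (simp only: right_diff_distrib of_int_mult of_int_of_nat_eq mult_of_nat_commute)
   also have "eqm (b, V2) (b, V2) \<dots> (of_int (c' 0) * 0)"
    by (rule eqm_left[OF _ free_hom_of_int]) (use eqm_diff[OF relations(13)[of b] eqm_refl[of _ _ "of_nat p"]] in simp)
   finally show ?thesis by (simp add: XY v True)
  qed (simp add: XY v)
 qed
qed

proposition characters_faithful:
 assumes f: "f \<in> Khom X Y" and "!!w. w \<in> chars X ==> w \<in> chars Y ==> chi w f = 0"
 shows "eqm X Y f 0"
proof -
 obtain c d where nf: "eqm X Y f (nf X Y c d)" using normal_form[OF f] unfolding normal_def by blast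
 then show ?thesis using eqm_trans[OF nf nf_faithful] chi_eqm[OF nf] assms(2) by metis
qed

end

section \<open>The symmetric Frobenius structure of Koehler's category\<close>

context koehler
begin

abbreviation eps :: "bool => int" where
 "eps b \<equiv> (if b then - 1 else 1)"

text \<open>\<open>WS b\<close> connects \<open>(b, V2)\<close> with \<open>(\<not> b, V1)\<close>. With these signs
 all characters at \<open>V0\<close> and at \<open>V1\<close> occur with the same sign, and at \<open>V2\<close> the
 two kinds of characters occur with opposite signs; this makes the average of the characters integral.\<close>

fun sgnc :: "character => int" where
 "sgnc (WA b) = eps b"
| "sgnc (WT b z) = eps b"
| "sgnc (WS b z) = - eps b"

definition trc :: "obj => arrow free_ring => complex" where
 "trc X f = (\<Sum>w\<in>chars X. of_int (sgnc w) * chi w f) / of_nat p"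

lemma trc_add: "trc X (f + g) = trc X f + trc X g"
 by (simp add: trc_def distrib_left sum.distrib add_divide_distrib)

lemma trc_eqm: "eqm X X f g ==> trc X f = trc X g"
 by (simp add: trc_def chi_eqm cong: sum.cong)

lemma trc_mult:
 assumes f: "f \<in> Khom X Y" and g: "g \<in> Khom Y X"
 shows "trc X (g * f) = (\<Sum>w\<in>chars X \<inter> chars Y. of_int (sgnc w) * chi w g * chi w f) / of_nat p"
proof -
 have "chi w f = 0" if "w \<in> chars X - chars X \<inter> chars Y" for w
  using ev_outside[OF f, of w] that by (auto simp: chars_iff)
 then have "(\<Sum>w\<in>chars X. of_int (sgnc w) * chi w (g * f)) = (\<Sum>w\<in>chars X \<inter> chars Y. of_int (sgnc w) * chi w (g * f))"
  by (intro sum.mono_neutral_right) auto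
 then show ?thesis by (simp add: trc_def mult.assoc)
qed

lemma trc_commute: "f \<in> Khom X Y ==> g \<in> Khom Y X ==> trc X (g * f) = trc Y (f * g)"
 by (simp add: trc_mult Int_commute mult_ac)

lemma sum_chars:
 "(\<Sum>w\<in>chars (b, V0). h w) = h (WA b) + (\<Sum>z\<in>roots. h (WT b z))"
 "(\<Sum>w\<in>chars (b, V1). h w) = h (WA b) + (\<Sum>z\<in>roots. h (WS (~ b) z))"
 "(\<Sum>w\<in>chars (b, V2). h w) = (\<Sum>z\<in>roots. h (WT b z)) + (\<Sum>z\<in>roots. h (WS b z))"
proof -
 have "inj_on (WT b) S" "inj_on (WS b) S" for b S by (auto simp: inj_on_def)
 moreover have "(\<Sum>w\<in>WT b ` roots \<union> WS b ` roots. h w) = (\<Sum>w\<in>WT b ` roots. h w) + (\<Sum>w\<in>WS b ` roots. h w)"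
  by (rule sum.union_disjoint) auto
 ultimately show "(\<Sum>w\<in>chars (b, V0). h w) = h (WA b) + (\<Sum>z\<in>roots. h (WT b z))"
  "(\<Sum>w\<in>chars (b, V1). h w) = h (WA b) + (\<Sum>z\<in>roots. h (WS (~ b) z))"
  "(\<Sum>w\<in>chars (b, V2). h w) = (\<Sum>z\<in>roots. h (WT b z)) + (\<Sum>z\<in>roots. h (WS b z))"
  by (auto simp: sum.insert_if sum.reindex image_iff)
qed

lemma card_roots: "of_nat (card roots) = (of_nat p - 1 :: complex)"
proof -
 have "card {z :: complex. z ^ p = 1} = p" "finite {z :: complex. z ^ p = 1}"
  using card_roots_unity_eq[OF p] finite_roots_unity[of p] p by simp_all
 then show ?thesis using p by (simp add: roots_def of_nat_diff)
qed

lemma trc_nf: "trc X (nf X X c d) \<in> \<int>"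
proof -
 let ?C = "\<Sum>i<p. c i" and ?D = "\<Sum>i<p. d i"
 have c: "(\<Sum>z\<in>roots. \<Sum>i<p. of_int (c i) * z ^ i) = of_nat p * of_int (c 0) - of_int ?C"
  and d: "(\<Sum>z\<in>roots. \<Sum>i<p. of_int (d i) * z ^ i) = of_nat p * of_int (d 0) - of_int ?D"
  by (simp_all add: sum_roots)
 obtain b v where X: "X = (b, v)" by (cases X)
 have e: "(\<Sum>z\<in>roots. of_int k * h z) = of_int k * (\<Sum>z\<in>roots. h z)" for k h by (simp add: sum_distrib_left)
 have "trc X (nf X X c d) = of_int (if v = V2 then eps b * (c 0 - d 0 - ?C + ?D) else eps b * c 0)"
 proof (cases v)
  case V0
  have "trc X (nf X X c d) = of_int (eps b) * (of_int ?C + (\<Sum>z\<in>roots. \<Sum>i<p. of_int (c i) * z ^ i)) / of_nat p"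
   by (simp add: X V0 trc_def sum_chars del: chars.simps add: sum_negf)
  then show ?thesis using p V0 unfolding c by simp
 next
  case V1
  have "trc X (nf X X c d) = of_int (eps b) * (of_int ?C + (\<Sum>z\<in>roots. \<Sum>i<p. of_int (c i) * z ^ i)) / of_nat p"
   by (simp add: X V1 trc_def sum_chars del: chars.simps add: sum_negf)
  then show ?thesis using p V1 unfolding c by simp
 next
  case V2
  have "trc X (nf X X c d) = of_int (eps b) * (((\<Sum>z\<in>roots. \<Sum>i<p. of_int (c i) * z ^ i) + (\<Sum>z\<in>roots. of_int ?D))
    - ((\<Sum>z\<in>roots. of_int ?C) + (\<Sum>z\<in>roots. \<Sum>i<p. of_int (d i) * z ^ i))) / of_nat p"
   by (simp add: X V2 trc_def sum_chars sum.distrib del: chars.simps sum_constant add: sum_negf sum_subtractf)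
  also have "\<dots> = of_int (eps b) * (of_nat p * of_int (c 0 - d 0 - ?C + ?D)) / of_nat p"
   unfolding c d sum_constant card_roots by (simp add: algebra_simps)
  finally show ?thesis using p V2 by simp
 qed
 then show ?thesis by simp
qed

lemma trc_integral: "f \<in> Khom X X ==> trc X f \<in> \<int>"
 using normal_form[of f X X] trc_eqm trc_nf unfolding normal_def by metis

definition tr :: "obj \<times> arrow free_ring set \<times> obj => int" where
 "tr a = \<lfloor>Re (trc (fst a) (SOME f. f \<in> fst (snd a)))\<rfloor>"

lemma tr_arr:
 assumes f: "f \<in> Khom X X"
 shows "of_int (tr (arr X X f)) = trc X f"
proof -
 let ?S = "residue_class arrow_src arrow_tgt (koehler_relator p) X X f"
 have "f \<in> ?S" using f by (simp add: residue_class_iff)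
 then have "(SOME g. g \<in> ?S) \<in> ?S" by (rule someI)
 then have "trc X (SOME g. g \<in> ?S) = trc X f" by (intro trc_eqm) (simp add: residue_class_iff)
 moreover obtain k where "trc X f = of_int k" using trc_integral[OF f] by (elim Ints_cases)
 ultimately show ?thesis by (simp add: tr_def arr_def)
qed

subsection \<open>Dual bases\<close>

text \<open>The dual bases rest on one identity: for \<open>p\<close>-th roots of unity \<open>u\<close> and
 \<open>v\<close> the sum of \<open>u^(p - i) v^i\<close> over \<open>i < p\<close> is \<open>p\<close> if \<open>u =
 v\<close> and \<open>0\<close> otherwise. Between \<open>V2\<close> and another object a truncated geometric series
 cancels the factor \<open>1 - z\<close> of the characters; at \<open>V2\<close> the last two pairs correct the
 products of the two kinds of characters. Opposite directions differ by exchanging the members.\<close>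

function dual_pairs :: "obj => obj => (arrow free_ring \<times> arrow free_ring) list" where
 "dual_pairs (b, V0) (b', V0) = (if b' = b then
   map (%i. (gen b t0 ^ (p - i), of_int (eps b) * gen b t0 ^ i)) [0..<p] else [])"
| "dual_pairs (b, V0) (b', V1) = (if b' = b then [(gen b \<alpha>10, of_int (eps b) * gen b \<alpha>01)] else [])"
| "dual_pairs (b, V0) (b', V2) = (if b' = b then
   map (%i. (gen b \<alpha>20 * gen b t0 ^ i, of_int (- eps b) * (\<Sum>j<p - i. gen b t0 ^ j * gen b \<alpha>02))) [0..<p] else [])"
| "dual_pairs (b, V1) (b', V1) = (if b' = b then
   map (%i. (gen b s1 ^ (p - i), of_int (eps b) * gen b s1 ^ i)) [0..<p] else [])"
| "dual_pairs (b, V1) (b', V2) = (if b' \<noteq> b then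
   map (%i. (gen b' \<alpha>21 * gen b s1 ^ i, of_int (- eps b) * (\<Sum>j<p - i. gen b s1 ^ j * gen b' \<alpha>12))) [0..<p] else [])"
| "dual_pairs (b, V2) (b', V2) = (if b' = b then
   map (%i. (gen b t2 ^ (p - i), of_int (eps b) * gen b t2 ^ i)) [0..<p] @
   map (%i. (gen b s2 ^ (p - i), of_int (- eps b) * gen b s2 ^ i)) [0..<p] @
   [(norm_sum p (gen b s2), of_int (eps b)), (of_int (- eps b), norm_sum p (gen b t2))] else [])"
| "dual_pairs (b, V1) (b', V0) = map prod.swap (dual_pairs (b', V0) (b, V1))"
| "dual_pairs (b, V2) (b', V0) = map prod.swap (dual_pairs (b', V0) (b, V2))"
| "dual_pairs (b, V2) (b', V1) = map prod.swap (dual_pairs (b', V1) (b, V2))"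
 by pat_completeness auto
termination
 by (relation "measure (%(Y, X). case snd Y of V0 => 0 | V1 => 1 | V2 => 2)") auto

lemma dual_pairs_swap:
 assumes "!!Y X. dual_pairs Y X = map prod.swap (dual_pairs X Y) ==> P X Y ==> P Y X"
  "!!b b'. P (b, V0) (b', V0)" "!!b b'. P (b, V0) (b', V1)" "!!b b'. P (b, V0) (b', V2)"
  "!!b b'. P (b, V1) (b', V1)" "!!b b'. P (b, V1) (b', V2)" "!!b b'. P (b, V2) (b', V2)"
 shows "P Y X"
proof -
 obtain b v b' v' where "Y = (b, v)" "X = (b', v')" by (cases Y; cases X)
 then show ?thesis
  using assms(2-)[of b b'] assms(1)[of Y X] assms(2-)[of b' b] by (cases v; cases v') auto
qed

lemma dual_pairs_hom:
 "\<forall>(e, f)\<in>set (dual_pairs Y X). e \<in> Khom Y X \<and> f \<in> Khom X Y"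
proof (induction Y X rule: dual_pairs_swap)
 case (1 Y X)
 then show ?case by auto
next
 case (6 b b')
 have "gen (~ b) \<alpha>12 \<in> Khom (~ b, V2) (b, V1)" "gen (~ b) \<alpha>21 \<in> Khom (b, V1) (~ b, V2)"
  using gen_hom(5,6)[of "~ b"] by simp_all
 then show ?case
  by (cases "b' = b") (auto intro!: free_hom_power free_hom_scale free_hom_uminus free_hom_sum gen_hom intro: free_hom_mult[OF _ free_hom_power] free_hom_mult[OF free_hom_power] simp del: of_int_minus)
qed (auto intro!: free_hom_power free_hom_scale free_hom_uminus free_hom_sum free_hom_of_int free_hom_one gen_hom free_hom_mult[OF gen_hom(3)]
  free_hom_mult[OF _ gen_hom(4)] simp: norm_sum_def)

lemma sum_list_upt: "(\<Sum>i\<leftarrow>[0..<n]. f i) = (\<Sum>i<n. f i)"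
 by (simp add: interv_sum_list_conv_sum_set_nat atLeast0LessThan)

lemma sum_quotient_powers_roots:
 "z \<in> roots ==> (\<Sum>i<p. z ^ (p - i)) = 0"
 "[|z \<in> roots; z' \<in> roots|] ==> (\<Sum>i<p. z' ^ (p - i) * z ^ i) = (if z' = z then of_nat p else 0)"
 using sum_quotient_powers[of z p 1] sum_quotient_powers[of z' p z] p rootsD by auto

lemma sum_truncated_powers:
 assumes "u \<in> roots" "v \<in> roots"
 shows "(\<Sum>i<p. u ^ i * (\<Sum>j<p - i. v ^ j * (1 - v))) = (if u = v then - of_nat p else 0)"
proof -
 have S: "(\<Sum>j<n. v ^ j * (1 - v)) = 1 - v ^ n" for n
  using sum_gp_strict[of v n] rootsD(2)[OF assms(2)] by (simp flip: sum_distrib_right)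
 have "(\<Sum>i<p. u ^ i * (\<Sum>j<p - i. v ^ j * (1 - v))) = (\<Sum>i<p. u ^ i) - (\<Sum>i<p. v ^ (p - i) * u ^ i)"
  unfolding S by (simp add: sum_subtractf algebra_simps)
 then show ?thesis
  using sum_quotient_powers_roots(2)[OF assms] sum_powers_root[OF assms(1)] by auto
qed

lemma dual_pairs_orthogonal:
 "\<forall>w w'. w \<in> chars X \<inter> chars Y --> w' \<in> chars X \<inter> chars Y -->
   (\<Sum>(e, f)\<leftarrow>dual_pairs Y X. chi w' e * chi w f) = (if w = w' then of_int (sgnc w) * of_nat p else 0)"
proof (induction Y X rule: dual_pairs_swap)
 case (1 Y X)
 have "(\<Sum>(e, f)\<leftarrow>dual_pairs Y X. chi w' e * chi w f) = (\<Sum>(e, f)\<leftarrow>dual_pairs X Y. chi w e * chi w' f)" for w w'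
  unfolding 1(1) by (simp add: comp_def split_def mult.commute)
 then show ?case using 1(2) by auto
next
 case (6 b b')
 show ?case
  by (cases b; cases b') (auto simp: comp_def sum_list_upt sum_negf sum_truncated_powers split: if_splits)
qed (auto simp: comp_def sum_list_upt sum_negf sum_powers_root sum_quotient_powers_roots sum_truncated_powers split: if_splits)

text \<open>By faithfulness it suffices to apply a character \<open>w\<close>. After the trace is written as a sum
 over characters, orthogonality leaves the term of \<open>w\<close> alone.\<close>

lemma dual_expansion:
 assumes f: "f \<in> Khom X Y" and L: "\<forall>(e, f)\<in>set L. e \<in> Khom Y X \<and> f \<in> Khom X Y"
  and orth: "!!w w'. w \<in> chars X \<inter> chars Y ==> w' \<in> chars X \<inter> chars Y ==>
   (\<Sum>(e, f)\<leftarrow>L. chi w' e * chi w f) = (if w = w' then of_int (sgnc w) * of_nat p else 0)"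
 shows "eqm X Y (\<Sum>(e, f')\<leftarrow>L. of_int (tr (arr X X (e * f))) * f') f" (is "eqm X Y ?F f")
proof -
 have hom: "e \<in> Khom Y X" "f' \<in> Khom X Y" if "(e, f') \<in> set L" for e f'
  using L that by auto
 have "?F \<in> Khom X Y" using hom by (intro free_hom_sum_list) (auto intro: free_hom_scale)
 then have "eqm X Y (?F - f) 0"
 proof (rule characters_faithful[OF free_hom_diff[OF _ f]])
  fix w assume w: "w \<in> chars X" "w \<in> chars Y"
  let ?S = "chars X \<inter> chars Y"
  have fin: "finite ?S" by simp
  have "chi w ?F = (\<Sum>(e, f')\<leftarrow>L. trc X (e * f) * chi w f')"
   using hom f tr_arr[OF free_hom_mult[OF hom(1) f]]
   by (auto intro!: arg_cong[of _ _ sum_list] simp: split_def)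
  also have "\<dots> = (\<Sum>(e, f')\<leftarrow>L. (\<Sum>w'\<in>?S. of_int (sgnc w') * chi w' f / of_nat p * (chi w' e * chi w f')))"
   using hom f by (auto intro!: arg_cong[of _ _ sum_list] simp: trc_mult sum_distrib_left sum_distrib_right sum_divide_distrib mult_ac)
  also have "\<dots> = (\<Sum>w'\<in>?S. of_int (sgnc w') * chi w' f / of_nat p * (\<Sum>(e, f')\<leftarrow>L. chi w' e * chi w f'))"
   by (induction L) (auto simp: sum.distrib distrib_left)
  also have "\<dots> = (\<Sum>w'\<in>?S. if w' = w then chi w f else 0)"
  proof (intro sum.cong refl)
   fix w' assume w': "w' \<in> ?S"
   have "sgnc w * sgnc w = 1" by (cases w) auto
   then have "of_int (sgnc w) * of_int (sgnc w) = (1 :: complex)" by (metis of_int_1 of_int_mult)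
   then show "of_int (sgnc w') * chi w' f / of_nat p * (\<Sum>(e, f')\<leftarrow>L. chi w' e * chi w f') = (if w' = w then chi w f else 0)"
    unfolding orth[OF _ w', of w, OF IntI[OF w]] using p by (auto simp: field_simps)
  qed
  also have "\<dots> = chi w f" using w fin by simp
  finally show "chi w (?F - f) = 0" by simp
 qed
 then show ?thesis using eqm_add[OF _ eqm_refl[of X Y f], of "?F - f" 0] by simp
qed

subsection \<open>Koehler's category is Gorenstein\<close>

definition objs :: "obj list" where
 "objs = [(b, v). b \<leftarrow> [False, True], v \<leftarrow> [V0, V1, V2]]"

definition casimir where
 "casimir Y = concat (map (%X. map (%(e, f). (arr Y X e, arr X Y f)) (dual_pairs Y X)) objs)"

lemma casimir_filter:
 "filter (%(e, f). Dom PC f = X) (casimir Y) = map (%(e, f). (arr Y X e, arr X Y f)) (dual_pairs Y X)"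
proof -
 let ?h = "%X. map (%(e, f). (arr Y X e, arr X Y f)) (dual_pairs Y X)"
 have "filter (%(e, f). Dom PC f = X) (?h X') = (if X' = X then ?h X else [])" for X'
  by (auto simp: filter_map comp_def split_def intro!: filter_True)
 moreover obtain b v where "X = (b, v)" by (cases X)
 ultimately show ?thesis
  by (cases b; cases v) (simp_all add: casimir_def objs_def)
qed

lemma casimir_arr:
 assumes "(a, a') \<in> set (casimir Y)"
 obtains X e f where "a = arr Y X e" "a' = arr X Y f" "e \<in> Khom Y X" "f \<in> Khom X Y"
proof -
 obtain X e f where "(e, f) \<in> set (dual_pairs Y X)" "a = arr Y X e" "a' = arr X Y f"
  using assms by (auto simp: casimir_def)
 then show thesis using that dual_pairs_hom[of Y X] by blast
qed

theorem frobenius_koehler: "frobenius_category PC hgrp tr casimir"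
proof (intro frobenius_category.intro linear_category.intro frobenius_category_axioms.intro)
 show "category PC" by (rule category_PC)
 fix X Y Z
 show "f \<in> homs PC X Y ==> g \<in> homs PC X Y ==> Add PC f g \<in> homs PC X Y" for f g
  by (auto simp: homs_PC free_hom_add)
 show "comm_group (hgrp X Y)" by (rule comm_group_hgrp)
 show "carrier (hgrp X Y) = homs PC X Y" "f *[hgrp X Y] g = Add PC f g" for f g by simp_all
 show "Comp PC (Add PC g h) f = Add PC (Comp PC g f) (Comp PC h f)"
  if "f \<in> homs PC X Y" "g \<in> homs PC Y Z" "h \<in> homs PC Y Z" for f g h
  using that by (auto simp: homs_PC free_hom_add free_hom_mult[of _ _ _ Y Z] distrib_right)
 show "Comp PC h (Add PC f g) = Add PC (Comp PC h f) (Comp PC h g)"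
  if "f \<in> homs PC X Y" "g \<in> homs PC X Y" "h \<in> homs PC Y Z" for f g h
  using that by (auto simp: homs_PC free_hom_add free_hom_mult[of _ _ _ Y Z] distrib_left)
 have tr_eq: "tr (arr X X f) = tr (arr Y Y g)" if "f \<in> Khom X X" "g \<in> Khom Y Y" "trc X f = trc Y g" for X Y f g
  using tr_arr[OF that(1)] tr_arr[OF that(2)] that(3) by (metis of_int_eq_iff)
 show "tr (Add PC f g) = tr f + tr g" if fg: "f \<in> homs PC X X" "g \<in> homs PC X X" for f g
 proof -
  obtain f' g' where f': "f' \<in> Khom X X" "f = arr X X f'" "g' \<in> Khom X X" "g = arr X X g'" using fg by (auto simp: homs_PC)
  have "(of_int (tr (Add PC f g)) :: complex) = of_int (tr f + tr g)"
   using f' tr_arr[OF free_hom_add[OF f'(1,3)]] by (simp add: tr_arr trc_add)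
  then show ?thesis by (simp only: of_int_eq_iff)
 qed
 show "tr (Comp PC g f) = tr (Comp PC f g)" if fg: "f \<in> homs PC X Y" "g \<in> homs PC Y X" for f g
 proof -
  obtain f' g' where f': "f' \<in> Khom X Y" "f = arr X Y f'" "g' \<in> Khom Y X" "g = arr Y X g'" using fg by (auto simp: homs_PC)
  then show ?thesis by (auto intro!: tr_eq trc_commute free_hom_mult)
 qed
 show "e \<in> Arr PC \<and> f \<in> Arr PC \<and> Dom PC e = Y \<and> Cod PC f = Y \<and> Cod PC e = Dom PC f"
  if "(e, f) \<in> set (casimir Y)" for e f
  using that by (elim casimir_arr) auto
 note hom = dual_pairs_hom[of Y X]
 show "gsum (hgrp X Y) (%(e, f'). f' ^[hgrp X Y] tr (Comp PC e f)) (filter (%(e, f'). Dom PC f' = X) (casimir Y)) = f"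
  if f: "f \<in> homs PC X Y" for f
 proof -
  obtain h where h: "h \<in> Khom X Y" "f = arr X Y h" using f by (rule homs_PCE)
  have "gsum (hgrp X Y) (%(e, f'). f' ^[hgrp X Y] tr (Comp PC e f)) (filter (%(e, f'). Dom PC f' = X) (casimir Y)) =
    gsum (hgrp X Y) (%i. arr X Y ((%(e, f'). of_int (tr (arr X X (e * h))) * f') i)) (dual_pairs Y X)"
   unfolding casimir_filter gsum_def foldr_map using hom h
   by (intro foldr_cong) (auto simp: hgrp_int_pow)
  also have "\<dots> = arr X Y (\<Sum>(e, f')\<leftarrow>dual_pairs Y X. of_int (tr (arr X X (e * h))) * f')"
   using hom by (intro gsum_hgrp) (auto intro: free_hom_scale)
  also have "\<dots> = f"
   unfolding h(2) using hom dual_pairs_orthogonal[of X Y]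
   by (subst arr_eq_iff) (auto intro!: dual_expansion free_hom_sum_list h intro: free_hom_scale)
  finally show ?thesis .
 qed
 show "gsum (hgrp Y X) (%(e, f'). e ^[hgrp Y X] tr (Comp PC f' g)) (filter (%(e, f'). Dom PC f' = X) (casimir Y)) = g"
  if g: "g \<in> homs PC Y X" for g
 proof -
  obtain h where h: "h \<in> Khom Y X" "g = arr Y X h" using g by (rule homs_PCE)
  have "gsum (hgrp Y X) (%(e, f'). e ^[hgrp Y X] tr (Comp PC f' g)) (filter (%(e, f'). Dom PC f' = X) (casimir Y)) =
    gsum (hgrp Y X) (%i. arr Y X ((%(e, f'). of_int (tr (arr Y Y (f' * h))) * e) i)) (dual_pairs Y X)"
   unfolding casimir_filter gsum_def foldr_map using hom h
   by (intro foldr_cong) (auto simp: hgrp_int_pow)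
  also have "\<dots> = arr Y X (\<Sum>(e, f')\<leftarrow>dual_pairs Y X. of_int (tr (arr Y Y (f' * h))) * e)"
   using hom by (intro gsum_hgrp) (auto intro: free_hom_scale)
  also have "\<dots> = g"
  proof -
   have "eqm Y X (\<Sum>(f', e)\<leftarrow>map prod.swap (dual_pairs Y X). of_int (tr (arr Y Y (f' * h))) * e) h"
   proof (rule dual_expansion[OF h(1)])
    show "\<forall>(f', e)\<in>set (map prod.swap (dual_pairs Y X)). f' \<in> Khom X Y \<and> e \<in> Khom Y X" using hom by auto
    fix w w' assume "w \<in> chars Y \<inter> chars X" "w' \<in> chars Y \<inter> chars X"
    then have "(\<Sum>(e, f)\<leftarrow>dual_pairs Y X. chi w e * chi w' f) = (if w' = w then of_int (sgnc w') * of_nat p else 0)"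
     using dual_pairs_orthogonal[of X Y] by blast
    then show "(\<Sum>(f', e)\<leftarrow>map prod.swap (dual_pairs Y X). chi w' f' * chi w e) = (if w = w' then of_int (sgnc w) * of_nat p else 0)"
     by (auto simp: comp_def split_def mult.commute)
   qed
   then show ?thesis
    unfolding h(2) using hom
    by (subst arr_eq_iff) (auto intro!: free_hom_sum_list h intro: free_hom_scale simp: comp_def split_def)
  qed
  finally show ?thesis .
 qed
qed

text \<open>The \<open>p\<close> characters at \<open>(False, V0)\<close> take the value one at the identity.\<close>

lemma tr_Id: "tr (Id PC (False, V0)) = 1"
proof -
 have "(of_int (tr (Id PC (False, V0))) :: complex) = 1"
  using p by (simp add: Id_PC tr_arr free_hom_one trc_def sum_chars card_roots del: chars.simps)
 then show ?thesis by (simp only: of_int_eq_1_iff)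
qed

end

theorem theorem10p16:
 fixes p :: nat
 assumes "prime p"
  and "infinite (UNIV :: 'u set)"
 shows "n_gorenstein TYPE('u) 1 (koehler_category p)"
proof -
 interpret koehler p
  by unfold_locales (rule prime_gt_0_nat[OF assms(1)])
 interpret frobenius_category PC hgrp tr casimir
  by (rule frobenius_koehler)
 show ?thesis
  unfolding koehler_category_def
  by (rule frobenius_gorenstein[OF assms(2), of "(False, V0)"]) (simp_all add: tr_Id)
qed

end
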